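(* The space $\mathfrak{X}_{wh}$ does not contain a quasi-minimal subspace.
   Context: A Banach space $X$ is quasi-minimal if every two infinite dimensional closed subspaces of $X$ are not totally incomparable; two Banach spaces are totally incomparable if no infinite dimensional closed subspace of one is isomorphic to a closed subspace of the other. Subspaces here are infinite dimensional and closed. The space $\mathfrak{X}_{wh}$. $c_{00}$ is the space of finitely supported real sequences with unit vectors $(e_n)$; $\operatorname{supp}x$ is the support of $x$. $Ba(\ell_2)$ is the closed unit ball of $\ell_2$ (finite sequences are regarded as elements of $\ell_2$). Schreier families: $\mathcal{S}_1=\{F\subset\mathbb{N}:|F|\le\min F\}$ and $\mathcal{S}_{n+1}=\{\bigcup_{i=1}^dF_i: F_1<\dots<F_d,\ F_i\in\mathcal{S}_n,\ \{\min F_i\}_{i=1}^d\in\mathcal{S}_1\}$. A finite sequence of sets $(E_i)_{i=1}^d$ is $\mathcal{S}_n$-allowable if the $E_i$ are pairwise disjoint finite subsets of $\mathbb{N}$ and $\{\min E_i\}_{i=1}^d\in\mathcal{S}_n$; a sequence of vectors is $\mathcal{S}_n$-allowable if its supports are. Fix increasing sequences of positive integers $(m_j)_{j\ge0}$, $(n_j)_{j\ge0}$ with $m_0=m_1=2$, $n_0=1$, and for $j\ge2$: $m_{j+1}\ge m_j^3$, and $n_j$ is such that $\ell_j(n_{j-1}+1)<n_j$, where $\ell_j=3\log_2(m_j)+1$. Fix disjoint infinite $N_1,N_2\subset\mathbb{N}$ with $\mathbb{N}=N_1\cup N_2$, and let $\Sigma$ be the set of finite sequences $(E_i,2j_i)_{i=1}^n$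 with $E_i\subset\mathbb{N}$ finite and pairwise disjoint, $j_1<\dots<j_n$, $j_1\in N_1$ and $j_i\in N_2$ for $i>1$. Fix an injective $\sigma:\Sigma\to N_2$ with $m_{2\sigma((E_1,2j_1),\dots,(E_{i+1},2j_{i+1}))}>m_{2\sigma((E_1,2j_1),\dots,(E_i,2j_i))}(\max E_i)^2$ and with $m_{2\sigma((E_1,2j_1),\dots,(E_p,2j_p))}>m_{2j_p}(\max E_p)^2$. A sequence $(E_i,2j_i)_i$ is $\sigma$-special if $j_1\in N_1$ and $\sigma((E_1,2j_1),\dots,(E_i,2j_i))=j_{i+1}$ for each $i\ge1$; a finite $\sigma$-special sequence $(E_i,2j_i)_{i=1}^p$ is $\mathcal{S}_{n_{2j+1}}$ $\sigma$-special if $\{\min E_i\}_{i=1}^p\in\mathcal{S}_{n_{2j+1}}$ and $2j_1>2j+2$. A sequence $(f_i)_{i=1}^p\subset c_{00}$ is an $\mathcal{S}_{n_{2j+1}}$ $\sigma$-special sequence of functionals if there is an $\mathcal{S}_{n_{2j+1}}$ $\sigma$-special sequence $(E_i,2j_i)_{i=1}^p$ with $\operatorname{supp}f_i\subset E_i$ and $w(f_i)=m_{2j_i}$ for all $i$. $D_{wh}\subset c_{00}$ is the smallest set such that: (1) $\pm e_n^*\in D_{wh}$ for all $n$; (2) for each $j\ge0$, $\frac1{m_{2j}}\sum_{i=1}^d\lambda_if_i\in D_{wh}$ whenever $(f_i)_{i=1}^d\subset D_{wh}$ is $\mathcal{S}_{n_{2j}}$-allowable and $(\lambda_i)\in Ba(\ell_2)$;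 (3) for each $j\ge 0$, $\frac1{m_{2j+1}}\sum_{i=1}^p\lambda_if_i\in D_{wh}$ whenever $(f_i)_{i=1}^p\subset D_{wh}$ is an $\mathcal{S}_{n_{2j+1}}$ $\sigma$-special sequence of functionals and $(\lambda_i)\in Ba(\ell_2)$. The weight $w(f)$ of a functional produced by (2) or (3) is $m_{2j}$ or $m_{2j+1}$ respectively. $\mathfrak{X}_{wh}$ is the completion of $c_{00}$ under $\|x\|=\sup\{f(x):f\in D_{wh}\}$. *)

theory Defs
  imports "HOL-Analysis.Analysis"
begin

text \<open>
  The natural numbers of the construction are the positive ones. They index the coordinates, so
  all supports and all Schreier sets are subsets of \<open>{1..}\<close>, and a finitely supported sequence is
  a function on \<open>nat\<close> that vanishes at 0. Sequences such as \<open>m\<close> and \<open>n\<close> are indexed from 0.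
\<close>

definition supp :: "(nat \<Rightarrow> real) \<Rightarrow> nat set" where
  "supp x = {k. x k \<noteq> 0}"

definition c00 :: "(nat \<Rightarrow> real) set" where
  "c00 = {x. finite (supp x) \<and> supp x \<subseteq> {1..}}"

definition unit_vec :: "nat \<Rightarrow> nat \<Rightarrow> real" where
  "unit_vec k = (\<lambda>i. if i = k then 1 else 0)"

definition pairing :: "(nat \<Rightarrow> real) \<Rightarrow> (nat \<Rightarrow> real) \<Rightarrow> real" where
  "pairing f x = (\<Sum>k\<in>supp x. f k * x k)"

text \<open>
  The families used in the construction are those with index at least 1. The value at 0 is the
  usual convention (at most one point) and plays no role. Blocks are nonempty, so that their
  minima make sense; the empty set belongs to every family.
\<close>

fun schreier :: "nat \<Rightarrow> nat set set" where
  "schreier 0 = {F. F \<subseteq> {1..} \<and> finite F \<and> card F \<le> 1}"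
| "schreier (Suc 0) = {F. F \<subseteq> {1..} \<and> finite F \<and> (F = {} \<or> card F \<le> Min F)}"
| "schreier (Suc (Suc n)) =
     {\<Union> (set Fs) | Fs.
        (\<forall>F\<in>set Fs. F \<noteq> {} \<and> F \<in> schreier (Suc n)) \<and>
        sorted_wrt (\<lambda>F G. Max F < Min G) Fs \<and>
        Min ` set Fs \<in> schreier (Suc 0)}"

definition allowable :: "nat \<Rightarrow> nat set list \<Rightarrow> bool" where
  "allowable n Es \<longleftrightarrow>
     (\<forall>E\<in>set Es. E \<noteq> {} \<and> finite E \<and> E \<subseteq> {1..}) \<and>
     sorted_wrt (\<lambda>E F. E \<inter> F = {}) Es \<and>
     Min ` set Es \<in> schreier n"

text \<open>
  A sequence \<open>(E\<^sub>i, 2j\<^sub>i)\<^sub>i\<close> is a list of pairs whose second entries are the doubled indices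
  \<open>2j\<^sub>i\<close>. The sets are nonempty because their minima and maxima are used below.
\<close>

definition coded_seqs :: "nat set \<Rightarrow> nat set \<Rightarrow> (nat set \<times> nat) list set" where
  "coded_seqs N1 N2 = {s. s \<noteq> [] \<and>
     (\<forall>(E, k)\<in>set s. E \<noteq> {} \<and> finite E \<and> E \<subseteq> {1..}) \<and>
     sorted_wrt (\<lambda>(E, k) (F, l). E \<inter> F = {} \<and> k < l) s \<and>
     snd (hd s) \<in> (\<lambda>j. 2 * j) ` N1 \<and>
     (\<forall>(E, k)\<in>set (tl s). k \<in> (\<lambda>j. 2 * j) ` N2)}"

text \<open>
  Since \<open>m 0 = m 1\<close>, "increasing" is read as nondecreasing for both sequences; the growth
  conditions make them strictly increasing from index 2 on.
\<close>

definition wh_parameters ::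
  "(nat \<Rightarrow> nat) \<Rightarrow> (nat \<Rightarrow> nat) \<Rightarrow> nat set \<Rightarrow> nat set \<Rightarrow> ((nat set \<times> nat) list \<Rightarrow> nat) \<Rightarrow> bool"
where
  "wh_parameters m n N1 N2 \<sigma> \<longleftrightarrow>
     mono m \<and> mono n \<and> m 0 = 2 \<and> m 1 = 2 \<and> n 0 = 1 \<and>
     (\<forall>j\<ge>2. m (j + 1) \<ge> m j ^ 3) \<and>
     (\<forall>j\<ge>2. (3 * log 2 (real (m j)) + 1) * (real (n (j - 1)) + 1) < real (n j)) \<and>
     infinite N1 \<and> infinite N2 \<and> N1 \<inter> N2 = {} \<and> N1 \<union> N2 = {1..} \<and>
     inj_on \<sigma> (coded_seqs N1 N2) \<and> \<sigma> ` coded_seqs N1 N2 \<subseteq> N2 \<and>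
     (\<forall>s\<in>coded_seqs N1 N2. \<forall>i. 1 \<le> i \<and> i < length s \<longrightarrow>
        m (2 * \<sigma> (take (i + 1) s)) > m (2 * \<sigma> (take i s)) * (Max (fst (s ! (i - 1))))\<^sup>2) \<and>
     (\<forall>s\<in>coded_seqs N1 N2.
        m (2 * \<sigma> s) > m (snd (last s)) * (Max (fst (last s)))\<^sup>2)"

definition special_seq ::
  "nat set \<Rightarrow> nat set \<Rightarrow> ((nat set \<times> nat) list \<Rightarrow> nat) \<Rightarrow> (nat set \<times> nat) list \<Rightarrow> bool"
where
  "special_seq N1 N2 \<sigma> s \<longleftrightarrow> s \<in> coded_seqs N1 N2 \<and>
     (\<forall>i. 1 \<le> i \<and> i < length s \<longrightarrow> snd (s ! i) = 2 * \<sigma> (take i s))"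

definition schreier_special_seq ::
  "(nat \<Rightarrow> nat) \<Rightarrow> nat set \<Rightarrow> nat set \<Rightarrow> ((nat set \<times> nat) list \<Rightarrow> nat) \<Rightarrow> nat \<Rightarrow>
   (nat set \<times> nat) list \<Rightarrow> bool"
where
  "schreier_special_seq n N1 N2 \<sigma> j s \<longleftrightarrow> special_seq N1 N2 \<sigma> s \<and>
     (\<lambda>(E, k). Min E) ` set s \<in> schreier (n (2 * j + 1)) \<and>
     snd (hd s) > 2 * j + 2"

text \<open>
  Weights are a relation: \<open>has_weight \<dots> f w\<close> says that \<open>f\<close> is produced by one of the two averaging
  rules with weight \<open>w\<close>. A functional may be produced in several ways, so its weight need not be
  unique, and \<open>\<plusminus>e\<^sub>k\<close> carries no weight from the first rule.
\<close>

inductive in_D and has_weight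
  for m n :: "nat \<Rightarrow> nat" and N1 N2 :: "nat set" and \<sigma> :: "(nat set \<times> nat) list \<Rightarrow> nat"
where
  pos_unit: "k \<ge> 1 \<Longrightarrow> in_D m n N1 N2 \<sigma> (unit_vec k)"
| neg_unit: "k \<ge> 1 \<Longrightarrow> in_D m n N1 N2 \<sigma> (\<lambda>i. - unit_vec k i)"
| weighted: "has_weight m n N1 N2 \<sigma> f w \<Longrightarrow> in_D m n N1 N2 \<sigma> f"
| even_average:
    "(\<And>f. f \<in> set fs \<Longrightarrow> in_D m n N1 N2 \<sigma> f) \<Longrightarrow>
     allowable (n (2 * j)) (map supp fs) \<Longrightarrow>
     (\<Sum>i<length fs. (l i)\<^sup>2) \<le> 1 \<Longrightarrow>
     has_weight m n N1 N2 \<sigma>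
       (\<lambda>k. (1 / real (m (2 * j))) * (\<Sum>i<length fs. l i * (fs ! i) k)) (m (2 * j))"
| odd_average:
    "schreier_special_seq n N1 N2 \<sigma> j s \<Longrightarrow>
     length fs = length s \<Longrightarrow>
     (\<And>i. i < length s \<Longrightarrow> supp (fs ! i) \<subseteq> fst (s ! i)) \<Longrightarrow>
     (\<And>i. i < length s \<Longrightarrow> has_weight m n N1 N2 \<sigma> (fs ! i) (m (snd (s ! i)))) \<Longrightarrow>
     (\<Sum>i<length fs. (l i)\<^sup>2) \<le> 1 \<Longrightarrow>
     has_weight m n N1 N2 \<sigma>
       (\<lambda>k. (1 / real (m (2 * j + 1))) * (\<Sum>i<length fs. l i * (fs ! i) k)) (m (2 * j + 1))"

definition D_wh ::
  "(nat \<Rightarrow> nat) \<Rightarrow> (nat \<Rightarrow> nat) \<Rightarrow> nat set \<Rightarrow> nat set \<Rightarrow> ((nat set \<times> nat) list \<Rightarrow> nat) \<Rightarrow>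
   (nat \<Rightarrow> real) set"
where
  "D_wh m n N1 N2 \<sigma> = {f. in_D m n N1 N2 \<sigma> f}"

definition wh_norm ::
  "(nat \<Rightarrow> nat) \<Rightarrow> (nat \<Rightarrow> nat) \<Rightarrow> nat set \<Rightarrow> nat set \<Rightarrow> ((nat set \<times> nat) list \<Rightarrow> nat) \<Rightarrow>
   (nat \<Rightarrow> real) \<Rightarrow> real"
where
  "wh_norm m n N1 N2 \<sigma> x = (SUP f\<in>D_wh m n N1 N2 \<sigma>. pairing f x)"

lemma abs_average_le_1:
  fixes g :: "nat \<Rightarrow> real"
  assumes disj: "\<And>i i'. i < d \<Longrightarrow> i' < d \<Longrightarrow> g i \<noteq> 0 \<Longrightarrow> g i' \<noteq> 0 \<Longrightarrow> i = i'"
    and g: "\<And>i. i < d \<Longrightarrow> \<bar>g i\<bar> \<le> 1"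
    and l: "(\<Sum>i<d. (l i)\<^sup>2) \<le> 1"
  shows "\<bar>(1 / real w) * (\<Sum>i<d. l i * g i)\<bar> \<le> 1"
proof -
  have "\<bar>\<Sum>i<d. l i * g i\<bar> \<le> 1"
  proof (cases "\<exists>i<d. g i \<noteq> 0")
    case True
    then obtain i where i: "i < d" "g i \<noteq> 0" by blast
    have "(\<Sum>i'<d. l i' * g i') = (\<Sum>i'\<in>{i}. l i' * g i')"
      using i disj by (intro sum.mono_neutral_right) auto
    moreover have "(l i)\<^sup>2 \<le> 1"
      using member_le_sum[of i "{..<d}" "\<lambda>i. (l i)\<^sup>2"] i l by simp
    then have "\<bar>l i\<bar> \<le> 1" by (simp add: abs_square_le_1)
    ultimately show ?thesis using g[OF i(1)] by (simp add: abs_mult mult_le_one)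
  qed simp
  moreover have "\<bar>1 / real w\<bar> \<le> 1" by (cases w) auto
  ultimately show ?thesis unfolding abs_mult by (intro mult_le_one) auto
qed

lemma D_wh_coordinate_le_1:
  "in_D m n N1 N2 \<sigma> f \<Longrightarrow> \<bar>f k\<bar> \<le> 1"
  "has_weight m n N1 N2 \<sigma> f w \<Longrightarrow> \<bar>f k\<bar> \<le> 1"
proof (induction rule: in_D_has_weight.inducts)
  case (even_average fs j l)
  then have "sorted_wrt (\<lambda>f g. supp f \<inter> supp g = {}) fs"
    by (simp add: allowable_def sorted_wrt_map)
  then have disj: "supp (fs ! i) \<inter> supp (fs ! i') = {}"
    if "i < i'" "i' < length fs" for i i'
    using that by (simp add: sorted_wrt_iff_nth_less)
  show ?case
  proof (rule abs_average_le_1)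
    fix i i' assume "i < length fs" "i' < length fs" "(fs ! i) k \<noteq> 0" "(fs ! i') k \<noteq> 0"
    then show "i = i'" using disj[of i i'] disj[of i' i]
      by (cases i i' rule: linorder_cases) (auto simp: supp_def)
  qed (use even_average in auto)
next
  case (odd_average j s fs l)
  then have "sorted_wrt (\<lambda>(E, k) (F, l). E \<inter> F = {} \<and> k < l) s"
    by (simp add: schreier_special_seq_def special_seq_def coded_seqs_def)
  then have disj: "fst (s ! i) \<inter> fst (s ! i') = {}"
    if "i < i'" "i' < length s" for i i'
    using that by (auto simp: sorted_wrt_iff_nth_less case_prod_beta)
  have len: "length fs = length s" using odd_average by blast
  have mem: "k \<in> fst (s ! i)" if "i < length s" "(fs ! i) k \<noteq> 0" for i
  proof -
    have "supp (fs ! i) \<subseteq> fst (s ! i)" using odd_average that(1) by blast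
    then show ?thesis using that(2) by (auto simp: supp_def)
  qed
  show ?case
  proof (rule abs_average_le_1)
    fix i i' assume "i < length fs" "i' < length fs" "(fs ! i) k \<noteq> 0" "(fs ! i') k \<noteq> 0"
    then show "i = i'" using disj[of i i'] disj[of i' i] mem[of i] mem[of i'] len
      by (cases i i' rule: linorder_cases) auto
  qed (use odd_average in auto)
qed (auto simp: unit_vec_def)

text \<open>The supremum in \<open>wh_norm\<close> is over a bounded nonempty set of reals, hence meaningful.\<close>

lemma bdd_above_pairing_D_wh:
  "bdd_above ((\<lambda>f. pairing f x) ` D_wh m n N1 N2 \<sigma>)"
proof (rule bdd_aboveI2)
  fix f assume "f \<in> D_wh m n N1 N2 \<sigma>"
  then have f: "\<bar>f k\<bar> \<le> 1" for k
    using D_wh_coordinate_le_1(1) by (auto simp: D_wh_def)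
  have "f k * x k \<le> \<bar>x k\<bar>" for k
    using abs_ge_self[of "f k * x k"] mult_right_mono[OF f[of k], of "\<bar>x k\<bar>"]
    by (simp add: abs_mult)
  then show "pairing f x \<le> (\<Sum>k\<in>supp x. \<bar>x k\<bar>)"
    unfolding pairing_def by (intro sum_mono)
qed

lemma D_wh_nonempty: "D_wh m n N1 N2 \<sigma> \<noteq> {}"
  unfolding D_wh_def using pos_unit[of 1 m n N1 N2 \<sigma>] by blast

text \<open>
  Completions are unique only up to isometric isomorphism, so the space is described by its
  defining property: \<open>X\<close> is a closed subspace of a Banach space, and \<open>\<iota>\<close> embeds \<open>c00\<close> with its
  norm linearly and isometrically onto a dense subspace of \<open>X\<close>. Taking \<open>X = UNIV\<close> gives a
  completion that is a whole type; allowing a closed subset lets one type contain the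
  completions for all choices of the parameters.
\<close>

definition wh_completion ::
  "(nat \<Rightarrow> nat) \<Rightarrow> (nat \<Rightarrow> nat) \<Rightarrow> nat set \<Rightarrow> nat set \<Rightarrow> ((nat set \<times> nat) list \<Rightarrow> nat) \<Rightarrow>
   ((nat \<Rightarrow> real) \<Rightarrow> 'a::banach) \<Rightarrow> 'a set \<Rightarrow> bool"
where
  "wh_completion m n N1 N2 \<sigma> \<iota> X \<longleftrightarrow>
     (\<forall>x\<in>c00. \<forall>y\<in>c00. \<iota> (\<lambda>k. x k + y k) = \<iota> x + \<iota> y) \<and>
     (\<forall>c. \<forall>x\<in>c00. \<iota> (\<lambda>k. c * x k) = c *\<^sub>R \<iota> x) \<and>
     (\<forall>x\<in>c00. norm (\<iota> x) = wh_norm m n N1 N2 \<sigma> x) \<and>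
     closure (\<iota> ` c00) = X"

text \<open>Banach spaces are represented as closed linear subspaces of a type of class \<open>banach\<close>.\<close>

definition closed_subspace_of :: "'a::real_normed_vector set \<Rightarrow> 'a set \<Rightarrow> bool" where
  "closed_subspace_of Y X \<longleftrightarrow> subspace Y \<and> closed Y \<and> Y \<subseteq> X"

definition infinite_dim :: "'a::real_vector set \<Rightarrow> bool" where
  "infinite_dim Y \<longleftrightarrow> \<not> (\<exists>B. finite B \<and> Y \<subseteq> span B)"

definition isomorphic :: "'a::real_normed_vector set \<Rightarrow> 'b::real_normed_vector set \<Rightarrow> bool" where
  "isomorphic Y Z \<longleftrightarrow>
     (\<exists>T S. (\<forall>x\<in>Y. \<forall>y\<in>Y. T (x + y) = T x + T y) \<and>
            (\<forall>c. \<forall>x\<in>Y. T (c *\<^sub>R x) = c *\<^sub>R T x) \<and>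
            homeomorphism Y Z T S)"

definition totally_incomparable ::
  "'a::real_normed_vector set \<Rightarrow> 'b::real_normed_vector set \<Rightarrow> bool"
where
  "totally_incomparable Y Z \<longleftrightarrow>
     \<not> (\<exists>U V. closed_subspace_of U Y \<and> infinite_dim U \<and> closed_subspace_of V Z \<and>
              isomorphic U V) \<and>
     \<not> (\<exists>U V. closed_subspace_of U Z \<and> infinite_dim U \<and> closed_subspace_of V Y \<and>
              isomorphic U V)"

definition quasi_minimal :: "'a::banach set \<Rightarrow> bool" where
  "quasi_minimal X \<longleftrightarrow>
     (\<forall>Y Z. closed_subspace_of Y X \<and> infinite_dim Y \<and> closed_subspace_of Z X \<and> infinite_dim Z \<longrightarrow>
            \<not> totally_incomparable Y Z)"

end

theory Submission imports Defs begin

text \<open>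
  A quasi-minimal subspace would contain, by a gliding hump argument, two closed spans of disjoint
  subsequences of an almost block sequence with isomorphic infinite dimensional subspaces. A second
  gliding hump yields block vectors \<open>z\<close> and \<open>v\<close> that correspond to each other under
  an isomorphism of constant \<open>K\<close>, all the \<open>z\<close> being supported in a set \<open>A\<close> and all the \<open>v\<close>
  in a set \<open>B\<close> disjoint from it. From averages of such vectors one builds pairs
  \<open>(z k, v k)\<close> together with functionals \<open>f k\<close> supported in \<open>A\<close> that norm \<open>z k\<close>, such that
  \<open>(f k)\<close> is a special sequence of functionals of order \<open>2 j + 1\<close>. Hence a suitable combination of the
  \<open>z k\<close> has norm at least a constant times \<open>1 / m (2 j + 1)\<close>. The same combination of the
  \<open>v k\<close> has norm at most a constant times \<open>1 / (m (2 j + 1))\<^sup>2\<close>: a functional of weight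
  \<open>m (2 j + 1)\<close> is built on a special sequence which either agrees with the given one, and then vanishes
  on \<open>B\<close>, or has weights different from all those of the \<open>f k\<close>. For large \<open>j\<close>
  this contradicts the equivalence.

  All upper estimates are for the sum of the squares of the values of an allowable family of
  functionals, which is the dual form of the \<open>\<ell>\<^sub>2\<close> combinations in the definition of the norming set.
\<close>

subsection \<open>Schreier families\<close>

text \<open>The obstacle is that allowable supports interleave: a functional may meet every block of
  a vector and cannot be localized by position. Two substitutes carry the proof. Restrictions of a
  functional to disjoint sets are multiples of functionals of the same weight, with multipliers in
  the unit ball of ell-2; hence vectors are combined with coefficients \<open>sqrt (b k)\<close>,
  where \<open>b\<close> is a special convex combination. And a functional of small weight can be
  traded for its children: squares shrink by the squared weight, while the order of the family
  grows. The growth of \<open>n\<close> leaves room for about \<open>log 2 (m J)\<close> such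
  rounds, after which a bound for large weights gives one for all functionals. Because orders are
  added in this way, upper estimates use the unordered families; membership in the norming set is
  checked in the ordered ones, and where only the unordered ones are at hand a factor exponential in
  the order is paid.\<close>

text \<open>
  Dropping the ordering of the pieces makes the Schreier families additive under the unordered unions
  that occur for allowable sequences.
\<close>

fun mschreier :: "nat \<Rightarrow> nat set set" where
  "mschreier 0 = {K. K \<subseteq> {1..} \<and> finite K \<and> card K \<le> 1}"
| "mschreier (Suc n) = {\<Union>\<K> | \<K>. finite \<K> \<and> \<K> \<subseteq> mschreier n \<and> (\<forall>k\<in>\<Union>\<K>. card \<K> \<le> k)}"

lemma mschreier_finite: "K \<in> mschreier n \<Longrightarrow> finite K \<and> K \<subseteq> {1..}"
proof (induction n arbitrary: K)
  case (Suc n)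
  then obtain \<K> where K: "K = \<Union>\<K>" "finite \<K>" "\<K> \<subseteq> mschreier n" by auto
  then have "\<forall>Q\<in>\<K>. finite Q \<and> Q \<subseteq> {1..}" using Suc.IH by blast
  then show ?case using K by blast
qed auto

text \<open>The images of the pieces cover the image, their number does not grow and their points
  move right, so spreading works along any map that moves points to the right. The analogue
  \<open>schreier_spread\<close> for the ordered families is proved for injections.\<close>

lemma mschreier_image:
  assumes "K \<in> mschreier n" "\<And>k. k \<in> K \<Longrightarrow> k \<le> \<phi> k" "K' \<subseteq> \<phi> ` K"
  shows "K' \<in> mschreier n"
  using assms
proof (induction n arbitrary: K K')
  case 0
  have K: "K \<subseteq> {1..}" "finite K" "card K \<le> 1" using 0(1) by auto
  have "K' \<subseteq> {1..}"
  proof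
    fix k' assume "k' \<in> K'"
    then obtain k where "k \<in> K" "k' = \<phi> k" using 0(3) by blast
    then have "1 \<le> k" "k \<le> k'" using K(1) 0(2) by auto
    then show "k' \<in> {1..}" by simp
  qed
  moreover have "finite K'" using finite_surj[OF K(2) 0(3)] .
  moreover have "card K' \<le> card K" using surj_card_le[OF K(2) 0(3)] .
  ultimately show ?case using K by simp
next
  case (Suc n)
  obtain \<K> where K: "K = \<Union>\<K>" "finite \<K>" "\<K> \<subseteq> mschreier n" "\<forall>k\<in>\<Union>\<K>. card \<K> \<le> k"
    using Suc.prems(1) by auto
  define \<K>' where "\<K>' = (\<lambda>Q. \<phi> ` Q \<inter> K') ` \<K>"
  have U: "K' = \<Union>\<K>'" using Suc.prems(3) K(1) unfolding \<K>'_def by blast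
  have fin: "finite \<K>'" using K(2) by (simp add: \<K>'_def)
  have "\<phi> ` Q \<inter> K' \<in> mschreier n" if "Q \<in> \<K>" for Q
  proof (rule Suc.IH)
    show "Q \<in> mschreier n" using that K(3) by blast
    have "Q \<subseteq> K" using \<open>Q \<in> \<K>\<close> K(1) by blast
    then show "k \<le> \<phi> k" if "k \<in> Q" for k using that by (intro Suc.prems(2)) (rule subsetD)
  qed blast
  then have sub: "\<K>' \<subseteq> mschreier n" by (auto simp: \<K>'_def)
  have c: "card \<K>' \<le> card \<K>" using K(2) by (simp add: \<K>'_def card_image_le)
  have "card \<K>' \<le> k'" if k': "k' \<in> K'" for k'
  proof -
    obtain k where k: "k \<in> K" "k' = \<phi> k" using k' Suc.prems(3) by blast
    have "card \<K> \<le> k" using bspec[OF K(4)] k(1) K(1) by simp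
    moreover have "k \<le> k'" using Suc.prems(2)[of k] k by simp
    ultimately show ?thesis using c by simp
  qed
  then show ?case unfolding mschreier.simps using U fin sub by blast
qed

text \<open>The form in which spreading is applied: \<open>a i\<close> is the minimum of a support
  and \<open>b i\<close> the minimum of a smaller support with the same index.\<close>

lemma mschreier_index:
  assumes "a ` I \<in> mschreier n" "inj_on a I" "J \<subseteq> I" "\<And>i. i \<in> J \<Longrightarrow> a i \<le> b i"
  shows "b ` J \<in> mschreier n"
proof -
  define \<phi> where "\<phi> k = b (the_inv_into I a k)" for k
  have \<phi>: "\<phi> (a i) = b i" if "i \<in> I" for i
    using that assms(2) by (simp add: \<phi>_def the_inv_into_f_f)
  have "a ` J \<in> mschreier n"
    by (rule mschreier_image[where \<phi> = id, OF assms(1)]) (use assms(3) in auto)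
  then show ?thesis
    by (rule mschreier_image[where \<phi> = \<phi>]) (use assms(3,4) \<phi> in \<open>force+\<close>)
qed

lemma mschreier_subset: "K \<in> mschreier n \<Longrightarrow> K' \<subseteq> K \<Longrightarrow> K' \<in> mschreier n"
  by (rule mschreier_image[where \<phi> = id]) auto

lemma mschreier_Suc: "K \<in> mschreier n \<Longrightarrow> K \<in> mschreier (Suc n)"
  using mschreier_finite[of K n] by (auto intro!: exI[of _ "{K}"])

lemma mschreier_mono: "K \<in> mschreier n \<Longrightarrow> n \<le> n' \<Longrightarrow> K \<in> mschreier n'"
  by (rotate_tac 1, induction rule: dec_induct) (auto simp del: mschreier.simps intro: mschreier_Suc)

lemma mschreier_empty: "{} \<in> mschreier n"
  by (rule mschreier_mono[of _ 0]) auto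

text \<open>Each piece of \<open>K\<close> is handled by induction, and the bound on the number of
  pieces survives because the points of \<open>G k\<close> lie to the right of \<open>k\<close>. No
  order between the sets \<open>G k\<close> is demanded; this is the additivity of orders behind the
  passage to children in \<open>al_Sigma\<close>.\<close>

lemma mschreier_comp:
  assumes "K \<in> mschreier a" "\<And>k. k \<in> K \<Longrightarrow> G k \<in> mschreier b" "\<And>k g. k \<in> K \<Longrightarrow> g \<in> G k \<Longrightarrow> k \<le> g"
  shows "(\<Union>k\<in>K. G k) \<in> mschreier (a + b)"
  using assms
proof (induction a arbitrary: K)
  case 0
  then consider "K = {}" | k where "K = {k}"
    by (auto simp: le_Suc_eq card_1_singleton_iff)
  then show ?case using 0 mschreier_empty by cases auto
next
  case (Suc a)
  then obtain \<K> where K: "K = \<Union>\<K>" "finite \<K>" "\<K> \<subseteq> mschreier a" "\<forall>k\<in>\<Union>\<K>. card \<K> \<le> k"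
    by auto
  define \<K>' where "\<K>' = (\<lambda>Q. \<Union>k\<in>Q. G k) ` \<K>"
  have "(\<Union>k\<in>K. G k) = \<Union>\<K>'" using K(1) by (auto simp: \<K>'_def)
  moreover have "finite \<K>'" using K by (auto simp: \<K>'_def)
  moreover have "(\<Union>k\<in>Q. G k) \<in> mschreier (a + b)" if "Q \<in> \<K>" for Q
  proof -
    have "Q \<subseteq> K" using that K(1) by blast
    then show ?thesis using that K(3) Suc.prems(2,3) by (intro Suc.IH[of Q]) blast+
  qed
  moreover have c: "card \<K>' \<le> card \<K>" using K by (auto simp: \<K>'_def intro: card_image_le)
  moreover have "card \<K>' \<le> g" if "k \<in> K" "g \<in> G k" for k g
  proof -
    have "card \<K> \<le> k" using that K(1,4) by blast
    then show ?thesis using c that Suc.prems(3)[of k g] by linarith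
  qed
  ultimately show ?case unfolding add_Suc mschreier.simps
    by (intro CollectI exI[of _ \<K>']) (auto simp: \<K>'_def K(1))
qed

lemma mschreier_1: "finite K \<Longrightarrow> K \<subseteq> {1..} \<Longrightarrow> (\<And>k. k \<in> K \<Longrightarrow> card K \<le> k) \<Longrightarrow> K \<in> mschreier 1"
proof -
  assume K: "finite K" "K \<subseteq> {1..}" "\<And>k. k \<in> K \<Longrightarrow> card K \<le> k"
  have "card ((\<lambda>k. {k}) ` K) = card K" by (simp add: card_image)
  then show ?thesis using K unfolding One_nat_def mschreier.simps
    by (intro CollectI exI[of _ "(\<lambda>k. {k}) ` K"]) auto
qed

lemma schreier_finite: "F \<in> schreier n \<Longrightarrow> finite F \<and> F \<subseteq> {1..}"
proof (induction n arbitrary: F rule: schreier.induct)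
  case (3 n)
  obtain Fs where Fs: "F = \<Union> (set Fs)" "\<forall>G\<in>set Fs. G \<noteq> {} \<and> G \<in> schreier (Suc n)"
    using "3.prems"(1) unfolding schreier.simps(3) by blast
  have "finite G \<and> G \<subseteq> {1..}" if "G \<in> set Fs" for G using 3(1)[OF that, of G] Fs(2) that by blast
  then show ?case using Fs(1) by blast
qed auto

lemma sorted_wrt_blocks_inj:
  fixes Fs :: "nat set list"
  assumes "sorted_wrt (\<lambda>F G. Max F < Min G) Fs" "\<forall>F\<in>set Fs. F \<noteq> {} \<and> finite F"
  shows "inj_on Min (set Fs)"
proof (rule inj_onI)
  fix F G assume FG: "F \<in> set Fs" "G \<in> set Fs" "Min F = Min G"
  obtain i j where ij: "i < length Fs" "j < length Fs" "F = Fs ! i" "G = Fs ! j"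
    using FG by (auto simp: in_set_conv_nth)
  have "Min H \<le> Max H" if "H \<in> set Fs" for H using assms(2) that by auto
  then have "i = j" using assms(1) ij FG
    by (metis linorder_neqE_nat not_le sorted_wrt_iff_nth_less)
  then show "F = G" using ij by simp
qed

text \<open>Ordered blocks have distinct minima, so the Schreier condition on the minima bounds the
  number of blocks.\<close>

lemma schreier_mschreier: "F \<in> schreier n \<Longrightarrow> F \<in> mschreier n"
proof (induction n arbitrary: F rule: schreier.induct)
  case 2
  show ?case unfolding One_nat_def[symmetric]
  proof (rule mschreier_1)
    fix k assume "k \<in> F"
    then show "card F \<le> k" using 2 by (auto intro: order_trans[OF _ Min_le])
  qed (use 2 in auto)
next
  case (3 n)
  obtain Fs where Fs: "F = \<Union> (set Fs)" "\<forall>F\<in>set Fs. F \<noteq> {} \<and> F \<in> schreier (Suc n)"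
    "sorted_wrt (\<lambda>F G. Max F < Min G) Fs" "Min ` set Fs \<in> schreier (Suc 0)"
    using "3.prems"(1) unfolding schreier.simps(3) by blast
  have fin: "\<forall>F\<in>set Fs. F \<noteq> {} \<and> finite F" using Fs(2) schreier_finite by blast
  have "card (set Fs) = card (Min ` set Fs)"
    using sorted_wrt_blocks_inj[OF Fs(3) fin] by (simp add: card_image)
  moreover have "card (Min ` set Fs) \<le> k" if "k \<in> G" "G \<in> set Fs" for k G
  proof -
    have "card (Min ` set Fs) \<le> Min (Min ` set Fs)" using Fs(4) that by auto
    also have "\<dots> \<le> Min G" using that by simp
    also have "\<dots> \<le> k" using that fin by simp
    finally show ?thesis .
  qed
  moreover have "set Fs \<subseteq> mschreier (Suc n)" using 3(1) Fs(2) by blast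
  ultimately show ?case
    unfolding mschreier.simps(2)[of "Suc n"] using Fs(1) by (intro CollectI exI[of _ "set Fs"]) auto
qed auto

lemma schreier_Suc: "F \<in> schreier n \<Longrightarrow> F \<in> schreier (Suc n)"
proof (cases n)
  case 0
  assume "F \<in> schreier n"
  then show ?thesis using 0 by (auto simp: le_Suc_eq card_1_singleton_iff)
next
  case (Suc k)
  assume F: "F \<in> schreier n"
  show ?thesis
  proof (cases "F = {}")
    case True
    then show ?thesis using Suc by (auto intro!: exI[of _ "[]"])
  next
    case False
    then have "1 \<le> Min F" using schreier_finite[OF F] by auto
    then show ?thesis using Suc F False by (auto intro!: exI[of _ "[F]"])
  qed
qed

lemma schreier_mono: "F \<in> schreier n \<Longrightarrow> n \<le> n' \<Longrightarrow> F \<in> schreier n'"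
  by (rotate_tac 1, induction rule: dec_induct) (auto simp del: schreier.simps intro: schreier_Suc)

lemma schreier_empty: "{} \<in> schreier n"
  by (rule schreier_mono[of _ 0]) auto

text \<open>The blocks of \<open>F\<close> are pulled back along \<open>\<psi>\<close>. Strict
  monotonicity keeps the preimages successive, empty ones are dropped, and minima only move right,
  so the condition on the minima persists.\<close>

lemma schreier_spread_mono:
  assumes "F \<in> schreier n" "strict_mono_on F' \<psi>" "\<psi> ` F' \<subseteq> F" "\<And>x. x \<in> F' \<Longrightarrow> \<psi> x \<le> x"
  shows "F' \<in> schreier n"
proof -
  have ge1: "1 \<le> x" if "F \<in> schreier n" "\<psi> ` F' \<subseteq> F" "\<And>x. x \<in> F' \<Longrightarrow> \<psi> x \<le> x" "x \<in> F'" for n F F' x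
  proof -
    have "\<psi> x \<in> F" using that(2,4) by (rule subsetD[OF _ imageI])
    then have "\<psi> x \<in> {1..}" using schreier_finite[OF that(1)] by blast
    then show ?thesis using that(3)[OF that(4)] by simp
  qed
  show ?thesis
    using assms
  proof (induction n arbitrary: F F' rule: schreier.induct)
    case 1
    have inj: "inj_on \<psi> F'" using 1(2) by (simp add: strict_mono_on_imp_inj_on)
    have "card F' \<le> card F" by (rule card_inj_on_le[OF inj 1(3)]) (use 1 in simp)
    moreover have "finite F'" by (rule inj_on_finite[OF inj 1(3)]) (use 1 in simp)
    moreover have "F' \<subseteq> {1..}" using ge1[OF 1(1,3,4)] by auto
    moreover have "card F \<le> 1" using 1(1) by simp
    ultimately show ?case by simp
  next
    case 2
    have inj: "inj_on \<psi> F'" using 2(2) by (simp add: strict_mono_on_imp_inj_on)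
    have "card F' \<le> card F" by (rule card_inj_on_le[OF inj 2(3)]) (use 2 in simp)
    moreover have "finite F'" by (rule inj_on_finite[OF inj 2(3)]) (use 2 in simp)
    ultimately have c: "card F' \<le> card F" "finite F'" by auto
    have "F' \<subseteq> {1..}" using ge1[OF 2(1,3,4)] by auto
    moreover have "card F' \<le> Min F'" if "F' \<noteq> {}"
    proof -
      have "Min F' \<in> F'" using that c by auto
      then have "\<psi> (Min F') \<in> F" "\<psi> (Min F') \<le> Min F'" using 2(3,4) by blast+
      then have "Min F \<le> Min F'" using 2(1) schreier_finite[OF 2(1)] by (meson Min_le order_trans)
      moreover have "F \<noteq> {}" using that 2(3) by auto
      ultimately show ?thesis using 2(1) c by simp
    qed
    ultimately show ?case using c unfolding schreier.simps by blast
  next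
    case (3 n)
    obtain Fs where Fs: "F = \<Union> (set Fs)" "\<forall>F\<in>set Fs. F \<noteq> {} \<and> F \<in> schreier (Suc n)"
      "sorted_wrt (\<lambda>F G. Max F < Min G) Fs" "Min ` set Fs \<in> schreier (Suc 0)"
      using "3.prems"(1) unfolding schreier.simps(3) by blast
    have fin: "\<forall>F\<in>set Fs. F \<noteq> {} \<and> finite F" using Fs(2) schreier_finite by blast
    define R where "R G = {x \<in> F'. \<psi> x \<in> G}" for G
    have inj: "inj_on \<psi> F'" using 3(4) by (simp add: strict_mono_on_imp_inj_on)
    have finF': "finite F'"
      using inj_on_finite[OF inj 3(5)] schreier_finite[OF 3(3)] by blast
    then have finR: "finite (R G)" for G by (simp add: R_def)
    define Gs where "Gs = filter (\<lambda>G. R G \<noteq> {}) Fs"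
    have RS: "R G \<in> schreier (Suc n)" if "G \<in> set Fs" for G
    proof (rule 3(1)[of G])
      show "strict_mono_on (R G) \<psi>" using 3(4) by (auto simp: R_def strict_mono_on_def)
    qed (use that Fs(2) 3(6) in \<open>auto simp: R_def\<close>)
    have U: "F' = \<Union> (set (map R Gs))"
      using 3(5) Fs(1) by (auto simp: R_def Gs_def)
    have sep: "Max (R G) < Min (R H)" if "R G \<noteq> {}" "R H \<noteq> {}" "Max G < Min H" "G \<in> set Fs" "H \<in> set Fs" for G H
    proof -
      have "Max (R G) \<in> R G" "Min (R H) \<in> R H" using that finR by auto
      then have *: "\<psi> (Max (R G)) \<in> G" "\<psi> (Min (R H)) \<in> H" "Max (R G) \<in> F'" "Min (R H) \<in> F'"
        by (auto simp: R_def)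
      have "\<psi> (Max (R G)) \<le> Max G" "Min H \<le> \<psi> (Min (R H))" using * fin that by auto
      then have "\<psi> (Max (R G)) < \<psi> (Min (R H))" using that by simp
      then show ?thesis using * 3(4)
        by (metis linorder_neqE_nat order_less_asym strict_mono_on_def)
    qed
    have "sorted_wrt (\<lambda>G H. Max (R G) < Min (R H)) Gs"
    proof (rule sorted_wrt_mono_rel[where P = "\<lambda>F G. Max F < Min G"])
      show "sorted_wrt (\<lambda>F G. Max F < Min G) Gs" unfolding Gs_def by (rule sorted_wrt_filter[OF Fs(3)])
    qed (use sep in \<open>auto simp: Gs_def\<close>)
    then have S: "sorted_wrt (\<lambda>F G. Max F < Min G) (map R Gs)" by (simp add: sorted_wrt_map)
    have ge: "Min G \<le> Min (R G)" if "R G \<noteq> {}" "G \<in> set Fs" for G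
    proof -
      have *: "Min (R G) \<in> R G" using that finR by auto
      then have "Min G \<le> \<psi> (Min (R G))" using fin that by (auto simp: R_def)
      also have "\<dots> \<le> Min (R G)" using * 3(6) by (auto simp: R_def)
      finally show ?thesis .
    qed
    have "Min ` set (map R Gs) \<in> schreier (Suc 0)"
    proof (cases "Gs = []")
      case False
      have 1: "card (Min ` set (map R Gs)) \<le> card (Min ` set Fs)"
      proof -
        have "card (Min ` set (map R Gs)) \<le> card (set Gs)"
          by (metis List.finite_set card_image_le image_image list.set_map)
        also have "\<dots> \<le> card (set Fs)" unfolding Gs_def by (auto intro: card_mono)
        also have "\<dots> = card (Min ` set Fs)"
          using sorted_wrt_blocks_inj[OF Fs(3) fin] by (simp add: card_image)
        finally show ?thesis .
      qed
      have ne: "set Fs \<noteq> {}" using False by (auto simp: Gs_def)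
      have 2: "card (Min ` set Fs) \<le> Min (Min ` set Fs)" using Fs(4) ne by auto
      have 3: "Min (Min ` set Fs) \<le> x" if x: "x \<in> Min ` set (map R Gs)" for x
      proof -
        obtain G where G: "G \<in> set Fs" "R G \<noteq> {}" "x = Min (R G)" using x by (auto simp: Gs_def)
        have "Min (Min ` set Fs) \<le> Min G" using G by simp
        then show ?thesis using ge[OF G(2,1)] G(3) by simp
      qed
      have 4: "1 \<le> Min (Min ` set Fs)" using Fs(4) ne by auto
      have "Min ` set (map R Gs) \<subseteq> {1..}"
      proof
        fix x assume "x \<in> Min ` set (map R Gs)"
        from 3[OF this] 4 show "x \<in> {1..}" by simp
      qed
      moreover have "Min (Min ` set Fs) \<le> Min (Min ` set (map R Gs))"
        using 3 False by (intro Min.boundedI) auto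
      then have "card (Min ` set (map R Gs)) \<le> Min (Min ` set (map R Gs))" using 1 2 by linarith
      ultimately show ?thesis unfolding schreier.simps by blast
    qed auto
    then show ?case using S U RS unfolding schreier.simps(3)
      by (intro CollectI exI[of _ "map R Gs"]) (auto simp: Gs_def)
  qed
qed

text \<open>The injection \<open>r\<close> is replaced by the monotone map that sends the element of
  a given rank in \<open>F'\<close> to the element of the same rank in \<open>F\<close>; counting
  shows that it also moves points left. Arbitrary injections occur because restricted supports may
  have their minima in a different order from the original ones.\<close>

lemma schreier_spread:
  assumes F: "F \<in> schreier n" and r: "inj_on r F'" "r ` F' \<subseteq> F" "\<And>x. x \<in> F' \<Longrightarrow> r x \<le> x"
  shows "F' \<in> schreier n"
proof -
  have finF: "finite F" using schreier_finite[OF F] by blast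
  have finF': "finite F'" using inj_on_finite[OF r(1,2) finF] .
  define xs where "xs = sorted_list_of_set F"
  have xs: "sorted xs" "distinct xs" "set xs = F" "length xs = card F"
    using finF by (auto simp: xs_def)
  define rk where "rk x = card {y \<in> F'. y < x}" for x
  define \<psi> where "\<psi> x = xs ! rk x" for x
  \<comment> \<open>Up to and including \<open>x\<close> there are more than \<open>rk x\<close>
    points of \<open>F'\<close>, and \<open>r\<close> maps them injectively into the points of
    \<open>F\<close> up to \<open>x\<close>.\<close>
  have c: "rk x < card {y \<in> F. y \<le> x}" if "x \<in> F'" for x
  proof -
    have "rk x < card {y \<in> F'. y \<le> x}" unfolding rk_def
      using that finF' by (intro psubset_card_mono) auto
    also have "\<dots> \<le> card {y \<in> F. y \<le> x}"
    proof (rule card_inj_on_le)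
      show "inj_on r {y \<in> F'. y \<le> x}" by (rule inj_on_subset[OF r(1)]) auto
      show "r ` {y \<in> F'. y \<le> x} \<subseteq> {y \<in> F. y \<le> x}" using r(2,3) order_trans by blast
    qed (use finF in simp)
    finally show ?thesis .
  qed
  have len: "rk x < length xs" if "x \<in> F'" for x
    using c[OF that] card_mono[of F "{y \<in> F. y \<le> x}"] finF xs(4) by auto
  have le: "\<psi> x \<le> x" if x: "x \<in> F'" for x
  proof (rule ccontr)
    assume gt: "\<not> \<psi> x \<le> x"
    have "{y \<in> F. y \<le> x} \<subseteq> (!) xs ` {..<rk x}"
    proof
      fix y assume "y \<in> {y \<in> F. y \<le> x}"
      then obtain i where i: "i < length xs" "y = xs ! i" "y \<le> x"
        using xs(3) by (metis (mono_tags, lifting) in_set_conv_nth mem_Collect_eq)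
      have "i < rk x"
      proof (rule ccontr)
        assume "\<not> i < rk x"
        then have "xs ! rk x \<le> xs ! i" using xs(1) i(1) by (simp add: sorted_nth_mono)
        then show False using gt i by (simp add: \<psi>_def)
      qed
      then show "y \<in> (!) xs ` {..<rk x}" using i(2) by blast
    qed
    then have "card {y \<in> F. y \<le> x} \<le> card ((!) xs ` {..<rk x})" by (intro card_mono) simp_all
    also have "\<dots> \<le> rk x" using card_image_le[of "{..<rk x}" "(!) xs"] by simp
    finally have "card {y \<in> F. y \<le> x} \<le> rk x" .
    then show False using c[OF x] by simp
  qed
  have "strict_mono_on F' \<psi>"
  proof (rule strict_mono_onI)
    fix x y assume xy: "x \<in> F'" "y \<in> F'" "x < y"
    then have "rk x < rk y" unfolding rk_def using finF' by (intro psubset_card_mono) auto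
    then show "\<psi> x < \<psi> y" unfolding \<psi>_def using xs(1,2) len[OF xy(2)]
      by (metis sorted_wrt_nth_less strict_sorted_iff)
  qed
  moreover have "\<psi> ` F' \<subseteq> F" using len xs by (auto simp: \<psi>_def)
  ultimately show ?thesis using schreier_spread_mono[OF F] le by blast
qed

text \<open>Composition of the ordered families. The sets \<open>G k\<close> are indexed by their
  minima and are successive, so the union over a piece of \<open>R\<close> has the minimum of that
  piece. This keeps iterated averages inside the families that the averaging rules ask for.\<close>

lemma schreier_comp:
  assumes "R \<in> schreier r" "\<And>k. k \<in> R \<Longrightarrow> G k \<in> schreier s \<and> G k \<noteq> {} \<and> Min (G k) = k"
    "\<And>k l. k \<in> R \<Longrightarrow> l \<in> R \<Longrightarrow> k < l \<Longrightarrow> Max (G k) < l"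
  shows "(\<Union>k\<in>R. G k) \<in> schreier (r + s)"
  using assms
proof (induction r arbitrary: R rule: schreier.induct)
  case 1
  then consider "R = {}" | k where "R = {k}"
    by (auto simp: le_Suc_eq card_1_singleton_iff)
  then show ?case using 1 schreier_empty by cases auto
next
  case 2
  have finR: "finite R" using 2 by auto
  show ?case
  proof (cases s)
    case 0
    have "G k = {k}" if "k \<in> R" for k
    proof -
      have G: "finite (G k)" "card (G k) \<le> 1" "G k \<noteq> {}" "Min (G k) = k" using 2(2)[OF that] 0 by auto
      then have "card (G k) \<noteq> 0" by simp
      then have "card (G k) = 1" using G(2) by linarith
      then obtain x where "G k = {x}" by (rule card_1_singletonE)
      then show ?thesis using G(4) by simp
    qed
    then show ?thesis using 2(1) 0 by auto
  next
    case (Suc s')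
    define Fs where "Fs = map G (sorted_list_of_set R)"
    have "Min ` set Fs = R" using 2(2) finR by (force simp: Fs_def)
    moreover have "sorted_wrt (\<lambda>F G. Max F < Min G) Fs"
      unfolding Fs_def sorted_wrt_map
      by (rule sorted_wrt_mono_rel[where P = "(<)"]) (use 2 finR in auto)
    ultimately have "(\<Union>k\<in>R. G k) \<in> schreier (Suc (Suc s'))"
      unfolding schreier.simps(3) using 2(1,2) finR Suc
      by (intro CollectI exI[of _ Fs]) (auto simp del: schreier.simps simp: Fs_def)
    then show ?thesis using Suc by simp
  qed
next
  case (3 n)
  obtain Fs where Fs: "R = \<Union> (set Fs)" "\<forall>F\<in>set Fs. F \<noteq> {} \<and> F \<in> schreier (Suc n)"
    "sorted_wrt (\<lambda>F G. Max F < Min G) Fs" "Min ` set Fs \<in> schreier (Suc 0)"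
    using "3.prems"(1) unfolding schreier.simps(3) by blast
  have fin: "\<forall>F\<in>set Fs. F \<noteq> {} \<and> finite F" using Fs(2) schreier_finite by blast
  have finG: "finite (G k)" if "k \<in> R" for k using 3(4)[OF that] schreier_finite by blast
  define H where "H F = (\<Union>k\<in>F. G k)" for F
  have HS: "H F \<in> schreier (Suc n + s)" if "F \<in> set Fs" for F
  proof -
    have "F \<subseteq> R" "F \<in> schreier (Suc n)" using that Fs(1,2) by blast+
    then show ?thesis unfolding H_def using 3(4,5) by (intro 3(1)[OF that]) blast+
  qed
  have Hne: "H F \<noteq> {}" "finite (H F)" if "F \<in> set Fs" for F
  proof -
    have sub: "F \<subseteq> R" using that Fs(1) by blast
    have "F \<noteq> {}" using fin that by blast
    then obtain k where k: "k \<in> F" by blast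
    then have "G k \<noteq> {}" using 3(4) sub by blast
    then show "H F \<noteq> {}" using k by (auto simp: H_def)
    show "finite (H F)" unfolding H_def using fin that sub finG by (intro finite_UN_I) auto
  qed
  have HMin: "Min (H F) = Min F" if "F \<in> set Fs" for F
  proof (rule Min_eqI)
    have "Min F \<in> F" using that fin by auto
    then show "Min F \<in> H F" using 3(4)[of "Min F"] that Fs(1) finG[of "Min F"] unfolding H_def
      by (metis Min_in UN_I UnionI)
    fix y assume "y \<in> H F"
    then obtain k where k: "k \<in> F" "y \<in> G k" by (auto simp: H_def)
    then have "k \<le> y" using 3(4)[of k] finG[of k] that Fs(1) by (metis Min_le UnionI)
    then show "Min F \<le> y" using k fin that by (meson Min_le order_trans)
  qed (use Hne that in auto)
  have sep: "Max (H F) < Min (H F')" if "Max F < Min F'" "F \<in> set Fs" "F' \<in> set Fs" for F F'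
  proof -
    have "Max (H F) \<in> H F" using Hne that by auto
    then obtain k where k: "k \<in> F" "Max (H F) \<in> G k" by (auto simp: H_def)
    have "k \<in> R" using k(1) that(2) Fs(1) by blast
    then have *: "Max (H F) \<le> Max (G k)" using k(2) finG by (intro Max_ge)
    have "k \<le> Max F" using k that fin by auto
    then have "k < Min F'" using that by simp
    moreover have "Min F' \<in> F'" using that fin by auto
    ultimately have "Max (G k) < Min F'" using 3(5) k that Fs(1) by blast
    then show ?thesis using * HMin that by simp
  qed
  have "sorted_wrt (\<lambda>F G. Max F < Min G) (map H Fs)"
    unfolding sorted_wrt_map by (rule sorted_wrt_mono_rel[OF _ Fs(3)]) (use sep in auto)
  moreover have "Min ` set (map H Fs) = Min ` set Fs" using HMin by (auto simp: image_iff)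
  moreover have "(\<Union>k\<in>R. G k) = \<Union> (set (map H Fs))" by (auto simp: Fs(1) H_def)
  ultimately have "(\<Union>k\<in>R. G k) \<in> schreier (Suc (Suc (n + s)))"
    unfolding schreier.simps(3) using HS Hne Fs(4)
    by (intro CollectI exI[of _ "map H Fs"]) (auto simp del: schreier.simps)
  then show ?case by simp
qed

subsection \<open>Special convex combinations\<close>

text \<open>Special convex combinations: carried by a set of order \<open>r + 1\<close>, with little
  mass on sets of order \<open>r\<close>. The carrier belongs to the smaller family
  \<open>schreier\<close>, so that averages with these coefficients can be formed in the norming
  set; the tests run over the larger family \<open>mschreier\<close>, which contains the minima
  arising in upper estimates.\<close>

definition scc :: "nat \<Rightarrow> (nat \<Rightarrow> nat) \<Rightarrow> nat \<Rightarrow> (nat \<Rightarrow> real) \<Rightarrow> real \<Rightarrow> bool" where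
  "scc r t p b \<delta> \<longleftrightarrow> (\<forall>k. 0 \<le> b k) \<and> (\<Sum>k<p. b k) = 1 \<and> t ` {..<p} \<in> schreier (Suc r) \<and>
     (\<forall>B h. B \<subseteq> {..<p} \<longrightarrow> inj_on h B \<longrightarrow> (\<forall>k\<in>B. h k < t (Suc k)) \<longrightarrow> h ` B \<in> mschreier r \<longrightarrow>
        sum b B \<le> \<delta>)"

lemma sccD:
  assumes "scc r t p b \<delta>"
  shows "0 \<le> b k" "(\<Sum>k<p. b k) = 1" "t ` {..<p} \<in> schreier (Suc r)"
    "B \<subseteq> {..<p} \<Longrightarrow> inj_on h B \<Longrightarrow> (\<And>k. k \<in> B \<Longrightarrow> h k < t (Suc k)) \<Longrightarrow> h ` B \<in> mschreier r \<Longrightarrow> sum b B \<le> \<delta>"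
  using assms unfolding scc_def by (blast, blast, blast, metis)

lemma sccI:
  assumes "\<And>k. 0 \<le> b k" "(\<Sum>k<p. b k) = 1" "t ` {..<p} \<in> schreier (Suc r)"
    "\<And>B h. B \<subseteq> {..<p} \<Longrightarrow> inj_on h B \<Longrightarrow> (\<forall>k\<in>B. h k < t (Suc k)) \<Longrightarrow> h ` B \<in> mschreier r \<Longrightarrow> sum b B \<le> \<delta>"
  shows "scc r t p b \<delta>"
  using assms unfolding scc_def by simp

lemma sum_UN_le:
  fixes f :: "'a \<Rightarrow> real"
  assumes "finite I" "\<And>i. i \<in> I \<Longrightarrow> finite (A i)" "\<And>x. 0 \<le> f x"
  shows "sum f (\<Union>i\<in>I. A i) \<le> (\<Sum>i\<in>I. sum f (A i))"
  using assms
proof (induction I rule: finite_induct)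
  case (insert i I)
  have "sum f (A i \<union> (\<Union>i\<in>I. A i)) \<le> sum f (A i) + sum f (\<Union>i\<in>I. A i)"
    using insert by (subst sum_Un) (auto intro!: sum_nonneg)
  then show ?case using insert by simp
qed simp

lemma doubling_power:
  fixes t :: "nat \<Rightarrow> nat"
  assumes "\<And>k. 2 * t k \<le> t (Suc k)"
  shows "2 ^ i * t k \<le> t (k + i)"
proof (induction i)
  case (Suc i)
  have "2 ^ Suc i * t k = 2 * (2 ^ i * t k)" by simp
  also have "\<dots> \<le> 2 * t (k + i)" using Suc by (rule mult_le_mono2)
  also have "\<dots> \<le> t (k + Suc i)" using assms[of "k + i"] by simp
  finally show ?case .
qed simp

lemma doubling_strict_mono:
  fixes t :: "nat \<Rightarrow> nat"
  assumes d: "\<And>k. 2 * t k \<le> t (Suc k)" and t0: "1 \<le> t 0"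
  shows "strict_mono t" "1 \<le> t k"
proof -
  have ge: "1 \<le> t k" for k
  proof (induction k)
    case (Suc k)
    then show ?case using d[of k] by simp
  qed (use t0 in simp)
  show "1 \<le> t k" using ge .
  have "t k < t (Suc k)" for k using d[of k] ge[of k] by simp
  then show "strict_mono t" by (rule strict_mono_Suc_iff[THEN iffD2, rule_format])
qed

text \<open>
  The set \<open>t ` {..<p}\<close> has to be an initial segment of the range of \<open>t\<close>, because an initial
  segment of a special sequence is special but a subsequence is not. The points \<open>h k < t (k + 1)\<close>
  stand for the places where a functional meets the block number \<open>k\<close>.
\<close>

lemma scc_exists:
  "\<exists>c>0. \<forall>t. (\<forall>k. 2 * t k \<le> t (Suc k)) \<and> 1 \<le> t 0 \<longrightarrow> (\<exists>p b. scc r t p b (c / real (t 0)))"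
proof (induction r)
  case 0
  have "\<exists>p b. scc 0 t p b (1 / real (t 0))"
    if d: "\<forall>k. 2 * t k \<le> t (Suc k)" and t0: "1 \<le> t 0" for t :: "nat \<Rightarrow> nat"
  proof -
    \<comment> \<open>The uniform distribution on \<open>t 0\<close> points, the largest number that
      a set of order 1 starting at \<open>t 0\<close> may have.\<close>
    define b where "b k = 1 / real (t 0)" for k :: nat
    have mono: "strict_mono t" and ge: "1 \<le> t k" for k
      using doubling_strict_mono d t0 by blast+
    have "card (t ` {..<t 0}) = t 0" using mono by (simp add: card_image strict_mono_imp_inj_on)
    moreover have "t 0 \<le> Min (t ` {..<t 0})"
      using t0 mono by (intro Min.boundedI) (auto simp: lessThan_empty_iff strict_mono_less_eq)
    ultimately have "t ` {..<t 0} \<in> schreier (Suc 0)" using ge by auto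
    moreover have "sum b B \<le> 1 / real (t 0)" if B: "B \<subseteq> {..<t 0}" "inj_on h B" "h ` B \<in> mschreier 0" for B h
    proof -
      have "card B = card (h ` B)" using B(2) by (simp add: card_image)
      also have "\<dots> \<le> 1" using B(3) by simp
      finally have "real (card B) \<le> 1" by simp
      then show ?thesis by (simp add: b_def divide_right_mono)
    qed
    moreover have "(\<Sum>k<t 0. b k) = 1" "\<And>k. 0 \<le> b k" using t0 by (simp_all add: b_def)
    ultimately have "scc 0 t (t 0) b (1 / real (t 0))" by (intro sccI)
    then show ?thesis by blast
  qed
  then show ?case by (intro exI[of _ 1]) auto
next
  case (Suc r)
  then obtain c where c: "c > 0"
    and IH: "\<And>t. \<forall>k. 2 * t k \<le> t (Suc k) \<Longrightarrow> 1 \<le> t 0 \<Longrightarrow> \<exists>p b. scc r t p b (c / real (t 0))"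
    by blast
  have "\<exists>p b. scc (Suc r) t p b ((1 + 2 * c) / real (t 0))"
    if d: "\<forall>k. 2 * t k \<le> t (Suc k)" and t0: "1 \<le> t 0" for t :: "nat \<Rightarrow> nat"
  proof -
    have mono: "strict_mono t" and ge: "1 \<le> t k" for k
      using doubling_strict_mono d t0 by blast+
    have "\<exists>p b. scc r (\<lambda>k. t (s + k)) p b (c / real (t s))" for s
      using IH[of "\<lambda>k. t (s + k)"] d ge by simp
    then obtain p b where pb: "\<And>s. scc r (\<lambda>k. t (s + k)) (p s) (b s) (c / real (t s))" by metis
    note b0 = sccD(1)[OF pb] and bsum = sccD(2)[OF pb] and bS = sccD(3)[OF pb]
    have bsmall: "sum (b s) B \<le> c / real (t s)"
      if "B \<subseteq> {..<p s}" "inj_on h B" "\<And>k. k \<in> B \<Longrightarrow> h k < t (s + Suc k)" "h ` B \<in> mschreier r"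
      for s B h by (rule sccD(4)[OF pb that(1,2) _ that(4)]) (use that(3) in simp)
    have p1: "1 \<le> p s" for s using bsum[of s] by (cases "p s") auto
    \<comment> \<open>Piece number \<open>i\<close> starts at position \<open>st i\<close> and
      carries the combination that the induction hypothesis gives for the sequence shifted to that
      position.\<close>
    define st where "st = rec_nat 0 (\<lambda>_ s. s + p s)"
    have st: "st 0 = 0" "\<And>i. st (Suc i) = st i + p (st i)" by (simp_all add: st_def)
    have st_mono: "strict_mono st" using st p1 by (simp add: strict_mono_Suc_iff Suc_le_eq)
    have st_gap: "i + st j \<le> st (j + i)" for i j
    proof (induction i)
      case (Suc i)
      then show ?case using st(2)[of "j + i"] p1[of "st (j + i)"] by simp
    qed simp
    \<comment> \<open>The first point \<open>t 0\<close> allows this many pieces, since their minima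
      have to form a set of order 1.\<close>
    define d0 where "d0 = t 0"
    have d0: "1 \<le> d0" using t0 by (simp add: d0_def)
    define blk where "blk i = {st i..<st (Suc i)}" for i
    have blk_shift: "blk i = (\<lambda>k. st i + k) ` {..<p (st i)}" for i
      by (simp add: blk_def st image_add_atLeastLessThan[of _ 0, simplified] add.commute flip: atLeast0LessThan)
    define b' where "b' k = (\<Sum>i<d0. if k \<in> blk i then b (st i) (k - st i) / real d0 else 0)" for k
    have b'0: "0 \<le> b' k" for k unfolding b'_def by (intro sum_nonneg) (auto simp: b0)
    have sumB: "sum b' B = (\<Sum>i<d0. (\<Sum>k\<in>{k. k < p (st i) \<and> st i + k \<in> B}. b (st i) k) / real d0)"
      if "finite B" for B
    proof -
      have "sum b' B = (\<Sum>i<d0. \<Sum>k\<in>B. if k \<in> blk i then b (st i) (k - st i) / real d0 else 0)"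
        unfolding b'_def by (rule sum.swap)
      also have "\<dots> = (\<Sum>i<d0. (\<Sum>k\<in>{k. k < p (st i) \<and> st i + k \<in> B}. b (st i) k) / real d0)"
      proof (rule sum.cong[OF refl])
        fix i
        have "(\<Sum>k\<in>B. if k \<in> blk i then b (st i) (k - st i) / real d0 else 0)
            = (\<Sum>k\<in>B \<inter> blk i. b (st i) (k - st i) / real d0)"
          using that by (simp add: sum.inter_restrict)
        also have "B \<inter> blk i = (\<lambda>k. st i + k) ` {k. k < p (st i) \<and> st i + k \<in> B}"
          by (auto simp: blk_shift)
        also have "(\<Sum>k\<in>\<dots>. b (st i) (k - st i) / real d0)
            = (\<Sum>k\<in>{k. k < p (st i) \<and> st i + k \<in> B}. b (st i) k / real d0)"
          by (subst sum.reindex) (auto simp: inj_on_def)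
        finally show "(\<Sum>k\<in>B. if k \<in> blk i then b (st i) (k - st i) / real d0 else 0)
            = (\<Sum>k\<in>{k. k < p (st i) \<and> st i + k \<in> B}. b (st i) k) / real d0"
          by (simp add: sum_divide_distrib)
      qed
      finally show ?thesis .
    qed
    have "(\<Sum>k<st d0. b' k) = (\<Sum>i<d0. 1 / real d0)"
      unfolding sumB[OF finite_lessThan]
    proof (rule sum.cong[OF refl])
      fix i assume "i \<in> {..<d0}"
      then have "st (Suc i) \<le> st d0" using strict_mono_less_eq[OF st_mono] by simp
      then have "{k. k < p (st i) \<and> st i + k \<in> {..<st d0}} = {..<p (st i)}" using st(2)[of i] by auto
      then show "(\<Sum>k\<in>{k. k < p (st i) \<and> st i + k \<in> {..<st d0}}. b (st i) k) / real d0 = 1 / real d0"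
        using bsum by simp
    qed
    then have sum1: "(\<Sum>k<st d0. b' k) = 1" using d0 by simp
    have cover: "{..<st e} = (\<Union>i<e. blk i)" for e
    proof (induction e)
      case (Suc e)
      have "{..<st (Suc e)} = {..<st e} \<union> blk e" using st(2)[of e] by (auto simp: blk_def)
      then show ?case using Suc by (auto simp: lessThan_Suc)
    qed (simp add: st)
    define Fs where "Fs = map (\<lambda>i. t ` blk i) [0..<d0]"
    have fin_blk: "finite (t ` blk i)" "t ` blk i \<noteq> {}" for i
      using p1[of "st i"] by (auto simp: blk_def st)
    have Min_blk: "Min (t ` blk i) = t (st i)" for i
    proof (rule Min_eqI[OF fin_blk(1)])
      show "t (st i) \<in> t ` blk i" using p1[of "st i"] by (auto simp: blk_def st)
    qed (use mono in \<open>auto simp: blk_def strict_mono_less_eq\<close>)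
    have Max_blk: "Max (t ` blk i) < t (st (Suc i))" for i
      using fin_blk mono by (auto simp: blk_def strict_mono_less)
    have blk_S: "t ` blk i \<in> schreier (Suc r)" for i
      using bS[of "st i"] by (simp add: blk_shift image_image)
    have "t ` {..<st d0} \<in> schreier (Suc (Suc r))"
    proof -
      have "t ` {..<st d0} = \<Union> (set Fs)" by (simp add: cover Fs_def image_UN atLeast0LessThan)
      moreover have "\<forall>F\<in>set Fs. F \<noteq> {} \<and> F \<in> schreier (Suc r)"
        using fin_blk(2) blk_S by (auto simp: Fs_def simp del: schreier.simps)
      moreover have "Max (t ` blk i) < Min (t ` blk j)" if "i < j" for i j
      proof -
        have "st (Suc i) \<le> st j" using that strict_mono_less_eq[OF st_mono] by simp
        then have "t (st (Suc i)) \<le> t (st j)" using mono by (simp add: strict_mono_less_eq)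
        then show ?thesis using Max_blk[of i] Min_blk[of j] by simp
      qed
      then have "sorted_wrt (\<lambda>F G. Max F < Min G) Fs"
        unfolding Fs_def sorted_wrt_map by (intro sorted_wrt_mono_rel[OF _ sorted_wrt_upt]) auto
      moreover have "Min ` set Fs \<in> schreier (Suc 0)"
      proof -
        have eq: "Min ` set Fs = (\<lambda>i. t (st i)) ` {..<d0}"
          unfolding Fs_def by (auto simp: image_image Min_blk atLeast0LessThan)
        have "card (Min ` set Fs) \<le> d0" unfolding eq using card_image_le[of "{..<d0}"] by fastforce
        moreover have "d0 \<le> Min (Min ` set Fs)" unfolding eq
        proof (rule Min.boundedI)
          fix x assume "x \<in> (\<lambda>i. t (st i)) ` {..<d0}"
          then show "d0 \<le> x" using mono by (auto simp: d0_def strict_mono_less_eq)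
        qed (use d0 in \<open>auto simp: lessThan_empty_iff\<close>)
        moreover have "Min ` set Fs \<subseteq> {1..}" unfolding eq using ge by auto
        moreover have "finite (Min ` set Fs)" by simp
        ultimately show ?thesis using le_trans unfolding schreier.simps by blast
      qed
      ultimately show ?thesis unfolding schreier.simps(3) by blast
    qed
    moreover have "sum b' B \<le> (1 + 2 * c) / real (t 0)"
      if B: "B \<subseteq> {..<st d0}" and inj: "inj_on h B" and h: "\<forall>k\<in>B. h k < t (Suc k)"
        and hB: "h ` B \<in> mschreier (Suc r)" for B h
    proof (cases "B = {}")
      case True
      then show ?thesis using c by simp
    next
      case False
      have finB: "finite B" using B finite_subset by blast
      obtain \<K> where K: "h ` B = \<Union>\<K>" "finite \<K>" "\<K> \<subseteq> mschreier r" "\<forall>k\<in>\<Union>\<K>. card \<K> \<le> k"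
        using hB by auto
      define S where "S i = {k. k < p (st i) \<and> st i + k \<in> B}" for i
      have finS: "finite (S i)" for i by (simp add: S_def)
      have "\<exists>i. S i \<noteq> {}"
      proof -
        obtain k where k: "k \<in> B" using False by blast
        then obtain i where "k \<in> blk i" using B cover by blast
        then have "k - st i \<in> S i" using k by (auto simp: S_def blk_def st)
        then show ?thesis by blast
      qed
      \<comment> \<open>The first piece met by \<open>B\<close> contributes at most 1. A value of
        \<open>h\<close> on it bounds the number of test sets by \<open>T0\<close>, the value of
        \<open>t\<close> at the start of the next piece; as \<open>t\<close> at least doubles at
        each step, the later pieces contribute a geometric series with sum at most
        \<open>2 * c\<close>.\<close>
      define i0 where "i0 = (LEAST i. S i \<noteq> {})"
      have i0: "S i0 \<noteq> {}" unfolding i0_def using \<open>\<exists>i. S i \<noteq> {}\<close> by (rule LeastI_ex)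
      have i0': "S i = {}" if "i < i0" for i using not_less_Least[of i] that unfolding i0_def by blast
      obtain k0 where k0: "k0 < p (st i0)" "st i0 + k0 \<in> B" using i0 by (auto simp: S_def)
      define T0 where "T0 = t (st (Suc i0))"
      have "card \<K> \<le> h (st i0 + k0)" using K(1,4) k0(2) by blast
      also have "\<dots> < t (Suc (st i0 + k0))" using h k0(2) by blast
      also have "\<dots> \<le> T0" unfolding T0_def using k0(1) mono by (simp add: strict_mono_less_eq st)
      finally have cK: "card \<K> \<le> T0" by simp
      have piece: "sum (b (st i)) (S i) \<le> real (card \<K>) * (c / real (t (st i)))" for i
      proof -
        have "S i = (\<Union>Q\<in>\<K>. {k\<in>S i. h (st i + k) \<in> Q})" using K(1) by (auto simp: S_def)
        then have "sum (b (st i)) (S i) = sum (b (st i)) (\<Union>Q\<in>\<K>. {k\<in>S i. h (st i + k) \<in> Q})" by simp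
        also have "\<dots> \<le> (\<Sum>Q\<in>\<K>. sum (b (st i)) {k\<in>S i. h (st i + k) \<in> Q})"
          using K(2) finS b0 by (intro sum_UN_le) auto
        also have "\<dots> \<le> (\<Sum>Q\<in>\<K>. c / real (t (st i)))"
        proof (rule sum_mono, rule bsmall)
          fix Q assume Q: "Q \<in> \<K>"
          show "{k \<in> S i. h (st i + k) \<in> Q} \<subseteq> {..<p (st i)}" by (auto simp: S_def)
          show "inj_on (\<lambda>k. h (st i + k)) {k \<in> S i. h (st i + k) \<in> Q}"
          proof (rule inj_onI)
            fix x y assume "x \<in> {k \<in> S i. h (st i + k) \<in> Q}" "y \<in> {k \<in> S i. h (st i + k) \<in> Q}"
              and eq: "h (st i + x) = h (st i + y)"
            then have "st i + x \<in> B" "st i + y \<in> B" by (simp_all add: S_def)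
            then show "x = y" using inj_onD[OF inj eq] by simp
          qed
          show "h (st i + k) < t (st i + Suc k)" if "k \<in> {k \<in> S i. h (st i + k) \<in> Q}" for k
            using that h by (auto simp: S_def)
          have "Q \<in> mschreier r" using Q K(3) by blast
          then show "(\<lambda>k. h (st i + k)) ` {k \<in> S i. h (st i + k) \<in> Q} \<in> mschreier r"
            by (rule mschreier_subset) auto
        qed
        also have "\<dots> = real (card \<K>) * (c / real (t (st i)))" by simp
        finally show ?thesis .
      qed
      have late: "sum (b (st (Suc i0 + i))) (S (Suc i0 + i)) \<le> c * (1 / 2) ^ i" for i
      proof -
        define j where "j = st (Suc i0 + i)"
        have "i + st (Suc i0) \<le> j" using st_gap[of i "Suc i0"] by (simp add: j_def)
        then have "t (st (Suc i0) + i) \<le> t j" using mono by (simp add: strict_mono_less_eq)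
        then have "2 ^ i * T0 \<le> t j" using doubling_power[of t i "st (Suc i0)"] d
          by (simp add: T0_def)
        then have "real (2 ^ i * T0) \<le> real (t j)" by (simp only: of_nat_le_iff)
        then have *: "2 ^ i * real T0 \<le> real (t j)" by simp
        have tj: "real (t j) > 0" using ge[of j] by simp
        have "real (card \<K>) * (c / real (t j)) \<le> real T0 * (c / real (t j))"
          using cK c tj by (intro mult_right_mono) auto
        also have "\<dots> \<le> c * (1 / 2) ^ i"
          using * tj c by (simp add: field_simps power_one_over)
        finally show ?thesis using piece[of "Suc i0 + i"] by (simp add: j_def)
      qed
      have first: "sum (b (st i0)) (S i0) \<le> 1"
        unfolding bsum[of "st i0", symmetric] by (rule sum_mono2) (auto simp: S_def b0)
      have tail: "(\<Sum>i<Suc i0 + e. sum (b (st i)) (S i)) \<le> 1 + 2 * c - 2 * c * (1 / 2) ^ e" for e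
      proof (induction e)
        case 0
        have "(\<Sum>i<i0. sum (b (st i)) (S i)) = 0" using i0' by (intro sum.neutral) auto
        then show ?case using first by simp
      next
        case (Suc e)
        then show ?case using late[of e] by simp
      qed
      have ex: "(\<Sum>i<e. sum (b (st i)) (S i)) \<le> 1 + 2 * c" for e
      proof -
        have "(\<Sum>i<e. sum (b (st i)) (S i)) \<le> (\<Sum>i<Suc i0 + e. sum (b (st i)) (S i))"
          by (rule sum_mono2) (auto intro: sum_nonneg b0)
        also have "\<dots> \<le> 1 + 2 * c - 2 * c * (1 / 2) ^ e" by (rule tail)
        also have "\<dots> \<le> 1 + 2 * c" using c by simp
        finally show ?thesis .
      qed
      have "sum b' B = (\<Sum>i<d0. sum (b (st i)) (S i)) / real d0"
        unfolding sumB[OF finB] S_def by (simp add: sum_divide_distrib)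
      also have "\<dots> \<le> (1 + 2 * c) / real d0" using ex by (intro divide_right_mono) auto
      finally show ?thesis by (simp add: d0_def)
    qed
    ultimately have "scc (Suc r) t (st d0) b' ((1 + 2 * c) / real (t 0))"
      by (intro sccI b'0 sum1)
    then show ?thesis by blast
  qed
  then show ?case using c by (intro exI[of _ "1 + 2 * c"]) auto
qed

subsection \<open>The norming set\<close>

lemma pairing_superset:
  assumes "finite A" "supp x \<subseteq> A"
  shows "pairing f x = (\<Sum>i\<in>A. f i * x i)"
  unfolding pairing_def by (rule sum.mono_neutral_left) (use assms in \<open>auto simp: supp_def\<close>)

lemma supp_lincomb: "supp (\<lambda>i. \<Sum>k\<in>I. a k * u k i) \<subseteq> (\<Union>k\<in>I. supp (u k))"
proof
  fix i assume "i \<in> supp (\<lambda>i. \<Sum>k\<in>I. a k * u k i)"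
  then have "(\<Sum>k\<in>I. a k * u k i) \<noteq> 0" by (simp add: supp_def)
  then obtain k where "k \<in> I" "a k * u k i \<noteq> 0" by (rule sum.not_neutral_contains_not_neutral)
  then show "i \<in> (\<Union>k\<in>I. supp (u k))" by (auto simp: supp_def)
qed

lemma pairing_lincomb:
  assumes "finite I" "\<And>k. k \<in> I \<Longrightarrow> finite (supp (u k))"
  shows "pairing f (\<lambda>i. \<Sum>k\<in>I. a k * u k i) = (\<Sum>k\<in>I. a k * pairing f (u k))"
proof -
  define A where "A = (\<Union>k\<in>I. supp (u k))"
  have A: "finite A" using assms by (simp add: A_def)
  have "pairing f (\<lambda>i. \<Sum>k\<in>I. a k * u k i) = (\<Sum>i\<in>A. f i * (\<Sum>k\<in>I. a k * u k i))"
    by (rule pairing_superset[OF A]) (use supp_lincomb[where I = I and a = a and u = u] in \<open>simp add: A_def\<close>)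
  also have "\<dots> = (\<Sum>i\<in>A. \<Sum>k\<in>I. a k * (f i * u k i))" by (simp add: sum_distrib_left algebra_simps)
  also have "\<dots> = (\<Sum>k\<in>I. \<Sum>i\<in>A. a k * (f i * u k i))" by (rule sum.swap)
  also have "\<dots> = (\<Sum>k\<in>I. a k * pairing f (u k))"
  proof (rule sum.cong[OF refl])
    fix k assume "k \<in> I"
    then have "pairing f (u k) = (\<Sum>i\<in>A. f i * u k i)" by (intro pairing_superset[OF A]) (auto simp: A_def)
    then show "(\<Sum>i\<in>A. a k * (f i * u k i)) = a k * pairing f (u k)" by (simp add: sum_distrib_left)
  qed
  finally show ?thesis .
qed

lemma supp_scale: "supp (\<lambda>i. c * x i) \<subseteq> supp x"
  by (auto simp: supp_def)

lemma c00_average: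
  assumes "finite I" "\<And>k. k \<in> I \<Longrightarrow> u k \<in> c00"
  shows "(\<lambda>i. c * (\<Sum>k\<in>I. a k * u k i)) \<in> c00"
proof -
  have sub: "supp (\<lambda>i. c * (\<Sum>k\<in>I. a k * u k i)) \<subseteq> (\<Union>k\<in>I. supp (u k))"
    using supp_scale supp_lincomb by (rule subset_trans)
  have "finite (\<Union>k\<in>I. supp (u k))" "(\<Union>k\<in>I. supp (u k)) \<subseteq> {1..}"
    using assms by (auto simp: c00_def)
  then show ?thesis using finite_subset[OF sub] order_trans[OF sub] by (simp add: c00_def)
qed

lemma pairing_scale: "pairing f (\<lambda>i. c * x i) = c * pairing f x"
proof (cases "c = 0")
  case False
  then have "supp (\<lambda>i. c * x i) = supp x" by (auto simp: supp_def)
  then show ?thesis by (simp add: pairing_def sum_distrib_left algebra_simps)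
qed (simp add: pairing_def)

lemma pairing_average:
  "pairing (\<lambda>i. c * (\<Sum>j\<in>J. l j * g j i)) x = c * (\<Sum>j\<in>J. l j * pairing (g j) x)"
proof -
  have "pairing (\<lambda>i. c * (\<Sum>j\<in>J. l j * g j i)) x = (\<Sum>i\<in>supp x. \<Sum>j\<in>J. c * (l j * (g j i * x i)))"
    by (simp add: pairing_def sum_distrib_left sum_distrib_right mult.assoc)
  also have "\<dots> = (\<Sum>j\<in>J. \<Sum>i\<in>supp x. c * (l j * (g j i * x i)))" by (rule sum.swap)
  finally show ?thesis by (simp add: pairing_def sum_distrib_left)
qed

lemma pairing_disjoint: "supp f \<inter> supp x = {} \<Longrightarrow> pairing f x = 0"
  unfolding pairing_def by (rule sum.neutral) (auto simp: supp_def)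

lemma pairing_scale_left: "(\<And>i. i \<in> supp x \<Longrightarrow> f i = c * g i) \<Longrightarrow> pairing f x = c * pairing g x"
  unfolding pairing_def by (simp add: sum_distrib_left mult.assoc)

lemma sq_pairing_le:
  fixes l p :: "'i \<Rightarrow> real"
  assumes "(\<Sum>i\<in>I. (l i)\<^sup>2) \<le> 1"
  shows "(\<Sum>i\<in>I. l i * p i)\<^sup>2 \<le> (\<Sum>i\<in>I. (p i)\<^sup>2)"
proof -
  have "(\<Sum>i\<in>I. l i * p i)\<^sup>2 \<le> (\<Sum>i\<in>I. (l i)\<^sup>2) * (\<Sum>i\<in>I. (p i)\<^sup>2)" by (rule Cauchy_Schwarz_ineq_sum)
  also have "\<dots> \<le> 1 * (\<Sum>i\<in>I. (p i)\<^sup>2)" using assms by (intro mult_right_mono sum_nonneg) auto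
  finally show ?thesis by simp
qed

text \<open>The test vector is \<open>p\<close> divided by its Euclidean norm. Bounds for averages
  in the norming set become bounds for sums of squares in this way.\<close>

lemma l2_duality:
  fixes p :: "'i \<Rightarrow> real"
  assumes "\<And>\<mu>. (\<Sum>i\<in>I. (\<mu> i)\<^sup>2) \<le> 1 \<Longrightarrow> (\<Sum>i\<in>I. \<mu> i * p i) \<le> C"
  shows "(\<Sum>i\<in>I. (p i)\<^sup>2) \<le> C\<^sup>2"
proof -
  define s where "s = sqrt (\<Sum>i\<in>I. (p i)\<^sup>2)"
  have s: "0 \<le> s" "s\<^sup>2 = (\<Sum>i\<in>I. (p i)\<^sup>2)" by (simp_all add: s_def sum_nonneg)
  show ?thesis
  proof (cases "s = 0")
    case False
    then have s0: "s > 0" using s by simp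
    have "(\<Sum>i\<in>I. (p i / s)\<^sup>2) = (\<Sum>i\<in>I. (p i)\<^sup>2) / s\<^sup>2"
      by (simp add: power_divide sum_divide_distrib)
    also have "\<dots> = s\<^sup>2 / s\<^sup>2" by (simp only: s(2))
    also have "\<dots> = 1" using False by simp
    finally have "(\<Sum>i\<in>I. (p i / s)\<^sup>2) = 1" .
    then have "(\<Sum>i\<in>I. p i / s * p i) \<le> C" using assms[of "\<lambda>i. p i / s"] by simp
    also have "(\<Sum>i\<in>I. p i / s * p i) = s\<^sup>2 / s"
      unfolding s(2) by (simp add: sum_divide_distrib power2_eq_square)
    also have "\<dots> = s" using False by (simp add: power2_eq_square)
    finally show ?thesis using s s0 by (metis less_imp_le power_mono)
  qed (use s in simp)
qed

lemma disjoint_scalar_sum: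
  fixes p :: "'i \<Rightarrow> real"
  assumes "finite I" "i \<in> I" "\<And>j. j \<in> I \<Longrightarrow> j \<noteq> i \<Longrightarrow> p j = 0"
  shows "(\<Sum>j\<in>I. p j) = p i"
  using assms by (subst sum.remove[of I i]) (auto intro: sum.neutral)

locale wh =
  fixes m n :: "nat \<Rightarrow> nat" and N1 N2 :: "nat set" and \<sigma> :: "(nat set \<times> nat) list \<Rightarrow> nat"
  assumes par: "wh_parameters m n N1 N2 \<sigma>"
begin

abbreviation D :: "(nat \<Rightarrow> real) \<Rightarrow> bool" where "D \<equiv> in_D m n N1 N2 \<sigma>"
abbreviation W :: "(nat \<Rightarrow> real) \<Rightarrow> nat \<Rightarrow> bool" where "W \<equiv> has_weight m n N1 N2 \<sigma>"

lemma par_simps: "mono m" "mono n" "m 0 = 2" "m 1 = 2" "n 0 = 1"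
  using par by (simp_all add: wh_parameters_def)

lemma m_ge_2: "2 \<le> m j"
  using monoD[OF par_simps(1), of 0 j] par_simps(3) by simp

lemma m_pos: "0 < real (m j)" "real (m j) \<noteq> 0"
  using m_ge_2[of j] by auto

lemma m_cube: "2 \<le> j \<Longrightarrow> m j ^ 3 \<le> m (Suc j)"
  using par by (simp add: wh_parameters_def)

lemma D_c00: "D f \<Longrightarrow> f \<in> c00" "W f w \<Longrightarrow> f \<in> c00"
proof (induction rule: in_D_has_weight.inducts)
  case (even_average fs j l)
  then show ?case by (intro c00_average) auto
next
  case (odd_average j s fs l)
  then show ?case by (intro c00_average) auto
qed (auto simp: c00_def supp_def unit_vec_def)

lemma D_supp: "D f \<Longrightarrow> finite (supp f)" "D f \<Longrightarrow> supp f \<subseteq> {1..}"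
  using D_c00(1) by (auto simp: c00_def)

text \<open>The even averaging rule for index sets instead of lists. Restriction produces members
  with empty support; they are dropped, since the rule admits nonempty supports only, and the
  remaining coefficients still lie in the unit ball.\<close>

lemma D_even:
  assumes I: "finite I" "\<And>i. i \<in> I \<Longrightarrow> D (h i)"
    and disj: "\<And>i j. i \<in> I \<Longrightarrow> j \<in> I \<Longrightarrow> i \<noteq> j \<Longrightarrow> supp (h i) \<inter> supp (h j) = {}"
    and S: "(\<lambda>i. Min (supp (h i))) ` {i \<in> I. supp (h i) \<noteq> {}} \<in> schreier (n (2 * j))"
    and \<mu>: "(\<Sum>i\<in>I. (\<mu> i)\<^sup>2) \<le> 1"
  shows "W (\<lambda>k. (1 / real (m (2 * j))) * (\<Sum>i\<in>I. \<mu> i * h i k)) (m (2 * j))"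
proof -
  define I' where "I' = {i \<in> I. supp (h i) \<noteq> {}}"
  have I': "finite I'" "I' \<subseteq> I" using I by (auto simp: I'_def)
  obtain xs where xs: "set xs = I'" "distinct xs" using finite_distinct_list[OF I'(1)] by blast
  have bij: "bij_betw ((!) xs) {..<length xs} I'" using bij_betw_nth xs by blast
  define fs where "fs = map h xs"
  define l where "l i = \<mu> (xs ! i)" for i
  have inI: "xs ! i \<in> I'" if "i < length xs" for i using that xs by auto
  have *: "(\<Sum>i<length fs. F (xs ! i)) = sum F I'" for F :: "_ \<Rightarrow> real"
    unfolding fs_def length_map by (rule sum.reindex_bij_betw[OF bij])
  have "W (\<lambda>k. (1 / real (m (2 * j))) * (\<Sum>i<length fs. l i * (fs ! i) k)) (m (2 * j))"
  proof (rule even_average)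
    show "D f" if "f \<in> set fs" for f using that I(2) xs(1) I'(2) by (auto simp: fs_def)
    have "Min ` set (map supp fs) = (\<lambda>i. Min (supp (h i))) ` I'" using xs(1) by (auto simp: fs_def image_image)
    then have "Min ` set (map supp fs) \<in> schreier (n (2 * j))" using S by (simp add: I'_def)
    moreover have "\<forall>E\<in>set (map supp fs). E \<noteq> {} \<and> finite E \<and> E \<subseteq> {1..}"
      using xs(1) D_supp I(2) by (fastforce simp: fs_def I'_def)
    moreover have "sorted_wrt (\<lambda>E F. E \<inter> F = {}) (map supp fs)"
      unfolding sorted_wrt_iff_nth_less
    proof (intro allI impI)
      fix i k assume ik: "i < k" "k < length (map supp fs)"
      then have "xs ! i \<noteq> xs ! k" using xs(2) by (simp add: nth_eq_iff_index_eq fs_def)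
      then show "map supp fs ! i \<inter> map supp fs ! k = {}"
        using ik disj inI[of i] inI[of k] I'(2) by (auto simp: fs_def)
    qed
    ultimately show "allowable (n (2 * j)) (map supp fs)" by (simp add: allowable_def)
    have "(\<Sum>i<length fs. (l i)\<^sup>2) = (\<Sum>i\<in>I'. (\<mu> i)\<^sup>2)" unfolding l_def by (rule *)
    also have "\<dots> \<le> (\<Sum>i\<in>I. (\<mu> i)\<^sup>2)" using I(1) I'(2) by (intro sum_mono2) auto
    finally show "(\<Sum>i<length fs. (l i)\<^sup>2) \<le> 1" using \<mu> by simp
  qed
  moreover have "(\<Sum>i<length fs. l i * (fs ! i) k) = (\<Sum>i\<in>I. \<mu> i * h i k)" for k
  proof -
    have "(\<Sum>i<length fs. l i * (fs ! i) k) = (\<Sum>i<length fs. \<mu> (xs ! i) * h (xs ! i) k)"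
      by (rule sum.cong) (auto simp: l_def fs_def)
    also have "\<dots> = (\<Sum>i\<in>I'. \<mu> i * h i k)" by (rule *)
    also have "\<dots> = (\<Sum>i\<in>I. \<mu> i * h i k)"
      using I(1) I'(2) by (intro sum.mono_neutral_left) (auto simp: I'_def supp_def)
    finally show ?thesis .
  qed
  ultimately show ?thesis by simp
qed

lemma W_zero: "W (\<lambda>_. 0) (m (2 * j))"
  using D_even[of "{}::nat set" "\<lambda>_ _. 0" j "\<lambda>_. 0"] schreier_empty by simp

lemma W_imp_index: "W f w \<Longrightarrow> \<exists>q. w = m q"
  by (erule has_weight.cases) auto

lemma W_pos: "W f w \<Longrightarrow> 2 \<le> w"
  using W_imp_index m_ge_2 by blast

subsection \<open>Allowable families\<close>

text \<open>The order is measured in \<open>mschreier\<close>, so that children of children again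
  form such a family, see \<open>al_Sigma\<close>. The index set allows the zero functional to occur
  repeatedly; empty supports contribute no minimum.\<close>

definition al :: "nat \<Rightarrow> 'i set \<Rightarrow> ('i \<Rightarrow> nat \<Rightarrow> real) \<Rightarrow> bool" where
  "al N I f \<longleftrightarrow> finite I \<and> (\<forall>i\<in>I. D (f i)) \<and>
     (\<forall>i\<in>I. \<forall>j\<in>I. i \<noteq> j \<longrightarrow> supp (f i) \<inter> supp (f j) = {}) \<and>
     (\<lambda>i. Min (supp (f i))) ` {i \<in> I. supp (f i) \<noteq> {}} \<in> mschreier N"

lemma alD: assumes "al N I f"
  shows "finite I" "i \<in> I \<Longrightarrow> D (f i)"
    "i \<in> I \<Longrightarrow> j \<in> I \<Longrightarrow> i \<noteq> j \<Longrightarrow> supp (f i) \<inter> supp (f j) = {}"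
    "(\<lambda>i. Min (supp (f i))) ` {i \<in> I. supp (f i) \<noteq> {}} \<in> mschreier N"
    "i \<in> I \<Longrightarrow> supp (f i) \<noteq> {} \<Longrightarrow> Min (supp (f i)) \<in> supp (f i)"
  using assms D_supp(1) by (auto simp: al_def)

lemma inj_on_Min_supp:
  assumes "\<And>i. i \<in> I \<Longrightarrow> D (f i)"
    "\<And>i j. i \<in> I \<Longrightarrow> j \<in> I \<Longrightarrow> i \<noteq> j \<Longrightarrow> supp (f i) \<inter> supp (f j) = {}"
  shows "inj_on (\<lambda>i. Min (supp (f i))) {i \<in> I. supp (f i) \<noteq> {}}"
proof (rule inj_onI)
  fix i j assume ij: "i \<in> {i \<in> I. supp (f i) \<noteq> {}}" "j \<in> {i \<in> I. supp (f i) \<noteq> {}}"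
    "Min (supp (f i)) = Min (supp (f j))"
  have "Min (supp (f k)) \<in> supp (f k)" if "k \<in> {i \<in> I. supp (f i) \<noteq> {}}" for k
    using that assms(1) D_supp(1) by (intro Min_in) auto
  then have "Min (supp (f i)) \<in> supp (f i) \<inter> supp (f j)" using ij by (metis IntI)
  then show "i = j" using assms(2)[of i j] ij by blast
qed

lemma al_sub:
  assumes al: "al N I f" and J: "J \<subseteq> I" "\<And>j. j \<in> J \<Longrightarrow> D (g j)" "\<And>j. j \<in> J \<Longrightarrow> supp (g j) \<subseteq> supp (f j)"
  shows "al N J g"
proof -
  have "(\<lambda>i. Min (supp (g i))) ` {i \<in> J. supp (g i) \<noteq> {}} \<in> mschreier N"
  proof (rule mschreier_index[OF alD(4)[OF al]])
    show "inj_on (\<lambda>i. Min (supp (f i))) {i \<in> I. supp (f i) \<noteq> {}}"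
      using alD[OF al] by (intro inj_on_Min_supp)
    show "{i \<in> J. supp (g i) \<noteq> {}} \<subseteq> {i \<in> I. supp (f i) \<noteq> {}}" using J by blast
    fix j assume "j \<in> {i \<in> J. supp (g i) \<noteq> {}}"
    then show "Min (supp (f j)) \<le> Min (supp (g j))"
      using J alD(2)[OF al] D_supp(1) by (intro Min_antimono) auto
  qed
  moreover have "supp (g i) \<inter> supp (g j) = {}" if "i \<in> J" "j \<in> J" "i \<noteq> j" for i j
    using alD(3)[OF al, of i j] J(1,3) that by blast
  moreover have "finite J" using J(1) alD(1)[OF al] by (rule finite_subset)
  ultimately show ?thesis using J(2) unfolding al_def by simp
qed

lemma al_mono: assumes "al N I f" "N \<le> N'" shows "al N' I f"
  using assms(1) mschreier_mono[OF alD(4)[OF assms(1)] assms(2)] unfolding al_def by simp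

lemma al_subset: assumes "al N I f" "J \<subseteq> I" shows "al N J f"
  using assms(2) alD(2)[OF assms(1)] by (intro al_sub[OF assms]) auto

text \<open>The support of a child has a minimum to the right of that of its parent, so the orders
  add by \<open>mschreier_comp\<close>. A parent with empty support has only children with empty
  support and contributes nothing.\<close>

lemma al_Sigma:
  assumes al: "al N I f" and ch: "\<And>i. i \<in> I \<Longrightarrow> al b (G i) (h i)"
    and sub: "\<And>i g. i \<in> I \<Longrightarrow> g \<in> G i \<Longrightarrow> supp (h i g) \<subseteq> supp (f i)"
  shows "al (N + b) (Sigma I G) (\<lambda>(i, g). h i g)"
proof -
  define I' where "I' = {i \<in> I. supp (f i) \<noteq> {}}"
  define a where "a i = Min (supp (f i))" for i
  \<comment> \<open>Disjoint supports have distinct minima, so a parent can be recovered from its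
    minimum; \<open>mschreier_comp\<close> indexes by points.\<close>
  have inj: "inj_on a I'" unfolding I'_def a_def using alD[OF al] by (intro inj_on_Min_supp)
  define M where "M i = (\<lambda>g. Min (supp (h i g))) ` {g \<in> G i. supp (h i g) \<noteq> {}}" for i
  have "(\<Union>k\<in>a ` I'. M (the_inv_into I' a k)) \<in> mschreier (N + b)"
  proof (rule mschreier_comp)
    show "a ` I' \<in> mschreier N" using alD(4)[OF al] by (simp add: a_def I'_def)
    fix k assume "k \<in> a ` I'"
    then obtain i where i: "i \<in> I'" "k = a i" by blast
    then have inv: "the_inv_into I' a k = i" using inj by (simp add: the_inv_into_f_f)
    have iI: "i \<in> I" using i by (simp add: I'_def)
    show "M (the_inv_into I' a k) \<in> mschreier b" using alD(4)[OF ch[OF iI]] by (simp add: inv M_def)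
    fix x assume "x \<in> M (the_inv_into I' a k)"
    then obtain g where g: "g \<in> G i" "supp (h i g) \<noteq> {}" "x = Min (supp (h i g))" by (auto simp: inv M_def)
    show "k \<le> x" unfolding g(3) i(2) a_def
      using g sub[OF iI g(1)] alD(2)[OF al iI] D_supp(1) by (intro Min_antimono) auto
  qed
  also have "(\<Union>k\<in>a ` I'. M (the_inv_into I' a k)) = (\<Union>i\<in>I'. M i)"
    using inj by (auto simp: the_inv_into_f_f)
  also have "\<dots> = (\<lambda>p. Min (supp (case p of (i, g) \<Rightarrow> h i g))) `
      {p \<in> Sigma I G. supp (case p of (i, g) \<Rightarrow> h i g) \<noteq> {}}"
    using sub by (fastforce simp: M_def I'_def image_iff)
  finally have 1: "(\<lambda>p. Min (supp (case p of (i, g) \<Rightarrow> h i g))) `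
      {p \<in> Sigma I G. supp (case p of (i, g) \<Rightarrow> h i g) \<noteq> {}} \<in> mschreier (N + b)" .
  have 2: "supp (h i g) \<inter> supp (h i' g') = {}"
    if "i \<in> I" "g \<in> G i" "i' \<in> I" "g' \<in> G i'" "(i, g) \<noteq> (i', g')" for i g i' g'
  proof (cases "i = i'")
    case True
    then show ?thesis using that alD(3)[OF ch] by blast
  next
    case False
    then show ?thesis using that alD(3)[OF al] sub by blast
  qed
  have "finite (Sigma I G)" using alD(1)[OF al] alD(1)[OF ch] by (intro finite_SigmaI)
  moreover have "D (h i g)" if "i \<in> I" "g \<in> G i" for i g using alD(2)[OF ch] that by blast
  ultimately show ?thesis unfolding al_def using 1 2 by auto
qed

text \<open>A bound for the square of a dual norm. The order \<open>N\<close> is a parameter because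
  every passage to children raises it, and \<open>P\<close> because functionals are treated
  according to their weights.\<close>

definition bd :: "((nat \<Rightarrow> real) \<Rightarrow> bool) \<Rightarrow> nat \<Rightarrow> (nat \<Rightarrow> real) \<Rightarrow> real \<Rightarrow> bool" where
  "bd P N x c \<longleftrightarrow> (\<forall>\<F>. al N \<F> (\<lambda>f. f) \<longrightarrow> (\<forall>f\<in>\<F>. P f) \<longrightarrow> (\<Sum>f\<in>\<F>. (pairing f x)\<^sup>2) \<le> c)"

text \<open>An indexed family reduces to a set of functionals because disjointness makes the
  indexing injective where the pairing does not vanish. Only members with nonzero pairing have to
  satisfy \<open>P\<close>.\<close>

lemma bd_al:
  assumes bd: "bd P N x c" and al: "al N I f" and P: "\<And>i. i \<in> I \<Longrightarrow> pairing (f i) x \<noteq> 0 \<Longrightarrow> P (f i)"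
  shows "(\<Sum>i\<in>I. (pairing (f i) x)\<^sup>2) \<le> c"
proof -
  define I' where "I' = {i \<in> I. pairing (f i) x \<noteq> 0}"
  have ne: "supp (f i) \<noteq> {}" if "i \<in> I'" for i
    using that pairing_disjoint[of "f i" x] by (auto simp: I'_def)
  have inj: "inj_on f I'"
  proof (rule inj_onI)
    fix i j assume "i \<in> I'" "j \<in> I'" "f i = f j"
    then show "i = j" using alD(3)[OF al, of i j] ne[of i] by (auto simp: I'_def)
  qed
  have al': "al N I' f" using al by (rule al_subset) (simp add: I'_def)
  have "al N (f ` I') (\<lambda>f. f)"
  proof -
    have "{g \<in> f ` I'. supp g \<noteq> {}} = f ` {i \<in> I'. supp (f i) \<noteq> {}}" by auto
    then have "(\<lambda>g. Min (supp g)) ` {g \<in> f ` I'. supp g \<noteq> {}} \<in> mschreier N"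
      using alD(4)[OF al'] by (simp add: image_image)
    then show ?thesis using alD(1,2,3)[OF al'] unfolding al_def by fastforce
  qed
  then have "(\<Sum>g\<in>f ` I'. (pairing g x)\<^sup>2) \<le> c" using bd P unfolding bd_def by (auto simp: I'_def)
  moreover have "(\<Sum>g\<in>f ` I'. (pairing g x)\<^sup>2) = (\<Sum>i\<in>I'. (pairing (f i) x)\<^sup>2)"
    using inj by (simp add: sum.reindex)
  moreover have "(\<Sum>i\<in>I'. (pairing (f i) x)\<^sup>2) = (\<Sum>i\<in>I. (pairing (f i) x)\<^sup>2)"
    using alD(1)[OF al] by (intro sum.mono_neutral_left) (auto simp: I'_def)
  ultimately show ?thesis by simp
qed

lemma bdI:
  assumes "\<And>\<F>. al N \<F> (\<lambda>f. f) \<Longrightarrow> (\<And>f. f \<in> \<F> \<Longrightarrow> P f) \<Longrightarrow> (\<Sum>f\<in>\<F>. (pairing f x)\<^sup>2) \<le> c"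
  shows "bd P N x c"
  using assms unfolding bd_def by blast

lemma bd_mono:
  assumes "bd P N x c" "N' \<le> N" "\<And>f. P' f \<Longrightarrow> P f" "c \<le> c'"
  shows "bd P' N' x c'"
proof (rule bdI)
  fix \<F> assume "al N' \<F> (\<lambda>f. f)" "\<And>f. f \<in> \<F> \<Longrightarrow> P' f"
  then have "(\<Sum>f\<in>\<F>. (pairing f x)\<^sup>2) \<le> c"
    using assms al_mono[of N' \<F> "\<lambda>f. f" N] by (intro bd_al[OF assms(1)]) auto
  then show "(\<Sum>f\<in>\<F>. (pairing f x)\<^sup>2) \<le> c'" using assms(4) by simp
qed

lemma bd_nonneg: assumes "bd P N x c" shows "0 \<le> c"
proof -
  have "al N {} (\<lambda>f. f)" using mschreier_empty by (simp add: al_def)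
  from bd_al[OF assms this] show ?thesis by simp
qed

lemma bd_scale:
  assumes "bd P N x c" shows "bd P N (\<lambda>i. r * x i) (r\<^sup>2 * c)"
proof (rule bdI)
  fix \<F> assume "al N \<F> (\<lambda>f. f)" "\<And>f. f \<in> \<F> \<Longrightarrow> P f"
  then have "(\<Sum>f\<in>\<F>. (pairing f x)\<^sup>2) \<le> c" using bd_al[OF assms] by blast
  then have "r\<^sup>2 * (\<Sum>f\<in>\<F>. (pairing f x)\<^sup>2) \<le> r\<^sup>2 * c" by (intro mult_left_mono) auto
  then show "(\<Sum>f\<in>\<F>. (pairing f (\<lambda>i. r * x i))\<^sup>2) \<le> r\<^sup>2 * c"
    by (simp add: pairing_scale power_mult_distrib sum_distrib_left)
qed

text \<open>Since \<open>m 0 = 2\<close> and \<open>n 0 = 1\<close>, each level in the construction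
  of a set of order \<open>N\<close> costs one average of weight 2, and so does the base level. The
  groups of a level are combined with the Euclidean norms \<open>\<rho> Q\<close> of their
  coefficients. The factor is exponential in \<open>N\<close>, but the family need not be
  ordered.\<close>

lemma al_combination:
  assumes "al N I f" "(\<Sum>i\<in>I. (\<mu> i)\<^sup>2) \<le> 1"
  shows "D (\<lambda>k. (1 / 2 ^ Suc N) * (\<Sum>i\<in>I. \<mu> i * f i k))"
  using assms
proof (induction N arbitrary: I \<mu>)
  case 0
  let ?M = "(\<lambda>i. Min (supp (f i))) ` {i \<in> I. supp (f i) \<noteq> {}}"
  have "?M \<in> schreier 0" using alD(4)[OF 0(1)] by simp
  then have "?M \<in> schreier (n (2 * 0))" by (rule schreier_mono) simp
  then have "W (\<lambda>k. (1 / real (m (2 * 0))) * (\<Sum>i\<in>I. \<mu> i * f i k)) (m (2 * 0))"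
    using 0(2) alD(1,2,3)[OF 0(1)] by (intro D_even)
  then show ?case using par_simps(3) by (auto intro: weighted)
next
  case (Suc N)
  note al = Suc.prems(1)
  define a where "a i = Min (supp (f i))" for i
  define I' where "I' = {i \<in> I. supp (f i) \<noteq> {}}"
  obtain \<K> where K: "a ` I' = \<Union>\<K>" "finite \<K>" "\<K> \<subseteq> mschreier N" "\<forall>k\<in>\<Union>\<K>. card \<K> \<le> k"
    using alD(4)[OF al] by (auto simp: a_def I'_def)
  \<comment> \<open>The pieces may overlap; each member is assigned to one of them, so that the
    groups become disjoint.\<close>
  have "\<forall>i\<in>I'. \<exists>Q\<in>\<K>. a i \<in> Q" using K(1) by blast
  then obtain qf where qf: "\<And>i. i \<in> I' \<Longrightarrow> qf i \<in> \<K> \<and> a i \<in> qf i" by metis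
  define J where "J Q = {i \<in> I'. qf i = Q}" for Q
  have J: "finite (J Q)" "J Q \<subseteq> I" for Q using alD(1)[OF al] by (auto simp: J_def I'_def)
  define \<rho> where "\<rho> Q = sqrt (\<Sum>i\<in>J Q. (\<mu> i)\<^sup>2)" for Q
  have \<rho>: "(\<rho> Q)\<^sup>2 = (\<Sum>i\<in>J Q. (\<mu> i)\<^sup>2)" for Q by (simp add: \<rho>_def sum_nonneg)
  define g where "g Q = (\<lambda>k. (1 / 2 ^ Suc N) * (\<Sum>i\<in>J Q. (\<mu> i / \<rho> Q) * f i k))" for Q
  have \<rho>0: "\<mu> i = 0" if "\<rho> Q = 0" "i \<in> J Q" for Q i
  proof -
    have "(\<Sum>i\<in>J Q. (\<mu> i)\<^sup>2) = 0" using \<rho>[of Q] that(1) by simp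
    then show ?thesis using that(2) J(1) by (simp add: sum_nonneg_eq_0_iff)
  qed
  have Dg: "D (g Q)" if Q: "Q \<in> \<K>" for Q
    unfolding g_def
  proof (rule Suc.IH)
    have "(\<lambda>i. Min (supp (f i))) ` {i \<in> J Q. supp (f i) \<noteq> {}} \<subseteq> Q"
      using qf by (auto simp: J_def a_def)
    then have "(\<lambda>i. Min (supp (f i))) ` {i \<in> J Q. supp (f i) \<noteq> {}} \<in> mschreier N"
      using K(3) Q mschreier_subset by blast
    moreover have "\<forall>i\<in>J Q. D (f i)" using J(2) alD(2)[OF al] by blast
    moreover have "\<forall>i\<in>J Q. \<forall>j\<in>J Q. i \<noteq> j \<longrightarrow> supp (f i) \<inter> supp (f j) = {}"
      using J(2) alD(3)[OF al] by (meson subsetD)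
    ultimately show "al N (J Q) f" using J(1) unfolding al_def by simp
    show "(\<Sum>i\<in>J Q. (\<mu> i / \<rho> Q)\<^sup>2) \<le> 1"
      using \<rho>[of Q] by (simp add: power_divide sum_divide_distrib[symmetric])
  qed
  have gsupp: "supp (g Q) \<subseteq> (\<Union>i\<in>J Q. supp (f i))" for Q
    unfolding g_def using supp_scale supp_lincomb by (rule subset_trans)
  have "W (\<lambda>k. (1 / real (m (2 * 0))) * (\<Sum>Q\<in>\<K>. \<rho> Q * g Q k)) (m (2 * 0))"
  proof (rule D_even[OF K(2) Dg])
    show "supp (g Q) \<inter> supp (g R) = {}" if "Q \<in> \<K>" "R \<in> \<K>" "Q \<noteq> R" for Q R
    proof -
      have "supp (f i) \<inter> supp (f j) = {}" if "i \<in> J Q" "j \<in> J R" for i j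
        using that \<open>Q \<noteq> R\<close> J by (intro alD(3)[OF al]) (auto simp: J_def)
      then show ?thesis using gsupp[of Q] gsupp[of R] by blast
    qed
    let ?M = "(\<lambda>Q. Min (supp (g Q))) ` {Q \<in> \<K>. supp (g Q) \<noteq> {}}"
    have "card ?M \<le> card {Q \<in> \<K>. supp (g Q) \<noteq> {}}" using K(2) by (intro card_image_le) auto
    also have "\<dots> \<le> card \<K>" using K(2) by (intro card_mono) auto
    finally have c: "card ?M \<le> card \<K>" .
    have ge: "card \<K> \<le> x \<and> 1 \<le> x" if x: "x \<in> ?M" for x
    proof -
      obtain Q where Q: "Q \<in> \<K>" "supp (g Q) \<noteq> {}" "x = Min (supp (g Q))" using x by blast
      then have xg: "x \<in> supp (g Q)" using D_supp(1)[OF Dg[OF Q(1)]] by simp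
      then obtain i where i: "i \<in> J Q" "x \<in> supp (f i)" using gsupp by blast
      then have i': "i \<in> I'" "i \<in> I" by (auto simp: J_def I'_def)
      have "a i \<le> x" unfolding a_def using i(2) D_supp(1)[OF alD(2)[OF al i'(2)]] by simp
      moreover have "card \<K> \<le> a i" using K(1,4) i'(1) by blast
      moreover have "1 \<le> x" using D_supp(2)[OF Dg[OF Q(1)]] xg by auto
      ultimately show ?thesis by simp
    qed
    have "finite ?M" using K(2) by simp
    then have "?M = {} \<or> card ?M \<le> Min ?M"
    proof (cases "?M = {}")
      case False
      then have "Min ?M \<in> ?M" using \<open>finite ?M\<close> by (intro Min_in)
      then have "card \<K> \<le> Min ?M" using ge by blast
      then show ?thesis using c by linarith
    qed simp
    then have "?M \<in> schreier (Suc 0)" unfolding schreier.simps using ge \<open>finite ?M\<close> by blast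
    then show "?M \<in> schreier (n (2 * 0))" using par_simps(5) by simp
    have "(\<Sum>Q\<in>\<K>. (\<rho> Q)\<^sup>2) = (\<Sum>Q\<in>\<K>. \<Sum>i\<in>{i \<in> I'. qf i = Q}. (\<mu> i)\<^sup>2)" by (simp add: \<rho> J_def)
    also have "\<dots> = (\<Sum>i\<in>I'. (\<mu> i)\<^sup>2)"
      using K(2) qf alD(1)[OF al] by (intro sum.group) (auto simp: I'_def)
    also have "\<dots> \<le> (\<Sum>i\<in>I. (\<mu> i)\<^sup>2)" using alD(1)[OF al] by (intro sum_mono2) (auto simp: I'_def)
    finally show "(\<Sum>Q\<in>\<K>. (\<rho> Q)\<^sup>2) \<le> 1" using Suc.prems(2) by simp
  qed
  moreover have "(1 / real (m (2 * 0))) * (\<Sum>Q\<in>\<K>. \<rho> Q * g Q k) = (1 / 2 ^ Suc (Suc N)) * (\<Sum>i\<in>I. \<mu> i * f i k)" for k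
  proof -
    have "\<rho> Q * g Q k = (1 / 2 ^ Suc N) * (\<Sum>i\<in>{i \<in> I'. qf i = Q}. \<mu> i * f i k)" for Q
    proof (cases "\<rho> Q = 0")
      case True
      then have "(\<Sum>i\<in>J Q. \<mu> i * f i k) = 0" using \<rho>0 by (intro sum.neutral) auto
      then show ?thesis using True by (simp add: J_def)
    next
      case False
      then show ?thesis unfolding g_def J_def[symmetric] by (simp add: sum_distrib_left)
    qed
    then have "(\<Sum>Q\<in>\<K>. \<rho> Q * g Q k) = (1 / 2 ^ Suc N) * (\<Sum>Q\<in>\<K>. \<Sum>i\<in>{i \<in> I'. qf i = Q}. \<mu> i * f i k)"
      by (simp add: sum_distrib_left)
    also have "(\<Sum>Q\<in>\<K>. \<Sum>i\<in>{i \<in> I'. qf i = Q}. \<mu> i * f i k) = (\<Sum>i\<in>I'. \<mu> i * f i k)"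
      using K(2) qf alD(1)[OF al] by (intro sum.group) (auto simp: I'_def)
    also have "\<dots> = (\<Sum>i\<in>I. \<mu> i * f i k)"
      using alD(1)[OF al] by (intro sum.mono_neutral_left) (auto simp: I'_def supp_def)
    finally show ?thesis using par_simps(3) by simp
  qed
  ultimately show ?case by (simp add: weighted)
qed

text \<open>The dual form of \<open>al_combination\<close>. Its exponential constant is harmless
  where it is multiplied by the small \<epsilon> of a special convex combination, or where the order
  is 1.\<close>

lemma al_lower:
  assumes x: "\<And>f. D f \<Longrightarrow> pairing f x \<le> K"
  shows "bd P N x (4 ^ Suc N * K\<^sup>2)"
proof (rule bdI)
  fix \<F> assume al: "al N \<F> (\<lambda>f. f)"
  have "(\<Sum>f\<in>\<F>. (pairing f x)\<^sup>2) \<le> (2 ^ Suc N * K)\<^sup>2"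
  proof (rule l2_duality)
    fix \<mu> :: "_ \<Rightarrow> real" assume "(\<Sum>i\<in>\<F>. (\<mu> i)\<^sup>2) \<le> 1"
    then have "D (\<lambda>k. (1 / 2 ^ Suc N) * (\<Sum>i\<in>\<F>. \<mu> i * i k))" by (rule al_combination[OF al])
    then have "pairing (\<lambda>k. (1 / 2 ^ Suc N) * (\<Sum>i\<in>\<F>. \<mu> i * i k)) x \<le> K" by (rule x)
    then have "(1 / 2 ^ Suc N) * (\<Sum>i\<in>\<F>. \<mu> i * pairing i x) \<le> K" by (simp only: pairing_average)
    then show "(\<Sum>i\<in>\<F>. \<mu> i * pairing i x) \<le> 2 ^ Suc N * K" by (simp add: field_simps)
  qed
  also have "(2 ^ Suc N * K)\<^sup>2 = 4 ^ Suc N * K\<^sup>2"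
    unfolding power_mult_distrib[of _ K] by (simp add: power2_eq_square flip: power_mult_distrib)
  finally show "(\<Sum>f\<in>\<F>. (pairing f x)\<^sup>2) \<le> 4 ^ Suc N * K\<^sup>2" .
qed

end

lemma schreier_index:
  assumes "a ` I \<in> schreier n" "inj_on a I" "J \<subseteq> I" "inj_on b J" "\<And>i. i \<in> J \<Longrightarrow> a i \<le> b i"
  shows "b ` J \<in> schreier n"
proof (rule schreier_spread[OF assms(1)])
  define r where "r x = a (the_inv_into J b x)" for x
  have r: "r (b i) = a i" if "i \<in> J" for i using that assms(4) by (simp add: r_def the_inv_into_f_f)
  show "inj_on r (b ` J)"
  proof (rule inj_onI)
    fix x y assume "x \<in> b ` J" "y \<in> b ` J" "r x = r y"
    then obtain i j where ij: "i \<in> J" "x = b i" "j \<in> J" "y = b j" "a i = a j" using r by auto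
    then have "i = j" using assms(2,3) by (meson inj_onD subsetD)
    then show "x = y" using ij by simp
  qed
  show "r ` (b ` J) \<subseteq> a ` I" using r assms(3) by auto
  show "r x \<le> x" if "x \<in> b ` J" for x using that r assms(5) by auto
qed

context wh begin

subsection \<open>Decomposition of functionals\<close>

definition unitf :: "(nat \<Rightarrow> real) \<Rightarrow> bool" where
  "unitf f \<longleftrightarrow> (\<exists>k\<ge>1. f = unit_vec k \<or> f = (\<lambda>i. - unit_vec k i))"

lemma D_cases: "D f \<Longrightarrow> unitf f \<or> (\<exists>w. W f w)"
  unfolding unitf_def by (erule in_D.cases) blast+

lemma unitf_D: "unitf f \<Longrightarrow> D f"
  unfolding unitf_def by (auto intro: pos_unit neg_unit)

lemma unitf_supp: "unitf f \<Longrightarrow> \<exists>k. supp f = {k}"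
  unfolding unitf_def by (auto simp: supp_def unit_vec_def)

text \<open>Multipliers in the Euclidean unit ball give, by Cauchy-Schwarz, upper ell-2 estimates
  with constant 1 for vectors supported in disjoint sets \<open>A k\<close>. For a single set the
  notion says that restriction costs nothing.\<close>

definition decomp :: "((nat \<Rightarrow> real) \<Rightarrow> bool) \<Rightarrow> 'k set \<Rightarrow> ('k \<Rightarrow> nat set) \<Rightarrow> (nat \<Rightarrow> real) \<Rightarrow> bool" where
  "decomp P K A f \<longleftrightarrow> (\<exists>g \<nu>. (\<forall>k\<in>K. P (g k) \<and> supp (g k) \<subseteq> supp f \<inter> A k \<and> (\<forall>x\<in>A k. f x = \<nu> k * g k x)) \<and>
     (\<Sum>k\<in>K. (\<nu> k)\<^sup>2) \<le> 1)"

lemma decomp_mono: "decomp P K A f \<Longrightarrow> (\<And>g. P g \<Longrightarrow> Q g) \<Longrightarrow> decomp Q K A f"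
  unfolding decomp_def by blast

lemma decomp_unit:
  assumes K: "finite K" "\<And>k l. k \<in> K \<Longrightarrow> l \<in> K \<Longrightarrow> k \<noteq> l \<Longrightarrow> A k \<inter> A l = {}" and f: "unitf f"
  shows "decomp (\<lambda>g. g = f \<or> g = (\<lambda>_. 0)) K A f"
proof -
  obtain t where t: "supp f = {t}" using unitf_supp[OF f] by blast
  define \<nu> where "\<nu> k = (if t \<in> A k then 1 else 0 :: real)" for k
  define g where "g k = (if t \<in> A k then f else (\<lambda>_. 0))" for k
  have "(\<Sum>k\<in>K. (\<nu> k)\<^sup>2) \<le> 1"
  proof (cases "\<exists>k\<in>K. t \<in> A k")
    case True
    then obtain k where k: "k \<in> K" "t \<in> A k" by blast
    then have "t \<notin> A l" if "l \<in> K" "l \<noteq> k" for l using K(2)[of l k] that by blast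
    then have "(\<Sum>k\<in>K. (\<nu> k)\<^sup>2) = (\<nu> k)\<^sup>2"
      using K(1) k(1) by (intro disjoint_scalar_sum) (auto simp: \<nu>_def)
    then show ?thesis by (simp add: \<nu>_def)
  next
    case False
    then have "(\<Sum>k\<in>K. (\<nu> k)\<^sup>2) = 0" by (intro sum.neutral) (auto simp: \<nu>_def)
    then show ?thesis by simp
  qed
  moreover have "f x = \<nu> k * g k x" if "x \<in> A k" for k x
  proof (cases "x = t")
    case False
    then have "x \<notin> supp f" using t by simp
    then show ?thesis by (simp add: supp_def g_def)
  qed (use that in \<open>simp add: \<nu>_def g_def\<close>)
  moreover have "supp (g k) \<subseteq> supp f \<inter> A k" for k
  proof (cases "t \<in> A k")
    case True
    then show ?thesis using t by (simp add: g_def)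
  qed (simp add: g_def supp_def)
  moreover have "g k = f \<or> g k = (\<lambda>_. 0)" for k by (simp add: g_def)
  ultimately show ?thesis unfolding decomp_def by blast
qed

text \<open>The new multiplier on \<open>A k\<close> is the Euclidean norm \<open>\<rho> k\<close>
  of the products \<open>l i * \<nu> i k\<close>; after division by it the products are coefficients
  in the unit ball, to be used in the average of the pieces. Exchanging sums shows that the squares
  of the \<open>\<rho> k\<close> add up to at most 1.\<close>

lemma decomp_average:
  fixes l :: "nat \<Rightarrow> real" and \<nu> :: "nat \<Rightarrow> 'k \<Rightarrow> real"
  assumes K: "finite K"
    and g: "\<And>i k. i < d \<Longrightarrow> k \<in> K \<Longrightarrow> supp (g i k) \<subseteq> A k"
      "\<And>i k x. i < d \<Longrightarrow> k \<in> K \<Longrightarrow> x \<in> A k \<Longrightarrow> f i x = \<nu> i k * g i k x"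
    and \<nu>: "\<And>i. i < d \<Longrightarrow> (\<Sum>k\<in>K. (\<nu> i k)\<^sup>2) \<le> 1" and l: "(\<Sum>i<d. (l i)\<^sup>2) \<le> 1"
    and P: "\<And>k \<mu>. k \<in> K \<Longrightarrow> (\<Sum>i<d. (\<mu> i)\<^sup>2) \<le> 1 \<Longrightarrow> P (\<lambda>x. c * (\<Sum>i<d. \<mu> i * g i k x))"
  shows "decomp P K A (\<lambda>x. c * (\<Sum>i<d. l i * f i x))"
proof -
  define \<rho> where "\<rho> k = sqrt (\<Sum>i<d. (l i * \<nu> i k)\<^sup>2)" for k
  have \<rho>: "(\<rho> k)\<^sup>2 = (\<Sum>i<d. (l i * \<nu> i k)\<^sup>2)" for k by (simp add: \<rho>_def sum_nonneg)
  define G where "G k = (\<lambda>x. c * (\<Sum>i<d. (l i * \<nu> i k / \<rho> k) * g i k x))" for k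
  have PG: "P (G k)" if "k \<in> K" for k unfolding G_def
  proof (rule P[OF that])
    show "(\<Sum>i<d. (l i * \<nu> i k / \<rho> k)\<^sup>2) \<le> 1"
      using \<rho>[of k] by (simp add: power_divide sum_divide_distrib[symmetric])
  qed
  have eq: "c * (\<Sum>i<d. l i * f i x) = \<rho> k * G k x" if k: "k \<in> K" "x \<in> A k" for k x
  proof (cases "\<rho> k = 0")
    case True
    then have "(\<Sum>i<d. (l i * \<nu> i k)\<^sup>2) = 0" using \<rho>[of k] by simp
    then have "\<forall>i<d. l i * \<nu> i k = 0" by (subst (asm) sum_nonneg_eq_0_iff) auto
    then have "l i * f i x = 0" if "i < d" for i using g(2)[OF that k] that by auto
    then have "(\<Sum>i<d. l i * f i x) = 0" by (intro sum.neutral) simp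
    then show ?thesis using True by simp
  next
    case False
    have "\<rho> k * G k x = c * (\<Sum>i<d. \<rho> k * ((l i * \<nu> i k / \<rho> k) * g i k x))"
      by (simp only: G_def mult.left_commute[of "\<rho> k" c] sum_distrib_left[of "\<rho> k"])
    also have "\<dots> = c * (\<Sum>i<d. l i * f i x)"
      using g(2) k False by (intro arg_cong[of _ _ "\<lambda>z. c * z"] sum.cong) auto
    finally show ?thesis by simp
  qed
  have "supp (G k) \<subseteq> A k" if "k \<in> K" for k
  proof -
    have "supp (G k) \<subseteq> (\<Union>i<d. supp (g i k))"
      unfolding G_def using supp_scale supp_lincomb by (rule subset_trans)
    then show ?thesis using g(1) that by blast
  qed
  moreover have "supp (G k) \<subseteq> supp (\<lambda>x. c * (\<Sum>i<d. l i * f i x))" if k: "k \<in> K" for k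
  proof
    fix x assume x: "x \<in> supp (G k)"
    then have xA: "x \<in> A k" using calculation[OF k] by blast
    have "\<rho> k \<noteq> 0"
    proof
      assume "\<rho> k = 0"
      then have "G k x = 0" by (simp add: G_def)
      then show False using x by (simp add: supp_def)
    qed
    then have "\<rho> k * G k x \<noteq> 0" using x by (simp add: supp_def)
    then show "x \<in> supp (\<lambda>x. c * (\<Sum>i<d. l i * f i x))" 
      by (simp only: supp_def mem_Collect_eq eq[OF k xA] not_False_eq_True)
  qed
  moreover have "(\<Sum>k\<in>K. (\<rho> k)\<^sup>2) \<le> 1"
  proof -
    have "(\<Sum>k\<in>K. (\<rho> k)\<^sup>2) = (\<Sum>i<d. \<Sum>k\<in>K. (l i * \<nu> i k)\<^sup>2)" unfolding \<rho> by (rule sum.swap)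
    also have "\<dots> = (\<Sum>i<d. (l i)\<^sup>2 * (\<Sum>k\<in>K. (\<nu> i k)\<^sup>2))" by (simp add: power_mult_distrib sum_distrib_left)
    also have "\<dots> \<le> (\<Sum>i<d. (l i)\<^sup>2 * 1)" using \<nu> by (intro sum_mono mult_left_mono) auto
    finally show ?thesis using l by simp
  qed
  ultimately show ?thesis unfolding decomp_def using PG eq by blast
qed

lemma D_zero: "D (\<lambda>_. 0)"
  by (rule weighted[OF W_zero])

text \<open>Induction over the construction of the norming set. Restriction keeps the weight: in the
  even case minima of supports move right, and in the odd case the sets of the special sequence need
  only contain the supports, so the same sequence serves for all pieces.\<close>

lemma D_W_decomp:
  assumes K: "finite K" "\<And>k l. k \<in> K \<Longrightarrow> l \<in> K \<Longrightarrow> k \<noteq> l \<Longrightarrow> A k \<inter> A l = {}"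
  shows "D f \<Longrightarrow> decomp D K A f" "W f w \<Longrightarrow> decomp (\<lambda>g. W g w) K A f"
proof (induction rule: in_D_has_weight.inducts)
  case (pos_unit k)
  then have "unitf (unit_vec k)" by (auto simp: unitf_def)
  from decomp_unit[OF K this] show ?case
    by (rule decomp_mono) (use unitf_D[OF \<open>unitf (unit_vec k)\<close>] D_zero in auto)
next
  case (neg_unit k)
  then have u: "unitf (\<lambda>i. - unit_vec k i)" by (auto simp: unitf_def)
  from decomp_unit[OF K this] show ?case
    by (rule decomp_mono) (use unitf_D[OF u] D_zero in auto)
next
  case (weighted f w)
  from weighted(2) show ?case by (rule decomp_mono) (rule in_D_has_weight.weighted)
next
  case (even_average fs j l)
  have "\<forall>i\<in>{..<length fs}. decomp D K A (fs ! i)" using even_average(2) by simp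
  then obtain g \<nu> where g: "\<And>i k. i < length fs \<Longrightarrow> k \<in> K \<Longrightarrow> D (g i k) \<and> supp (g i k) \<subseteq> supp (fs ! i) \<inter> A k \<and>
      (\<forall>x\<in>A k. (fs ! i) x = \<nu> i k * g i k x)" and \<nu>: "\<And>i. i < length fs \<Longrightarrow> (\<Sum>k\<in>K. (\<nu> i k)\<^sup>2) \<le> 1"
    unfolding decomp_def by (metis lessThan_iff)
  have alw: "\<forall>E\<in>set (map supp fs). E \<noteq> {} \<and> finite E" "sorted_wrt (\<lambda>E F. E \<inter> F = {}) (map supp fs)"
    "Min ` set (map supp fs) \<in> schreier (n (2 * j))" using even_average(3) by (simp_all add: allowable_def)
  have fin: "supp (fs ! i) \<noteq> {}" "finite (supp (fs ! i))" if "i < length fs" for i using alw(1) that by auto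
  have disj: "supp (fs ! i) \<inter> supp (fs ! i') = {}" if "i < length fs" "i' < length fs" "i \<noteq> i'" for i i'
    using alw(2) that unfolding sorted_wrt_iff_nth_less by (cases i i' rule: linorder_cases) force+
  have "set fs = (!) fs ` {..<length fs}" by (auto simp: set_conv_nth)
  show ?case
  proof (rule decomp_average[OF K(1)])
    fix k and \<mu> :: "nat \<Rightarrow> real" assume k: "k \<in> K" and \<mu>: "(\<Sum>i<length fs. (\<mu> i)\<^sup>2) \<le> 1"
    show "W (\<lambda>x. 1 / real (m (2 * j)) * (\<Sum>i<length fs. \<mu> i * g i k x)) (m (2 * j))"
    proof (rule D_even[OF _ _ _ _ \<mu>])
      show "D (g i k)" if "i \<in> {..<length fs}" for i using g that k by simp
      show dj: "supp (g i k) \<inter> supp (g i' k) = {}" if "i \<in> {..<length fs}" "i' \<in> {..<length fs}" "i \<noteq> i'" for i i'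
        using g[of i k] g[of i' k] disj[of i i'] that k by auto
      let ?J = "{i \<in> {..<length fs}. supp (g i k) \<noteq> {}}"
      show "(\<lambda>i. Min (supp (g i k))) ` ?J \<in> schreier (n (2 * j))"
      proof (rule schreier_index[where a = "\<lambda>i. Min (supp (fs ! i))" and I = "{..<length fs}"])
        have "Min ` set (map supp fs) = (\<lambda>i. Min (supp (fs ! i))) ` {..<length fs}"
          using \<open>set fs = (!) fs ` {..<length fs}\<close> by (simp add: image_image)
        then show "(\<lambda>i. Min (supp (fs ! i))) ` {..<length fs} \<in> schreier (n (2 * j))" using alw(3) by simp
        show "inj_on (\<lambda>i. Min (supp (fs ! i))) {..<length fs}"
        proof (rule inj_onI)
          fix i i' assume ii: "i \<in> {..<length fs}" "i' \<in> {..<length fs}" "Min (supp (fs ! i)) = Min (supp (fs ! i'))"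
          then have "Min (supp (fs ! i)) \<in> supp (fs ! i) \<inter> supp (fs ! i')"
            using Min_in fin by (metis IntI lessThan_iff)
          then show "i = i'" using disj ii by (metis empty_iff lessThan_iff)
        qed
        show "inj_on (\<lambda>i. Min (supp (g i k))) ?J"
          using g k dj by (intro inj_on_Min_supp) auto
        fix i assume i: "i \<in> ?J"
        then show "Min (supp (fs ! i)) \<le> Min (supp (g i k))"
          using g[of i k] k fin by (intro Min_antimono) auto
      qed auto
    qed auto
  qed (use g \<nu> even_average(4) in auto)
next
  case (odd_average j s fs l)
  have len: "length fs = length s" by fact
  have "\<forall>i\<in>{..<length fs}. decomp (\<lambda>g. W g (m (snd (s ! i)))) K A (fs ! i)" using odd_average(3) len by simp
  then have "\<forall>i\<in>{..<length fs}. \<exists>g \<nu>. (\<forall>k\<in>K. W (g k) (m (snd (s ! i))) \<and> supp (g k) \<subseteq> supp (fs ! i) \<inter> A k \<and> (\<forall>x\<in>A k. (fs ! i) x = \<nu> k * g k x)) \<and>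
     (\<Sum>k\<in>K. (\<nu> k)\<^sup>2) \<le> 1" unfolding decomp_def .
  then obtain g \<nu> where g: "\<And>i k. i < length fs \<Longrightarrow> k \<in> K \<Longrightarrow> W (g i k) (m (snd (s ! i))) \<and> supp (g i k) \<subseteq> supp (fs ! i) \<inter> A k \<and>
      (\<forall>x\<in>A k. (fs ! i) x = \<nu> i k * g i k x)" and \<nu>: "\<And>i. i < length fs \<Longrightarrow> (\<Sum>k\<in>K. (\<nu> i k)\<^sup>2) \<le> 1"
    by (metis lessThan_iff)
  show ?case
  proof (rule decomp_average[OF K(1)])
    fix k and \<mu> :: "nat \<Rightarrow> real" assume k: "k \<in> K" and \<mu>: "(\<Sum>i<length fs. (\<mu> i)\<^sup>2) \<le> 1"
    define hs where "hs = map (\<lambda>i. g i k) [0..<length fs]"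
    have hs: "length hs = length fs" "\<And>i. i < length fs \<Longrightarrow> hs ! i = g i k" by (simp_all add: hs_def)
    have "W (\<lambda>x. 1 / real (m (2 * j + 1)) * (\<Sum>i<length hs. \<mu> i * (hs ! i) x)) (m (2 * j + 1))"
    proof (rule in_D_has_weight.odd_average)
      show "schreier_special_seq n N1 N2 \<sigma> j s" by fact
      show "supp (hs ! i) \<subseteq> fst (s ! i)" if "i < length s" for i
        using odd_average(5)[OF that] g[of i k] hs(2)[of i] that k len by auto
      show "W (hs ! i) (m (snd (s ! i)))" if "i < length s" for i
        using g[of i k] hs(2)[of i] that k len by auto
    qed (use hs \<mu> len in auto)
    moreover have "(\<Sum>i<length hs. \<mu> i * (hs ! i) x) = (\<Sum>i<length fs. \<mu> i * g i k x)" for x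
      using hs by (intro sum.cong) auto
    ultimately show "W (\<lambda>x. 1 / real (m (2 * j + 1)) * (\<Sum>i<length fs. \<mu> i * g i k x)) (m (2 * j + 1))"
      by simp
  qed (use g \<nu> odd_average(6) in auto)
qed

section \<open>Children of weighted functionals\<close>

lemma average_child_supp:
  fixes d :: nat
  assumes c: "c \<noteq> 0" and i: "i < d" "l i \<noteq> 0"
    and disj: "\<And>j. j < d \<Longrightarrow> j \<noteq> i \<Longrightarrow> supp (f i) \<inter> supp (f j) = {}"
  shows "supp (f i) \<subseteq> supp (\<lambda>x. c * (\<Sum>i<d. l i * f i x))"
proof
  fix x assume x: "x \<in> supp (f i)"
  have "f j x = 0" if "j < d" "j \<noteq> i" for j using disj[OF that] x by (auto simp: supp_def)
  then have "(\<Sum>j<d. l j * f j x) = l i * f i x" using i by (intro disjoint_scalar_sum) auto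
  then show "x \<in> supp (\<lambda>x. c * (\<Sum>i<d. l i * f i x))" using x c i by (simp add: supp_def)
qed

lemma average_sq:
  fixes d :: nat
  assumes "(\<Sum>i<d. (l i)\<^sup>2) \<le> 1"
  shows "(pairing (\<lambda>x. (1 / real w) * (\<Sum>i<d. l i * f i x)) y)\<^sup>2
    \<le> (1 / real w)\<^sup>2 * (\<Sum>i\<in>{i \<in> {..<d}. l i \<noteq> 0}. (pairing (f i) y)\<^sup>2)"
proof -
  let ?I = "{i \<in> {..<d}. l i \<noteq> 0}"
  have "(\<Sum>i\<in>?I. (l i)\<^sup>2) \<le> (\<Sum>i<d. (l i)\<^sup>2)" by (rule sum_mono2) auto
  then have "(\<Sum>i\<in>?I. l i * pairing (f i) y)\<^sup>2 \<le> (\<Sum>i\<in>?I. (pairing (f i) y)\<^sup>2)"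
    using assms by (intro sq_pairing_le) linarith
  moreover have "(\<Sum>i<d. l i * pairing (f i) y) = (\<Sum>i\<in>?I. l i * pairing (f i) y)"
    by (rule sum.mono_neutral_right) auto
  ultimately have "(\<Sum>i<d. l i * pairing (f i) y)\<^sup>2 \<le> (\<Sum>i\<in>?I. (pairing (f i) y)\<^sup>2)" by simp
  then show ?thesis unfolding pairing_average power_mult_distrib by (intro mult_left_mono) auto
qed

lemma special_sets:
  assumes "schreier_special_seq n N1 N2 \<sigma> j s"
  shows "i < length s \<Longrightarrow> fst (s ! i) \<noteq> {} \<and> finite (fst (s ! i))"
    "i < length s \<Longrightarrow> i' < length s \<Longrightarrow> i \<noteq> i' \<Longrightarrow> fst (s ! i) \<inter> fst (s ! i') = {}"
    "(\<lambda>i. Min (fst (s ! i))) ` {..<length s} \<in> schreier (n (2 * j + 1))"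
    "inj_on (\<lambda>i. Min (fst (s ! i))) {..<length s}"
proof -
  have s: "\<forall>(E, k)\<in>set s. E \<noteq> {} \<and> finite E \<and> E \<subseteq> {1..}" "sorted_wrt (\<lambda>(E, k) (F, l). E \<inter> F = {} \<and> k < l) s"
    "(\<lambda>(E, k). Min E) ` set s \<in> schreier (n (2 * j + 1))"
    using assms by (simp_all add: schreier_special_seq_def special_seq_def coded_seqs_def)
  show fin: "fst (s ! i) \<noteq> {} \<and> finite (fst (s ! i))" if "i < length s" for i
    using s(1) nth_mem[OF that] by (cases "s ! i") auto
  have lt: "fst (s ! i) \<inter> fst (s ! i') = {}" if "i < i'" "i' < length s" for i i'
    using s(2) that by (auto simp: sorted_wrt_iff_nth_less case_prod_beta)
  show disj: "fst (s ! i) \<inter> fst (s ! i') = {}" if "i < length s" "i' < length s" "i \<noteq> i'" for i i'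
    using lt[of i i'] lt[of i' i] that by (cases i i' rule: linorder_cases) auto
  have "(\<lambda>(E, k). Min E) ` set s = (\<lambda>i. Min (fst (s ! i))) ` {..<length s}"
    by (auto simp: set_conv_nth image_iff case_prod_beta)
  then show "(\<lambda>i. Min (fst (s ! i))) ` {..<length s} \<in> schreier (n (2 * j + 1))" using s(3) by simp
  show "inj_on (\<lambda>i. Min (fst (s ! i))) {..<length s}"
  proof (rule inj_onI)
    fix i i' assume ii: "i \<in> {..<length s}" "i' \<in> {..<length s}" "Min (fst (s ! i)) = Min (fst (s ! i'))"
    then have "Min (fst (s ! i)) \<in> fst (s ! i) \<inter> fst (s ! i')"
      using Min_in fin by (metis IntI lessThan_iff)
    then show "i = i'" using disj ii by (metis empty_iff lessThan_iff)
  qed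
qed

text \<open>The Schreier condition of a special sequence concerns the sets; the supports inside them
  have later minima, so the spreading property of \<open>mschreier\<close> transfers the
  order.\<close>

lemma special_al:
  assumes s: "schreier_special_seq n N1 N2 \<sigma> j s" "length fs = length s"
    and fs: "\<And>i. i < length s \<Longrightarrow> supp (fs ! i) \<subseteq> fst (s ! i)" "\<And>i. i < length s \<Longrightarrow> D (fs ! i)"
    and I: "I \<subseteq> {..<length s}"
  shows "al (n (2 * j + 1)) I (\<lambda>i. fs ! i)"
proof -
  note sp = special_sets[OF s(1)]
  have "finite I" using I finite_subset by blast
  moreover have "supp (fs ! i) \<inter> supp (fs ! k) = {}" if "i \<in> I" "k \<in> I" "i \<noteq> k" for i k
    using fs(1)[of i] fs(1)[of k] sp(2)[of i k] that I by blast
  moreover have "(\<lambda>i. Min (supp (fs ! i))) ` {i \<in> I. supp (fs ! i) \<noteq> {}} \<in> mschreier (n (2 * j + 1))"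
  proof (rule mschreier_index[OF schreier_mschreier[OF sp(3)] sp(4)])
    show "{i \<in> I. supp (fs ! i) \<noteq> {}} \<subseteq> {..<length s}" using I by blast
    fix i assume "i \<in> {i \<in> I. supp (fs ! i) \<noteq> {}}"
    then show "Min (fst (s ! i)) \<le> Min (supp (fs ! i))"
      using fs(1)[of i] sp(1)[of i] I by (intro Min_antimono) auto
  qed
  ultimately show ?thesis using fs(2) I unfolding al_def by blast
qed

text \<open>One form for both averaging rules. The index set keeps only nonzero coefficients: as
  disjoint supports exclude cancellation, the supports of these children lie in that of the parent,
  as \<open>al_Sigma\<close> requires.\<close>

lemma children:
  assumes "W f w"
  shows "\<exists>q I G. w = m q \<and> al (n q) (I :: nat set) G \<and> (\<forall>i\<in>I. supp (G i) \<subseteq> supp f) \<and>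
    (\<forall>y. (pairing f y)\<^sup>2 \<le> (1 / real w)\<^sup>2 * (\<Sum>i\<in>I. (pairing (G i) y)\<^sup>2))"
  using assms
proof (cases rule: has_weight.cases)
  case (even_average fs j l)
  define I where "I = {i \<in> {..<length fs}. l i \<noteq> 0}"
  have alw: "\<forall>E\<in>set (map supp fs). E \<noteq> {} \<and> finite E" "sorted_wrt (\<lambda>E F. E \<inter> F = {}) (map supp fs)"
    "Min ` set (map supp fs) \<in> schreier (n (2 * j))" using even_average by (auto simp: allowable_def)
  have disj: "supp (fs ! i) \<inter> supp (fs ! i') = {}" if "i < length fs" "i' < length fs" "i \<noteq> i'" for i i'
    using alw(2) that unfolding sorted_wrt_iff_nth_less by (cases i i' rule: linorder_cases) force+
  have "(\<lambda>i. Min (supp (fs ! i))) ` {i \<in> I. supp (fs ! i) \<noteq> {}} \<in> mschreier (n (2 * j))"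
    using schreier_mschreier[OF alw(3)] by (rule mschreier_subset) (auto simp: I_def)
  then have "al (n (2 * j)) I (\<lambda>i. fs ! i)"
    unfolding al_def using disj even_average(3) by (auto simp: I_def)
  moreover have "supp (fs ! i) \<subseteq> supp f" if "i \<in> I" for i
    unfolding even_average(1) using that disj m_pos(2)[of "2 * j"] by (intro average_child_supp) (auto simp: I_def)
  moreover have "(pairing f y)\<^sup>2 \<le> (1 / real w)\<^sup>2 * (\<Sum>i\<in>I. (pairing (fs ! i) y)\<^sup>2)" for y
    unfolding even_average(1,2) I_def by (rule average_sq) (rule even_average)
  ultimately show ?thesis using even_average(2) by blast
next
  case (odd_average j s fs l)
  define I where "I = {i \<in> {..<length fs}. l i \<noteq> 0}"
  have al: "al (n (2 * j + 1)) I (\<lambda>i. fs ! i)"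
    using odd_average by (intro special_al[of j s]) (auto simp: I_def intro: weighted)
  have disj: "supp (fs ! i) \<inter> supp (fs ! i') = {}" if "i < length fs" "i' < length fs" "i \<noteq> i'" for i i'
    using special_sets(2)[OF odd_average(3), of i i'] odd_average(5)[of i] odd_average(5)[of i'] odd_average(4) that by auto
  have "supp (fs ! i) \<subseteq> supp f" if "i \<in> I" for i
    unfolding odd_average(1) using that disj m_pos(2)[of "2 * j + 1"] by (intro average_child_supp) (auto simp: I_def)
  moreover have "(pairing f y)\<^sup>2 \<le> (1 / real w)\<^sup>2 * (\<Sum>i\<in>I. (pairing (fs ! i) y)\<^sup>2)" for y
    unfolding odd_average(1,2) I_def by (rule average_sq) (rule odd_average)
  ultimately show ?thesis using odd_average(2) al by blast
qed

text \<open>At most one child is nonzero at \<open>k\<close>, and its value there is at most 1 in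
  modulus, so \<open>children\<close> applied to \<open>unit_vec k\<close> leaves the factor given
  by the weight.\<close>

lemma W_coordinate: "W f w \<Longrightarrow> \<bar>f k\<bar> \<le> 1 / real w"
proof (cases "k = 0")
  case True
  assume "W f w"
  then have "f \<in> c00" by (rule D_c00)
  then have "f 0 = 0" by (force simp: c00_def supp_def)
  then show ?thesis using True by simp
next
  case False
  assume "W f w"
  then obtain q and I :: "nat set" and G where G: "al (n q) I G"
    "\<And>y. (pairing f y)\<^sup>2 \<le> (1 / real w)\<^sup>2 * (\<Sum>i\<in>I. (pairing (G i) y)\<^sup>2)" using children by blast
  have supp: "supp (unit_vec k) = {k}" by (auto simp: supp_def unit_vec_def)
  have pr: "pairing h (unit_vec k) = h k" for h unfolding pairing_def supp by (simp add: unit_vec_def)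
  have "(\<Sum>i\<in>I. (G i k)\<^sup>2) \<le> 1"
  proof (cases "\<exists>i\<in>I. G i k \<noteq> 0")
    case True
    then obtain i where i: "i \<in> I" "G i k \<noteq> 0" by blast
    have "G j k = 0" if "j \<in> I" "j \<noteq> i" for j
      using alD(3)[OF G(1), of i j] i that by (auto simp: supp_def)
    then have "(\<Sum>j\<in>I. (G j k)\<^sup>2) = (G i k)\<^sup>2"
      using i alD(1)[OF G(1)] by (intro disjoint_scalar_sum) auto
    then show ?thesis using D_wh_coordinate_le_1(1)[OF alD(2)[OF G(1) i(1)], of k] by (simp add: abs_square_le_1)
  next
    case False
    then show ?thesis by simp
  qed
  then have "(f k)\<^sup>2 \<le> (1 / real w)\<^sup>2 * 1"
    using G(2)[of "unit_vec k"] unfolding pr by (meson mult_left_mono order_trans zero_le_power2)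
  then show ?thesis using abs_le_square_iff[of "f k" "1 / real w"] by simp
qed

text \<open>Each functional is split over the blocks, Cauchy-Schwarz removes the multipliers and the
  sums are exchanged. On every block there remains a family whose supports lie in those of the given
  one, so bounds for single blocks carry over with squared coefficients.\<close>

lemma upper_estimate:
  assumes al: "al N I f" and K: "finite K" "\<And>k. k \<in> K \<Longrightarrow> finite (supp (u k))"
    and disj: "\<And>k l. k \<in> K \<Longrightarrow> l \<in> K \<Longrightarrow> k \<noteq> l \<Longrightarrow> supp (u k) \<inter> supp (u l) = {}"
    and P: "\<And>i. i \<in> I \<Longrightarrow> decomp (P i) K (\<lambda>k. supp (u k)) (f i)"
  shows "\<exists>g. (\<forall>i\<in>I. \<forall>k\<in>K. P i (g i k) \<and> supp (g i k) \<subseteq> supp (f i) \<inter> supp (u k)) \<and>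
    (\<Sum>i\<in>I. (pairing (f i) (\<lambda>x. \<Sum>k\<in>K. a k * u k x))\<^sup>2) \<le> (\<Sum>k\<in>K. (a k)\<^sup>2 * (\<Sum>i\<in>I. (pairing (g i k) (u k))\<^sup>2))"
proof -
  obtain g \<nu> where g: "\<And>i k. i \<in> I \<Longrightarrow> k \<in> K \<Longrightarrow> P i (g i k) \<and> supp (g i k) \<subseteq> supp (f i) \<inter> supp (u k) \<and>
      (\<forall>x\<in>supp (u k). f i x = \<nu> i k * g i k x)" and \<nu>: "\<And>i. i \<in> I \<Longrightarrow> (\<Sum>k\<in>K. (\<nu> i k)\<^sup>2) \<le> 1"
    using P unfolding decomp_def by metis
  have "(pairing (f i) (\<lambda>x. \<Sum>k\<in>K. a k * u k x))\<^sup>2 \<le> (\<Sum>k\<in>K. (a k)\<^sup>2 * (pairing (g i k) (u k))\<^sup>2)" if i: "i \<in> I" for i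
  proof -
    have "pairing (f i) (\<lambda>x. \<Sum>k\<in>K. a k * u k x) = (\<Sum>k\<in>K. a k * pairing (f i) (u k))"
      by (rule pairing_lincomb[OF K])
    also have "\<dots> = (\<Sum>k\<in>K. \<nu> i k * (a k * pairing (g i k) (u k)))"
    proof (rule sum.cong[OF refl])
      fix k assume "k \<in> K"
      then have "pairing (f i) (u k) = \<nu> i k * pairing (g i k) (u k)"
        using g[OF i] by (intro pairing_scale_left) blast
      then show "a k * pairing (f i) (u k) = \<nu> i k * (a k * pairing (g i k) (u k))" by simp
    qed
    also have "(\<dots>)\<^sup>2 \<le> (\<Sum>k\<in>K. (a k * pairing (g i k) (u k))\<^sup>2)" by (rule sq_pairing_le[OF \<nu>[OF i]])
    finally show ?thesis by (simp add: power_mult_distrib)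
  qed
  then have "(\<Sum>i\<in>I. (pairing (f i) (\<lambda>x. \<Sum>k\<in>K. a k * u k x))\<^sup>2)
      \<le> (\<Sum>i\<in>I. \<Sum>k\<in>K. (a k)\<^sup>2 * (pairing (g i k) (u k))\<^sup>2)" by (rule sum_mono)
  also have "\<dots> = (\<Sum>k\<in>K. (a k)\<^sup>2 * (\<Sum>i\<in>I. (pairing (g i k) (u k))\<^sup>2))"
    by (subst sum.swap) (simp add: sum_distrib_left)
  finally show ?thesis using g by (intro exI[of _ g]) auto
qed

text \<open>A weight below \<open>m J\<close> has an index below \<open>J\<close>, so passing to
  children raises the order by at most \<open>n (J - 1)\<close> and gains the square of the least
  weight.\<close>

lemma children_bound:
  assumes al: "al N I f" and W: "\<And>i. i \<in> I \<Longrightarrow> W (f i) (wt i) \<and> \<omega> \<le> wt i \<and> wt i < m J" and \<omega>: "1 \<le> \<omega>"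
    and bd: "bd (\<lambda>_. True) (N + n (J - 1)) x c"
  shows "(\<Sum>i\<in>I. (pairing (f i) x)\<^sup>2) \<le> (1 / real \<omega>)\<^sup>2 * c"
proof -
  have "\<forall>i\<in>I. \<exists>K G. al (n (J - 1)) (K :: nat set) G \<and> (\<forall>k\<in>K. supp (G k) \<subseteq> supp (f i)) \<and>
    (\<forall>y. (pairing (f i) y)\<^sup>2 \<le> (1 / real (wt i))\<^sup>2 * (\<Sum>k\<in>K. (pairing (G k) y)\<^sup>2))"
  proof
    fix i assume i: "i \<in> I"
    obtain q and K :: "nat set" and G where G: "wt i = m q" "al (n q) K G" "\<forall>k\<in>K. supp (G k) \<subseteq> supp (f i)"
      "\<forall>y. (pairing (f i) y)\<^sup>2 \<le> (1 / real (wt i))\<^sup>2 * (\<Sum>k\<in>K. (pairing (G k) y)\<^sup>2)"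
      using children W[OF i] by blast
    have "q < J" using G(1) W[OF i] monoD[OF par_simps(1), of J q] by (metis not_le)
    then have "n q \<le> n (J - 1)" by (intro monoD[OF par_simps(2)]) simp
    then show "\<exists>K G. al (n (J - 1)) (K :: nat set) G \<and> (\<forall>k\<in>K. supp (G k) \<subseteq> supp (f i)) \<and>
    (\<forall>y. (pairing (f i) y)\<^sup>2 \<le> (1 / real (wt i))\<^sup>2 * (\<Sum>k\<in>K. (pairing (G k) y)\<^sup>2))"
      using G al_mono by blast
  qed
  then obtain K G where G: "\<And>i. i \<in> I \<Longrightarrow> al (n (J - 1)) (K i :: nat set) (G i)"
    "\<And>i k. i \<in> I \<Longrightarrow> k \<in> K i \<Longrightarrow> supp (G i k) \<subseteq> supp (f i)"
    "\<And>i y. i \<in> I \<Longrightarrow> (pairing (f i) y)\<^sup>2 \<le> (1 / real (wt i))\<^sup>2 * (\<Sum>k\<in>K i. (pairing (G i k) y)\<^sup>2)"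
    by metis
  have "al (N + n (J - 1)) (Sigma I K) (\<lambda>(i, k). G i k)" by (rule al_Sigma[OF al G(1,2)])
  then have "(\<Sum>p\<in>Sigma I K. (pairing (case p of (i, k) \<Rightarrow> G i k) x)\<^sup>2) \<le> c" by (rule bd_al[OF bd]) simp
  moreover have "(\<Sum>p\<in>Sigma I K. (pairing (case p of (i, k) \<Rightarrow> G i k) x)\<^sup>2) = (\<Sum>i\<in>I. \<Sum>k\<in>K i. (pairing (G i k) x)\<^sup>2)"
    using alD(1)[OF al] alD(1)[OF G(1)] by (subst sum.Sigma) (auto intro: sum.cong)
  ultimately have le: "(\<Sum>i\<in>I. \<Sum>k\<in>K i. (pairing (G i k) x)\<^sup>2) \<le> c" by simp
  have "(\<Sum>i\<in>I. (pairing (f i) x)\<^sup>2) \<le> (\<Sum>i\<in>I. (1 / real \<omega>)\<^sup>2 * (\<Sum>k\<in>K i. (pairing (G i k) x)\<^sup>2))"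
  proof (rule sum_mono)
    fix i assume i: "i \<in> I"
    have "(1 / real (wt i))\<^sup>2 \<le> (1 / real \<omega>)\<^sup>2" using W[OF i] \<omega> by (intro power_mono divide_left_mono) auto
    then have "(1 / real (wt i))\<^sup>2 * (\<Sum>k\<in>K i. (pairing (G i k) x)\<^sup>2) \<le> (1 / real \<omega>)\<^sup>2 * (\<Sum>k\<in>K i. (pairing (G i k) x)\<^sup>2)"
      by (intro mult_right_mono sum_nonneg) auto
    then show "(pairing (f i) x)\<^sup>2 \<le> (1 / real \<omega>)\<^sup>2 * (\<Sum>k\<in>K i. (pairing (G i k) x)\<^sup>2)" using G(3)[OF i] by (rule order_trans[rotated])
  qed
  also have "\<dots> = (1 / real \<omega>)\<^sup>2 * (\<Sum>i\<in>I. \<Sum>k\<in>K i. (pairing (G i k) x)\<^sup>2)" by (simp add: sum_distrib_left)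
  also have "\<dots> \<le> (1 / real \<omega>)\<^sup>2 * c" using le by (intro mult_left_mono) auto
  finally show ?thesis .
qed

text \<open>Weights are not unique, so one weight from \<open>m J\<close> on suffices. A functional
  of the norming set that is not large has a weight below \<open>m J\<close> and can be replaced by
  its children.\<close>

definition large :: "nat \<Rightarrow> (nat \<Rightarrow> real) \<Rightarrow> bool" where
  "large J f \<longleftrightarrow> unitf f \<or> (\<exists>w\<ge>m J. W f w)"

text \<open>Members that are not large are replaced by their children; weights are at least 2, so
  each round divides the squares by 4 and raises the order by \<open>n (J - 1)\<close>. The starting
  bound \<alpha> is divided by \<open>4 ^ d\<close>, and the large members met in all rounds add up
  to at most \<open>2 * \<beta>\<close>, a geometric series.\<close>

lemma bd_from_large:
  assumes "bd (large J) (N + d * n (J - 1)) x \<beta>" "bd (\<lambda>_. True) (N + d * n (J - 1)) x \<alpha>"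
  shows "bd (\<lambda>_. True) N x (2 * \<beta> + \<alpha> / 4 ^ d)"
  using assms
proof (induction d arbitrary: N)
  case 0
  then show ?case using bd_nonneg[OF 0(1)] by (intro bd_mono[OF 0(2)]) auto
next
  case (Suc d)
  define b where "b = n (J - 1)"
  have IH: "bd (\<lambda>_. True) (N + b) x (2 * \<beta> + \<alpha> / 4 ^ d)"
    using Suc.prems by (intro Suc.IH) (simp_all add: b_def algebra_simps)
  show ?case
  proof (rule bdI)
    fix \<F> assume al: "al N \<F> (\<lambda>f. f)"
    define A where "A = {f \<in> \<F>. large J f}"
    define B where "B = {f \<in> \<F>. \<not> large J f}"
    have fin: "finite \<F>" using alD(1)[OF al] .
    have "al (N + Suc d * n (J - 1)) A (\<lambda>f. f)"
      using al_mono[OF al_subset[OF al, of A]] by (simp add: A_def)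
    then have 1: "(\<Sum>f\<in>A. (pairing f x)\<^sup>2) \<le> \<beta>" by (rule bd_al[OF Suc.prems(1)]) (simp add: A_def)
    have "\<forall>f\<in>B. \<exists>w. W f w \<and> w < m J"
    proof
      fix f assume f: "f \<in> B"
      then have "D f" using alD(2)[OF al] by (simp add: B_def)
      then show "\<exists>w. W f w \<and> w < m J" using f D_cases unfolding B_def large_def by (metis (mono_tags, lifting) mem_Collect_eq not_le)
    qed
    then obtain wt where wt: "\<And>f. f \<in> B \<Longrightarrow> W f (wt f) \<and> wt f < m J" by metis
    have "(\<Sum>f\<in>B. (pairing f x)\<^sup>2) \<le> (1 / real 2)\<^sup>2 * (2 * \<beta> + \<alpha> / 4 ^ d)"
    proof (rule children_bound)
      show "al N B (\<lambda>f. f)" using al by (rule al_subset) (simp add: B_def)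
      show "W f (wt f) \<and> 2 \<le> wt f \<and> wt f < m J" if "f \<in> B" for f using wt[OF that] W_pos by blast
    qed (use IH in \<open>simp_all add: b_def\<close>)
    then have 2: "(\<Sum>f\<in>B. (pairing f x)\<^sup>2) \<le> \<beta> / 2 + \<alpha> / 4 ^ Suc d" by (simp add: power2_eq_square field_simps)
    have "(\<Sum>f\<in>\<F>. (pairing f x)\<^sup>2) = (\<Sum>f\<in>A. (pairing f x)\<^sup>2) + (\<Sum>f\<in>B. (pairing f x)\<^sup>2)"
      unfolding A_def B_def using fin by (subst sum.union_disjoint[symmetric]) (auto intro: sum.cong)
    then show "(\<Sum>f\<in>\<F>. (pairing f x)\<^sup>2) \<le> 2 * \<beta> + \<alpha> / 4 ^ Suc d"
      using 1 2 bd_nonneg[OF Suc.prems(1)] by linarith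
  qed
qed

text \<open>
  The relation \<open>M\<close> assigns each functional at most one block. The blocks reached in this way form
  a set of low complexity, on which the coefficients of a special combination are small.
\<close>

lemma match_bound:
  assumes al: "al N I f"
    and g: "\<And>i k. i \<in> I \<Longrightarrow> k < p \<Longrightarrow> D (g i k)" "\<And>i k. i \<in> I \<Longrightarrow> k < p \<Longrightarrow> supp (g i k) \<subseteq> supp (f i) \<inter> supp (u k)"
    and disj: "\<And>k l. k < p \<Longrightarrow> l < p \<Longrightarrow> k \<noteq> l \<Longrightarrow> supp (u k) \<inter> supp (u l) = {}"
    and t: "\<And>k x. k < p \<Longrightarrow> x \<in> supp (u k) \<Longrightarrow> x < t (Suc k)"
    and M: "\<And>i k l. i \<in> I \<Longrightarrow> k < p \<Longrightarrow> l < p \<Longrightarrow> M i k \<Longrightarrow> M i l \<Longrightarrow> supp (g i k) \<noteq> {} \<Longrightarrow> supp (g i l) \<noteq> {} \<Longrightarrow> k = l"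
    and bd: "\<And>k. k < p \<Longrightarrow> bd (\<lambda>_. True) N (u k) C" and C: "0 \<le> C"
    and scc: "scc r t p b \<epsilon>" "N \<le> r"
  shows "(\<Sum>k<p. b k * (\<Sum>i\<in>{i \<in> I. M i k}. (pairing (g i k) (u k))\<^sup>2)) \<le> \<epsilon> * C"
proof -
  define B where "B = {k \<in> {..<p}. \<exists>i\<in>I. M i k \<and> supp (g i k) \<noteq> {}}"
  have B: "B \<subseteq> {..<p}" by (auto simp: B_def)
  have "\<forall>k\<in>B. \<exists>i. i \<in> I \<and> M i k \<and> supp (g i k) \<noteq> {}" by (auto simp: B_def)
  then obtain \<iota> where \<iota>: "\<And>k. k \<in> B \<Longrightarrow> \<iota> k \<in> I \<and> M (\<iota> k) k \<and> supp (g (\<iota> k) k) \<noteq> {}" by metis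
  have lt: "k < p" if "k \<in> B" for k using B that by auto
  have inj\<iota>: "inj_on \<iota> B"
  proof (rule inj_onI)
    fix k l assume kl: "k \<in> B" "l \<in> B" "\<iota> k = \<iota> l"
    then show "k = l" using M[of "\<iota> k" k l] \<iota>[of k] \<iota>[of l] lt by simp
  qed
  \<comment> \<open>The functional chosen for block \<open>k\<close> enters the block at
    \<open>h k\<close>, to the right of its own minimum. Different blocks have different
    functionals, so \<open>h\<close> spreads the minima of the family and its image has order
    \<open>N\<close>.\<close>
  define h where "h k = Min (supp (g (\<iota> k) k))" for k
  have hin: "h k \<in> supp (g (\<iota> k) k)" if "k \<in> B" for k
    unfolding h_def using \<iota>[OF that] D_supp(1)[OF g(1)[of "\<iota> k" k]] lt[OF that] by (intro Min_in) auto
  have hu: "h k \<in> supp (u k)" if "k \<in> B" for k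
    using hin[OF that] g(2)[of "\<iota> k" k] \<iota>[OF that] lt[OF that] by blast
  define a where "a i = Min (supp (f i))" for i
  have fne: "supp (f (\<iota> k)) \<noteq> {}" if "k \<in> B" for k
    using g(2)[of "\<iota> k" k] \<iota>[OF that] lt[OF that] by blast
  have sub: "\<iota> ` B \<subseteq> {i \<in> I. supp (f i) \<noteq> {}}" using \<iota> fne by blast
  have inja: "inj_on a {i \<in> I. supp (f i) \<noteq> {}}"
    unfolding a_def using alD(2,3)[OF al] by (intro inj_on_Min_supp)
  have "a ` \<iota> ` B \<subseteq> a ` {i \<in> I. supp (f i) \<noteq> {}}" using sub by (rule image_mono)
  then have "a ` \<iota> ` B \<in> mschreier N"
    using alD(4)[OF al] unfolding a_def by (rule mschreier_subset[rotated])
  then have "(a \<circ> \<iota>) ` B \<in> mschreier N" by (simp add: image_comp)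
  moreover have "inj_on (a \<circ> \<iota>) B" using inj\<iota> inj_on_subset[OF inja sub] by (rule comp_inj_on)
  moreover have "(a \<circ> \<iota>) k \<le> h k" if "k \<in> B" for k
    using g(2)[of "\<iota> k" k] \<iota>[OF that] lt[OF that] D_supp(1)[OF alD(2)[OF al, of "\<iota> k"]]
    unfolding a_def h_def comp_def by (intro Min_antimono) auto
  ultimately have "h ` B \<in> mschreier N" by (intro mschreier_index[of "a \<circ> \<iota>" B N B h]) auto
  then have hB: "h ` B \<in> mschreier r" using scc(2) by (rule mschreier_mono)
  have injh: "inj_on h B"
  proof (rule inj_onI)
    fix k l assume "k \<in> B" "l \<in> B" "h k = h l"
    then show "k = l" using hu[of k] hu[of l] disj[of k l] lt[of k] lt[of l] by auto
  qed
  have bB: "sum b B \<le> \<epsilon>" by (rule sccD(4)[OF scc(1) B injh _ hB]) (use hu t lt in blast)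
  have zero: "(\<Sum>i\<in>{i \<in> I. M i k}. (pairing (g i k) (u k))\<^sup>2) = 0" if "k < p" "k \<notin> B" for k
  proof (rule sum.neutral, rule ballI)
    fix i assume "i \<in> {i \<in> I. M i k}"
    then have "supp (g i k) = {}" using that by (auto simp: B_def)
    then show "(pairing (g i k) (u k))\<^sup>2 = 0" by (simp add: pairing_disjoint)
  qed
  have le: "(\<Sum>i\<in>{i \<in> I. M i k}. (pairing (g i k) (u k))\<^sup>2) \<le> C" if "k < p" for k
  proof (rule bd_al[OF bd[OF that]])
    show "al N {i \<in> I. M i k} (\<lambda>i. g i k)" using g that by (intro al_sub[OF al]) auto
  qed simp
  have "(\<Sum>k<p. b k * (\<Sum>i\<in>{i \<in> I. M i k}. (pairing (g i k) (u k))\<^sup>2))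
      = (\<Sum>k\<in>B. b k * (\<Sum>i\<in>{i \<in> I. M i k}. (pairing (g i k) (u k))\<^sup>2))"
    using B zero by (intro sum.mono_neutral_right) auto
  also have "\<dots> \<le> (\<Sum>k\<in>B. b k * C)"
    using le lt sccD(1)[OF scc(1)] by (intro sum_mono mult_left_mono) auto
  also have "\<dots> = sum b B * C" by (simp add: sum_distrib_right)
  also have "\<dots> \<le> \<epsilon> * C" using bB C by (rule mult_right_mono)
  finally show ?thesis .
qed

definition l1 :: "(nat \<Rightarrow> real) \<Rightarrow> real" where
  "l1 x = (\<Sum>i\<in>supp x. \<bar>x i\<bar>)"

text \<open>At each coordinate only one member of a disjoint family is nonzero, with modulus at most
  \<open>1 / \<omega>\<close>. The bound does not depend on the order; functionals of very large
  weight are neglected by it.\<close>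

lemma heavy_bound:
  assumes al: "al N I f" and W: "\<And>i. i \<in> I \<Longrightarrow> W (f i) (wt i) \<and> \<omega> \<le> wt i" and \<omega>: "1 \<le> \<omega>"
  shows "(\<Sum>i\<in>I. (pairing (f i) x)\<^sup>2) \<le> (l1 x / real \<omega>)\<^sup>2"
proof -
  have fin: "finite I" using alD(1)[OF al] .
  have "(\<Sum>i\<in>I. \<bar>f i k\<bar>) \<le> 1 / real \<omega>" for k
  proof (cases "\<exists>i\<in>I. f i k \<noteq> 0")
    case True
    then obtain i where i: "i \<in> I" "f i k \<noteq> 0" by blast
    have "f j k = 0" if "j \<in> I" "j \<noteq> i" for j
      using alD(3)[OF al, of i j] i that by (auto simp: supp_def)
    then have "(\<Sum>i\<in>I. \<bar>f i k\<bar>) = \<bar>f i k\<bar>" using i fin by (intro disjoint_scalar_sum) auto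
    also have "\<dots> \<le> 1 / real (wt i)" using W[OF i(1)] by (intro W_coordinate) blast
    also have "\<dots> \<le> 1 / real \<omega>" using W[OF i(1)] \<omega> by (intro divide_left_mono) auto
    finally show ?thesis .
  next
    case False
    then show ?thesis by simp
  qed
  then have *: "\<bar>x k\<bar> * (\<Sum>i\<in>I. \<bar>f i k\<bar>) \<le> \<bar>x k\<bar> * (1 / real \<omega>)" for k by (intro mult_left_mono) auto
  have "(\<Sum>i\<in>I. \<bar>pairing (f i) x\<bar>) \<le> (\<Sum>i\<in>I. \<Sum>k\<in>supp x. \<bar>x k\<bar> * \<bar>f i k\<bar>)"
    unfolding pairing_def by (intro sum_mono order_trans[OF sum_abs]) (simp add: abs_mult mult.commute)
  also have "\<dots> = (\<Sum>k\<in>supp x. \<bar>x k\<bar> * (\<Sum>i\<in>I. \<bar>f i k\<bar>))"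
    by (subst sum.swap) (simp add: sum_distrib_left)
  also have "\<dots> \<le> (\<Sum>k\<in>supp x. \<bar>x k\<bar> * (1 / real \<omega>))" using * by (rule sum_mono)
  also have "\<dots> = l1 x / real \<omega>" by (simp add: l1_def sum_divide_distrib)
  finally have 1: "(\<Sum>i\<in>I. \<bar>pairing (f i) x\<bar>) \<le> l1 x / real \<omega>" .
  have "sqrt (\<Sum>i\<in>I. (pairing (f i) x)\<^sup>2) \<le> (\<Sum>i\<in>I. \<bar>pairing (f i) x\<bar>)"
    using L2_set_le_sum_abs[of "\<lambda>i. pairing (f i) x" I] by (simp add: L2_set_def)
  then have "sqrt (\<Sum>i\<in>I. (pairing (f i) x)\<^sup>2) \<le> l1 x / real \<omega>" using 1 by linarith
  then show ?thesis by (rule sqrt_le_D)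
qed

lemma block_disjoint:
  assumes "mono T" "\<And>k. supp (u k) \<subseteq> {T k<..T (Suc k)}" "k \<noteq> (l :: nat)"
  shows "supp (u k) \<inter> supp (u l) = {}"
proof -
  have "supp (u k) \<inter> supp (u l) = {}" if "k < l" for k l
  proof -
    have "T (Suc k) \<le> T l" using that by (intro monoD[OF assms(1)]) simp
    then have "{T k<..T (Suc k)} \<inter> {T l<..T (Suc l)} = {}" by auto
    then show ?thesis using assms(2)[of k] assms(2)[of l] by blast
  qed
  then show ?thesis using assms(3) by (cases k l rule: linorder_cases) blast+
qed

text \<open>A functional that meets block \<open>k\<close> starts in that block or earlier. It
  starts in one block only, so the first kind falls under \<open>match_bound\<close>, where
  \<epsilon> absorbs the constant \<open>4 ^ Suc N\<close> and leaves \<open>K\<^sup>2\<close>. Of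
  the second kind there are at most \<open>T k\<close>, because their minima are distinct; their
  restrictions live beyond \<open>T k\<close>, so they form a family of order 1 whatever
  \<open>N\<close> is, and contribute \<open>4\<^sup>2 * K\<^sup>2\<close>. This gives 17,
  independently of \<open>N\<close>.\<close>

lemma averages_bd:
  assumes T: "mono T" and y: "\<And>k. supp (y k) \<subseteq> {T k<..T (Suc k)}"
    and norm: "\<And>k f. D f \<Longrightarrow> pairing f (y k) \<le> K"
    and t: "\<And>k. T (Suc k) < t (Suc k)" and scc: "scc N t p b \<epsilon>" and \<epsilon>: "\<epsilon> * 4 ^ Suc N \<le> 1"
  shows "bd (\<lambda>_. True) N (\<lambda>x. \<Sum>k<p. sqrt (b k) * y k x) (17 * K\<^sup>2)"
proof (rule bdI)
  fix \<F> assume al: "al N \<F> (\<lambda>f. f)"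
  have fin: "finite (supp (y k))" for k using y[of k] finite_subset by blast
  have disj: "supp (y k) \<inter> supp (y l) = {}" if "k \<noteq> l" for k l using block_disjoint[OF T y that] .
  have "\<exists>g. (\<forall>i\<in>\<F>. \<forall>k\<in>{..<p}. D (g i k) \<and> supp (g i k) \<subseteq> supp i \<inter> supp (y k)) \<and>
      (\<Sum>f\<in>\<F>. (pairing f (\<lambda>x. \<Sum>k<p. sqrt (b k) * y k x))\<^sup>2)
      \<le> (\<Sum>k<p. (sqrt (b k))\<^sup>2 * (\<Sum>i\<in>\<F>. (pairing (g i k) (y k))\<^sup>2))"
    by (rule upper_estimate[OF al]) (use fin disj in \<open>auto intro!: D_W_decomp(1) alD(2)[OF al]\<close>)
  then obtain g where g: "\<forall>i\<in>\<F>. \<forall>k\<in>{..<p}. D (g i k) \<and> supp (g i k) \<subseteq> supp i \<inter> supp (y k)"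
    and up: "(\<Sum>f\<in>\<F>. (pairing f (\<lambda>x. \<Sum>k<p. sqrt (b k) * y k x))\<^sup>2)
      \<le> (\<Sum>k<p. (sqrt (b k))\<^sup>2 * (\<Sum>i\<in>\<F>. (pairing (g i k) (y k))\<^sup>2))"
    by blast
  have b: "0 \<le> b k" "(\<Sum>k<p. b k) = 1" for k using sccD(1,2)[OF scc] by auto
  define M where "M i k \<longleftrightarrow> Min (supp i) \<in> {T k<..T (Suc k)}" for i :: "nat \<Rightarrow> real" and k
  have match: "(\<Sum>k<p. b k * (\<Sum>i\<in>{i \<in> \<F>. M i k}. (pairing (g i k) (y k))\<^sup>2)) \<le> \<epsilon> * (4 ^ Suc N * K\<^sup>2)"
  proof (rule match_bound[OF al])
    show "x < t (Suc k)" if "x \<in> supp (y k)" for k x using y[of k] t[of k] that by fastforce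
    show "k = l" if "M i k" "M i l" for i k l
    proof (rule ccontr)
      assume "k \<noteq> l"
      then have "T (Suc k) \<le> T l \<or> T (Suc l) \<le> T k"
        using monoD[OF T, of "Suc k" l] monoD[OF T, of "Suc l" k] by linarith
      then show False using that by (auto simp: M_def)
    qed
    show "bd (\<lambda>_. True) N (y k) (4 ^ Suc N * K\<^sup>2)" for k using norm by (rule al_lower)
    show "scc N t p b \<epsilon>" "N \<le> N" using scc by simp_all
  qed (use g disj in auto)
  also have "\<epsilon> * (4 ^ Suc N * K\<^sup>2) \<le> 1 * K\<^sup>2" unfolding mult.assoc[symmetric]
    using \<epsilon> by (intro mult_right_mono) auto
  finally have match: "(\<Sum>k<p. b k * (\<Sum>i\<in>{i \<in> \<F>. M i k}. (pairing (g i k) (y k))\<^sup>2)) \<le> K\<^sup>2" by simp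
  have early: "(\<Sum>i\<in>{i \<in> \<F>. \<not> M i k}. (pairing (g i k) (y k))\<^sup>2) \<le> 16 * K\<^sup>2" if k: "k < p" for k
  proof -
    define I where "I = {i \<in> \<F>. \<not> M i k \<and> supp (g i k) \<noteq> {}}"
    have gk: "D (g i k)" "supp (g i k) \<subseteq> supp i" "supp (g i k) \<subseteq> {T k<..T (Suc k)}" if "i \<in> I" for i
    proof -
      have "D (g i k) \<and> supp (g i k) \<subseteq> supp i \<inter> supp (y k)" using g that k by (simp add: I_def)
      then show "D (g i k)" "supp (g i k) \<subseteq> supp i" "supp (g i k) \<subseteq> {T k<..T (Suc k)}" using y[of k] by blast+
    qed
    have Iin: "i \<in> \<F>" "supp i \<noteq> {}" if "i \<in> I" for i using that gk(2)[OF that] by (auto simp: I_def)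
    have finI: "finite I" using alD(1)[OF al] by (simp add: I_def)
    have Mi: "Min (supp i) \<in> {1..T k}" if i: "i \<in> I" for i
    proof -
      have fi: "finite (supp i)" "supp i \<subseteq> {1..}" using D_supp alD(2)[OF al Iin(1)[OF i]] by auto
      then have "Min (supp i) \<in> supp i" using Iin(2)[OF i] by simp
      then have 1: "1 \<le> Min (supp i)" using fi(2) by auto
      obtain x where x: "x \<in> supp (g i k)" using i by (auto simp: I_def)
      then have "Min (supp i) \<le> x" using gk(2)[OF i] fi(1) by auto
      also have "x \<le> T (Suc k)" using x gk(3)[OF i] by auto
      finally show ?thesis using i 1 by (auto simp: I_def M_def)
    qed
    have "inj_on (\<lambda>i. Min (supp i)) I"
    proof (rule inj_on_subset)
      show "inj_on (\<lambda>i. Min (supp i)) {i \<in> \<F>. supp i \<noteq> {}}"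
        using alD(2,3)[OF al] by (intro inj_on_Min_supp)
      show "I \<subseteq> {i \<in> \<F>. supp i \<noteq> {}}" using Iin by blast
    qed
    then have "card I \<le> card {1..T k}" using Mi by (intro card_inj_on_le[of "\<lambda>i. Min (supp i)"]) auto
    then have cI: "card I \<le> T k" by simp
    have "(\<lambda>i. Min (supp (g i k))) ` {i \<in> I. supp (g i k) \<noteq> {}} \<in> mschreier 1" (is "?M \<in> _")
    proof (rule mschreier_1)
      have "card ?M \<le> card {i \<in> I. supp (g i k) \<noteq> {}}" using finI by (intro card_image_le) auto
      also have "\<dots> \<le> card I" using finI by (intro card_mono) auto
      finally have c: "card ?M \<le> T k" using cI by simp
      have gt: "T k < x" if x: "x \<in> ?M" for x
      proof -
        obtain i where i: "i \<in> I" "supp (g i k) \<noteq> {}" "x = Min (supp (g i k))" using x by blast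
        then have "x \<in> supp (g i k)" using D_supp(1)[OF gk(1)[OF i(1)]] by simp
        then show ?thesis using gk(3)[OF i(1)] by auto
      qed
      show "?M \<subseteq> {1..}" using gt by force
      show "card ?M \<le> x" if "x \<in> ?M" for x using gt[OF that] c by simp
    qed (use finI in auto)
    moreover have "supp (g i k) \<inter> supp (g j k) = {}" if "i \<in> I" "j \<in> I" "i \<noteq> j" for i j
      using gk(2)[OF that(1)] gk(2)[OF that(2)] alD(3)[OF al Iin(1)[OF that(1)] Iin(1)[OF that(2)] that(3)] by blast
    ultimately have "al 1 I (\<lambda>i. g i k)" using finI gk(1) unfolding al_def by blast
    from bd_al[OF al_lower[where P = "\<lambda>_. True", OF norm] this]
    have "(\<Sum>i\<in>I. (pairing (g i k) (y k))\<^sup>2) \<le> 4 ^ Suc 1 * K\<^sup>2" by simp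
    moreover have "(\<Sum>i\<in>{i \<in> \<F>. \<not> M i k}. (pairing (g i k) (y k))\<^sup>2) = (\<Sum>i\<in>I. (pairing (g i k) (y k))\<^sup>2)"
      using alD(1)[OF al] by (intro sum.mono_neutral_right) (auto simp: I_def pairing_disjoint)
    ultimately show ?thesis by simp
  qed
  have "(\<Sum>k<p. (sqrt (b k))\<^sup>2 * (\<Sum>i\<in>\<F>. (pairing (g i k) (y k))\<^sup>2))
      \<le> (\<Sum>k<p. b k * (\<Sum>i\<in>{i \<in> \<F>. M i k}. (pairing (g i k) (y k))\<^sup>2) + b k * (16 * K\<^sup>2))"
  proof (rule sum_mono)
    fix k assume k: "k \<in> {..<p}"
    have "(\<Sum>i\<in>\<F>. (pairing (g i k) (y k))\<^sup>2) = (\<Sum>i\<in>{i \<in> \<F>. M i k}. (pairing (g i k) (y k))\<^sup>2)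
        + (\<Sum>i\<in>{i \<in> \<F>. \<not> M i k}. (pairing (g i k) (y k))\<^sup>2)"
      using alD(1)[OF al] by (subst sum.union_disjoint[symmetric]) (auto intro: sum.cong)
    also have "\<dots> \<le> (\<Sum>i\<in>{i \<in> \<F>. M i k}. (pairing (g i k) (y k))\<^sup>2) + 16 * K\<^sup>2" using early[of k] k by simp
    finally have "b k * (\<Sum>i\<in>\<F>. (pairing (g i k) (y k))\<^sup>2)
        \<le> b k * ((\<Sum>i\<in>{i \<in> \<F>. M i k}. (pairing (g i k) (y k))\<^sup>2) + 16 * K\<^sup>2)"
      using b(1) by (intro mult_left_mono) auto
    then show "(sqrt (b k))\<^sup>2 * (\<Sum>i\<in>\<F>. (pairing (g i k) (y k))\<^sup>2)
        \<le> b k * (\<Sum>i\<in>{i \<in> \<F>. M i k}. (pairing (g i k) (y k))\<^sup>2) + b k * (16 * K\<^sup>2)"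
      using b(1)[of k] by (simp add: distrib_left)
  qed
  also have "\<dots> = (\<Sum>k<p. b k * (\<Sum>i\<in>{i \<in> \<F>. M i k}. (pairing (g i k) (y k))\<^sup>2)) + (\<Sum>k<p. b k) * (16 * K\<^sup>2)"
    by (simp add: sum.distrib sum_distrib_right)
  also have "\<dots> \<le> 17 * K\<^sup>2" using match b(2) by simp
  finally show "(\<Sum>f\<in>\<F>. (pairing f (\<lambda>x. \<Sum>k<p. sqrt (b k) * y k x))\<^sup>2) \<le> 17 * K\<^sup>2" using up by linarith
qed

subsection \<open>Rapidly increasing sequences\<close>

text \<open>
  The vector \<open>u k\<close> sees functionals of weight less than
  \<open>m (q k)\<close> through their children, and functionals of weight at least \<open>m (q (k + 1))\<close> are
  negligible on it.
\<close>

definition ris :: "(nat \<Rightarrow> nat) \<Rightarrow> (nat \<Rightarrow> nat) \<Rightarrow> (nat \<Rightarrow> nat \<Rightarrow> real) \<Rightarrow> nat \<Rightarrow> real \<Rightarrow> real \<Rightarrow> bool" where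
  "ris T q u M C \<kappa> \<longleftrightarrow> mono T \<and> mono q \<and> 0 \<le> C \<and> 0 \<le> \<kappa> \<and> (\<forall>k. supp (u k) \<subseteq> {T k<..T (Suc k)} \<and>
     bd (\<lambda>_. True) (M + n (q k - 1)) (u k) C \<and> l1 (u k) \<le> \<kappa> * real (m (q (Suc k))))"

lemma risD:
  assumes "ris T q u M C \<kappa>"
  shows "mono T" "mono q" "0 \<le> C" "0 \<le> \<kappa>" "supp (u k) \<subseteq> {T k<..T (Suc k)}" "finite (supp (u k))"
    "bd (\<lambda>_. True) (M + n (q k - 1)) (u k) C" "l1 (u k) \<le> \<kappa> * real (m (q (Suc k)))"
    "bd (\<lambda>_. True) M (u k) C" "k \<noteq> l \<Longrightarrow> supp (u k) \<inter> supp (u l) = {}"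
proof -
  show 1: "mono T" "mono q" "0 \<le> C" "0 \<le> \<kappa>" "supp (u k) \<subseteq> {T k<..T (Suc k)}"
    "bd (\<lambda>_. True) (M + n (q k - 1)) (u k) C" "l1 (u k) \<le> \<kappa> * real (m (q (Suc k)))" for k
    using assms by (simp_all add: ris_def)
  show "finite (supp (u k))" using finite_subset[OF 1(5)] by simp
  show "bd (\<lambda>_. True) M (u k) C" by (rule bd_mono[OF 1(6)]) auto
  show "k \<noteq> l \<Longrightarrow> supp (u k) \<inter> supp (u l) = {}" by (rule block_disjoint[OF 1(1,5)])
qed

lemma scc_weighted_sum:
  assumes scc: "scc r t p b \<epsilon>" and S: "\<And>k. k < p \<Longrightarrow> S k \<le> X k + c" and X: "(\<Sum>k<p. b k * X k) \<le> a"
  shows "(\<Sum>k<p. (sqrt (b k))\<^sup>2 * S k) \<le> a + c"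
proof -
  have "(\<Sum>k<p. (sqrt (b k))\<^sup>2 * S k) \<le> (\<Sum>k<p. b k * X k + b k * c)"
  proof (rule sum_mono)
    fix k assume "k \<in> {..<p}"
    then have "b k * S k \<le> b k * (X k + c)" using S sccD(1)[OF scc] by (intro mult_left_mono) auto
    then show "(sqrt (b k))\<^sup>2 * S k \<le> b k * X k + b k * c" using sccD(1)[OF scc] by (simp add: distrib_left)
  qed
  also have "\<dots> = (\<Sum>k<p. b k * X k) + (\<Sum>k<p. b k) * c" by (simp add: sum.distrib sum_distrib_right)
  also have "\<dots> \<le> a + c" using X sccD(2)[OF scc] by simp
  finally show ?thesis .
qed

text \<open>For block \<open>k\<close> the weights fall into three ranges. Below
  \<open>m (q k)\<close> the children give \<open>C / \<omega>\<^sup>2\<close>; from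
  \<open>m (q (Suc k))\<close> on the functionals are heavy and give
  \<open>\<kappa>\<^sup>2\<close>. A weight lies in the middle range of one block only, so these
  functionals are matched with blocks and give \<open>\<epsilon> * C\<close>.\<close>

lemma ris_weighted:
  assumes ris: "ris T q u M C \<kappa>" and al: "al M I f" and wt: "\<And>i. i \<in> I \<Longrightarrow> W (f i) (wt i) \<and> \<omega> \<le> wt i" and \<omega>: "1 \<le> \<omega>"
    and scc: "scc r t p b \<epsilon>" "M \<le> r" and t: "\<And>k. T (Suc k) < t (Suc k)"
  shows "(\<Sum>i\<in>I. (pairing (f i) (\<lambda>x. \<Sum>k<p. sqrt (b k) * u k x))\<^sup>2) \<le> \<epsilon> * C + ((1 / real \<omega>)\<^sup>2 * C + \<kappa>\<^sup>2)"
proof -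
  note r = risD[OF ris]
  have "decomp (\<lambda>g. W g (wt i)) {..<p} (\<lambda>k. supp (u k)) (f i)" if "i \<in> I" for i
    using wt[OF that] r(10) by (intro D_W_decomp(2)) auto
  note dec = this
  have "\<exists>g. (\<forall>i\<in>I. \<forall>k\<in>{..<p}. W (g i k) (wt i) \<and> supp (g i k) \<subseteq> supp (f i) \<inter> supp (u k)) \<and>
      (\<Sum>i\<in>I. (pairing (f i) (\<lambda>x. \<Sum>k<p. sqrt (b k) * u k x))\<^sup>2)
      \<le> (\<Sum>k<p. (sqrt (b k))\<^sup>2 * (\<Sum>i\<in>I. (pairing (g i k) (u k))\<^sup>2))"
    by (rule upper_estimate[OF al]) (use dec r(6,10) in auto)
  then obtain g where g: "\<forall>i\<in>I. \<forall>k\<in>{..<p}. W (g i k) (wt i) \<and> supp (g i k) \<subseteq> supp (f i) \<inter> supp (u k)"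
    and up: "(\<Sum>i\<in>I. (pairing (f i) (\<lambda>x. \<Sum>k<p. sqrt (b k) * u k x))\<^sup>2)
      \<le> (\<Sum>k<p. (sqrt (b k))\<^sup>2 * (\<Sum>i\<in>I. (pairing (g i k) (u k))\<^sup>2))"
    by blast
  have gD: "D (g i k)" if "i \<in> I" "k < p" for i k using g that by (auto intro: weighted)
  have alg: "al M J (\<lambda>i. g i k)" if "J \<subseteq> I" "k < p" for J k
    using that g gD by (intro al_sub[OF al]) auto
  define Mid where "Mid i k \<longleftrightarrow> m (q k) \<le> wt i \<and> wt i < m (q (Suc k))" for i k
  have mono_mq: "m (q k) \<le> m (q l)" if "k \<le> l" for k l
    using that monoD[OF r(2)] monoD[OF par_simps(1)] by simp
  have "(\<Sum>k<p. b k * (\<Sum>i\<in>{i \<in> I. Mid i k}. (pairing (g i k) (u k))\<^sup>2)) \<le> \<epsilon> * C"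
  proof (rule match_bound[OF al])
    show "x < t (Suc k)" if "x \<in> supp (u k)" for k x using r(5)[of k] t[of k] that by fastforce
    show "k = l" if "Mid i k" "Mid i l" for i k l
    proof (rule ccontr)
      assume "k \<noteq> l"
      then have "m (q (Suc k)) \<le> m (q l) \<or> m (q (Suc l)) \<le> m (q k)"
        using mono_mq[of "Suc k" l] mono_mq[of "Suc l" k] by linarith
      then show False using that by (auto simp: Mid_def)
    qed
    show "bd (\<lambda>_. True) M (u k) C" for k by (rule r(9))
    show "scc r t p b \<epsilon>" "M \<le> r" "0 \<le> C" using scc r(3) by simp_all
  qed (use g gD r(10) in auto)
  moreover have "(\<Sum>i\<in>I. (pairing (g i k) (u k))\<^sup>2) \<le> (\<Sum>i\<in>{i \<in> I. Mid i k}. (pairing (g i k) (u k))\<^sup>2) + ((1 / real \<omega>)\<^sup>2 * C + \<kappa>\<^sup>2)"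
    if k: "k < p" for k
  proof -
    let ?s = "\<lambda>i. (pairing (g i k) (u k))\<^sup>2"
    let ?L = "{i \<in> I. wt i < m (q k)}" and ?H = "{i \<in> I. m (q (Suc k)) \<le> wt i}" and ?Mi = "{i \<in> I. Mid i k}"
    have fin: "finite I" using alD(1)[OF al] .
    have "(\<Sum>i\<in>?L. ?s i) \<le> (1 / real \<omega>)\<^sup>2 * C"
    proof (rule children_bound[where wt = wt and J = "q k"])
      show "al M ?L (\<lambda>i. g i k)" using k by (intro alg) auto
      show "bd (\<lambda>_. True) (M + n (q k - 1)) (u k) C" by (rule r(7))
    qed (use g wt k \<omega> in auto)
    moreover have "(\<Sum>i\<in>?H. ?s i) \<le> \<kappa>\<^sup>2"
    proof -
      have "(\<Sum>i\<in>?H. ?s i) \<le> (l1 (u k) / real (m (q (Suc k))))\<^sup>2"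
      proof (rule heavy_bound[where wt = wt])
        show "al M ?H (\<lambda>i. g i k)" using k by (intro alg) auto
        show "1 \<le> m (q (Suc k))" using m_ge_2[of "q (Suc k)"] by simp
      qed (use g k in auto)
      also have "\<dots> \<le> \<kappa>\<^sup>2"
        using r(8)[of k] m_pos(1)[of "q (Suc k)"] by (intro power_mono) (auto simp: l1_def sum_nonneg divide_le_eq)
      finally show ?thesis .
    qed
    moreover have "(\<Sum>i\<in>I. ?s i) = (\<Sum>i\<in>?Mi. ?s i) + (\<Sum>i\<in>?L. ?s i) + (\<Sum>i\<in>?H. ?s i)"
    proof -
      have "I = (?Mi \<union> ?L) \<union> ?H" by (auto simp: Mid_def)
      then have "(\<Sum>i\<in>I. ?s i) = (\<Sum>i\<in>(?Mi \<union> ?L) \<union> ?H. ?s i)" by simp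
      also have "\<dots> = (\<Sum>i\<in>?Mi \<union> ?L. ?s i) + (\<Sum>i\<in>?H. ?s i)"
        using fin mono_mq[of k "Suc k"] by (intro sum.union_disjoint) (auto simp: Mid_def)
      also have "(\<Sum>i\<in>?Mi \<union> ?L. ?s i) = (\<Sum>i\<in>?Mi. ?s i) + (\<Sum>i\<in>?L. ?s i)"
        using fin by (intro sum.union_disjoint) (auto simp: Mid_def)
      finally show ?thesis .
    qed
    ultimately show ?thesis by linarith
  qed
  ultimately have "(\<Sum>k<p. (sqrt (b k))\<^sup>2 * (\<Sum>i\<in>I. (pairing (g i k) (u k))\<^sup>2)) \<le> \<epsilon> * C + ((1 / real \<omega>)\<^sup>2 * C + \<kappa>\<^sup>2)"
    by (intro scc_weighted_sum[OF scc(1)])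
  then show ?thesis using up by linarith
qed

text \<open>A unit functional has a one-point support and meets at most one block, so
  \<open>match_bound\<close> applies with the relation that is always true.\<close>

lemma ris_unit:
  assumes ris: "ris T q u M C \<kappa>" and al: "al M I f" and f: "\<And>i. i \<in> I \<Longrightarrow> unitf (f i)"
    and scc: "scc r t p b \<epsilon>" "M \<le> r" and t: "\<And>k. T (Suc k) < t (Suc k)"
  shows "(\<Sum>i\<in>I. (pairing (f i) (\<lambda>x. \<Sum>k<p. sqrt (b k) * u k x))\<^sup>2) \<le> \<epsilon> * C"
proof -
  note r = risD[OF ris]
  have "decomp D {..<p} (\<lambda>k. supp (u k)) (f i)" if "i \<in> I" for i
    using r(10) alD(2)[OF al that] by (intro D_W_decomp(1)) auto
  note dec = this
  have "\<exists>g. (\<forall>i\<in>I. \<forall>k\<in>{..<p}. D (g i k) \<and> supp (g i k) \<subseteq> supp (f i) \<inter> supp (u k)) \<and>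
      (\<Sum>i\<in>I. (pairing (f i) (\<lambda>x. \<Sum>k<p. sqrt (b k) * u k x))\<^sup>2)
      \<le> (\<Sum>k<p. (sqrt (b k))\<^sup>2 * (\<Sum>i\<in>I. (pairing (g i k) (u k))\<^sup>2))"
    by (rule upper_estimate[OF al]) (use dec r(6,10) in auto)
  then obtain g where g: "\<forall>i\<in>I. \<forall>k\<in>{..<p}. D (g i k) \<and> supp (g i k) \<subseteq> supp (f i) \<inter> supp (u k)"
    and up: "(\<Sum>i\<in>I. (pairing (f i) (\<lambda>x. \<Sum>k<p. sqrt (b k) * u k x))\<^sup>2)
      \<le> (\<Sum>k<p. (sqrt (b k))\<^sup>2 * (\<Sum>i\<in>I. (pairing (g i k) (u k))\<^sup>2))"
    by blast
  have "(\<Sum>k<p. b k * (\<Sum>i\<in>{i \<in> I. True}. (pairing (g i k) (u k))\<^sup>2)) \<le> \<epsilon> * C"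
  proof (rule match_bound[OF al])
    show "x < t (Suc k)" if "x \<in> supp (u k)" for k x using r(5)[of k] t[of k] that by fastforce
    show "k = l" if i: "i \<in> I" and k: "k < p" "l < p" "supp (g i k) \<noteq> {}" "supp (g i l) \<noteq> {}" for i k l
    proof (rule ccontr)
      assume "k \<noteq> l"
      obtain s where s: "supp (f i) = {s}" using unitf_supp[OF f[OF i]] by blast
      have *: "s \<in> supp (u k)" if "k < p" "supp (g i k) \<noteq> {}" for k
      proof -
        have "supp (g i k) \<subseteq> {s} \<inter> supp (u k)"
          using bspec[OF bspec[OF g i], of k] that(1) s by simp
        then show ?thesis using that(2) by blast
      qed
      have "s \<in> supp (u k) \<inter> supp (u l)" using *[OF k(1,3)] *[OF k(2,4)] by simp
      then show False using r(10)[OF \<open>k \<noteq> l\<close>] by blast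
    qed
    show "bd (\<lambda>_. True) M (u k) C" for k by (rule r(9))
    show "scc r t p b \<epsilon>" "M \<le> r" "0 \<le> C" using scc r(3) by simp_all
  qed (use g r(10) in auto)
  then have "(\<Sum>k<p. (sqrt (b k))\<^sup>2 * (\<Sum>i\<in>I. (pairing (g i k) (u k))\<^sup>2)) \<le> \<epsilon> * C + 0"
    by (intro scc_weighted_sum[OF scc(1), where X = "\<lambda>k. \<Sum>i\<in>I. (pairing (g i k) (u k))\<^sup>2"]) auto
  then show ?thesis using up by linarith
qed

text \<open>No smallness is gained here, as the squared coefficients just add up to 1. It is the
  starting bound that \<open>bd_from_large\<close> divides by a power of 4.\<close>

lemma ris_bd:
  assumes ris: "ris T q u M C \<kappa>" and scc: "scc r t p b \<epsilon>"
  shows "bd (\<lambda>_. True) M (\<lambda>x. \<Sum>k<p. sqrt (b k) * u k x) C"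
proof (rule bdI)
  fix \<F> assume al: "al M \<F> (\<lambda>f. f)"
  note r = risD[OF ris]
  have "decomp D {..<p} (\<lambda>k. supp (u k)) f" if "f \<in> \<F>" for f
    using r(10) alD(2)[OF al that] by (intro D_W_decomp(1)) auto
  note dec = this
  have "\<exists>g. (\<forall>i\<in>\<F>. \<forall>k\<in>{..<p}. D (g i k) \<and> supp (g i k) \<subseteq> supp i \<inter> supp (u k)) \<and>
      (\<Sum>i\<in>\<F>. (pairing i (\<lambda>x. \<Sum>k<p. sqrt (b k) * u k x))\<^sup>2)
      \<le> (\<Sum>k<p. (sqrt (b k))\<^sup>2 * (\<Sum>i\<in>\<F>. (pairing (g i k) (u k))\<^sup>2))"
    by (rule upper_estimate[OF al]) (use dec r(6,10) in auto)
  then obtain g where g: "\<forall>i\<in>\<F>. \<forall>k\<in>{..<p}. D (g i k) \<and> supp (g i k) \<subseteq> supp i \<inter> supp (u k)"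
    and up: "(\<Sum>i\<in>\<F>. (pairing i (\<lambda>x. \<Sum>k<p. sqrt (b k) * u k x))\<^sup>2)
      \<le> (\<Sum>k<p. (sqrt (b k))\<^sup>2 * (\<Sum>i\<in>\<F>. (pairing (g i k) (u k))\<^sup>2))"
    by blast
  have "(\<Sum>i\<in>\<F>. (pairing (g i k) (u k))\<^sup>2) \<le> 0 + C" if "k < p" for k
  proof -
    have "al M \<F> (\<lambda>i. g i k)" using g that by (intro al_sub[OF al]) auto
    then show ?thesis using bd_al[OF r(9)] by simp
  qed
  then have "(\<Sum>k<p. (sqrt (b k))\<^sup>2 * (\<Sum>i\<in>\<F>. (pairing (g i k) (u k))\<^sup>2)) \<le> 0 + C"
    by (rule scc_weighted_sum[OF scc]) auto
  then show "(\<Sum>f\<in>\<F>. (pairing f (\<lambda>x. \<Sum>k<p. sqrt (b k) * u k x))\<^sup>2) \<le> C" using up by linarith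
qed

text \<open>When no weight equals an \<open>m (q k)\<close>, every weight is below or above it, and
  the sharper bounds assumed for the blocks cover both cases. No matching takes place, so the order
  \<open>M'\<close> is not tied to the order \<open>r\<close> of the combination; it is applied to
  families too complex for the combination.\<close>

lemma ris_off_weights:
  assumes ris: "ris T q u M C \<kappa>" and al: "al M' I f"
    and wt: "\<And>i. i \<in> I \<Longrightarrow> W (f i) (wt i) \<and> \<omega> \<le> wt i \<and> (\<forall>k. wt i \<noteq> m (q k))" and \<omega>: "1 \<le> \<omega>"
    and scc: "scc r t p b \<epsilon>"
    and u: "\<And>k. bd (\<lambda>_. True) (M' + n (q k - 1)) (u k) C" "\<And>k. bd (\<lambda>f. \<exists>w>m (q k). W f w) M' (u k) \<eta>"
  shows "(\<Sum>i\<in>I. (pairing (f i) (\<lambda>x. \<Sum>k<p. sqrt (b k) * u k x))\<^sup>2) \<le> (1 / real \<omega>)\<^sup>2 * C + \<eta>"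
proof -
  note r = risD[OF ris]
  have "decomp (\<lambda>g. W g (wt i)) {..<p} (\<lambda>k. supp (u k)) (f i)" if "i \<in> I" for i
    using wt[OF that] r(10) by (intro D_W_decomp(2)) auto
  note dec = this
  have "\<exists>g. (\<forall>i\<in>I. \<forall>k\<in>{..<p}. W (g i k) (wt i) \<and> supp (g i k) \<subseteq> supp (f i) \<inter> supp (u k)) \<and>
      (\<Sum>i\<in>I. (pairing (f i) (\<lambda>x. \<Sum>k<p. sqrt (b k) * u k x))\<^sup>2)
      \<le> (\<Sum>k<p. (sqrt (b k))\<^sup>2 * (\<Sum>i\<in>I. (pairing (g i k) (u k))\<^sup>2))"
    by (rule upper_estimate[OF al]) (use dec r(6,10) in auto)
  then obtain g where g: "\<forall>i\<in>I. \<forall>k\<in>{..<p}. W (g i k) (wt i) \<and> supp (g i k) \<subseteq> supp (f i) \<inter> supp (u k)"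
    and up: "(\<Sum>i\<in>I. (pairing (f i) (\<lambda>x. \<Sum>k<p. sqrt (b k) * u k x))\<^sup>2)
      \<le> (\<Sum>k<p. (sqrt (b k))\<^sup>2 * (\<Sum>i\<in>I. (pairing (g i k) (u k))\<^sup>2))"
    by blast
  have gD: "D (g i k)" if "i \<in> I" "k < p" for i k using g that by (auto intro: weighted)
  have alg: "al M' J (\<lambda>i. g i k)" if "J \<subseteq> I" "k < p" for J k
    using that g gD by (intro al_sub[OF al]) auto
  have "(\<Sum>i\<in>I. (pairing (g i k) (u k))\<^sup>2) \<le> 0 + ((1 / real \<omega>)\<^sup>2 * C + \<eta>)" if k: "k < p" for k
  proof -
    let ?s = "\<lambda>i. (pairing (g i k) (u k))\<^sup>2"
    let ?L = "{i \<in> I. wt i < m (q k)}" and ?H = "{i \<in> I. m (q k) < wt i}"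
    have fin: "finite I" using alD(1)[OF al] .
    have "(\<Sum>i\<in>?L. ?s i) \<le> (1 / real \<omega>)\<^sup>2 * C"
    proof (rule children_bound[where wt = wt and J = "q k"])
      show "al M' ?L (\<lambda>i. g i k)" using k by (intro alg) auto
      show "bd (\<lambda>_. True) (M' + n (q k - 1)) (u k) C" by (rule u(1))
    qed (use g wt k \<omega> in auto)
    moreover have "(\<Sum>i\<in>?H. ?s i) \<le> \<eta>"
    proof (rule bd_al[OF u(2)])
      show "al M' ?H (\<lambda>i. g i k)" using k by (intro alg) auto
    qed (use g k in auto)
    moreover have "(\<Sum>i\<in>I. ?s i) = (\<Sum>i\<in>?L. ?s i) + (\<Sum>i\<in>?H. ?s i)"
    proof -
      have "I = ?L \<union> ?H" using wt linorder_neqE_nat by blast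
      then have "(\<Sum>i\<in>I. ?s i) = (\<Sum>i\<in>?L \<union> ?H. ?s i)" by simp
      also have "\<dots> = (\<Sum>i\<in>?L. ?s i) + (\<Sum>i\<in>?H. ?s i)" using fin by (intro sum.union_disjoint) auto
      finally show ?thesis .
    qed
    ultimately show ?thesis by linarith
  qed
  then have "(\<Sum>k<p. (sqrt (b k))\<^sup>2 * (\<Sum>i\<in>I. (pairing (g i k) (u k))\<^sup>2)) \<le> 0 + ((1 / real \<omega>)\<^sup>2 * C + \<eta>)"
    by (rule scc_weighted_sum[OF scc]) auto
  then show ?thesis using up by linarith
qed

end

text \<open>\<open>e z\<close> collects what the next position has to exceed and what is known only
  after \<open>z\<close> has been chosen: the right end of a block, or an index making later weights
  negligible.\<close>

lemma recursive_blocks: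
  fixes e :: "'z \<Rightarrow> nat"
  assumes "\<And>N. N0 \<le> N \<Longrightarrow> \<exists>z. R N z"
  shows "\<exists>T z. T 0 = N0 \<and> strict_mono T \<and> (\<forall>k. R (T k) (z k) \<and> e (z k) \<le> T (Suc k))"
proof -
  obtain Z where Z: "\<And>N. N0 \<le> N \<Longrightarrow> R N (Z N)" using assms by metis
  define T where "T = rec_nat N0 (\<lambda>_ N. max (Suc N) (e (Z N)))"
  have T: "T 0 = N0" "\<And>k. T (Suc k) = max (Suc (T k)) (e (Z (T k)))" by (simp_all add: T_def)
  have mono: "strict_mono T" by (simp add: strict_mono_Suc_iff T(2) less_max_iff_disj)
  have "N0 \<le> T k" for k using strict_mono_less_eq[OF mono, of 0 k] T(1) by simp
  then show ?thesis using T mono Z by (intro exI[of _ T] exI[of _ "\<lambda>k. Z (T k)"]) auto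
qed

context wh begin

section \<open>Growth of the parameters\<close>

lemma m_strict: "2 \<le> i \<Longrightarrow> i < j \<Longrightarrow> m i < m j"
proof -
  assume i: "2 \<le> i" "i < j"
  have "m i < m i ^ 3" using m_ge_2[of i] power_strict_increasing[of 1 3 "m i"] by simp
  also have "\<dots> \<le> m (Suc i)" using i by (intro m_cube)
  also have "\<dots> \<le> m j" using i by (intro monoD[OF par_simps(1)]) simp
  finally show ?thesis .
qed

lemma m_eqD: "2 \<le> i \<Longrightarrow> 2 \<le> j \<Longrightarrow> m i = m j \<Longrightarrow> i = j"
  by (metis linorder_neqE_nat m_strict nat_neq_iff)

lemma m_ge_8: "3 \<le> j \<Longrightarrow> 8 \<le> m j"
proof -
  assume j: "3 \<le> j"
  have "(2::nat) ^ 3 \<le> m 2 ^ 3" using m_ge_2 by (rule power_mono) simp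
  also have "\<dots> \<le> m (Suc 2)" by (rule m_cube) simp
  also have "\<dots> \<le> m j" using j by (intro monoD[OF par_simps(1)]) simp
  finally show ?thesis by simp
qed

lemma m_ge_index: "2 \<le> j \<Longrightarrow> j \<le> m j"
proof (induction j rule: dec_induct)
  case (step j)
  then show ?case using m_strict[of j "Suc j"] by simp
qed (use m_ge_2 in simp)

lemma m_unbounded: "\<exists>j. 2 \<le> j \<and> x \<le> real (m j)"
proof -
  obtain j where j: "x \<le> real j" using real_arch_simple by blast
  have "j \<le> m (max 2 j)" using m_ge_index[of "max 2 j"] by simp
  then show ?thesis using j by (intro exI[of _ "max 2 j"]) (simp add: order_trans[of x "real j"])
qed

text \<open>A number of rounds of \<open>bd_from_large\<close> that suffices for a division by the
  square of \<open>m J\<close>, since \<open>2 ^ lg J\<close> is at least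
  \<open>m J\<close>.\<close>

definition lg :: "nat \<Rightarrow> nat" where
  "lg J = nat \<lceil>log 2 (real (m J))\<rceil>"

lemma lg_bounds: "real (m J) \<le> 2 ^ lg J" "real (lg J) \<le> log 2 (real (m J)) + 1" "1 \<le> log 2 (real (m J))"
proof -
  show 1: "1 \<le> log 2 (real (m J))" using m_ge_2[of J] by (simp add: le_log_iff)
  show "real (lg J) \<le> log 2 (real (m J)) + 1" unfolding lg_def using 1 by (simp add: of_nat_nat)
  have "log 2 (real (m J)) \<le> real (lg J)" unfolding lg_def by (rule real_nat_ceiling_ge)
  then have "real (m J) \<le> 2 powr real (lg J)" using m_pos by (simp add: log_le_iff)
  then show "real (m J) \<le> 2 ^ lg J" by (simp add: powr_realpow)
qed

text \<open>As \<open>m J\<close> is at least 8, both multipliers are below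
  \<open>3 * log 2 (m J) + 1\<close>. The first leaves room for \<open>lg J\<close> rounds and three
  more summands \<open>n (J - 1)\<close>; the second for \<open>2 * lg J\<close> rounds, used when a
  gain of the fourth power of \<open>m J\<close> is wanted.\<close>

lemma n_growth:
  assumes J: "3 \<le> J"
  shows "(lg J + 3) * (n (J - 1) + 1) \<le> n J" "(2 * lg J + 1) * (n (J - 1) + 1) \<le> n J"
proof -
  define L where "L = log 2 (real (m J))"
  have *: "(3 * L + 1) * (real (n (J - 1)) + 1) < real (n J)"
    using par J unfolding wh_parameters_def L_def by simp
  have "3 = log 2 (2 ^ 3 :: real)" by (subst log_nat_power) auto
  also have "\<dots> \<le> L" unfolding L_def using m_ge_8[OF J] by simp
  finally have L: "3 \<le> L" .
  have lgL: "real (lg J) \<le> L + 1" using lg_bounds(2) by (simp add: L_def)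
  have "(real (lg J) + 3) * (real (n (J - 1)) + 1) \<le> (3 * L + 1) * (real (n (J - 1)) + 1)"
    using L lgL by (intro mult_right_mono) auto
  moreover have "real ((lg J + 3) * (n (J - 1) + 1)) = (real (lg J) + 3) * (real (n (J - 1)) + 1)"
    by (simp only: of_nat_mult of_nat_add of_nat_1 of_nat_numeral)
  ultimately have "real ((lg J + 3) * (n (J - 1) + 1)) \<le> real (n J)" using * by linarith
  then show "(lg J + 3) * (n (J - 1) + 1) \<le> n J" by (simp only: of_nat_le_iff)
  have "(2 * real (lg J) + 1) * (real (n (J - 1)) + 1) \<le> (3 * L + 1) * (real (n (J - 1)) + 1)"
    using L lgL by (intro mult_right_mono) auto
  moreover have "real ((2 * lg J + 1) * (n (J - 1) + 1)) = (2 * real (lg J) + 1) * (real (n (J - 1)) + 1)"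
    by (simp only: of_nat_mult of_nat_add of_nat_1 of_nat_numeral)
  ultimately have "real ((2 * lg J + 1) * (n (J - 1) + 1)) \<le> real (n J)" using * by linarith
  then show "(2 * lg J + 1) * (n (J - 1) + 1) \<le> n J" by (simp only: of_nat_le_iff)
qed

lemma n_ge_index: "j \<le> n j + 2"
proof (induction j)
  case (Suc j)
  show ?case
  proof (cases "3 \<le> Suc j")
    case True
    have "1 * (n j + 1) \<le> (lg (Suc j) + 3) * (n (Suc j - 1) + 1)" by (intro mult_mono) auto
    also have "\<dots> \<le> n (Suc j)" by (rule n_growth(1)[OF True])
    finally show ?thesis using Suc by simp
  qed simp
qed simp

section \<open>The norm and norming functionals\<close>

abbreviation nrm :: "(nat \<Rightarrow> real) \<Rightarrow> real" where "nrm \<equiv> wh_norm m n N1 N2 \<sigma>"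

lemma pairing_le_nrm: "D f \<Longrightarrow> pairing f x \<le> nrm x"
  unfolding wh_norm_def by (rule cSUP_upper[OF _ bdd_above_pairing_D_wh]) (simp add: D_wh_def)

lemma nrm_le: "(\<And>f. D f \<Longrightarrow> pairing f x \<le> c) \<Longrightarrow> nrm x \<le> c"
  unfolding wh_norm_def by (rule cSUP_least[OF D_wh_nonempty]) (simp add: D_wh_def)

lemma nrm_nonneg: "0 \<le> nrm x"
  using pairing_le_nrm[OF D_zero, of x] by (simp add: pairing_def)

lemma nrm_scale_le: "0 \<le> c \<Longrightarrow> nrm (\<lambda>i. c * x i) \<le> c * nrm x"
  by (rule nrm_le) (simp add: pairing_scale mult_left_mono pairing_le_nrm)

lemma nrm_scale: "0 < c \<Longrightarrow> nrm (\<lambda>i. c * x i) = c * nrm x"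
proof (rule antisym)
  assume c: "0 < c"
  show "nrm (\<lambda>i. c * x i) \<le> c * nrm x" using c by (intro nrm_scale_le) simp
  have "nrm (\<lambda>i. 1 / c * (c * x i)) \<le> 1 / c * nrm (\<lambda>i. c * x i)" using c by (intro nrm_scale_le) simp
  moreover have "(\<lambda>i. 1 / c * (c * x i)) = x" using c by auto
  ultimately show "c * nrm x \<le> nrm (\<lambda>i. c * x i)" using c by (simp add: field_simps)
qed

lemma pairing_unit: "finite (supp x) \<Longrightarrow> pairing (unit_vec k) x = x k"
  unfolding pairing_def unit_vec_def by (simp add: if_distrib[of "\<lambda>z. z * _"] sum.delta' supp_def cong: if_cong)

lemma pairing_uminus: "pairing (\<lambda>i. - f i) x = - pairing f x"
  by (simp add: pairing_def sum_negf)

lemma coordinate_le_nrm: "x \<in> c00 \<Longrightarrow> \<bar>x k\<bar> \<le> nrm x"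
proof (cases "k = 0")
  case True
  assume "x \<in> c00"
  then have "x 0 = 0" by (force simp: c00_def supp_def)
  then show ?thesis using True nrm_nonneg by simp
next
  case False
  assume x: "x \<in> c00"
  then have "pairing (unit_vec k) x = x k" by (intro pairing_unit) (simp add: c00_def)
  moreover have "D (unit_vec k)" "D (\<lambda>i. - unit_vec k i)" using False by (auto intro: pos_unit neg_unit)
  ultimately have "x k \<le> nrm x" "- x k \<le> nrm x" using pairing_le_nrm pairing_uminus by metis+
  then show ?thesis by simp
qed

lemma nrm_pos: "x \<in> c00 \<Longrightarrow> x i \<noteq> 0 \<Longrightarrow> 0 < nrm x"
  using coordinate_le_nrm[of x i] by simp

text \<open>On \<open>supp x\<close> a nearly norming functional is \<open>\<nu>\<close> times a
  functional supported there, with \<open>\<nu>\<close> of modulus at most 1. The sign of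
  \<open>\<nu>\<close> is lost, hence the absolute value.\<close>

lemma norming:
  assumes "0 \<le> c" "c < nrm x"
  shows "\<exists>g. D g \<and> supp g \<subseteq> supp x \<and> c < \<bar>pairing g x\<bar>"
proof -
  have "\<exists>f\<in>D_wh m n N1 N2 \<sigma>. c < pairing f x"
    using assms(2) unfolding wh_norm_def
    by (subst (asm) less_cSUP_iff[OF D_wh_nonempty bdd_above_pairing_D_wh]) blast
  then obtain f where f: "D f" "c < pairing f x" by (auto simp: D_wh_def)
  have "decomp D {()} (\<lambda>_. supp x) f" using f(1) by (intro D_W_decomp) auto
  then obtain g \<nu> where g: "D (g ())" "supp (g ()) \<subseteq> supp f \<inter> supp x" "\<forall>i\<in>supp x. f i = \<nu> () * g () i" "(\<nu> ())\<^sup>2 \<le> 1"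
    unfolding decomp_def by auto
  have "pairing f x = \<nu> () * pairing (g ()) x" using g(3) by (intro pairing_scale_left) blast
  then have "pairing f x \<le> \<bar>\<nu> ()\<bar> * \<bar>pairing (g ()) x\<bar>" by (simp add: abs_mult[symmetric])
  also have "\<dots> \<le> 1 * \<bar>pairing (g ()) x\<bar>" using g(4) by (intro mult_right_mono) (auto simp: abs_square_le_1)
  finally show ?thesis using f(2) g(1,2) by (intro exI[of _ "g ()"]) auto
qed

text \<open>
  Families whose minima lie in the true Schreier family can be averaged inside the norming set.
\<close>

definition schreier_fam :: "nat \<Rightarrow> nat \<Rightarrow> (nat \<Rightarrow> real) set \<Rightarrow> bool" where
  "schreier_fam M s \<F> \<longleftrightarrow> finite \<F> \<and> (\<forall>f\<in>\<F>. D f \<and> supp f \<noteq> {} \<and> supp f \<subseteq> {M<..}) \<and>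
     (\<forall>f\<in>\<F>. \<forall>g\<in>\<F>. f \<noteq> g \<longrightarrow> supp f \<inter> supp g = {}) \<and> (\<lambda>f. Min (supp f)) ` \<F> \<in> schreier s"

text \<open>The averages of weight \<open>m (2 * j)\<close> over the family lie in the norming set,
  and \<open>l2_duality\<close> turns their bound into one for squares. The doubling in
  \<open>average_exists\<close> runs against this limit.\<close>

lemma schreier_fam_sq_le:
  assumes F: "schreier_fam M s \<F>" and s: "s \<le> n (2 * j)" and x: "nrm x \<le> c"
  shows "(\<Sum>f\<in>\<F>. (pairing f x)\<^sup>2) \<le> (real (m (2 * j)) * c)\<^sup>2"
proof (rule l2_duality)
  fix \<mu> :: "_ \<Rightarrow> real" assume \<mu>: "(\<Sum>f\<in>\<F>. (\<mu> f)\<^sup>2) \<le> 1"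
  have "W (\<lambda>k. (1 / real (m (2 * j))) * (\<Sum>f\<in>\<F>. \<mu> f * f k)) (m (2 * j))"
  proof (rule D_even[OF _ _ _ _ \<mu>])
    have "{f \<in> \<F>. supp f \<noteq> {}} = \<F>" using F by (auto simp: schreier_fam_def)
    then show "(\<lambda>f. Min (supp f)) ` {f \<in> \<F>. supp f \<noteq> {}} \<in> schreier (n (2 * j))"
      using F schreier_mono[OF _ s] by (simp add: schreier_fam_def)
  qed (use F in \<open>auto simp: schreier_fam_def\<close>)
  then have "pairing (\<lambda>k. (1 / real (m (2 * j))) * (\<Sum>f\<in>\<F>. \<mu> f * f k)) x \<le> c"
    using pairing_le_nrm[OF weighted] x by (meson order_trans)
  then have "(1 / real (m (2 * j))) * (\<Sum>f\<in>\<F>. \<mu> f * pairing f x) \<le> c" by (simp only: pairing_average)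
  then show "(\<Sum>f\<in>\<F>. \<mu> f * pairing f x) \<le> real (m (2 * j)) * c"
    using m_pos(1)[of "2 * j"] by (simp add: field_simps)
qed

end

subsection \<open>Equivalent block vectors with disjoint supports\<close>

text \<open>
  The relation \<open>P\<close> is the graph of an isomorphism between two spaces spanned by block vectors, the
  supports in the first space being disjoint from those in the second.
\<close>

locale wh_pair = wh +
  fixes P :: "(nat \<Rightarrow> real) \<Rightarrow> (nat \<Rightarrow> real) \<Rightarrow> bool" and K :: real and A B :: "nat set"
  assumes P_comb: "\<And>(p::nat) c x y. (\<And>k. k < p \<Longrightarrow> P (x k) (y k)) \<Longrightarrow>
      P (\<lambda>i. \<Sum>k<p. c k * x k i) (\<lambda>i. \<Sum>k<p. c k * y k i)"
    and P_c00: "\<And>x y. P x y \<Longrightarrow> x \<in> c00" "\<And>x y. P x y \<Longrightarrow> y \<in> c00"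
    and P_supp: "\<And>x y. P x y \<Longrightarrow> supp x \<subseteq> A" "\<And>x y. P x y \<Longrightarrow> supp y \<subseteq> B" and AB: "A \<inter> B = {}"
    and K: "1 \<le> K" and P_le: "\<And>x y. P x y \<Longrightarrow> nrm x \<le> K * nrm y" "\<And>x y. P x y \<Longrightarrow> nrm y \<le> K * nrm x"
    and P_tail: "\<And>N. \<exists>x y. P x y \<and> (\<exists>i. x i \<noteq> 0) \<and> supp x \<union> supp y \<subseteq> {N<..}"
begin

lemma P_scale: "P x y \<Longrightarrow> P (\<lambda>i. c * x i) (\<lambda>i. c * y i)"
  using P_comb[of 1 "\<lambda>_. x" "\<lambda>_. y" "\<lambda>_. c"] by simp

lemma P_finite: "P x y \<Longrightarrow> finite (supp x)" "P x y \<Longrightarrow> finite (supp y)"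
  using P_c00 by (auto simp: c00_def)

lemma normalized_tail: "\<exists>x y. P x y \<and> nrm x = 1 \<and> supp x \<union> supp y \<subseteq> {N<..}"
proof -
  obtain x y i where xy: "P x y" "x i \<noteq> 0" "supp x \<union> supp y \<subseteq> {N<..}" using P_tail by blast
  then have pos: "0 < nrm x" using P_c00 nrm_pos by blast
  have "P (\<lambda>i. (1 / nrm x) * x i) (\<lambda>i. (1 / nrm x) * y i)" using xy(1) by (rule P_scale)
  moreover have "nrm (\<lambda>i. (1 / nrm x) * x i) = 1" using pos by (subst nrm_scale) auto
  moreover have "supp (\<lambda>i. (1 / nrm x) * x i) \<union> supp (\<lambda>i. (1 / nrm x) * y i) \<subseteq> {N<..}"
    using xy(3) supp_scale[of "1 / nrm x" x] supp_scale[of "1 / nrm x" y] by blast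
  ultimately show ?thesis by blast
qed

text \<open>
  If all averages had norm less than 1/2, iterating them and doubling each time would give unit
  vectors whose lower estimates contradict the growth of the sequence \<open>n\<close>.
\<close>

lemma average_exists:
  "\<exists>u u'. P u u' \<and> supp u \<union> supp u' \<subseteq> {N0<..} \<and> 1 / 2 \<le> nrm u \<and> bd (\<lambda>_. True) N u' (17 * K\<^sup>2)"
proof (rule ccontr)
  assume "\<not> ?thesis"
  then have neg: "nrm u < 1 / 2" if "P u u'" "supp u \<union> supp u' \<subseteq> {N0<..}" "bd (\<lambda>_. True) N u' (17 * K\<^sup>2)" for u u'
    using that by (meson not_le)
  \<comment> \<open>After \<open>t\<close> doublings the norm is still at most 1, while a family of
    order \<open>t * Suc N\<close> sees squares of sum at least \<open>4 ^ t / 4\<close>. At the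
    start, 1/4 is the square of a value above 1/2.\<close>
  define R where "R t M z = (case z of (x, y, \<F>) \<Rightarrow> P x y \<and> supp x \<union> supp y \<subseteq> {M<..} \<and> nrm x \<le> 1 \<and>
    schreier_fam M (t * Suc N) \<F> \<and> 4 ^ t / 4 \<le> (\<Sum>f\<in>\<F>. (pairing f x)\<^sup>2))" for t M z
  have claim: "\<exists>z. R t M z" if "N0 \<le> M" for t M
    using that
  proof (induction t arbitrary: M)
    case 0
    obtain x y where xy: "P x y" "nrm x = 1" "supp x \<union> supp y \<subseteq> {M<..}" using normalized_tail by blast
    obtain g where g: "D g" "supp g \<subseteq> supp x" "1 / 2 < \<bar>pairing g x\<bar>" using norming[of "1 / 2" x] xy(2) by auto
    have gne: "supp g \<noteq> {}" using g(3) pairing_disjoint[of g x] by auto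
    have "Min (supp g) \<in> supp g" using gne D_supp(1)[OF g(1)] by simp
    then have "1 \<le> Min (supp g)" using D_supp(2)[OF g(1)] by auto
    then have "schreier_fam M 0 {g}" using g(1,2) gne xy(3) by (auto simp: schreier_fam_def)
    moreover have "(1 / 2)\<^sup>2 \<le> \<bar>pairing g x\<bar>\<^sup>2" using g(3) by (intro power_mono) auto
    ultimately have "R 0 M (x, y, {g})" using xy by (simp add: R_def power2_eq_square)
    then show ?case by blast
  next
    case (Suc t)
    obtain c where c: "c > 0" and scc: "\<And>\<tau>. (\<forall>k. 2 * \<tau> k \<le> \<tau> (Suc k)) \<and> 1 \<le> \<tau> 0 \<Longrightarrow> \<exists>p b. scc N \<tau> p b (c / real (\<tau> 0))"
      using scc_exists[of N] by blast
    \<comment> \<open>Starting this far to the right makes the \<epsilon> of the combination at most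
      \<open>1 / 4 ^ Suc N\<close>, as \<open>averages_bd\<close> requires.\<close>
    define N' where "N' = Suc (max M (nat \<lceil>c * 4 ^ Suc N\<rceil>))"
    define S where "S z = (case z of (x, y, \<F>) \<Rightarrow> supp x \<union> supp y \<union> (\<Union>f\<in>\<F>. supp f))"
      for z :: "(nat \<Rightarrow> real) \<times> (nat \<Rightarrow> real) \<times> (nat \<Rightarrow> real) set"
    have "\<exists>z. R t M' z" if "N' \<le> M'" for M' using that Suc.prems by (intro Suc.IH) (simp add: N'_def)
    then obtain T z where T: "T 0 = N'" "strict_mono T" and z: "\<And>k. R t (T k) (z k)" "\<And>k. 2 * Max (insert 0 (S (z k))) \<le> T (Suc k)"
      using recursive_blocks[of N' "R t" "\<lambda>z. 2 * Max (insert 0 (S z))"] by blast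
    define x where "x k = fst (z k)" for k
    define y where "y k = fst (snd (z k))" for k
    define F where "F k = snd (snd (z k))" for k
    have zk: "z k = (x k, y k, F k)" for k by (simp add: x_def y_def F_def)
    have xy: "P (x k) (y k)" "supp (x k) \<union> supp (y k) \<subseteq> {T k<..}" "nrm (x k) \<le> 1"
      "schreier_fam (T k) (t * Suc N) (F k)" "4 ^ t / 4 \<le> (\<Sum>f\<in>F k. (pairing f (x k))\<^sup>2)" for k
      using z(1)[of k] by (simp_all add: R_def zk)
    have Ff: "finite (F k)" "f \<in> F k \<Longrightarrow> D f" "f \<in> F k \<Longrightarrow> supp f \<noteq> {}" "f \<in> F k \<Longrightarrow> supp f \<subseteq> {T k<..}"
      "f \<in> F k \<Longrightarrow> g \<in> F k \<Longrightarrow> f \<noteq> g \<Longrightarrow> supp f \<inter> supp g = {}" "(\<lambda>f. Min (supp f)) ` F k \<in> schreier (t * Suc N)" for k f g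
      using xy(4)[of k] by (auto simp: schreier_fam_def)
    have finS: "finite (S (z k))" for k
      using P_finite[OF xy(1)[of k]] Ff(1)[of k] Ff(2)[of _ k] D_supp(1) by (auto simp: S_def zk)
    have S2: "2 * i \<le> T (Suc k)" if "i \<in> S (z k)" for i k
    proof -
      have "i \<le> Max (insert 0 (S (z k)))" using finS that by (intro Max_ge) auto
      then show ?thesis using z(2)[of k] by simp
    qed
    have inT: "S (z k) \<subseteq> {T k<..T (Suc k)}" for k
    proof
      fix i assume i: "i \<in> S (z k)"
      then have "T k < i" using xy(2)[of k] Ff(4)[of _ k] by (auto simp: S_def zk)
      then show "i \<in> {T k<..T (Suc k)}" using S2[OF i] by simp
    qed
    have Tm: "mono T" using T(2) by (rule strict_mono_mono)
    have supx: "supp (x k) \<subseteq> {T k<..T (Suc k)}" "supp (y k) \<subseteq> {T k<..T (Suc k)}"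
      "f \<in> F k \<Longrightarrow> supp f \<subseteq> {T k<..T (Suc k)}" for k f
      using inT[of k] by (auto simp: S_def zk)
    \<comment> \<open>The combination is placed on the first minimum of each family, so that
      \<open>schreier_comp\<close> applies to the minima of their union.\<close>
    define \<tau> where "\<tau> k = Min ((\<lambda>f. Min (supp f)) ` F k)" for k
    have Fne: "F k \<noteq> {}" for k
    proof
      assume "F k = {}"
      then have "(4::real) ^ t / 4 \<le> 0" using xy(5)[of k] by simp
      then show False using zero_less_power[of "4::real" t] by linarith
    qed
    have Minf: "Min (supp f) \<in> supp f" if "f \<in> F k" for f k using Ff(2,3)[OF that] D_supp(1) by simp
    have \<tau>S: "\<tau> k \<in> S (z k)" for k
    proof -
      have "\<tau> k \<in> (\<lambda>f. Min (supp f)) ` F k" unfolding \<tau>_def using Ff(1) Fne by (intro Min_in) auto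
      then obtain f where "f \<in> F k" "\<tau> k = Min (supp f)" by blast
      then show ?thesis using Minf[of f k] by (auto simp: S_def zk)
    qed
    have \<tau>T: "T k < \<tau> k" "2 * \<tau> k \<le> T (Suc k)" for k using inT[of k] \<tau>S[of k] S2[OF \<tau>S] by auto
    have dbl: "2 * \<tau> k \<le> \<tau> (Suc k)" for k using \<tau>T(2)[of k] \<tau>T(1)[of "Suc k"] by simp
    have \<tau>0: "N' < \<tau> 0" using \<tau>T(1)[of 0] T(1) by simp
    then obtain p b where pb: "scc N \<tau> p b (c / real (\<tau> 0))" using scc[of \<tau>] dbl by auto
    have b: "0 \<le> b k" "(\<Sum>k<p. b k) = 1" for k using sccD(1,2)[OF pb] by auto
    have \<epsilon>: "c / real (\<tau> 0) * 4 ^ Suc N \<le> 1"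
    proof -
      have "c * 4 ^ Suc N \<le> real (nat \<lceil>c * 4 ^ Suc N\<rceil>)" by (rule real_nat_ceiling_ge)
      also have "nat \<lceil>c * 4 ^ Suc N\<rceil> \<le> \<tau> 0" using \<tau>0 unfolding N'_def by linarith
      finally show ?thesis using \<tau>0 by (simp add: divide_le_eq)
    qed
    define u where "u = (\<lambda>i. \<Sum>k<p. sqrt (b k) * x k i)"
    define u' where "u' = (\<lambda>i. \<Sum>k<p. sqrt (b k) * y k i)"
    have Pu: "P u u'" unfolding u_def u'_def using xy(1) by (rule P_comb)
    have MT: "M < T k" for k
    proof -
      have "T 0 \<le> T k" using Tm by (rule monoD) simp
      then show ?thesis using T(1) by (simp add: N'_def)
    qed
    have supu: "supp u \<union> supp u' \<subseteq> {M<..}"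
    proof -
      have "supp (x k) \<union> supp (y k) \<subseteq> {M<..}" for k using xy(2)[of k] MT[of k] by force
      then show ?thesis unfolding u_def u'_def using supp_lincomb[where I = "{..<p}" and a = "\<lambda>k. sqrt (b k)" and u = x]
        supp_lincomb[where I = "{..<p}" and a = "\<lambda>k. sqrt (b k)" and u = y] by blast
    qed
    have "bd (\<lambda>_. True) N u' (17 * K\<^sup>2)"
      unfolding u'_def
    proof (rule averages_bd[OF Tm supx(2) _ _ pb \<epsilon>])
      show "pairing f (y k) \<le> K" if "D f" for k f
      proof -
        have "pairing f (y k) \<le> nrm (y k)" using that by (rule pairing_le_nrm)
        also have "\<dots> \<le> K * nrm (x k)" by (rule P_le(2)[OF xy(1)])
        also have "\<dots> \<le> K * 1" using xy(3) K by (intro mult_left_mono) auto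
        finally show ?thesis by simp
      qed
      show "T (Suc k) < \<tau> (Suc k)" for k by (rule \<tau>T(1))
    qed
    \<comment> \<open>The partner \<open>u'\<close> satisfies the upper estimate, so by assumption
      \<open>u\<close> is short and may be doubled; the squares then grow by the factor 4.\<close>
    then have "nrm u < 1 / 2" using Suc.prems supu by (intro neg[OF Pu]) auto
    then have n1: "nrm (\<lambda>i. 2 * u i) \<le> 1" using nrm_scale_le[of 2 u] by simp
    define \<F> where "\<F> = (\<Union>k<p. F k)"
    have Fdisj: "supp f \<inter> supp g = {}" if "f \<in> F k" "g \<in> F l" "k \<noteq> l" for f g k l
      using block_disjoint[OF Tm, of "\<lambda>j. if j = k then f else if j = l then g else (\<lambda>_. 0)" k l] supx(3)[OF that(1)] supx(3)[OF that(2)] that(3)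
      by (auto simp: supp_def)
    have fam: "schreier_fam M (Suc t * Suc N) \<F>"
    proof -
      define G where "G i = (\<lambda>f. Min (supp f)) ` F (the_inv \<tau> i)" for i
      have inj: "inj \<tau>" using doubling_strict_mono(1)[of \<tau>] dbl \<tau>0 by (intro strict_mono_imp_inj_on) auto
      have smono: "strict_mono \<tau>" using doubling_strict_mono(1)[of \<tau>] dbl \<tau>0 by auto
      have inv: "the_inv \<tau> (\<tau> k) = k" for k using inj by (rule the_inv_f_f)
      have "(\<Union>i\<in>\<tau> ` {..<p}. G i) \<in> schreier (Suc N + t * Suc N)"
      proof (rule schreier_comp[OF sccD(3)[OF pb]])
        fix i assume "i \<in> \<tau> ` {..<p}"
        then obtain k where k: "i = \<tau> k" by blast
        show "G i \<in> schreier (t * Suc N) \<and> G i \<noteq> {} \<and> Min (G i) = i"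
        proof -
          have Gi: "G i = (\<lambda>f. Min (supp f)) ` F k" by (simp add: G_def k inv)
          have "Min (G i) = \<tau> k" unfolding Gi by (simp add: \<tau>_def)
          then have "Min (G i) = i" using k by simp
          then show ?thesis using Ff(6)[of k] Fne[of k] by (simp add: Gi del: schreier.simps)
        qed
        fix l assume "l \<in> \<tau> ` {..<p}" "i < l"
        then obtain k' where k': "l = \<tau> k'" "k < k'" using k strict_mono_less[OF smono] by auto
        have "finite (G i)" "G i \<noteq> {}" using Ff(1)[of k] Fne[of k] by (simp_all add: G_def k inv)
        then have "Max (G i) \<in> G i" by simp
        then obtain f where f: "f \<in> F k" "Max (G i) = Min (supp f)" by (auto simp: G_def k inv)
        then have "Max (G i) \<le> T (Suc k)" using Minf[OF f(1)] supx(3)[OF f(1)] by auto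
        also have "\<dots> \<le> T k'" using k'(2) by (intro monoD[OF Tm]) simp
        also have "\<dots> < l" using \<tau>T(1)[of k'] k'(1) by simp
        finally show "Max (G i) < l" .
      qed
      moreover have "(\<lambda>f. Min (supp f)) ` \<F> = (\<Union>i\<in>\<tau> ` {..<p}. G i)" by (auto simp: \<F>_def G_def inv)
      ultimately have 1: "(\<lambda>f. Min (supp f)) ` \<F> \<in> schreier (Suc t * Suc N)"
        unfolding mult_Suc by (simp only:)
      have 2: "supp f \<inter> supp g = {}" if fg: "f \<in> \<F>" "g \<in> \<F>" "f \<noteq> g" for f g
      proof -
        obtain k l where kl: "f \<in> F k" "g \<in> F l" using fg by (auto simp: \<F>_def)
        then show ?thesis using Ff(5)[of f k g] Fdisj[of f k g l] fg(3) by (cases "k = l") auto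
      qed
      have 3: "D f \<and> supp f \<noteq> {} \<and> supp f \<subseteq> {M<..}" if f: "f \<in> \<F>" for f
      proof -
        obtain k where k: "f \<in> F k" using f by (auto simp: \<F>_def)
        have "{T k<..} \<subseteq> {M<..}" using MT[of k] by auto
        from subset_trans[OF Ff(4)[OF k] this] show ?thesis using Ff(2)[OF k] Ff(3)[OF k] by simp
      qed
      have "finite \<F>" using Ff(1) by (simp add: \<F>_def)
      then show ?thesis unfolding schreier_fam_def using 1 2 3 by blast
    qed
    have "(\<Sum>f\<in>\<F>. (pairing f (\<lambda>i. 2 * u i))\<^sup>2) = (\<Sum>k<p. \<Sum>f\<in>F k. (pairing f (\<lambda>i. 2 * u i))\<^sup>2)"
      unfolding \<F>_def
    proof (rule sum.UNION_disjoint)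
      show "\<forall>k\<in>{..<p}. \<forall>l\<in>{..<p}. k \<noteq> l \<longrightarrow> F k \<inter> F l = {}" using Fdisj Ff(3) by blast
    qed (use Ff(1) in auto)
    also have "\<dots> = (\<Sum>k<p. 4 * (b k * (\<Sum>f\<in>F k. (pairing f (x k))\<^sup>2)))"
    proof (rule sum.cong[OF refl])
      fix k assume k: "k \<in> {..<p}"
      have "pairing f (\<lambda>i. 2 * u i) = 2 * (sqrt (b k) * pairing f (x k))" if f: "f \<in> F k" for f
      proof -
        have "pairing f u = (\<Sum>l<p. sqrt (b l) * pairing f (x l))"
          unfolding u_def using P_finite(1)[OF xy(1)] by (intro pairing_lincomb) auto
        also have "\<dots> = sqrt (b k) * pairing f (x k)"
        proof (rule disjoint_scalar_sum)
          fix l assume "l \<in> {..<p}" "l \<noteq> k"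
          then have "supp f \<inter> supp (x l) = {}"
            using block_disjoint[OF Tm, of "\<lambda>j. if j = k then f else x j" k l] supx(3)[OF f] supx(1) by auto
          then show "sqrt (b l) * pairing f (x l) = 0" by (simp add: pairing_disjoint)
        qed (use k in auto)
        finally show ?thesis by (simp add: pairing_scale)
      qed
      then show "(\<Sum>f\<in>F k. (pairing f (\<lambda>i. 2 * u i))\<^sup>2) = 4 * (b k * (\<Sum>f\<in>F k. (pairing f (x k))\<^sup>2))"
        using b(1)[of k] by (simp add: power_mult_distrib sum_distrib_left)
    qed
    also have "\<dots> \<ge> (\<Sum>k<p. 4 * (b k * (4 ^ t / 4)))"
      using xy(5) b(1) by (intro sum_mono mult_left_mono) auto
    finally have "(\<Sum>k<p. b k) * 4 ^ t \<le> (\<Sum>f\<in>\<F>. (pairing f (\<lambda>i. 2 * u i))\<^sup>2)"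
      by (simp add: sum_distrib_right)
    then have "4 ^ Suc t / 4 \<le> (\<Sum>f\<in>\<F>. (pairing f (\<lambda>i. 2 * u i))\<^sup>2)" using b(2) by simp
    moreover have "P (\<lambda>i. 2 * u i) (\<lambda>i. 2 * u' i)" using Pu by (rule P_scale)
    moreover have "supp (\<lambda>i. 2 * u i) \<union> supp (\<lambda>i. 2 * u' i) \<subseteq> {M<..}"
      using supu supp_scale[of 2 u] supp_scale[of 2 u'] by blast
    ultimately have "R (Suc t) M (\<lambda>i. 2 * u i, \<lambda>i. 2 * u' i, \<F>)" unfolding R_def using n1 fam by simp
    then show ?case by blast
  qed
  \<comment> \<open>This makes \<open>n (J - 1)\<close> at least \<open>N\<close>. Then
    \<open>lg J + 2\<close> doublings stay within order \<open>n J\<close>, although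
    \<open>4 ^ (lg J + 2) / 4\<close> exceeds the square of \<open>m J\<close>.\<close>
  define j where "j = N + 3"
  define J where "J = 2 * j"
  have J3: "3 \<le> J" by (simp add: J_def j_def)
  have "N \<le> n (J - 1)" using n_ge_index[of "J - 1"] by (simp add: J_def j_def)
  then have "(lg J + 2) * Suc N \<le> (lg J + 3) * (n (J - 1) + 1)" by (intro mult_mono) auto
  also have "\<dots> \<le> n J" by (rule n_growth(1)[OF J3])
  finally have s: "(lg J + 2) * Suc N \<le> n (2 * j)" by (simp add: J_def)
  obtain x y \<F> where "R (lg J + 2) N0 (x, y, \<F>)" using claim[of N0 "lg J + 2"] by auto
  then have F: "nrm x \<le> 1" "schreier_fam N0 ((lg J + 2) * Suc N) \<F>" "4 ^ (lg J + 2) / 4 \<le> (\<Sum>f\<in>\<F>. (pairing f x)\<^sup>2)"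
    by (simp_all add: R_def)
  have "4 ^ (lg J + 2) / 4 \<le> (real (m J))\<^sup>2"
    using F(3) schreier_fam_sq_le[OF F(2) s F(1)] by (simp add: J_def)
  also have "\<dots> \<le> (2 ^ lg J)\<^sup>2" using lg_bounds(1) by (intro power_mono) auto
  also have "\<dots> = 4 ^ lg J" by (simp add: power2_eq_square flip: power_mult_distrib)
  finally show False by simp
qed

end

lemma ceiling_scc_small:
  assumes "0 < c" "real (nat \<lceil>c * x\<rceil>) \<le> real t" "0 < x" "0 < t"
  shows "c / real t \<le> 1 / x"
proof -
  have "c * x \<le> real (nat \<lceil>c * x\<rceil>)" by (rule real_nat_ceiling_ge)
  then have "c * x \<le> real t" using assms(2) by linarith
  then show ?thesis using assms by (simp add: field_simps)
qed

context wh begin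

lemma bd_le: "bd P N x c \<Longrightarrow> c \<le> c' \<Longrightarrow> bd P N x c'"
  by (rule bd_mono[where P = P and N = N and c = c]) auto

lemma large_split:
  assumes al: "al N \<F> (\<lambda>f. f)" and large: "\<And>f. f \<in> \<F> \<Longrightarrow> large J f"
    and unit: "(\<Sum>f\<in>{f \<in> \<F>. unitf f}. (pairing f x)\<^sup>2) \<le> a"
    and weight: "(\<Sum>f\<in>{f \<in> \<F>. \<not> unitf f}. (pairing f x)\<^sup>2) \<le> c"
  shows "(\<Sum>f\<in>\<F>. (pairing f x)\<^sup>2) \<le> a + c"
proof -
  have "\<F> = {f \<in> \<F>. unitf f} \<union> {f \<in> \<F>. \<not> unitf f}" by blast
  then have "(\<Sum>f\<in>\<F>. (pairing f x)\<^sup>2) = (\<Sum>f\<in>{f \<in> \<F>. unitf f} \<union> {f \<in> \<F>. \<not> unitf f}. (pairing f x)\<^sup>2)" by simp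
  also have "\<dots> = (\<Sum>f\<in>{f \<in> \<F>. unitf f}. (pairing f x)\<^sup>2) + (\<Sum>f\<in>{f \<in> \<F>. \<not> unitf f}. (pairing f x)\<^sup>2)"
    using alD(1)[OF al] by (intro sum.union_disjoint) auto
  finally show ?thesis using unit weight by linarith
qed

text \<open>The two estimates that make the multiple of a special average of a rapidly increasing sequence
  behave like a single term of such a sequence.\<close>

lemma exact_bounds:
  assumes ris: "ris T q u M C \<kappa>" and scc: "scc M t p b \<epsilon>" and t: "\<And>k. T (Suc k) < t (Suc k)"
    and Q: "3 \<le> Q" and M: "M = 3 * n (Q - 1) + lg Q * n (Q - 1)"
    and \<epsilon>: "\<epsilon> \<le> 1 / real (m Q) ^ 6" and \<kappa>: "\<kappa> = 1 / real (m Q) ^ 3" and C: "1 \<le> C"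
  defines "v \<equiv> (\<lambda>i. real (m Q) * (\<Sum>k<p. sqrt (b k) * u k i))"
  shows "bd (\<lambda>_. True) (3 * n (Q - 1)) v (9 * C)"
    "bd (\<lambda>f. \<exists>w>m Q. W f w) (3 * n (Q - 1)) v (9 * C / real (m Q) ^ 4)"
proof -
  define \<mu> where "\<mu> = real (m Q)"
  have \<mu>: "8 \<le> \<mu>" using m_ge_8[OF Q] by (simp add: \<mu>_def)
  define x where "x = (\<lambda>i. \<Sum>k<p. sqrt (b k) * u k i)"
  have v: "v = (\<lambda>i. \<mu> * x i)" by (simp add: v_def x_def \<mu>_def)
  have pw: "1 / \<mu> ^ 6 \<le> 1 / \<mu>\<^sup>2" "1 / \<mu> ^ 6 \<le> 1 / \<mu> ^ 4"
    using \<mu> by (auto intro!: divide_left_mono power_increasing)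
  have \<epsilon>C: "\<epsilon> * C \<le> C * (1 / \<mu> ^ 6)" using \<epsilon> C by (subst mult.commute, intro mult_left_mono) (auto simp: \<mu>_def)
  have \<kappa>2: "\<kappa>\<^sup>2 = 1 / \<mu> ^ 6" by (simp add: \<kappa> \<mu>_def power_divide flip: power_mult)
  have "1 * (1 / \<mu> ^ 6) \<le> C * (1 / \<mu> ^ 6)" using C \<mu> by (intro mult_right_mono) auto
  then have \<kappa>C: "\<kappa>\<^sup>2 \<le> C * (1 / \<mu> ^ 6)" by (simp only: \<kappa>2 mult_1)
  have C2: "C * (1 / \<mu> ^ 6) \<le> C * (1 / \<mu>\<^sup>2)" using C pw(1) by (intro mult_left_mono) auto
  \<comment> \<open>The main term \<open>C / \<mu>\<^sup>2\<close> comes from the weights, which are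
    at least \<open>m Q\<close>. The three other terms are at most \<open>C / \<mu> ^ 6\<close>
    each, hence the factor 4.\<close>
  have large: "bd (large Q) M x (4 * (C * (1 / \<mu>\<^sup>2)))"
  proof (rule bdI)
    fix \<F> assume al: "al M \<F> (\<lambda>f. f)" and la: "\<And>f. f \<in> \<F> \<Longrightarrow> large Q f"
    have "(\<Sum>f\<in>{f \<in> \<F>. unitf f}. (pairing f x)\<^sup>2) \<le> \<epsilon> * C"
      unfolding x_def by (rule ris_unit[OF ris al_subset[OF al] _ scc order_refl t]) auto
    moreover have "(\<Sum>f\<in>{f \<in> \<F>. \<not> unitf f}. (pairing f x)\<^sup>2) \<le> \<epsilon> * C + ((1 / real (m Q))\<^sup>2 * C + \<kappa>\<^sup>2)"
    proof -
      have "\<forall>f\<in>{f \<in> \<F>. \<not> unitf f}. \<exists>w. W f w \<and> m Q \<le> w" using la by (auto simp: large_def)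
      then obtain wt where wt: "\<And>f. f \<in> {f \<in> \<F>. \<not> unitf f} \<Longrightarrow> W f (wt f) \<and> m Q \<le> wt f" by metis
      show ?thesis unfolding x_def
        by (rule ris_weighted[OF ris al_subset[OF al] wt _ scc order_refl t]) (use m_ge_2[of Q] in auto)
    qed
    ultimately have "(\<Sum>f\<in>\<F>. (pairing f x)\<^sup>2) \<le> \<epsilon> * C + (\<epsilon> * C + ((1 / real (m Q))\<^sup>2 * C + \<kappa>\<^sup>2))"
      by (intro large_split[OF al]) (assumption | rule la)+
    also have "(1 / real (m Q))\<^sup>2 * C = C * (1 / \<mu>\<^sup>2)" by (simp add: \<mu>_def power_divide)
    also have "\<epsilon> * C + (\<epsilon> * C + (C * (1 / \<mu>\<^sup>2) + \<kappa>\<^sup>2)) \<le> 4 * (C * (1 / \<mu>\<^sup>2))"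
      using \<epsilon>C \<kappa>C C2 by linarith
    finally show "(\<Sum>f\<in>\<F>. (pairing f x)\<^sup>2) \<le> 4 * (C * (1 / \<mu>\<^sup>2))" .
  qed
  \<comment> \<open>\<open>M\<close> leaves room for \<open>lg Q\<close> rounds above order
    \<open>3 * n (Q - 1)\<close>. After scaling by \<open>\<mu>\<close> the large functionals give
    \<open>8 * C\<close> and the rest \<open>C\<close>.\<close>
  have "bd (\<lambda>_. True) M x C" unfolding x_def by (rule ris_bd[OF ris scc])
  then have "bd (\<lambda>_. True) (3 * n (Q - 1)) x (2 * (4 * (C * (1 / \<mu>\<^sup>2))) + C / 4 ^ lg Q)"
    using large by (intro bd_from_large) (simp_all add: M)
  then have "bd (\<lambda>_. True) (3 * n (Q - 1)) (\<lambda>i. \<mu> * x i) (\<mu>\<^sup>2 * (2 * (4 * (C * (1 / \<mu>\<^sup>2))) + C / 4 ^ lg Q))"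
    by (rule bd_scale)
  moreover have "\<mu>\<^sup>2 * (2 * (4 * (C * (1 / \<mu>\<^sup>2))) + C / 4 ^ lg Q) \<le> 9 * C"
  proof -
    have "\<mu>\<^sup>2 \<le> (2 ^ lg Q)\<^sup>2" using lg_bounds(1)[of Q] \<mu> by (intro power_mono) (auto simp: \<mu>_def)
    also have "\<dots> = 4 ^ lg Q" by (simp add: power2_eq_square flip: power_mult_distrib)
    finally have "\<mu>\<^sup>2 * (C / 4 ^ lg Q) \<le> C" using C by (simp add: field_simps)
    moreover have "\<mu>\<^sup>2 * (2 * (4 * (C * (1 / \<mu>\<^sup>2)))) = 8 * C" using \<mu> by simp
    ultimately show ?thesis by (simp add: distrib_left)
  qed
  ultimately show "bd (\<lambda>_. True) (3 * n (Q - 1)) v (9 * C)"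
    unfolding v by (rule bd_le)
  have "bd (\<lambda>f. \<exists>w>m Q. W f w) (3 * n (Q - 1)) x (3 * (C * (1 / \<mu> ^ 6)))"
  proof (rule bdI)
    fix \<F> assume al: "al (3 * n (Q - 1)) \<F> (\<lambda>f. f)" and wf: "\<And>f. f \<in> \<F> \<Longrightarrow> \<exists>w>m Q. W f w"
    then obtain wt where wt: "\<And>f. f \<in> \<F> \<Longrightarrow> m Q < wt f \<and> W f (wt f)" by metis
    \<comment> \<open>A weight above \<open>m Q\<close> jumps to at least \<open>m Q ^ 3\<close>.
      All terms are then of size \<open>C / \<mu> ^ 6\<close>, and scaling by \<open>\<mu>\<close>
      leaves \<open>\<mu> ^ 4\<close> in the denominator.\<close>
    have wt': "W f (wt f) \<and> m Q ^ 3 \<le> wt f" if "f \<in> \<F>" for f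
    proof -
      have "\<exists>q'. wt f = m q'" using W_imp_index wt[OF that] by blast
      then obtain q' where q': "wt f = m q'" by blast
      then have "\<not> q' \<le> Q" using wt[OF that] monoD[OF par_simps(1), of q' Q] by auto
      then have "m (Suc Q) \<le> m q'" by (intro monoD[OF par_simps(1)]) simp
      moreover have "m Q ^ 3 \<le> m (Suc Q)" using Q by (intro m_cube) simp
      ultimately show ?thesis using wt[OF that] q' by simp
    qed
    have "(\<Sum>f\<in>\<F>. (pairing f x)\<^sup>2) \<le> \<epsilon> * C + ((1 / real (m Q ^ 3))\<^sup>2 * C + \<kappa>\<^sup>2)"
      unfolding x_def
    proof (rule ris_weighted[OF ris _ wt' _ scc order_refl t])
      show "al M \<F> (\<lambda>f. f)" using al by (rule al_mono) (simp add: M)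
      show "1 \<le> m Q ^ 3" using m_ge_2[of Q] by simp
    qed
    also have "(1 / real (m Q ^ 3))\<^sup>2 = 1 / \<mu> ^ 6" by (simp add: \<mu>_def power_divide flip: power_mult)
    also have "\<epsilon> * C + (1 / \<mu> ^ 6 * C + \<kappa>\<^sup>2) \<le> 3 * (C * (1 / \<mu> ^ 6))" using \<epsilon>C \<kappa>C by simp
    finally show "(\<Sum>f\<in>\<F>. (pairing f x)\<^sup>2) \<le> 3 * (C * (1 / \<mu> ^ 6))" .
  qed
  then have "bd (\<lambda>f. \<exists>w>m Q. W f w) (3 * n (Q - 1)) (\<lambda>i. \<mu> * x i) (\<mu>\<^sup>2 * (3 * (C * (1 / \<mu> ^ 6))))"
    by (rule bd_scale)
  moreover have "\<mu>\<^sup>2 * (3 * (C * (1 / \<mu> ^ 6))) \<le> 9 * C / \<mu> ^ 4"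
  proof -
    have "\<mu> ^ 6 = \<mu>\<^sup>2 * \<mu> ^ 4" by (simp flip: power_add)
    moreover have "\<mu>\<^sup>2 / (\<mu>\<^sup>2 * \<mu> ^ 4) = 1 / \<mu> ^ 4"
      by (rule nonzero_divide_mult_cancel_left) (use \<mu> in simp)
    ultimately have "\<mu>\<^sup>2 / \<mu> ^ 6 = 1 / \<mu> ^ 4" by (simp only:)
    moreover have "\<mu>\<^sup>2 * (3 * (C * (1 / \<mu> ^ 6))) = 3 * C * (\<mu>\<^sup>2 / \<mu> ^ 6)" by (simp add: mult_ac)
    ultimately have "\<mu>\<^sup>2 * (3 * (C * (1 / \<mu> ^ 6))) = 3 * C / \<mu> ^ 4" by simp
    also have "\<dots> \<le> 9 * C / \<mu> ^ 4" using C \<mu> by (intro divide_right_mono) auto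
    finally show ?thesis .
  qed
  ultimately show "bd (\<lambda>f. \<exists>w>m Q. W f w) (3 * n (Q - 1)) v (9 * C / real (m Q) ^ 4)"
    unfolding v \<mu>_def[symmetric] by (rule bd_le)
qed

end

context wh_pair begin

text \<open>The constant \<open>17 * K\<^sup>2\<close> of \<open>averages_bd\<close> times the
  factor 9 of \<open>exact_bounds\<close>.\<close>

definition CP :: real where "CP = 153 * K\<^sup>2"

lemma CP: "1 \<le> 17 * K\<^sup>2" "CP = 9 * (17 * K\<^sup>2)" "1 \<le> CP"
proof -
  have "1 \<le> K\<^sup>2" using K by simp
  then show "1 \<le> 17 * K\<^sup>2" "CP = 9 * (17 * K\<^sup>2)" "1 \<le> CP" by (simp_all add: CP_def)
qed

text \<open>A rapidly increasing sequence of vectors from \<open>average_exists\<close> is averaged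
  again and multiplied by \<open>m Q\<close>; the matching even average of nearly norming
  functionals has weight \<open>m Q\<close> and takes a value of at least 1/4 on it. The upper
  bounds concern the partner \<open>v\<close>. The order \<open>3 * n (Q - 1)\<close> will absorb a
  sum of three orders, each at most \<open>n (Q - 1)\<close>.\<close>

lemma exact_pair_exists:
  assumes Q: "3 \<le> Q" and even: "Q = 2 * j"
  shows "\<exists>z v f. P z v \<and> supp z \<union> supp v \<union> supp f \<subseteq> {N0<..} \<and> supp f \<subseteq> A \<and> W f (m Q) \<and> 1 / 4 \<le> pairing f z \<and>
    bd (\<lambda>_. True) (3 * n (Q - 1)) v CP \<and> bd (\<lambda>f. \<exists>w>m Q. W f w) (3 * n (Q - 1)) v (CP / real (m Q) ^ 4)"
proof -
  define M where "M = 3 * n (Q - 1) + lg Q * n (Q - 1)"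
  define \<kappa> where "\<kappa> = 1 / real (m Q) ^ 3"
  define C where "C = 17 * K\<^sup>2"
  have \<kappa>pos: "0 < \<kappa>" using m_pos[of Q] by (simp add: \<kappa>_def)
  obtain c where c: "c > 0" and scc: "\<And>\<tau>. (\<forall>k. 2 * \<tau> k \<le> \<tau> (Suc k)) \<and> 1 \<le> \<tau> 0 \<Longrightarrow> \<exists>p b. scc M \<tau> p b (c / real (\<tau> 0))"
    using scc_exists[of M] by blast
  \<comment> \<open>The position of a block is also used as its weight index, so the order demanded
    of the partner is known once the position is.\<close>
  define R where "R N z = (case z of (u, u', \<phi>) \<Rightarrow> P u u' \<and> supp u \<union> supp u' \<subseteq> {N<..} \<and>
      bd (\<lambda>_. True) (M + n (N - 1)) u' C \<and> D \<phi> \<and> supp \<phi> \<subseteq> supp u \<and> 1 / 4 < \<bar>pairing \<phi> u\<bar>)" for N z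
  have ex: "\<exists>z. R N z" for N
  proof -
    obtain u u' where u: "P u u'" "supp u \<union> supp u' \<subseteq> {N<..}" "1 / 2 \<le> nrm u" "bd (\<lambda>_. True) (M + n (N - 1)) u' (17 * K\<^sup>2)"
      using average_exists by blast
    obtain \<phi> where "D \<phi>" "supp \<phi> \<subseteq> supp u" "1 / 4 < \<bar>pairing \<phi> u\<bar>" using norming[of "1 / 4" u] u(3) by auto
    then have "R N (u, u', \<phi>)" using u by (simp add: R_def C_def)
    then show ?thesis by blast
  qed
  define jj where "jj x = (SOME i. x \<le> real (m i))" for x
  have jj: "x \<le> real (m (jj x))" for x
  proof -
    have "\<exists>i. x \<le> real (m i)" using m_unbounded[of x] by blast
    then show ?thesis unfolding jj_def by (rule someI_ex)
  qed
  \<comment> \<open>Putting \<open>jj (l1 u' / \<kappa>)\<close> below the next position makes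
    functionals of weight at least that of the next index negligible on \<open>u'\<close>. The
    factor 2 makes the points \<tau> double.\<close>
  define e where "e z = (case z of (u, u', \<phi>) \<Rightarrow> 2 * Max (insert 0 (supp u \<union> supp u')) + jj (l1 u' / \<kappa>))"
    for z :: "(nat \<Rightarrow> real) \<times> (nat \<Rightarrow> real) \<times> (nat \<Rightarrow> real)"
  define N' where "N' = Suc (max N0 (nat \<lceil>c * real (m Q) ^ 6\<rceil>))"
  obtain T z where T: "T 0 = N'" "strict_mono T" and z: "\<And>k. R (T k) (z k)" "\<And>k. e (z k) \<le> T (Suc k)"
    using recursive_blocks[of N' R e] ex by blast
  define u where "u k = fst (z k)" for k
  define u' where "u' k = fst (snd (z k))" for k
  define \<phi> where "\<phi> k = snd (snd (z k))" for k
  have zk: "z k = (u k, u' k, \<phi> k)" for k by (simp add: u_def u'_def \<phi>_def)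
  have u: "P (u k) (u' k)" "supp (u k) \<union> supp (u' k) \<subseteq> {T k<..}" "bd (\<lambda>_. True) (M + n (T k - 1)) (u' k) C"
    "D (\<phi> k)" "supp (\<phi> k) \<subseteq> supp (u k)" "1 / 4 < \<bar>pairing (\<phi> k) (u k)\<bar>" for k
    using z(1)[of k] by (simp_all add: R_def zk)
  have ek: "2 * Max (insert 0 (supp (u k) \<union> supp (u' k))) \<le> T (Suc k)" "jj (l1 (u' k) / \<kappa>) \<le> T (Suc k)" for k
    using z(2)[of k] by (simp_all add: e_def zk)
  have Tm: "mono T" using T(2) by (rule strict_mono_mono)
  have S2: "2 * i \<le> T (Suc k)" if "i \<in> supp (u k) \<union> supp (u' k)" for i k
  proof -
    have "i \<le> Max (insert 0 (supp (u k) \<union> supp (u' k)))" using P_finite[OF u(1)[of k]] that by (intro Max_ge) auto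
    then show ?thesis using ek(1)[of k] by simp
  qed
  have supu: "supp (u k) \<subseteq> {T k<..T (Suc k)}" "supp (u' k) \<subseteq> {T k<..T (Suc k)}" for k
  proof -
    have "i \<in> {T k<..T (Suc k)}" if i: "i \<in> supp (u k) \<union> supp (u' k)" for i
    proof -
      have "T k < i" using subsetD[OF u(2)[of k] i] by simp
      then show ?thesis using S2[OF i] by simp
    qed
    then show "supp (u k) \<subseteq> {T k<..T (Suc k)}" "supp (u' k) \<subseteq> {T k<..T (Suc k)}" by auto
  qed
  have sup\<phi>: "supp (\<phi> k) \<subseteq> {T k<..T (Suc k)}" for k using u(5) supu(1) by (rule subset_trans)
  have ris: "ris T T u' M C \<kappa>"
    unfolding ris_def
  proof (intro conjI allI)
    show "l1 (u' k) \<le> \<kappa> * real (m (T (Suc k)))" for k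
    proof -
      have "l1 (u' k) / \<kappa> \<le> real (m (jj (l1 (u' k) / \<kappa>)))" by (rule jj)
      also have "\<dots> \<le> real (m (T (Suc k)))" using monoD[OF par_simps(1) ek(2)] by simp
      finally show ?thesis using \<kappa>pos by (simp add: field_simps)
    qed
  qed (use Tm supu(2) u(3) \<kappa>pos CP(1) in \<open>auto simp: C_def\<close>)
  define \<tau> where "\<tau> k = Min (supp (\<phi> k))" for k
  have \<phi>ne: "supp (\<phi> k) \<noteq> {}" for k using u(6)[of k] pairing_disjoint[of "\<phi> k" "u k"] by auto
  have \<tau>in: "\<tau> k \<in> supp (\<phi> k)" for k unfolding \<tau>_def using \<phi>ne D_supp(1)[OF u(4)] by simp
  have \<tau>T: "T k < \<tau> k" "2 * \<tau> k \<le> T (Suc k)" for k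
    using \<tau>in[of k] sup\<phi>[of k] u(5)[of k] S2[of "\<tau> k" k] by auto
  have dbl: "2 * \<tau> k \<le> \<tau> (Suc k)" for k using \<tau>T(2)[of k] \<tau>T(1)[of "Suc k"] by simp
  have \<tau>0: "N' < \<tau> 0" using \<tau>T(1)[of 0] T(1) by simp
  then obtain p b where pb: "scc M \<tau> p b (c / real (\<tau> 0))" using scc[of \<tau>] dbl by auto
  have b: "0 \<le> b k" "(\<Sum>k<p. b k) = 1" for k using sccD(1,2)[OF pb] by auto
  have \<epsilon>: "c / real (\<tau> 0) \<le> 1 / real (m Q) ^ 6"
  proof (rule ceiling_scc_small[OF c])
    have "nat \<lceil>c * real (m Q) ^ 6\<rceil> \<le> \<tau> 0" using \<tau>0 unfolding N'_def by linarith
    then show "real (nat \<lceil>c * real (m Q) ^ 6\<rceil>) \<le> real (\<tau> 0)" by (simp only: of_nat_le_iff)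
  qed (use \<tau>0 m_pos[of Q] in auto)
  define v where "v = (\<lambda>i. real (m Q) * (\<Sum>k<p. sqrt (b k) * u' k i))"
  define w where "w = (\<lambda>i. real (m Q) * (\<Sum>k<p. sqrt (b k) * u k i))"
  have Pwv: "P w v" unfolding w_def v_def by (rule P_scale[OF P_comb]) (rule u(1))
  have \<tau>T': "T (Suc k) < \<tau> (Suc k)" for k by (rule \<tau>T(1))
  have bds: "bd (\<lambda>_. True) (3 * n (Q - 1)) v CP" "bd (\<lambda>f. \<exists>w>m Q. W f w) (3 * n (Q - 1)) v (CP / real (m Q) ^ 4)"
    using exact_bounds[OF ris pb \<tau>T' Q M_def \<epsilon> \<kappa>_def] CP(1) unfolding v_def CP(2) C_def by auto
  \<comment> \<open>The signs turn the terms of \<open>pairing f w\<close> into \<open>b k\<close>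
    times absolute values; the coefficients lie in the unit ball because \<open>b\<close> sums to
    1.\<close>
  define l where "l k = sqrt (b k) * sgn (pairing (\<phi> k) (u k))" for k
  define f where "f = (\<lambda>i. (1 / real (m (2 * j))) * (\<Sum>k<p. l k * \<phi> k i))"
  have f_W: "W f (m Q)" unfolding f_def even
  proof (rule D_even)
    show "supp (\<phi> k) \<inter> supp (\<phi> k') = {}" if "k \<noteq> k'" for k k' by (rule block_disjoint[OF Tm sup\<phi> that])
    have "Suc M \<le> (lg Q + 3) * (n (Q - 1) + 1)" by (simp add: M_def algebra_simps)
    also have "\<dots> \<le> n Q" by (rule n_growth(1)[OF Q])
    finally have "\<tau> ` {..<p} \<in> schreier (n Q)" by (rule schreier_mono[OF sccD(3)[OF pb]])
    moreover have "(\<lambda>k. Min (supp (\<phi> k))) ` {k \<in> {..<p}. supp (\<phi> k) \<noteq> {}} = \<tau> ` {..<p}" using \<phi>ne by (auto simp: \<tau>_def)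
    ultimately show "(\<lambda>k. Min (supp (\<phi> k))) ` {k \<in> {..<p}. supp (\<phi> k) \<noteq> {}} \<in> schreier (n (2 * j))" using even by simp
    have "(\<Sum>k<p. (l k)\<^sup>2) \<le> (\<Sum>k<p. b k)"
    proof (rule sum_mono)
      fix k
      have "(sgn (pairing (\<phi> k) (u k)))\<^sup>2 \<le> 1" by (simp add: sgn_real_def)
      then show "(l k)\<^sup>2 \<le> b k" using b(1)[of k] mult_left_mono[of "(sgn (pairing (\<phi> k) (u k)))\<^sup>2" 1 "b k"]
        by (simp add: l_def power_mult_distrib)
    qed
    then show "(\<Sum>k<p. (l k)\<^sup>2) \<le> 1" using b(2) by simp
  qed (use u(4) in auto)
  have "pairing f w = (\<Sum>k<p. b k * \<bar>pairing (\<phi> k) (u k)\<bar>)"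
  proof -
    have "pairing f w = (1 / real (m Q)) * (\<Sum>k<p. l k * pairing (\<phi> k) w)"
      unfolding f_def even by (rule pairing_average)
    also have "(\<Sum>k<p. l k * pairing (\<phi> k) w) = (\<Sum>k<p. real (m Q) * (b k * \<bar>pairing (\<phi> k) (u k)\<bar>))"
    proof (rule sum.cong[OF refl])
      fix k assume k: "k \<in> {..<p}"
      have "pairing (\<phi> k) (\<lambda>i. \<Sum>k<p. sqrt (b k) * u k i) = (\<Sum>i<p. sqrt (b i) * pairing (\<phi> k) (u i))"
        using P_finite(1)[OF u(1)] by (intro pairing_lincomb) auto
      also have "\<dots> = sqrt (b k) * pairing (\<phi> k) (u k)"
      proof (rule disjoint_scalar_sum)
        fix i assume "i \<in> {..<p}" "i \<noteq> k"
        then have "supp (u k) \<inter> supp (u i) = {}" by (intro block_disjoint[OF Tm supu(1)]) auto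
        then have "supp (\<phi> k) \<inter> supp (u i) = {}" using u(5)[of k] by blast
        then show "sqrt (b i) * pairing (\<phi> k) (u i) = 0" by (simp add: pairing_disjoint)
      qed (use k in auto)
      finally have "pairing (\<phi> k) w = real (m Q) * (sqrt (b k) * pairing (\<phi> k) (u k))"
        unfolding w_def pairing_scale by simp
      then have "l k * pairing (\<phi> k) w = real (m Q) * ((sqrt (b k) * sqrt (b k)) * (sgn (pairing (\<phi> k) (u k)) * pairing (\<phi> k) (u k)))"
        by (simp add: l_def mult_ac)
      then show "l k * pairing (\<phi> k) w = real (m Q) * (b k * \<bar>pairing (\<phi> k) (u k)\<bar>)"
      proof -
        have "sqrt (b k) * sqrt (b k) = b k" using b(1) by simp
        moreover have "sgn (pairing (\<phi> k) (u k)) * pairing (\<phi> k) (u k) = \<bar>pairing (\<phi> k) (u k)\<bar>"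
          by (simp add: abs_sgn mult.commute)
        ultimately show ?thesis using \<open>l k * _ = _\<close> by (simp only:)
      qed
    qed
    finally show ?thesis using m_pos[of Q] by (simp flip: sum_distrib_left)
  qed
  also have "\<dots> \<ge> (\<Sum>k<p. b k * (1 / 4))" using u(6) b(1) by (intro sum_mono mult_left_mono) (auto intro: less_imp_le)
  finally have "(\<Sum>k<p. b k) * (1 / 4) \<le> pairing f w" by (simp only: sum_distrib_right)
  then have fw: "1 / 4 \<le> pairing f w" using b(2) by simp
  have N0T: "N0 < T k" for k
  proof -
    have "T 0 \<le> T k" using Tm by (rule monoD) simp
    then show ?thesis using T(1) by (simp add: N'_def)
  qed
  have gtN: "{T k<..T (Suc k)} \<subseteq> {N0<..}" for k using N0T[of k] by auto
  have "supp w \<subseteq> {N0<..}" "supp v \<subseteq> {N0<..}" "supp f \<subseteq> {N0<..}" "supp f \<subseteq> A"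
  proof -
    have "supp w \<subseteq> (\<Union>k<p. supp (u k))" unfolding w_def by (rule subset_trans[OF supp_scale supp_lincomb])
    then show "supp w \<subseteq> {N0<..}" using supu(1) gtN by blast
    have "supp v \<subseteq> (\<Union>k<p. supp (u' k))" unfolding v_def by (rule subset_trans[OF supp_scale supp_lincomb])
    then show "supp v \<subseteq> {N0<..}" using supu(2) gtN by blast
    have sf: "supp f \<subseteq> (\<Union>k<p. supp (\<phi> k))" unfolding f_def by (rule subset_trans[OF supp_scale supp_lincomb])
    then show "supp f \<subseteq> {N0<..}" using sup\<phi> gtN by blast
    show "supp f \<subseteq> A" using sf u(5) P_supp(1)[OF u(1)] by blast
  qed
  then show ?thesis using Pwv f_W fw bds by (intro exI[of _ w] exI[of _ v] exI[of _ f]) simp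
qed

end

subsection \<open>Special sequences\<close>

lemma coded_take:
  assumes s: "s \<in> coded_seqs N1 N2" and i: "1 \<le> i"
  shows "take i s \<in> coded_seqs N1 N2"
proof -
  have s': "s \<noteq> []" "\<forall>(E, k)\<in>set s. E \<noteq> {} \<and> finite E \<and> E \<subseteq> {1..}"
    "sorted_wrt (\<lambda>(E, k) (F, l). E \<inter> F = {} \<and> k < l) s" "snd (hd s) \<in> (\<lambda>j. 2 * j) ` N1"
    "\<forall>(E, k)\<in>set (tl s). k \<in> (\<lambda>j. 2 * j) ` N2" using s by (simp_all add: coded_seqs_def)
  have "set (take i s) \<subseteq> set s" "set (tl (take i s)) \<subseteq> set (tl s)"
    by (simp_all add: set_take_subset tl_take)
  then have "\<forall>(E, k)\<in>set (take i s). E \<noteq> {} \<and> finite E \<and> E \<subseteq> {1..}"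
    "\<forall>(E, k)\<in>set (tl (take i s)). k \<in> (\<lambda>j. 2 * j) ` N2"
    using s'(2,5) by (meson subsetD)+
  moreover have "take i s \<noteq> []" "hd (take i s) = hd s" using s'(1) i by (simp_all add: hd_take)
  ultimately show ?thesis using s'(4) sorted_wrt_take[OF s'(3), of i] unfolding coded_seqs_def by simp
qed

lemma coded_snoc:
  assumes s: "s \<in> coded_seqs N1 N2" and E: "E \<noteq> {}" "finite E" "E \<subseteq> {1..}"
    and new: "\<And>F l. (F, l) \<in> set s \<Longrightarrow> F \<inter> E = {} \<and> l < k" and k: "k \<in> (\<lambda>j. 2 * j) ` N2"
  shows "s @ [(E, k)] \<in> coded_seqs N1 N2"
proof -
  have s': "s \<noteq> []" "\<forall>(E, k)\<in>set s. E \<noteq> {} \<and> finite E \<and> E \<subseteq> {1..}"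
    "sorted_wrt (\<lambda>(E, k) (F, l). E \<inter> F = {} \<and> k < l) s" "snd (hd s) \<in> (\<lambda>j. 2 * j) ` N1"
    "\<forall>(E, k)\<in>set (tl s). k \<in> (\<lambda>j. 2 * j) ` N2" using s by (simp_all add: coded_seqs_def)
  have "sorted_wrt (\<lambda>(E, k) (F, l). E \<inter> F = {} \<and> k < l) (s @ [(E, k)])"
    using s'(3) new by (auto simp: sorted_wrt_append)
  moreover have "\<forall>(E, k)\<in>set (tl (s @ [(E, k)])). k \<in> (\<lambda>j. 2 * j) ` N2"
    using s'(1,5) k by auto
  ultimately show ?thesis using s'(1,2,4) E unfolding coded_seqs_def by simp
qed

lemma coded_singleton:
  "E \<noteq> {} \<Longrightarrow> finite E \<Longrightarrow> E \<subseteq> {1..} \<Longrightarrow> j \<in> N1 \<Longrightarrow> [(E, 2 * j)] \<in> coded_seqs N1 N2"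
  by (simp add: coded_seqs_def)

context wh begin

lemma sigma_props:
  "inj_on \<sigma> (coded_seqs N1 N2)" "s \<in> coded_seqs N1 N2 \<Longrightarrow> \<sigma> s \<in> N2" "N1 \<inter> N2 = {}" "infinite N1"
  "s \<in> coded_seqs N1 N2 \<Longrightarrow> m (snd (last s)) * (Max (fst (last s)))\<^sup>2 < m (2 * \<sigma> s)"
  using par unfolding wh_parameters_def by auto

text \<open>
  A functional of weight \<open>m J\<close> with \<open>J\<close> odd, acting on a vector supported away from the sets
  \<open>E k\<close> of a special sequence, loses the part of its own special sequence that agrees with the given
  one. After the first disagreement the injectivity of \<open>\<sigma>\<close> makes all weights different.
\<close>

lemma special_split:
  assumes W: "W f (m J)" and J: "J = 2 * j + 1" "3 \<le> J"
    and code: "\<And>k. code k = map (\<lambda>i. (E i, q i)) [0..<k]" "\<And>k. 1 \<le> k \<Longrightarrow> code k \<in> coded_seqs N1 N2"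
    and q: "q 0 = 2 * j1" "j1 \<in> N1" "\<And>k. q (Suc k) = 2 * \<sigma> (code (Suc k))" "\<And>k. 2 \<le> q k"
    and y: "\<And>k. supp y \<inter> E k = {}"
  shows "\<exists>I G k0. al (n J) (I :: nat set) G \<and> (\<forall>i\<in>I. supp (G i) \<subseteq> supp f) \<and>
    (pairing f y)\<^sup>2 \<le> (1 / real (m J))\<^sup>2 * (\<Sum>i\<in>I. (pairing (G i) y)\<^sup>2) \<and>
    (\<forall>i\<in>I. \<exists>w. W (G i) w \<and> m (Suc J) \<le> w \<and> (i \<noteq> k0 \<longrightarrow> (\<forall>l. w \<noteq> m (q l))))"
  using W
proof (cases rule: has_weight.cases)
  case (even_average fs j' l)
  \<comment> \<open>\<open>m\<close> is strictly increasing from index 2 on, and index 0 gives the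
    weight 2, below \<open>m J\<close>. So an even index cannot produce the weight
    \<open>m J\<close>.\<close>
  have "m (2 * j') \<noteq> m J"
  proof
    assume eq: "m (2 * j') = m J"
    then have "j' \<noteq> 0" using m_ge_8[OF J(2)] par_simps(3) by (cases j') auto
    then have "2 * j' = J" using J(2) by (intro m_eqD[OF _ _ eq]) auto
    then show False using J(1) by presburger
  qed
  then show ?thesis using even_average(2) by simp
next
  case (odd_average j' s fs l)
  have jj: "j' = j"
  proof -
    have eq: "m (2 * j' + 1) = m J" using odd_average(2) by simp
    then have "j' \<noteq> 0" using m_ge_8[OF J(2)] par_simps(4) by (cases j') auto
    then have "2 * j' + 1 = J" using J(2) by (intro m_eqD[OF _ _ eq]) auto
    then show ?thesis using J(1) by simp
  qed
  have fsl: "length fs = length s" by fact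
  have sp: "special_seq N1 N2 \<sigma> s" "2 * j + 2 < snd (hd s)"
    using odd_average(3) jj by (simp_all add: schreier_special_seq_def)
  have s: "s \<in> coded_seqs N1 N2" "\<And>i. 1 \<le> i \<Longrightarrow> i < length s \<Longrightarrow> snd (s ! i) = 2 * \<sigma> (take i s)"
    using sp(1) by (simp_all add: special_seq_def)
  have s_sorted: "sorted_wrt (\<lambda>(E, k) (F, l). E \<inter> F = {} \<and> k < l) s" "s \<noteq> []"
    using s(1) by (simp_all add: coded_seqs_def)
  have wt_large: "Suc J < snd (s ! i)" if "i < length s" for i
  proof (cases "i = 0")
    case True
    then show ?thesis using sp(2) s_sorted(2) J(1) by (simp add: hd_conv_nth)
  next
    case False
    then have "snd (s ! 0) < snd (s ! i)" using s_sorted(1) that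
      by (auto simp: sorted_wrt_iff_nth_less case_prod_beta)
    then show ?thesis using sp(2) s_sorted(2) J(1) by (simp add: hd_conv_nth)
  qed
  \<comment> \<open>The first disagreement with the given special sequence; \<open>length s\<close>
    is the default when \<open>s\<close> is an initial part of it.\<close>
  define k0 where "k0 = (LEAST i. i = length s \<or> (i < length s \<and> s ! i \<noteq> (E i, q i)))"
  have k0: "k0 = length s \<or> (k0 < length s \<and> s ! k0 \<noteq> (E k0, q k0))"
    unfolding k0_def by (rule LeastI[of _ "length s"]) simp
  have before: "s ! i = (E i, q i)" if "i < k0" "i < length s" for i
  proof (rule ccontr)
    assume "s ! i \<noteq> (E i, q i)"
    then have "k0 \<le> i" unfolding k0_def using that(2) by (intro Least_le) simp
    then show False using that(1) by simp
  qed
  \<comment> \<open>Children before the disagreement are supported in the sets \<open>E i\<close>,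
    which \<open>y\<close> avoids, so they drop out.\<close>
  define I where "I = {i \<in> {..<length fs}. l i \<noteq> 0 \<and> k0 \<le> i}"
  have al: "al (n J) I (\<lambda>i. fs ! i)"
    unfolding J(1) using odd_average jj by (intro special_al[of j s]) (auto simp: I_def intro: weighted)
  have disj: "supp (fs ! i) \<inter> supp (fs ! i') = {}" if "i < length fs" "i' < length fs" "i \<noteq> i'" for i i'
    using special_sets(2)[OF odd_average(3), of i i'] odd_average(5)[of i] odd_average(5)[of i'] odd_average(4) that by auto
  have sub: "supp (fs ! i) \<subseteq> supp f" if "i \<in> I" for i
    unfolding odd_average(1) using that disj m_pos(2)[of "2 * j' + 1"] by (intro average_child_supp) (auto simp: I_def)
  have "(pairing f y)\<^sup>2 \<le> (1 / real (m J))\<^sup>2 * (\<Sum>i\<in>{i \<in> {..<length fs}. l i \<noteq> 0}. (pairing (fs ! i) y)\<^sup>2)"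
    unfolding odd_average(1,2) by (rule average_sq) (rule odd_average)
  also have "(\<Sum>i\<in>{i \<in> {..<length fs}. l i \<noteq> 0}. (pairing (fs ! i) y)\<^sup>2) = (\<Sum>i\<in>I. (pairing (fs ! i) y)\<^sup>2)"
  proof (rule sum.mono_neutral_right)
    show "\<forall>i\<in>{i \<in> {..<length fs}. l i \<noteq> 0} - I. (pairing (fs ! i) y)\<^sup>2 = 0"
    proof
      fix i assume "i \<in> {i \<in> {..<length fs}. l i \<noteq> 0} - I"
      then have i: "i < length s" "i < k0" using fsl by (auto simp: I_def)
      then have "supp (fs ! i) \<subseteq> E i" using odd_average(5)[OF i(1)] before by simp
      then have "supp (fs ! i) \<inter> supp y = {}" using y[of i] by blast
      then show "(pairing (fs ! i) y)\<^sup>2 = 0" by (simp add: pairing_disjoint)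
    qed
  qed (auto simp: I_def)
  finally have le: "(pairing f y)\<^sup>2 \<le> (1 / real (m J))\<^sup>2 * (\<Sum>i\<in>I. (pairing (fs ! i) y)\<^sup>2)" .
  have wts: "W (fs ! i) (m (snd (s ! i))) \<and> m (Suc J) \<le> m (snd (s ! i)) \<and> (i \<noteq> k0 \<longrightarrow> (\<forall>l. m (snd (s ! i)) \<noteq> m (q l)))"
    if i: "i \<in> I" for i
  proof -
    have il: "i < length s" "k0 \<le> i" using i fsl by (auto simp: I_def)
    \<comment> \<open>Equal weights after \<open>k0\<close> mean equal values of \<sigma>, hence
      equal codes and agreement at all earlier places, including \<open>k0\<close>. For
      \<open>l = 0\<close> the index comes from \<open>N1\<close>, where \<sigma> takes no values.
      At \<open>k0\<close> itself the weights may coincide although the sets differ.\<close>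
    have "m (snd (s ! i)) \<noteq> m (q l)" if "i \<noteq> k0" for l
    proof
      assume eq: "m (snd (s ! i)) = m (q l)"
      have ki: "k0 < i" "1 \<le> i" using il(2) that by auto
      have "snd (s ! i) = q l" using wt_large[OF il(1)] J(2) q(4)[of l] by (intro m_eqD[OF _ _ eq]) auto
      then have sql: "2 * \<sigma> (take i s) = q l" using s(2)[OF ki(2) il(1)] by simp
      have ti: "take i s \<in> coded_seqs N1 N2" using s(1) ki(2) by (rule coded_take)
      show False
      proof (cases l)
        case 0
        then have "\<sigma> (take i s) = j1" using sql q(1) by simp
        then show False using sigma_props(2)[OF ti] sigma_props(3) q(2) by blast
      next
        case (Suc l')
        then have "\<sigma> (take i s) = \<sigma> (code l)" using sql q(3)[of l'] by simp
        moreover have "code l \<in> coded_seqs N1 N2" using Suc by (intro code(2)) simp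
        ultimately have tc: "take i s = code l" using inj_onD[OF sigma_props(1)] ti by blast
        then have "length (take i s) = length (code l)" by simp
        then have "i = l" using il(1) by (simp add: code(1))
        then have "s ! k0 = code i ! k0" using tc ki(1) nth_take[of k0 i s] by simp
        then have "s ! k0 = (E k0, q k0)" using ki(1) by (simp add: code(1))
        then show False using k0 ki(1) il(1) by simp
      qed
    qed
    moreover have "m (Suc J) \<le> m (snd (s ! i))" using wt_large[OF il(1)] by (intro monoD[OF par_simps(1)]) simp
    ultimately show ?thesis using odd_average(6)[OF il(1)] by blast
  qed
  have "\<exists>w. W (fs ! i) w \<and> m (Suc J) \<le> w \<and> (i \<noteq> k0 \<longrightarrow> (\<forall>l. w \<noteq> m (q l)))" if "i \<in> I" for i
    using wts[OF that] by (rule exI[of _ "m (snd (s ! i))"])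
  then have w: "\<forall>i\<in>I. \<exists>w. W (fs ! i) w \<and> m (Suc J) \<le> w \<and> (i \<noteq> k0 \<longrightarrow> (\<forall>l. w \<noteq> m (q l)))"
    by (rule ballI)
  have "\<forall>i\<in>I. supp (fs ! i) \<subseteq> supp f" using sub by (rule ballI)
  from al this le w show ?thesis
    by (intro exI[of _ I] exI[of _ "\<lambda>i. fs ! i"] exI[of _ k0] conjI)
qed

text \<open>Each functional has at most one child that may share a weight with the given sequence.
  These exceptional children form a family of the original order \<open>M\<close>, within reach of
  the special convex combination (\<open>fam1\<close>). All others form a family of order
  \<open>M + n J\<close>, which is treated by the fact that its weights avoid every
  \<open>m (q l)\<close> (\<open>fam2\<close>).\<close>

lemma special_family_bound:
  fixes I :: "'i set"
  assumes al: "al M I f" and W: "\<And>i. i \<in> I \<Longrightarrow> W (f i) (m J)" and J: "J = 2 * j + 1" "3 \<le> J"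
    and code: "\<And>k. code k = map (\<lambda>i. (E i, q i)) [0..<k]" "\<And>k. 1 \<le> k \<Longrightarrow> code k \<in> coded_seqs N1 N2"
    and q: "q 0 = 2 * j1" "j1 \<in> N1" "\<And>k. q (Suc k) = 2 * \<sigma> (code (Suc k))" "\<And>k. 2 \<le> q k"
    and y: "\<And>k. supp y \<inter> E k = {}"
    and fam1: "\<And>(X :: 'i set) G wt. al M X G \<Longrightarrow> (\<And>i. i \<in> X \<Longrightarrow> W (G i) (wt i) \<and> m (Suc J) \<le> wt i) \<Longrightarrow> (\<Sum>i\<in>X. (pairing (G i) y)\<^sup>2) \<le> a"
    and fam2: "\<And>(X :: ('i \<times> nat) set) G wt. al (M + n J) X G \<Longrightarrow>
      (\<And>i. i \<in> X \<Longrightarrow> W (G i) (wt i) \<and> m (Suc J) \<le> wt i \<and> (\<forall>l. wt i \<noteq> m (q l))) \<Longrightarrow> (\<Sum>i\<in>X. (pairing (G i) y)\<^sup>2) \<le> c"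
  shows "(\<Sum>i\<in>I. (pairing (f i) y)\<^sup>2) \<le> (1 / real (m J))\<^sup>2 * (a + c)"
proof -
  define \<Phi> where "\<Phi> i X G k0 wt \<longleftrightarrow> al (n J) (X :: nat set) G \<and> (\<forall>k\<in>X. supp (G k) \<subseteq> supp (f i)) \<and>
    (pairing (f i) y)\<^sup>2 \<le> (1 / real (m J))\<^sup>2 * (\<Sum>k\<in>X. (pairing (G k) y)\<^sup>2) \<and>
    (\<forall>k\<in>X. W (G k) (wt k) \<and> m (Suc J) \<le> wt k \<and> (k \<noteq> k0 \<longrightarrow> (\<forall>l. wt k \<noteq> m (q l))))" for i X G k0 wt
  have "\<forall>i\<in>I. \<exists>X G k0 wt. \<Phi> i X G k0 wt"
  proof
    fix i assume "i \<in> I"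
    from special_split[OF W[OF this] J code q y] obtain X :: "nat set" and G k0 where
      X: "al (n J) X G" "\<forall>k\<in>X. supp (G k) \<subseteq> supp (f i)"
      "(pairing (f i) y)\<^sup>2 \<le> (1 / real (m J))\<^sup>2 * (\<Sum>k\<in>X. (pairing (G k) y)\<^sup>2)"
      "\<forall>k\<in>X. \<exists>w. W (G k) w \<and> m (Suc J) \<le> w \<and> (k \<noteq> k0 \<longrightarrow> (\<forall>l. w \<noteq> m (q l)))" by blast
    from bchoice[OF X(4)] obtain wt where "\<forall>k\<in>X. W (G k) (wt k) \<and> m (Suc J) \<le> wt k \<and> (k \<noteq> k0 \<longrightarrow> (\<forall>l. wt k \<noteq> m (q l)))" by blast
    then have "\<Phi> i X G k0 wt" using X(1,2,3) unfolding \<Phi>_def by blast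
    then show "\<exists>X G k0 wt. \<Phi> i X G k0 wt" by blast
  qed
  from bchoice[OF this] obtain X where "\<forall>i\<in>I. \<exists>G k0 wt. \<Phi> i (X i) G k0 wt" by blast
  from bchoice[OF this] obtain G where "\<forall>i\<in>I. \<exists>k0 wt. \<Phi> i (X i) (G i) k0 wt" by blast
  from bchoice[OF this] obtain k0 where "\<forall>i\<in>I. \<exists>wt. \<Phi> i (X i) (G i) (k0 i) wt" by blast
  from bchoice[OF this] obtain wt where \<Phi>: "\<forall>i\<in>I. \<Phi> i (X i) (G i) (k0 i) (wt i)" by blast
  have X: "al (n J) (X i) (G i)" "k \<in> X i \<Longrightarrow> supp (G i k) \<subseteq> supp (f i)"
    "(pairing (f i) y)\<^sup>2 \<le> (1 / real (m J))\<^sup>2 * (\<Sum>k\<in>X i. (pairing (G i k) y)\<^sup>2)"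
    "k \<in> X i \<Longrightarrow> W (G i k) (wt i k) \<and> m (Suc J) \<le> wt i k \<and> (k \<noteq> k0 i \<longrightarrow> (\<forall>l. wt i k \<noteq> m (q l)))"
    if "i \<in> I" for i k
    using bspec[OF \<Phi> that] by (simp_all add: \<Phi>_def)
  have finI: "finite I" and finX: "finite (X i)" if "i \<in> I" for i using alD(1)[OF al] alD(1)[OF X(1)] that by auto
  define I1 where "I1 = {i \<in> I. k0 i \<in> X i}"
  define X2 where "X2 i = X i - {k0 i}" for i
  have s1: "(\<Sum>i\<in>I1. (pairing (G i (k0 i)) y)\<^sup>2) \<le> a"
  proof (rule fam1)
    have "D (G i (k0 i)) \<and> supp (G i (k0 i)) \<subseteq> supp (f i)" if "i \<in> I1" for i
      using alD(2)[OF X(1), of i "k0 i"] X(2)[of i "k0 i"] that by (simp add: I1_def)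
    then show "al M I1 (\<lambda>i. G i (k0 i))" by (intro al_sub[OF al]) (auto simp: I1_def)
    show "W (G i (k0 i)) (wt i (k0 i)) \<and> m (Suc J) \<le> wt i (k0 i)" if "i \<in> I1" for i
      using that X(4)[of i "k0 i"] by (simp add: I1_def)
  qed
  have "al (M + n J) (Sigma I X2) (\<lambda>(i, k). G i k)"
  proof (rule al_Sigma[OF al])
    show "al (n J) (X2 i) (G i)" if "i \<in> I" for i by (rule al_subset[OF X(1)[OF that]]) (auto simp: X2_def)
    show "supp (G i k) \<subseteq> supp (f i)" if "i \<in> I" "k \<in> X2 i" for i k using X(2) that by (simp add: X2_def)
  qed
  then have s2': "(\<Sum>p\<in>Sigma I X2. (pairing (case p of (i, k) \<Rightarrow> G i k) y)\<^sup>2) \<le> c"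
  proof (rule fam2)
    fix p assume "p \<in> Sigma I X2"
    then obtain i k where p: "p = (i, k)" "i \<in> I" "k \<in> X i" "k \<noteq> k0 i" by (auto simp: X2_def)
    then show "W (case p of (i, k) \<Rightarrow> G i k) ((\<lambda>(i, k). wt i k) p) \<and> m (Suc J) \<le> (\<lambda>(i, k). wt i k) p \<and> (\<forall>l. (\<lambda>(i, k). wt i k) p \<noteq> m (q l))"
      using X(4)[OF p(2,3)] by simp
  qed
  have s2: "(\<Sum>i\<in>I. \<Sum>k\<in>X2 i. (pairing (G i k) y)\<^sup>2) \<le> c"
  proof -
    have "(\<Sum>i\<in>I. \<Sum>k\<in>X2 i. (pairing (G i k) y)\<^sup>2) = (\<Sum>(i, k)\<in>Sigma I X2. (pairing (G i k) y)\<^sup>2)"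
      using alD(1)[OF al] finX by (intro sum.Sigma) (auto simp: X2_def)
    also have "\<dots> = (\<Sum>p\<in>Sigma I X2. (pairing (case p of (i, k) \<Rightarrow> G i k) y)\<^sup>2)" by (rule sum.cong) auto
    finally show ?thesis using s2' by simp
  qed
  have split: "(\<Sum>k\<in>X i. (pairing (G i k) y)\<^sup>2) = (if k0 i \<in> X i then (pairing (G i (k0 i)) y)\<^sup>2 else 0) + (\<Sum>k\<in>X2 i. (pairing (G i k) y)\<^sup>2)"
    if "i \<in> I" for i
  proof (cases "k0 i \<in> X i")
    case True
    then show ?thesis using sum.remove[OF finX[OF that] True] by (simp add: X2_def)
  next
    case False
    then show ?thesis by (simp add: X2_def)
  qed
  have "(\<Sum>i\<in>I. (pairing (f i) y)\<^sup>2) \<le> (\<Sum>i\<in>I. (1 / real (m J))\<^sup>2 * (\<Sum>k\<in>X i. (pairing (G i k) y)\<^sup>2))"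
    using X(3) by (rule sum_mono)
  also have "\<dots> = (1 / real (m J))\<^sup>2 * (\<Sum>i\<in>I. \<Sum>k\<in>X i. (pairing (G i k) y)\<^sup>2)" by (simp add: sum_distrib_left)
  also have "(\<Sum>i\<in>I. \<Sum>k\<in>X i. (pairing (G i k) y)\<^sup>2)
      = (\<Sum>i\<in>I. (if k0 i \<in> X i then (pairing (G i (k0 i)) y)\<^sup>2 else 0) + (\<Sum>k\<in>X2 i. (pairing (G i k) y)\<^sup>2))"
    by (rule sum.cong[OF refl split])
  also have "\<dots> = (\<Sum>i\<in>I1. (pairing (G i (k0 i)) y)\<^sup>2) + (\<Sum>i\<in>I. \<Sum>k\<in>X2 i. (pairing (G i k) y)\<^sup>2)"
    using alD(1)[OF al] by (simp add: sum.distrib I1_def sum.inter_filter)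
  also have "(1 / real (m J))\<^sup>2 * \<dots> \<le> (1 / real (m J))\<^sup>2 * (a + c)" using s1 s2 by (intro mult_left_mono add_mono) auto
  finally show ?thesis .
qed

end

context wh_pair begin

lemma A_unbounded: "\<exists>a\<in>A. N < a"
proof -
  obtain x y i where "P x y" "x i \<noteq> 0" "supp x \<union> supp y \<subseteq> {N<..}" using P_tail by blast
  then show ?thesis using P_supp(1)[of x y] by (intro bexI[of _ i]) (auto simp: supp_def)
qed

text \<open>
  The extra point \<open>a\<close> is put into the coding
  set; as the weight of the next functional exceeds \<open>a\<close>, this makes the next index as large as needed.
\<close>

definition block_step :: "real \<Rightarrow> nat \<Rightarrow> nat \<Rightarrow> (nat \<Rightarrow> real) \<times> (nat \<Rightarrow> real) \<times> (nat \<Rightarrow> real) \<times> nat \<Rightarrow> bool" where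
  "block_step \<kappa> N Q r = (case r of (z, v, f, a) \<Rightarrow> P z v \<and> supp z \<union> supp v \<union> supp f \<subseteq> {N<..} \<and> supp f \<subseteq> A \<and>
    W f (m Q) \<and> 1 / 4 \<le> pairing f z \<and> bd (\<lambda>_. True) (3 * n (Q - 1)) v CP \<and>
    bd (\<lambda>f. \<exists>w>m Q. W f w) (3 * n (Q - 1)) v (CP / real (m Q) ^ 4) \<and>
    a \<in> A \<and> N < a \<and> (\<forall>i\<in>supp z \<union> supp v \<union> supp f. 2 * i \<le> a) \<and> l1 v \<le> \<kappa> * real a)"

lemma block_step_exists:
  assumes "3 \<le> Q" "even Q" "0 < \<kappa>"
  shows "\<exists>r. block_step \<kappa> N Q r"
proof -
  obtain j where j: "Q = 2 * j" using assms(2) by (elim evenE)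
  obtain z v f where zvf: "P z v" "supp z \<union> supp v \<union> supp f \<subseteq> {N<..}" "supp f \<subseteq> A" "W f (m Q)" "1 / 4 \<le> pairing f z"
    "bd (\<lambda>_. True) (3 * n (Q - 1)) v CP" "bd (\<lambda>f. \<exists>w>m Q. W f w) (3 * n (Q - 1)) v (CP / real (m Q) ^ 4)"
    using exact_pair_exists[OF assms(1) j] by blast
  define S where "S = insert 0 (supp z \<union> supp v \<union> supp f)"
  have finS: "finite S" using P_finite[OF zvf(1)] D_supp(1)[OF weighted[OF zvf(4)]] by (simp add: S_def)
  obtain a where a: "a \<in> A" "N + 2 * Max S + nat \<lceil>l1 v / \<kappa>\<rceil> < a" using A_unbounded by blast
  have "2 * i \<le> a" if "i \<in> supp z \<union> supp v \<union> supp f" for i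
  proof -
    have "i \<le> Max S" using finS that by (intro Max_ge) (auto simp: S_def)
    then show ?thesis using a(2) by simp
  qed
  moreover have "l1 v \<le> \<kappa> * real a"
  proof -
    have "l1 v / \<kappa> \<le> real (nat \<lceil>l1 v / \<kappa>\<rceil>)" by (rule real_nat_ceiling_ge)
    also have "nat \<lceil>l1 v / \<kappa>\<rceil> \<le> a" using a(2) by linarith
    finally show ?thesis using assms(3) by (simp add: field_simps)
  qed
  ultimately have "block_step \<kappa> N Q (z, v, f, a)" unfolding block_step_def using zvf a by simp
  then show ?thesis by blast
qed

lemma no_disjoint_equivalent_blocks: False
proof -
  \<comment> \<open>Comes from the last comparison: 304 is 16 * 19, with 16 the square of the 4 in
    the lower estimate of \<open>x\<close> and 19 the factor in the upper estimate of
    \<open>y\<close>.\<close>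
  obtain j' where j': "2 \<le> j'" "304 * K\<^sup>2 * CP + 1 \<le> real (m j')" using m_unbounded by blast
  define j where "j = j'"
  define J where "J = 2 * j + 1"
  have J: "J = 2 * j + 1" "3 \<le> J" using j'(1) by (simp_all add: J_def j_def)
  define \<mu> where "\<mu> = real (m J)"
  have \<mu>8: "8 \<le> \<mu>" using m_ge_8[OF J(2)] by (simp add: \<mu>_def)
  have "m j' \<le> m J" by (rule monoD[OF par_simps(1)]) (simp add: J_def j_def)
  then have \<mu>big: "304 * K\<^sup>2 * CP < \<mu>" using j'(2) by (simp add: \<mu>_def)
  \<comment> \<open>Room for \<open>2 * lg J\<close> rounds, which divide by at least
    \<open>\<mu> ^ 4\<close>, the size aimed at for the squares on \<open>y\<close>.\<close>
  define M where "M = 2 * lg J * n (J - 1)"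
  have "Suc M \<le> (2 * lg J + 1) * (n (J - 1) + 1)" by (simp add: M_def algebra_simps)
  then have MJ: "Suc M \<le> n J" using n_growth(2)[OF J(2)] by linarith
  define \<kappa> where "\<kappa> = 1 / \<mu>\<^sup>2"
  have \<kappa>: "0 < \<kappa>" using \<mu>8 by (simp add: \<kappa>_def)
  obtain c where c: "c > 0" and scc: "\<And>\<tau>. (\<forall>k. 2 * \<tau> k \<le> \<tau> (Suc k)) \<and> 1 \<le> \<tau> 0 \<Longrightarrow> \<exists>p b. scc M \<tau> p b (c / real (\<tau> 0))"
    using scc_exists[of M] by blast
  \<comment> \<open>Gives \<open>2 * j1 > 2 * j + 2\<close>, the condition on the first index of a
    special sequence of order \<open>2 * j + 1\<close>; all later indices are larger still.\<close>
  obtain j1 where j1: "j1 \<in> N1" "j + 1 < j1"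
    using sigma_props(4) unfolding infinite_nat_iff_unbounded by blast

  \<comment> \<open>Recursive construction of the special sequence\<close>
  define N' where "N' = Suc (nat \<lceil>c * \<mu> ^ 4\<rceil>)"
  define Z where "Z N Q = (SOME r. block_step \<kappa> N Q r)" for N Q
  have Z: "block_step \<kappa> N Q (Z N Q)" if "3 \<le> Q" "even Q" for N Q
    unfolding Z_def using block_step_exists[OF that \<kappa>] by (rule someI_ex)
  define pr where "pr r = (case r of ((z, v, f, a), Q) \<Rightarrow> (insert a (supp f), Q))"
    for r :: "((nat \<Rightarrow> real) \<times> (nat \<Rightarrow> real) \<times> (nat \<Rightarrow> real) \<times> nat) \<times> nat"
  \<comment> \<open>The next index depends through \<sigma> on the whole code built so far, so the
    recursion runs over the list of all earlier choices.\<close>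
  define nxt where "nxt L = (let Q = (if L = [] then 2 * j1 else 2 * \<sigma> (map pr L));
      N = (if L = [] then N' else snd (snd (snd (fst (last L))))) in (Z N Q, Q))" for L
  define LL where "LL k = ((\<lambda>L. L @ [nxt L]) ^^ k) []" for k
  define wd where "wd k = nxt (LL k)" for k
  have LL: "LL k = map wd [0..<k]" for k
    by (induction k) (simp_all add: LL_def wd_def)
  define q where "q k = snd (wd k)" for k
  define z where "z k = fst (fst (wd k))" for k
  define v where "v k = fst (snd (fst (wd k)))" for k
  define f where "f k = fst (snd (snd (fst (wd k))))" for k
  define a where "a k = snd (snd (snd (fst (wd k))))" for k
  define E where "E k = insert (a k) (supp (f k))" for k
  define T where "T k = (case k of 0 \<Rightarrow> N' | Suc i \<Rightarrow> a i)" for k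
  have wd: "wd k = ((z k, v k, f k, a k), q k)" for k by (simp add: q_def z_def v_def f_def a_def)
  define code where "code k = map (\<lambda>i. (E i, q i)) [0..<k]" for k
  have code_LL: "map pr (LL k) = code k" for k by (simp add: LL code_def pr_def wd E_def)
  have q0: "q 0 = 2 * j1" by (simp add: q_def wd_def LL nxt_def Let_def)
  have qS: "q (Suc k) = 2 * \<sigma> (code (Suc k))" for k
    unfolding code_LL[symmetric] by (simp add: q_def wd_def LL nxt_def Let_def)
  have fst_wd: "(z k, v k, f k, a k) = Z (T k) (q k)" for k
  proof (cases k)
    case 0
    have "fst (wd 0) = Z N' (2 * j1)" by (simp add: wd_def LL nxt_def Let_def)
    then have "fst (wd 0) = Z (T 0) (q 0)" by (simp add: T_def q0)
    then show ?thesis using 0 by (simp add: wd[of 0])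
  next
    case (Suc i)
    have "last (LL k) = wd i" by (simp add: LL Suc)
    then have "fst (wd k) = Z (a i) (q k)" using Suc by (simp add: wd_def LL nxt_def Let_def q_def a_def)
    then show ?thesis using wd[of k] Suc by (simp add: T_def)
  qed
  \<comment> \<open>A step is meaningful only if its index is even and at least 3. That the indices
    stay in this range follows from the growth of \<sigma> along the earlier steps, so both are
    proved in one induction, together with the validity of the code.\<close>
  define good where "good k \<longleftrightarrow> block_step \<kappa> (T k) (q k) (z k, v k, f k, a k) \<and> 3 \<le> q k" for k
  have step: "block_step \<kappa> (T k) (q k) (z k, v k, f k, a k)" if "3 \<le> q k" "even (q k)" for k
    unfolding fst_wd by (rule Z[OF that])
  have TS: "T (Suc k) = a k" for k by (simp add: T_def)
  have goodD: "P (z k) (v k)" "supp (z k) \<subseteq> {T k<..T (Suc k)}" "supp (v k) \<subseteq> {T k<..T (Suc k)}" "supp (f k) \<subseteq> {T k<..T (Suc k)}"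
    "supp (f k) \<subseteq> A" "W (f k) (m (q k))" "1 / 4 \<le> pairing (f k) (z k)" "bd (\<lambda>_. True) (3 * n (q k - 1)) (v k) CP"
    "bd (\<lambda>f. \<exists>w>m (q k). W f w) (3 * n (q k - 1)) (v k) (CP / real (m (q k)) ^ 4)" "a k \<in> A" "T k < a k"
    "i \<in> supp (f k) \<Longrightarrow> 2 * i \<le> a k" "l1 (v k) \<le> \<kappa> * real (a k)"
    "E k \<noteq> {}" "finite (E k)" "E k \<subseteq> {T k<..T (Suc k)}" "E k \<subseteq> {1..}" "Max (E k) = a k" if g: "good k" for k i
  proof -
    have s: "P (z k) (v k)" "supp (z k) \<union> supp (v k) \<union> supp (f k) \<subseteq> {T k<..}" "supp (f k) \<subseteq> A" "W (f k) (m (q k))"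
      "1 / 4 \<le> pairing (f k) (z k)" "bd (\<lambda>_. True) (3 * n (q k - 1)) (v k) CP"
      "bd (\<lambda>f. \<exists>w>m (q k). W f w) (3 * n (q k - 1)) (v k) (CP / real (m (q k)) ^ 4)" "a k \<in> A" "T k < a k"
      "\<forall>i\<in>supp (z k) \<union> supp (v k) \<union> supp (f k). 2 * i \<le> a k" "l1 (v k) \<le> \<kappa> * real (a k)"
      using g by (simp_all add: good_def block_step_def)
    have inT: "supp (z k) \<union> supp (v k) \<union> supp (f k) \<subseteq> {T k<..a k}"
    proof
      fix i assume i: "i \<in> supp (z k) \<union> supp (v k) \<union> supp (f k)"
      have "2 * i \<le> a k" using s(10) i by (rule bspec)
      then show "i \<in> {T k<..a k}" using subsetD[OF s(2) i] by simp
    qed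
    show "P (z k) (v k)" "supp (f k) \<subseteq> A" "W (f k) (m (q k))" "1 / 4 \<le> pairing (f k) (z k)" "bd (\<lambda>_. True) (3 * n (q k - 1)) (v k) CP"
      "bd (\<lambda>f. \<exists>w>m (q k). W f w) (3 * n (q k - 1)) (v k) (CP / real (m (q k)) ^ 4)" "a k \<in> A" "T k < a k" "l1 (v k) \<le> \<kappa> * real (a k)"
      using s by simp_all
    show "supp (z k) \<subseteq> {T k<..T (Suc k)}" "supp (v k) \<subseteq> {T k<..T (Suc k)}" "supp (f k) \<subseteq> {T k<..T (Suc k)}"
      using inT unfolding TS by simp_all
    show "i \<in> supp (f k) \<Longrightarrow> 2 * i \<le> a k" using s(10) by simp
    show "E k \<noteq> {}" by (simp add: E_def)
    show fin: "finite (E k)" using D_supp(1)[OF weighted[OF s(4)]] by (simp add: E_def)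
    show ET: "E k \<subseteq> {T k<..T (Suc k)}" using inT s(9) unfolding TS E_def by simp
    show "E k \<subseteq> {1..}" using ET by fastforce
    show "Max (E k) = a k" by (rule Max_eqI[OF fin]) (use ET in \<open>auto simp: TS E_def\<close>)
  qed
  have inv: "(\<forall>i\<le>k. good i) \<and> (\<forall>i<k. q i < q (Suc i)) \<and> code (Suc k) \<in> coded_seqs N1 N2" for k
  proof (induction k)
    case 0
    have "good 0" unfolding good_def using j1(2) by (intro conjI step) (simp_all add: q0)
    moreover have "code (Suc 0) \<in> coded_seqs N1 N2"
      using coded_singleton[OF goodD(14,15,17)[OF \<open>good 0\<close>] j1(1)] by (simp add: code_def q0)
    ultimately show ?case by simp
  next
    case (Suc k)
    then have IH: "\<And>i. i \<le> k \<Longrightarrow> good i" "\<And>i. i < k \<Longrightarrow> q i < q (Suc i)" "code (Suc k) \<in> coded_seqs N1 N2" by auto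
    have "last (code (Suc k)) = (E k, q k)" by (simp add: code_def)
    then have "m (q k) * (a k)\<^sup>2 < m (q (Suc k))"
      using sigma_props(5)[OF IH(3)] goodD(18)[OF IH(1)[of k]] by (simp add: qS)
    moreover have "1 \<le> a k" using goodD(11)[OF IH(1)[of k]] by simp
    then have "m (q k) * 1 \<le> m (q k) * (a k)\<^sup>2" by (intro mult_le_mono2) simp
    ultimately have "m (q k) < m (q (Suc k))" by linarith
    then have qk: "q k < q (Suc k)" using monoD[OF par_simps(1), of "q (Suc k)" "q k"] by (meson not_le)
    have "3 \<le> q k" using IH(1)[of k] by (simp add: good_def)
    then have gS: "good (Suc k)" unfolding good_def using qk by (intro conjI step) (simp_all add: qS)
    have qle: "q i \<le> q k" if "i \<le> k" for i
      using that by (induction rule: inc_induct) (use IH(2) in \<open>auto intro: order_trans[OF less_imp_le]\<close>)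
    have TT: "T (Suc i) \<le> T (Suc k)" if "i \<le> k" for i
      using that
    proof (induction rule: inc_induct)
      case (step i)
      have "T (Suc i) < a (Suc i)" using step by (intro goodD(11) IH(1)) simp
      then show ?case using step TS[of "Suc i"] by simp
    qed simp
    have "code (Suc (Suc k)) = code (Suc k) @ [(E (Suc k), q (Suc k))]" by (simp add: code_def)
    also have "\<dots> \<in> coded_seqs N1 N2"
    proof (rule coded_snoc[OF IH(3) goodD(14,15,17)[OF gS]])
      fix F l assume "(F, l) \<in> set (code (Suc k))"
      then have "\<exists>i\<le>k. F = E i \<and> l = q i" by (auto simp: code_def less_Suc_eq_le simp del: upt_Suc)
      then obtain i where i: "i \<le> k" "F = E i" "l = q i" by blast
      have "E i \<subseteq> {..T (Suc k)}" using goodD(16)[OF IH(1)[OF i(1)]] TT[OF i(1)] by fastforce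
      then have "F \<inter> E (Suc k) = {}" using goodD(16)[OF gS] i(2) by fastforce
      then show "F \<inter> E (Suc k) = {} \<and> l < q (Suc k)" using qle[OF i(1)] qk i(3) by simp
    qed (use sigma_props(2)[OF IH(3)] qS in auto)
    finally show ?case using IH gS qk by (auto simp: le_Suc_eq less_Suc_eq)
  qed
  have good: "good k" for k using inv[of k] by blast
  note G = goodD[OF good]
  have code_in: "code k \<in> coded_seqs N1 N2" if "1 \<le> k" for k using inv[of "k - 1"] that by simp
  have qmono: "mono q" using inv by (intro mono_iff_le_Suc[THEN iffD2] allI) (meson lessI less_imp_le)
  have Tm: "mono T" unfolding mono_iff_le_Suc using G(11) TS by (simp add: less_imp_le)
  have qJ: "Suc J < q k" for k
  proof -
    have "q 0 \<le> q k" using qmono by (rule monoD) simp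
    then show ?thesis using j1(2) by (simp add: q0 J_def)
  qed
  have nq: "n J \<le> n (q k - 1)" for k using qJ[of k] by (intro monoD[OF par_simps(2)]) simp
  have ris: "ris T q v M CP \<kappa>"
    unfolding ris_def
  proof (intro conjI allI)
    show "bd (\<lambda>_. True) (M + n (q k - 1)) (v k) CP" for k
      using nq[of k] MJ by (intro bd_mono[OF G(8)[of k]]) auto
    show "l1 (v k) \<le> \<kappa> * real (m (q (Suc k)))" for k
    proof -
      have "last (code (Suc k)) = (E k, q k)" by (simp add: code_def)
      then have gr: "m (q k) * (a k)\<^sup>2 < m (q (Suc k))"
        using sigma_props(5)[OF code_in[of "Suc k"]] G(18)[of k] by (simp add: qS)
      have "1 \<le> a k * m (q k)" using G(11)[of k] m_ge_2[of "q k"] by (simp add: Suc_le_eq)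
      then have "a k * 1 \<le> a k * (a k * m (q k))" by (rule mult_le_mono2)
      also have "a k * (a k * m (q k)) = m (q k) * (a k)\<^sup>2" by (simp add: power2_eq_square mult_ac)
      also note gr
      finally have "a k \<le> m (q (Suc k))" by simp
      then have "\<kappa> * real (a k) \<le> \<kappa> * real (m (q (Suc k)))" using \<kappa> by (intro mult_left_mono) auto
      then show ?thesis using G(13)[of k] by linarith
    qed
  qed (use Tm qmono G(3) \<kappa> CP(3) in auto)
  define \<tau> where "\<tau> k = Min (supp (f k))" for k
  have fne: "supp (f k) \<noteq> {}" for k using G(7)[of k] pairing_disjoint[of "f k" "z k"] by auto
  have Df: "D (f k)" for k by (rule weighted[OF G(6)])
  have \<tau>in: "\<tau> k \<in> supp (f k)" for k unfolding \<tau>_def using fne D_supp(1)[OF Df] by simp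
  have \<tau>T: "T k < \<tau> k" "2 * \<tau> k \<le> T (Suc k)" for k
    using \<tau>in[of k] subsetD[OF G(4) \<tau>in[of k]] G(12)[OF \<tau>in[of k]] by (auto simp: TS)
  have dbl: "2 * \<tau> k \<le> \<tau> (Suc k)" for k using \<tau>T(2)[of k] \<tau>T(1)[of "Suc k"] by simp
  have "T 0 = N'" by (simp add: T_def)
  then have \<tau>0: "N' < \<tau> 0" using \<tau>T(1)[of 0] by simp
  then obtain p b where pb: "scc M \<tau> p b (c / real (\<tau> 0))" using scc[of \<tau>] dbl by auto
  have b: "0 \<le> b k" "(\<Sum>k<p. b k) = 1" for k using sccD(1,2)[OF pb] by auto
  have p0: "p \<noteq> 0"
  proof
    assume "p = 0"
    then show False using b(2) by simp
  qed
  define \<epsilon> where "\<epsilon> = c / real (\<tau> 0)"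
  have \<epsilon>: "\<epsilon> \<le> 1 / \<mu> ^ 4" unfolding \<epsilon>_def
  proof (rule ceiling_scc_small[OF c])
    have "nat \<lceil>c * \<mu> ^ 4\<rceil> \<le> \<tau> 0" using \<tau>0 unfolding N'_def by linarith
    then show "real (nat \<lceil>c * \<mu> ^ 4\<rceil>) \<le> real (\<tau> 0)" by (simp only: of_nat_le_iff)
  qed (use \<tau>0 \<mu>8 in auto)
  define x where "x = (\<lambda>i. \<Sum>k<p. sqrt (b k) * z k i)"
  define y where "y = (\<lambda>i. \<Sum>k<p. sqrt (b k) * v k i)"
  have Pxy: "P x y" unfolding x_def y_def using G(1) by (rule P_comb)

  \<comment> \<open>Lower estimate for \<open>x\<close> by a special functional\<close>
  have lower: "1 / (4 * \<mu>) \<le> nrm x"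
  proof -
    define fs where "fs = map f [0..<p]"
    define F where "F = (\<lambda>i. (1 / real (m (2 * j + 1))) * (\<Sum>k<length fs. sqrt (b k) * (fs ! k) i))"
    have "W F (m (2 * j + 1))" unfolding F_def
    proof (rule odd_average[where s = "code p"])
      have "(\<lambda>(E, k). Min E) ` set (code p) = \<tau> ` {..<p}"
      proof -
        \<comment> \<open>The extra point leaves the minimum unchanged, because it is at least twice
          every point of the support.\<close>
        have "Min (E k) = \<tau> k" for k
        proof (rule Min_eqI[OF G(15)])
          show "\<tau> k \<in> E k" using \<tau>in by (simp add: E_def)
          fix i assume "i \<in> E k"
          then consider "i = a k" | "i \<in> supp (f k)" by (auto simp: E_def)
          then show "\<tau> k \<le> i"
          proof cases
            case 1
            then show ?thesis using G(12)[OF \<tau>in[of k]] by simp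
          next
            case 2
            then show ?thesis unfolding \<tau>_def using D_supp(1)[OF Df] by (intro Min_le)
          qed
        qed
        then show ?thesis by (simp add: code_def image_image atLeast0LessThan)
      qed
      moreover have "\<tau> ` {..<p} \<in> schreier (n (2 * j + 1))"
        using sccD(3)[OF pb] MJ unfolding J(1) by (rule schreier_mono)
      moreover have "snd (hd (code p)) = q 0" using p0 by (simp add: code_def hd_map)
      moreover have "special_seq N1 N2 \<sigma> (code p)"
      proof -
        have "snd (code p ! i) = 2 * \<sigma> (take i (code p))" if "1 \<le> i" "i < p" for i
        proof -
          have "take i (code p) = code i" using that by (simp add: code_def take_map)
          then show ?thesis using that qS[of "i - 1"] by (simp add: code_def)
        qed
        then show ?thesis using code_in[of p] p0 by (simp add: special_seq_def code_def)
      qed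
      ultimately show "schreier_special_seq n N1 N2 \<sigma> j (code p)"
        using qJ[of 0] by (simp add: schreier_special_seq_def J_def)
      show "length fs = length (code p)" by (simp add: fs_def code_def)
      show "supp (fs ! i) \<subseteq> fst (code p ! i)" if "i < length (code p)" for i
        using that by (auto simp: fs_def code_def E_def)
      show "W (fs ! i) (m (snd (code p ! i)))" if "i < length (code p)" for i
        using that G(6)[of i] by (simp add: fs_def code_def)
      show "(\<Sum>i<length fs. (sqrt (b i))\<^sup>2) \<le> 1" using b by (simp add: fs_def)
    qed
    then have "pairing F x \<le> nrm x" by (intro pairing_le_nrm weighted)
    moreover have "pairing F x = (1 / \<mu>) * (\<Sum>k<p. b k * pairing (f k) (z k))"
    proof -
      have "pairing F x = (1 / \<mu>) * (\<Sum>k<length fs. sqrt (b k) * pairing (fs ! k) x)"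
        unfolding F_def \<mu>_def J(1) by (rule pairing_average)
      also have "(\<Sum>k<length fs. sqrt (b k) * pairing (fs ! k) x) = (\<Sum>k<p. b k * pairing (f k) (z k))"
      proof (rule sum.cong)
        fix k assume k: "k \<in> {..<p}"
        have "pairing (f k) x = (\<Sum>i<p. sqrt (b i) * pairing (f k) (z i))"
          unfolding x_def using P_finite(1)[OF G(1)] by (intro pairing_lincomb) auto
        also have "\<dots> = sqrt (b k) * pairing (f k) (z k)"
        proof (rule disjoint_scalar_sum)
          fix i assume "i \<in> {..<p}" "i \<noteq> k"
          then have "supp (f k) \<inter> supp (z i) = {}"
            using block_disjoint[OF Tm, of "\<lambda>l. if l = k then f k else z l" k i] G(2,4) by auto
          then show "sqrt (b i) * pairing (f k) (z i) = 0" by (simp add: pairing_disjoint)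
        qed (use k in auto)
        finally have "sqrt (b k) * pairing (f k) x = (sqrt (b k) * sqrt (b k)) * pairing (f k) (z k)" by simp
        moreover have "sqrt (b k) * sqrt (b k) = b k" using b(1) by simp
        ultimately show "sqrt (b k) * pairing (fs ! k) x = b k * pairing (f k) (z k)"
          using k by (simp add: fs_def)
      qed (simp add: fs_def)
      finally show ?thesis .
    qed
    moreover have "(\<Sum>k<p. b k * (1 / 4)) \<le> (\<Sum>k<p. b k * pairing (f k) (z k))"
      using G(7) b(1) by (intro sum_mono mult_left_mono) auto
    then have "1 / 4 \<le> (\<Sum>k<p. b k * pairing (f k) (z k))" using b(2) by (simp flip: sum_divide_distrib)
    then have "(1 / \<mu>) * (1 / 4) \<le> (1 / \<mu>) * (\<Sum>k<p. b k * pairing (f k) (z k))"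
      using \<mu>8 by (intro mult_left_mono) auto
    ultimately show ?thesis by simp
  qed

  \<comment> \<open>Upper estimate for \<open>y\<close>\<close>
  have suppy: "supp y \<inter> E k = {}" for k
  proof -
    have "E k \<subseteq> A" using G(5,10)[of k] by (simp add: E_def)
    then show ?thesis using P_supp(2)[OF Pxy] AB by blast
  qed
  define \<eta> where "\<eta> = CP / \<mu> ^ 4"
  have \<eta>: "0 \<le> \<eta>" using CP(3) \<mu>8 by (simp add: \<eta>_def)
  have \<epsilon>CP: "\<epsilon> * CP \<le> \<eta>"
  proof -
    have "\<epsilon> * CP \<le> 1 / \<mu> ^ 4 * CP" using \<epsilon> CP(3) by (intro mult_right_mono) auto
    then show ?thesis by (simp add: \<eta>_def)
  qed
  have \<kappa>2: "\<kappa>\<^sup>2 \<le> \<eta>"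
  proof -
    have "\<kappa>\<^sup>2 = 1 / \<mu> ^ 4" by (simp add: \<kappa>_def power_divide flip: power_mult)
    also have "\<dots> \<le> CP / \<mu> ^ 4" using CP(3) \<mu>8 by (intro divide_right_mono) auto
    finally show ?thesis by (simp add: \<eta>_def)
  qed
  have \<omega>: "(1 / real (m (Suc J)))\<^sup>2 * CP \<le> \<eta>"
  proof -
    have "m J ^ 3 \<le> m (Suc J)" using J(2) by (intro m_cube) simp
    then have "real (m J ^ 3) \<le> real (m (Suc J))" by (simp only: of_nat_le_iff)
    then have "\<mu> ^ 3 \<le> real (m (Suc J))" by (simp add: \<mu>_def)
    moreover have "\<mu>\<^sup>2 \<le> \<mu> ^ 3" using \<mu>8 by (intro power_increasing) auto
    ultimately have "\<mu>\<^sup>2 \<le> real (m (Suc J))" by linarith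
    then have "1 / real (m (Suc J)) \<le> 1 / \<mu>\<^sup>2"
      using \<mu>8 m_pos(1)[of "Suc J"] by (intro divide_left_mono mult_pos_pos) auto
    then have "(1 / real (m (Suc J)))\<^sup>2 \<le> (1 / \<mu>\<^sup>2)\<^sup>2" by (intro power_mono) auto
    also have "(1 / \<mu>\<^sup>2)\<^sup>2 = 1 / \<mu> ^ 4" by (simp add: power_divide flip: power_mult)
    finally have "(1 / real (m (Suc J)))\<^sup>2 * CP \<le> 1 / \<mu> ^ 4 * CP" using CP(3) by (intro mult_right_mono) auto
    then show ?thesis by (simp add: \<eta>_def)
  qed
  note pb' = pb[folded \<epsilon>_def]
  have \<tau>T': "T (Suc k) < \<tau> (Suc k)" for k by (rule \<tau>T(1))
  have m1: "1 \<le> m (Suc J)" using m_ge_2[of "Suc J"] by simp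
  have fam1: "(\<Sum>i\<in>X. (pairing (H i) y)\<^sup>2) \<le> 3 * \<eta>"
    if "al M X H" "\<And>i. i \<in> X \<Longrightarrow> W (H i) (wt i) \<and> m (Suc J) \<le> wt i" for X :: "(nat \<Rightarrow> real) set" and H wt
  proof -
    have "(\<Sum>i\<in>X. (pairing (H i) y)\<^sup>2) \<le> \<epsilon> * CP + ((1 / real (m (Suc J)))\<^sup>2 * CP + \<kappa>\<^sup>2)"
      unfolding y_def by (rule ris_weighted[OF ris that m1 pb' order_refl \<tau>T'])
    then show ?thesis using \<epsilon>CP \<kappa>2 \<omega> by linarith
  qed
  have fam2: "(\<Sum>i\<in>X. (pairing (H i) y)\<^sup>2) \<le> 2 * \<eta>"
    if alX: "al (M + n J) X H" and wX: "\<And>i. i \<in> X \<Longrightarrow> W (H i) (wt i) \<and> m (Suc J) \<le> wt i \<and> (\<forall>l. wt i \<noteq> m (q l))"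
    for X :: "((nat \<Rightarrow> real) \<times> nat) set" and H wt
  proof -
    have "(\<Sum>i\<in>X. (pairing (H i) y)\<^sup>2) \<le> (1 / real (m (Suc J)))\<^sup>2 * CP + \<eta>"
      unfolding y_def
    proof (rule ris_off_weights[OF ris alX wX m1 pb'])
      show "bd (\<lambda>_. True) (M + n J + n (q k - 1)) (v k) CP" for k
        using nq[of k] MJ by (intro bd_mono[OF G(8)[of k]]) auto
      show "bd (\<lambda>f. \<exists>w>m (q k). W f w) (M + n J) (v k) \<eta>" for k
      proof (rule bd_mono[OF G(9)[of k]])
        show "M + n J \<le> 3 * n (q k - 1)" using nq[of k] MJ by linarith
        have "\<mu> \<le> real (m (q k))" unfolding \<mu>_def using monoD[OF par_simps(1), of J "q k"] qJ[of k] by simp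
        then have "\<mu> ^ 4 \<le> real (m (q k)) ^ 4" using \<mu>8 by (intro power_mono) auto
        then show "CP / real (m (q k)) ^ 4 \<le> \<eta>" unfolding \<eta>_def using CP(3) \<mu>8 by (intro divide_left_mono) auto
      qed
    qed
    then show ?thesis using \<omega> by linarith
  qed
  have q2: "2 \<le> q k" for k using qJ[of k] J(2) by simp
  \<comment> \<open>The 9 is 1 for unit functionals, 3 for weights above \<open>m J\<close>, and 5
    for functionals of weight \<open>m J\<close>, namely 3 for the exceptional children and 2 for
    the others.\<close>
  have "bd (large J) M y (9 * \<eta>)"
  proof (rule bdI)
    fix \<F> assume al: "al M \<F> (\<lambda>f. f)" and la: "\<And>f. f \<in> \<F> \<Longrightarrow> large J f"
    have 1: "(\<Sum>f\<in>{f \<in> \<F>. unitf f}. (pairing f y)\<^sup>2) \<le> \<eta>"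
    proof -
      have "(\<Sum>f\<in>{f \<in> \<F>. unitf f}. (pairing f y)\<^sup>2) \<le> \<epsilon> * CP"
        unfolding y_def by (rule ris_unit[OF ris al_subset[OF al] _ pb' order_refl \<tau>T']) auto
      then show ?thesis using \<epsilon>CP by linarith
    qed
    have 2: "(\<Sum>f\<in>{f \<in> \<F>. \<not> unitf f}. (pairing f y)\<^sup>2) \<le> 8 * \<eta>"
    proof -
      \<comment> \<open>Members with \<open>m J\<close> among their weights are treated as special
        functionals, whatever other weights they have; the others have a weight of index above
        \<open>J\<close>.\<close>
      define F1 where "F1 = {f \<in> \<F>. \<not> unitf f \<and> W f (m J)}"
      define F2 where "F2 = {f \<in> \<F>. \<not> unitf f \<and> \<not> W f (m J)}"
      have fin: "finite \<F>" using alD(1)[OF al] .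
      have "\<forall>f\<in>F2. \<exists>w. W f w \<and> m (Suc J) \<le> w"
      proof
        fix f' assume f': "f' \<in> F2"
        then obtain w where w: "W f' w" "m J \<le> w" using la[of f'] by (auto simp: F2_def large_def)
        obtain Q where Q: "w = m Q" using W_imp_index[OF w(1)] by blast
        have "w \<noteq> m J" using f' w(1) by (auto simp: F2_def)
        then have "\<not> Q \<le> J" using w(2) Q monoD[OF par_simps(1), of Q J] by auto
        then have "m (Suc J) \<le> w" unfolding Q by (intro monoD[OF par_simps(1)]) simp
        then show "\<exists>w. W f' w \<and> m (Suc J) \<le> w" using w(1) by blast
      qed
      then obtain wt where wt: "\<And>f. f \<in> F2 \<Longrightarrow> W f (wt f) \<and> m (Suc J) \<le> wt f" by metis
      have s2: "(\<Sum>f\<in>F2. (pairing f y)\<^sup>2) \<le> 3 * \<eta>"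
        by (rule fam1[OF al_subset[OF al] wt]) (auto simp: F2_def)
      have "(\<Sum>f\<in>F1. (pairing f y)\<^sup>2) \<le> (1 / real (m J))\<^sup>2 * (3 * \<eta> + 2 * \<eta>)"
      proof (rule special_family_bound[where code = code and E = E and q = q, OF _ _ J _ _ q0 j1(1) qS q2 suppy])
        show "al M F1 (\<lambda>f. f)" by (rule al_subset[OF al]) (auto simp: F1_def)
        show "W h (m J)" if "h \<in> F1" for h using that by (simp add: F1_def)
        show "code k = map (\<lambda>i. (E i, q i)) [0..<k]" for k by (simp add: code_def)
        show "code k \<in> coded_seqs N1 N2" if "1 \<le> k" for k using that by (rule code_in)
        show "(\<Sum>i\<in>X. (pairing (H i) y)\<^sup>2) \<le> 3 * \<eta>"
          if "al M X H" "\<And>i. i \<in> X \<Longrightarrow> W (H i) (wt i) \<and> m (Suc J) \<le> wt i" for X :: "(nat \<Rightarrow> real) set" and H wt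
          using that by (rule fam1)
        show "(\<Sum>i\<in>X. (pairing (H i) y)\<^sup>2) \<le> 2 * \<eta>"
          if "al (M + n J) X H" "\<And>i. i \<in> X \<Longrightarrow> W (H i) (wt i) \<and> m (Suc J) \<le> wt i \<and> (\<forall>l. wt i \<noteq> m (q l))"
          for X :: "((nat \<Rightarrow> real) \<times> nat) set" and H wt
          using that by (rule fam2)
      qed
      also have "\<dots> \<le> 1 * (3 * \<eta> + 2 * \<eta>)"
        using \<eta> \<mu>8 by (intro mult_right_mono) (auto simp: \<mu>_def power_le_one_iff divide_le_eq)
      finally have s1: "(\<Sum>f\<in>F1. (pairing f y)\<^sup>2) \<le> 5 * \<eta>" by simp
      have "{f \<in> \<F>. \<not> unitf f} = F1 \<union> F2" by (auto simp: F1_def F2_def)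
      then have "(\<Sum>f\<in>{f \<in> \<F>. \<not> unitf f}. (pairing f y)\<^sup>2) = (\<Sum>f\<in>F1 \<union> F2. (pairing f y)\<^sup>2)" by simp
      also have "\<dots> = (\<Sum>f\<in>F1. (pairing f y)\<^sup>2) + (\<Sum>f\<in>F2. (pairing f y)\<^sup>2)"
        using fin by (intro sum.union_disjoint) (auto simp: F1_def F2_def)
      finally show ?thesis using s1 s2 by linarith
    qed
    have "(\<Sum>f\<in>\<F>. (pairing f y)\<^sup>2) \<le> \<eta> + 8 * \<eta>"
      using 1 2 by (intro large_split[OF al]) (assumption | rule la)+
    then show "(\<Sum>f\<in>\<F>. (pairing f y)\<^sup>2) \<le> 9 * \<eta>" by simp
  qed
  moreover have "bd (\<lambda>_. True) M y CP" unfolding y_def by (rule ris_bd[OF ris pb])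
  ultimately have bdA: "bd (\<lambda>_. True) 0 y (2 * (9 * \<eta>) + CP / 4 ^ (2 * lg J))"
    by (intro bd_from_large) (simp_all add: M_def)
  have le4: "CP / 4 ^ (2 * lg J) \<le> \<eta>"
  proof -
    have "\<mu> ^ 4 \<le> (2 ^ lg J) ^ 4" using lg_bounds(1)[of J] \<mu>8 by (intro power_mono) (auto simp: \<mu>_def)
    also have "\<dots> = 4 ^ (2 * lg J)"
    proof -
      have "(4::real) ^ (2 * lg J) = (2 ^ 2) ^ (2 * lg J)" by simp
      also have "\<dots> = 2 ^ (lg J * 4)" by (simp only: power_mult[symmetric]) (simp add: mult_ac)
      finally show ?thesis by (simp only: power_mult)
    qed
    finally show ?thesis unfolding \<eta>_def using CP(3) \<mu>8 by (intro divide_left_mono) auto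
  qed
  have "2 * (9 * \<eta>) + CP / 4 ^ (2 * lg J) \<le> 19 * \<eta>" using le4 by linarith
  from bd_le[OF bdA this] have bd0: "bd (\<lambda>_. True) 0 y (19 * \<eta>)" .
  have "nrm y \<le> sqrt (19 * \<eta>)"
  proof (rule nrm_le)
    fix h assume h: "D h"
    \<comment> \<open>A single functional is a family of order 0, the order at which all rounds of
      replacement have been spent.\<close>
    have "al 0 {()} (\<lambda>_. h)"
    proof -
      have "Min (supp h) \<in> {1..}" if "supp h \<noteq> {}" using Min_in[OF D_supp(1)[OF h] that] D_supp(2)[OF h] by blast
      then show ?thesis using h by (auto simp: al_def)
    qed
    from bd_al[OF bd0 this] have "(pairing h y)\<^sup>2 \<le> 19 * \<eta>" by simp
    then show "pairing h y \<le> sqrt (19 * \<eta>)" by (rule real_le_rsqrt)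
  qed
  then have "1 / (4 * \<mu>) \<le> K * sqrt (19 * \<eta>)"
    using lower P_le(1)[OF Pxy] K mult_left_mono[of "nrm y" "sqrt (19 * \<eta>)" K] by linarith
  then have "(1 / (4 * \<mu>))\<^sup>2 \<le> (K * sqrt (19 * \<eta>))\<^sup>2" using \<mu>8 by (intro power_mono) auto
  then have "1 / (16 * \<mu>\<^sup>2) \<le> K\<^sup>2 * (19 * \<eta>)" using \<eta> by (simp add: power_mult_distrib power_divide)
  then have "1 / (16 * \<mu>\<^sup>2) * (16 * \<mu> ^ 4) \<le> K\<^sup>2 * (19 * \<eta>) * (16 * \<mu> ^ 4)" using \<mu>8 by (intro mult_right_mono) auto
  moreover have "1 / (16 * \<mu>\<^sup>2) * (16 * \<mu> ^ 4) = \<mu>\<^sup>2"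
  proof -
    have eq: "\<mu> ^ 4 = \<mu>\<^sup>2 * \<mu>\<^sup>2" by (simp flip: power_add)
    have cancel: "1 / (16 * a) * (16 * (a * a)) = a" if "a \<noteq> 0" for a :: real using that by simp
    have "\<mu>\<^sup>2 \<noteq> 0" using \<mu>8 by simp
    then show ?thesis unfolding eq by (rule cancel)
  qed
  moreover have "K\<^sup>2 * (19 * \<eta>) * (16 * \<mu> ^ 4) = 304 * K\<^sup>2 * CP" using \<mu>8 by (simp add: \<eta>_def)
  ultimately have "\<mu>\<^sup>2 \<le> 304 * K\<^sup>2 * CP" by linarith
  then have "\<mu>\<^sup>2 < \<mu>" using \<mu>big by linarith
  moreover have "\<mu> * 1 \<le> \<mu> * \<mu>" using \<mu>8 by (intro mult_left_mono) auto
  ultimately show False by (simp add: power2_eq_square)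
qed

end

subsection \<open>Gliding humps in the completion\<close>

lemma subspace_closure:
  fixes S :: "'a::real_normed_vector set"
  assumes "subspace S"
  shows "subspace (closure S)"
  unfolding subspace_def
proof (intro conjI ballI allI)
  show "0 \<in> closure S" using subspace_0[OF assms] closure_subset by blast
  fix x assume x: "x \<in> closure S"
  then obtain a where a: "\<And>k. a k \<in> S" "a \<longlonglongrightarrow> x" unfolding closure_sequential by blast
  show "c *\<^sub>R x \<in> closure S" for c
    unfolding closure_sequential
    by (rule exI[of _ "\<lambda>k. c *\<^sub>R a k"]) (use a assms in \<open>auto intro: tendsto_scaleR subspace_scale\<close>)
  fix y assume "y \<in> closure S"
  then obtain b where b: "\<And>k. b k \<in> S" "b \<longlonglongrightarrow> y" unfolding closure_sequential by blast
  show "x + y \<in> closure S"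
    unfolding closure_sequential
    by (rule exI[of _ "\<lambda>k. a k + b k"]) (use a b assms in \<open>auto intro: tendsto_add subspace_add\<close>)
qed

text \<open>The kernel has codimension at most 1 in \<open>U\<close>: one vector outside it
  completes a finite spanning set. Linearity is asked for on \<open>U\<close> only, since
  coordinates and isomorphisms are controlled on subsets of the type.\<close>

lemma infinite_dim_kernel:
  fixes U :: "'a::real_vector set"
  assumes U: "subspace U" "infinite_dim U"
    and \<phi>: "\<And>x y. x \<in> U \<Longrightarrow> y \<in> U \<Longrightarrow> \<phi> (x + y) = \<phi> x + \<phi> y" "\<And>c x. x \<in> U \<Longrightarrow> \<phi> (c *\<^sub>R x) = c * (\<phi> x :: real)"
  shows "subspace {x \<in> U. \<phi> x = 0}" "infinite_dim {x \<in> U. \<phi> x = 0}"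
proof -
  have "\<phi> 0 = 0" using \<phi>(2)[of 0 0] subspace_0[OF U(1)] by simp
  then show "subspace {x \<in> U. \<phi> x = 0}"
    using U(1) \<phi> by (auto simp: subspace_def)
  show "infinite_dim {x \<in> U. \<phi> x = 0}"
  proof (rule ccontr)
    assume "\<not> infinite_dim {x \<in> U. \<phi> x = 0}"
    then obtain B where B: "finite B" "{x \<in> U. \<phi> x = 0} \<subseteq> span B" unfolding infinite_dim_def by blast
    show False
    proof (cases "\<exists>u\<in>U. \<phi> u \<noteq> 0")
      case True
      then obtain u where u: "u \<in> U" "\<phi> u \<noteq> 0" by blast
      have "U \<subseteq> span (insert u B)"
      proof
        fix x assume x: "x \<in> U"
        define c where "c = - (\<phi> x / \<phi> u)"
        have "\<phi> (x + c *\<^sub>R u) = \<phi> x + c * \<phi> u"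
          using \<phi>(1)[OF x subspace_scale[OF U(1) u(1), of c]] \<phi>(2)[OF u(1), of c] by simp
        then have "\<phi> (x + c *\<^sub>R u) = 0" using u(2) by (simp add: c_def)
        moreover have "x + c *\<^sub>R u \<in> U" using x u U(1) by (simp add: subspace_add subspace_scale)
        ultimately have "x + c *\<^sub>R u \<in> span B" using B(2) by blast
        then have "x + c *\<^sub>R u \<in> span (insert u B)" using span_mono[of B "insert u B"] by blast
        moreover have "c *\<^sub>R u \<in> span (insert u B)" by (simp add: span_base span_scale)
        ultimately have "(x + c *\<^sub>R u) - c *\<^sub>R u \<in> span (insert u B)" by (rule span_diff)
        then show "x \<in> span (insert u B)" by simp
      qed
      then show False using U(2) B(1) unfolding infinite_dim_def by (meson finite_insert)
    next
      case False
      then have "U \<subseteq> span B" using B(2) by blast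
      then show False using U(2) B(1) unfolding infinite_dim_def by blast
    qed
  qed
qed

lemma infinite_dim_kernels:
  fixes U :: "'a::real_vector set" and \<phi> :: "nat \<Rightarrow> 'a \<Rightarrow> real"
  assumes U: "subspace U" "infinite_dim U"
    and \<phi>: "\<And>k x y. x \<in> U \<Longrightarrow> y \<in> U \<Longrightarrow> \<phi> k (x + y) = \<phi> k x + \<phi> k y" "\<And>k c x. x \<in> U \<Longrightarrow> \<phi> k (c *\<^sub>R x) = c * \<phi> k x"
  shows "subspace {x \<in> U. \<forall>k<N. \<phi> k x = 0} \<and> infinite_dim {x \<in> U. \<forall>k<N. \<phi> k x = 0}"
proof (induction N)
  case (Suc N)
  let ?V = "{x \<in> U. \<forall>k<N. \<phi> k x = 0}"
  have "{x \<in> U. \<forall>k<Suc N. \<phi> k x = 0} = {x \<in> ?V. \<phi> N x = 0}" by (auto simp: less_Suc_eq)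
  then show ?case using infinite_dim_kernel[of ?V "\<phi> N"] Suc \<phi> by simp
qed (use U in simp)

lemma infinite_dim_unit:
  fixes U :: "'a::real_normed_vector set"
  assumes U: "subspace U" "infinite_dim U"
  shows "\<exists>x\<in>U. norm x = 1"
proof -
  have "\<not> U \<subseteq> span {}" using U(2) unfolding infinite_dim_def by blast
  then obtain x where x: "x \<in> U" "x \<noteq> 0" by auto
  then have "(1 / norm x) *\<^sub>R x \<in> U" using U(1) by (simp add: subspace_scale)
  moreover have "norm ((1 / norm x) *\<^sub>R x) = 1" using x by simp
  ultimately show ?thesis by blast
qed

lemma infinite_dim_unit_kernels:
  fixes U :: "'a::real_normed_vector set" and \<phi> :: "nat \<Rightarrow> 'a \<Rightarrow> real"
  assumes "subspace U" "infinite_dim U"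
    "\<And>k x y. x \<in> U \<Longrightarrow> y \<in> U \<Longrightarrow> \<phi> k (x + y) = \<phi> k x + \<phi> k y" "\<And>k c x. x \<in> U \<Longrightarrow> \<phi> k (c *\<^sub>R x) = c * \<phi> k x"
  shows "\<exists>x\<in>U. norm x = 1 \<and> (\<forall>k<N. \<phi> k x = 0)"
proof -
  have *: "subspace {x \<in> U. \<forall>k<N. \<phi> k x = 0} \<and> infinite_dim {x \<in> U. \<forall>k<N. \<phi> k x = 0}"
    by (rule infinite_dim_kernels) (fact assms)+
  from infinite_dim_unit[OF *[THEN conjunct1] *[THEN conjunct2]] show ?thesis by auto
qed

definition restr :: "nat set \<Rightarrow> (nat \<Rightarrow> real) \<Rightarrow> nat \<Rightarrow> real" where
  "restr A x = (\<lambda>i. if i \<in> A then x i else 0)"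

lemma restr_supp: "supp (restr A x) = supp x \<inter> A"
  by (auto simp: restr_def supp_def)

lemma restr_c00: "x \<in> c00 \<Longrightarrow> restr A x \<in> c00"
  by (auto simp: c00_def restr_supp)

lemma c00_add: "x \<in> c00 \<Longrightarrow> y \<in> c00 \<Longrightarrow> (\<lambda>k. x k + y k) \<in> c00"
proof -
  assume *: "x \<in> c00" "y \<in> c00"
  have "supp (\<lambda>k. x k + y k) \<subseteq> supp x \<union> supp y" by (auto simp: supp_def)
  moreover have "finite (supp x \<union> supp y)" "supp x \<union> supp y \<subseteq> {1..}" using * by (simp_all add: c00_def)
  ultimately show ?thesis unfolding c00_def using finite_subset by blast
qed

lemma c00_scale: "x \<in> c00 \<Longrightarrow> (\<lambda>k. c * x k) \<in> c00"
  unfolding c00_def by (auto intro: finite_subset[of _ "supp x"] simp: supp_def)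

lemma c00_zero: "(\<lambda>_. 0) \<in> c00"
  by (simp add: c00_def supp_def)

lemma c00_sum: "finite I \<Longrightarrow> (\<And>k. k \<in> I \<Longrightarrow> u k \<in> c00) \<Longrightarrow> (\<lambda>i. \<Sum>k\<in>I. a k * u k i) \<in> c00"
  using c00_average[of I u 1 a] by simp

lemma sum_half_powers: "(\<Sum>k<p. \<theta> / 2 ^ Suc k) \<le> (\<theta> :: real)" if "0 \<le> \<theta>"
proof -
  have "(\<Sum>k<p. \<theta> / 2 ^ Suc k) = \<theta> - \<theta> / 2 ^ p" by (induction p) (simp_all add: field_simps)
  then show ?thesis using that by simp
qed

lemma eq_if_diff_le_epsilon:
  assumes "\<And>\<epsilon>. 0 < \<epsilon> \<Longrightarrow> \<bar>r - (s :: real)\<bar> \<le> C * \<epsilon>" "0 < C"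
  shows "r = s"
proof (rule ccontr)
  assume "r \<noteq> s"
  then have "0 < \<bar>r - s\<bar> / (2 * C)" using assms(2) by simp
  from assms(1)[OF this] have "\<bar>r - s\<bar> \<le> \<bar>r - s\<bar> / 2" using assms(2) by simp
  then show False using \<open>r \<noteq> s\<close> by simp
qed

locale wh_space = wh +
  fixes \<iota> :: "(nat \<Rightarrow> real) \<Rightarrow> 'a::banach" and X :: "'a set"
  assumes comp: "wh_completion m n N1 N2 \<sigma> \<iota> X"
begin

lemma \<iota>: "x \<in> c00 \<Longrightarrow> y \<in> c00 \<Longrightarrow> \<iota> (\<lambda>k. x k + y k) = \<iota> x + \<iota> y"
  "x \<in> c00 \<Longrightarrow> \<iota> (\<lambda>k. c * x k) = c *\<^sub>R \<iota> x" "x \<in> c00 \<Longrightarrow> norm (\<iota> x) = nrm x" "closure (\<iota> ` c00) = X"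
  using comp by (simp_all add: wh_completion_def)

lemma \<iota>_zero: "\<iota> (\<lambda>_. 0) = 0"
  using \<iota>(2)[OF c00_zero, of 0] by simp

lemma \<iota>_diff: assumes "x \<in> c00" "y \<in> c00" shows "\<iota> (\<lambda>k. x k - y k) = \<iota> x - \<iota> y" "(\<lambda>k. x k - y k) \<in> c00"
proof -
  have y: "(\<lambda>k. (- 1) * y k) \<in> c00" using assms(2) by (rule c00_scale)
  show "\<iota> (\<lambda>k. x k - y k) = \<iota> x - \<iota> y" using \<iota>(1)[OF assms(1) y] \<iota>(2)[OF assms(2), of "- 1"] by simp
  show "(\<lambda>k. x k - y k) \<in> c00" using c00_add[OF assms(1) y] by simp
qed

lemma \<iota>_sum:
  assumes "finite I" "\<And>k. k \<in> I \<Longrightarrow> u k \<in> c00"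
  shows "\<iota> (\<lambda>i. \<Sum>k\<in>I. c k * u k i) = (\<Sum>k\<in>I. c k *\<^sub>R \<iota> (u k))"
  using assms
proof (induction I rule: finite_induct)
  case (insert k I)
  have "(\<lambda>i. \<Sum>k\<in>insert k I. c k * u k i) = (\<lambda>i. (c k * u k i) + (\<Sum>k\<in>I. c k * u k i))" using insert by auto
  then have "\<iota> (\<lambda>i. \<Sum>k\<in>insert k I. c k * u k i) = \<iota> (\<lambda>i. c k * u k i) + \<iota> (\<lambda>i. \<Sum>k\<in>I. c k * u k i)"
    using insert by (simp add: \<iota>(1) c00_scale c00_sum)
  then show ?case using insert by (simp add: \<iota>(2))
qed (simp add: \<iota>_zero)

lemma subspace_X: "subspace X"
proof -
  have "subspace (\<iota> ` c00)"
    unfolding subspace_def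
  proof (intro conjI ballI allI)
    show "0 \<in> \<iota> ` c00" using \<iota>_zero c00_zero by (metis imageI)
    fix x assume "x \<in> \<iota> ` c00"
    then obtain a where a: "a \<in> c00" "x = \<iota> a" by blast
    show "c *\<^sub>R x \<in> \<iota> ` c00" for c
      using \<iota>(2)[OF a(1), of c] c00_scale[OF a(1), of c] a(2) by (metis imageI)
    fix y assume "y \<in> \<iota> ` c00"
    then obtain b where b: "b \<in> c00" "y = \<iota> b" by blast
    show "x + y \<in> \<iota> ` c00"
      using \<iota>(1)[OF a(1) b(1)] c00_add[OF a(1) b(1)] a(2) b(2) by (metis imageI)
  qed
  from subspace_closure[OF this] show ?thesis by (simp only: \<iota>(4))
qed

lemma approx: "\<xi> \<in> X \<Longrightarrow> 0 < \<epsilon> \<Longrightarrow> \<exists>a\<in>c00. norm (\<iota> a - \<xi>) < \<epsilon>"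
proof -
  assume "\<xi> \<in> X" "0 < \<epsilon>"
  then have "\<exists>y\<in>\<iota> ` c00. dist y \<xi> < \<epsilon>" using \<iota>(4) closure_approachable by blast
  then show ?thesis unfolding dist_norm by blast
qed

lemma nrm_triangle: "x \<in> c00 \<Longrightarrow> y \<in> c00 \<Longrightarrow> nrm (\<lambda>k. x k + y k) \<le> nrm x + nrm y"
  using \<iota>(3)[OF c00_add, of x y] \<iota>(1)[of x y] \<iota>(3)[of x] \<iota>(3)[of y] norm_triangle_ineq[of "\<iota> x" "\<iota> y"] by simp

lemma abs_pairing_le_nrm: "D f \<Longrightarrow> x \<in> c00 \<Longrightarrow> \<bar>pairing f x\<bar> \<le> nrm x"
proof -
  assume f: "D f" and x: "x \<in> c00"
  have "nrm (\<lambda>k. (- 1) * x k) = nrm x" using \<iota>(2)[OF x, of "- 1"] \<iota>(3)[OF x] \<iota>(3)[OF c00_scale[OF x, of "- 1"]] by simp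
  moreover have "pairing f (\<lambda>k. (- 1) * x k) = - pairing f x" by (simp only: pairing_scale)
  ultimately have "- pairing f x \<le> nrm x" using pairing_le_nrm[OF f, of "\<lambda>k. (- 1) * x k"] by simp
  then show ?thesis using pairing_le_nrm[OF f, of x] by simp
qed

text \<open>The single-set case of \<open>decomp\<close>. Restriction to any set is a contraction,
  so vectors may be cut anywhere in the gliding hump arguments.\<close>

lemma nrm_restr: "x \<in> c00 \<Longrightarrow> nrm (restr A x) \<le> nrm x"
proof (rule nrm_le)
  fix f assume x: "x \<in> c00" and f: "D f"
  have "decomp D {()} (\<lambda>_. A) f" using f by (intro D_W_decomp) auto
  then obtain g \<nu> where g: "D (g ())" "supp (g ()) \<subseteq> supp f \<inter> A" "\<forall>i\<in>A. f i = \<nu> () * g () i" "(\<nu> ())\<^sup>2 \<le> 1"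
    unfolding decomp_def by auto
  have fin: "finite (supp x)" using x by (simp add: c00_def)
  have "pairing f (restr A x) = \<nu> () * pairing (g ()) (restr A x)"
    using g(3) by (intro pairing_scale_left) (auto simp: restr_supp)
  also have "pairing (g ()) (restr A x) = (\<Sum>i\<in>supp x. g () i * restr A x i)"
    using fin by (intro pairing_superset) (auto simp: restr_supp)
  also have "\<dots> = pairing (g ()) x"
    unfolding pairing_def using g(2) by (intro sum.cong) (auto simp: restr_def supp_def)
  also have "\<nu> () * pairing (g ()) x \<le> \<bar>\<nu> ()\<bar> * \<bar>pairing (g ()) x\<bar>" by (simp add: abs_mult[symmetric])
  also have "\<dots> \<le> 1 * \<bar>pairing (g ()) x\<bar>" using g(4) by (intro mult_right_mono) (auto simp: abs_square_le_1)
  also have "\<dots> \<le> nrm x" using abs_pairing_le_nrm[OF g(1) x] by simp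
  finally show "pairing f (restr A x) \<le> nrm x" .
qed

section \<open>Coordinate functionals on the completion\<close>

definition coord :: "nat \<Rightarrow> 'a \<Rightarrow> real" where
  "coord k \<xi> = (SOME r. \<forall>a\<in>c00. \<bar>a k - r\<bar> \<le> norm (\<iota> a - \<xi>))"

text \<open>Coordinates are 1-Lipschitz on \<open>c00\<close>, so those of an approximating sequence
  converge, and the limit satisfies the inequality by which \<open>coord\<close> is chosen.\<close>

lemma coord_bound: assumes "\<xi> \<in> X" "a \<in> c00" shows "\<bar>a k - coord k \<xi>\<bar> \<le> norm (\<iota> a - \<xi>)"
proof -
  have diff: "\<bar>a k - b k\<bar> \<le> norm (\<iota> a - \<iota> b)" if "a \<in> c00" "b \<in> c00" for a b
    using coordinate_le_nrm[OF \<iota>_diff(2)[OF that], of k] \<iota>(3)[OF \<iota>_diff(2)[OF that]] \<iota>_diff(1)[OF that] by simp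
  have "\<xi> \<in> closure (\<iota> ` c00)" using assms(1) \<iota>(4) by simp
  then obtain s where s: "\<And>j. s j \<in> \<iota> ` c00" "s \<longlonglongrightarrow> \<xi>" unfolding closure_sequential by blast
  then have "\<forall>j. \<exists>a. a \<in> c00 \<and> s j = \<iota> a" by blast
  then obtain b where b: "\<And>j. b j \<in> c00" "\<And>j. s j = \<iota> (b j)" by metis
  have "Cauchy s" using s(2) by (rule LIMSEQ_imp_Cauchy)
  have "Cauchy (\<lambda>j. b j k)"
    unfolding Cauchy_def
  proof (intro allI impI)
    fix e :: real assume "0 < e"
    then obtain M where M: "\<And>i j. M \<le> i \<Longrightarrow> M \<le> j \<Longrightarrow> dist (s i) (s j) < e"
      using \<open>Cauchy s\<close> unfolding Cauchy_def by blast
    have "dist (b i k) (b j k) < e" if "M \<le> i" "M \<le> j" for i j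
    proof -
      have "dist (b i k) (b j k) \<le> dist (s i) (s j)"
        unfolding dist_norm b(2) using diff[OF b(1)[of i] b(1)[of j]] by simp
      then show ?thesis using M[OF that] by simp
    qed
    then show "\<exists>M. \<forall>i\<ge>M. \<forall>j\<ge>M. dist (b i k) (b j k) < e" by blast
  qed
  then obtain r where r: "(\<lambda>j. b j k) \<longlonglongrightarrow> r" using Cauchy_convergent convergent_def by blast
  have "\<bar>a k - r\<bar> \<le> norm (\<iota> a - \<xi>)" if a: "a \<in> c00" for a
  proof (rule LIMSEQ_le)
    show "(\<lambda>j. \<bar>a k - b j k\<bar>) \<longlonglongrightarrow> \<bar>a k - r\<bar>" by (intro tendsto_intros r)
    show "(\<lambda>j. norm (\<iota> a - s j)) \<longlonglongrightarrow> norm (\<iota> a - \<xi>)" by (intro tendsto_intros s(2))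
    show "\<exists>N. \<forall>j\<ge>N. \<bar>a k - b j k\<bar> \<le> norm (\<iota> a - s j)" using diff[OF a b(1)] b(2) by simp
  qed
  then have "\<exists>r. \<forall>a\<in>c00. \<bar>a k - r\<bar> \<le> norm (\<iota> a - \<xi>)" by blast
  then have "\<forall>a\<in>c00. \<bar>a k - coord k \<xi>\<bar> \<le> norm (\<iota> a - \<xi>)" unfolding coord_def by (rule someI_ex)
  then show ?thesis using assms(2) by blast
qed

lemma coord_add: assumes "\<xi> \<in> X" "\<eta> \<in> X" shows "coord k (\<xi> + \<eta>) = coord k \<xi> + coord k \<eta>"
proof (rule eq_if_diff_le_epsilon[where C = 4])
  fix \<epsilon> :: real assume \<epsilon>: "0 < \<epsilon>"
  obtain a where a: "a \<in> c00" "norm (\<iota> a - \<xi>) < \<epsilon>" using approx[OF assms(1) \<epsilon>] by blast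
  obtain b where b: "b \<in> c00" "norm (\<iota> b - \<eta>) < \<epsilon>" using approx[OF assms(2) \<epsilon>] by blast
  have sum: "\<xi> + \<eta> \<in> X" using assms subspace_X by (simp add: subspace_add)
  have "\<bar>(a k + b k) - coord k (\<xi> + \<eta>)\<bar> \<le> norm (\<iota> (\<lambda>k. a k + b k) - (\<xi> + \<eta>))"
    using coord_bound[OF sum c00_add[OF a(1) b(1)], of k] by simp
  also have "\<iota> (\<lambda>k. a k + b k) - (\<xi> + \<eta>) = (\<iota> a - \<xi>) + (\<iota> b - \<eta>)" by (simp add: \<iota>(1) a b)
  also have "norm \<dots> \<le> norm (\<iota> a - \<xi>) + norm (\<iota> b - \<eta>)" by (rule norm_triangle_ineq)
  finally have "\<bar>(a k + b k) - coord k (\<xi> + \<eta>)\<bar> \<le> 2 * \<epsilon>" using a(2) b(2) by linarith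
  then show "\<bar>coord k (\<xi> + \<eta>) - (coord k \<xi> + coord k \<eta>)\<bar> \<le> 4 * \<epsilon>"
    using coord_bound[OF assms(1) a(1), of k] coord_bound[OF assms(2) b(1), of k] a(2) b(2) by linarith
qed simp

lemma coord_scale: assumes "\<xi> \<in> X" shows "coord k (c *\<^sub>R \<xi>) = c * coord k \<xi>"
proof (rule eq_if_diff_le_epsilon[where C = "2 * \<bar>c\<bar> + 1"])
  fix \<epsilon> :: real assume \<epsilon>: "0 < \<epsilon>"
  obtain a where a: "a \<in> c00" "norm (\<iota> a - \<xi>) < \<epsilon>" using approx[OF assms(1) \<epsilon>] by blast
  have sc: "c *\<^sub>R \<xi> \<in> X" using assms subspace_X by (simp add: subspace_scale)
  have "\<bar>c * a k - coord k (c *\<^sub>R \<xi>)\<bar> \<le> norm (\<iota> (\<lambda>k. c * a k) - c *\<^sub>R \<xi>)"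
    using coord_bound[OF sc c00_scale[OF a(1)], of c k] by simp
  also have "\<iota> (\<lambda>k. c * a k) - c *\<^sub>R \<xi> = c *\<^sub>R (\<iota> a - \<xi>)" by (simp add: \<iota>(2) a scaleR_diff_right)
  also have "norm \<dots> \<le> \<bar>c\<bar> * \<epsilon>" using a(2) by (simp add: mult_left_mono)
  finally have 1: "\<bar>c * a k - coord k (c *\<^sub>R \<xi>)\<bar> \<le> \<bar>c\<bar> * \<epsilon>" .
  have "\<bar>c * a k - c * coord k \<xi>\<bar> = \<bar>c\<bar> * \<bar>a k - coord k \<xi>\<bar>" by (simp add: abs_mult[symmetric] right_diff_distrib)
  also have "\<dots> \<le> \<bar>c\<bar> * \<epsilon>" using coord_bound[OF assms a(1), of k] a(2) by (intro mult_left_mono) auto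
  finally have "\<bar>coord k (c *\<^sub>R \<xi>) - c * coord k \<xi>\<bar> \<le> \<bar>c\<bar> * \<epsilon> + \<bar>c\<bar> * \<epsilon>" using 1 by linarith
  also have "\<dots> \<le> (2 * \<bar>c\<bar> + 1) * \<epsilon>" using \<epsilon> by (simp add: distrib_right)
  finally show "\<bar>coord k (c *\<^sub>R \<xi>) - c * coord k \<xi>\<bar> \<le> (2 * \<bar>c\<bar> + 1) * \<epsilon>" .
qed simp

text \<open>Vanishing coordinates of \<xi> force the first entries of an approximant below \<delta>,
  and functionals have entries of modulus at most 1. The crude factor \<open>Suc N\<close> is
  affordable since \<delta> is chosen after \<open>N\<close>.\<close>

lemma initial_part_bound:
  assumes \<xi>: "\<xi> \<in> X" "\<And>k. k \<le> N \<Longrightarrow> coord k \<xi> = 0" and a: "a \<in> c00" "norm (\<iota> a - \<xi>) \<le> \<delta>"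
  shows "nrm (restr {..N} a) \<le> real (Suc N) * \<delta>"
proof (rule nrm_le)
  fix f assume f: "D f"
  have "\<bar>a k\<bar> \<le> \<delta>" if "k \<le> N" for k using coord_bound[OF \<xi>(1) a(1), of k] \<xi>(2)[OF that] a(2) by simp
  have "pairing f (restr {..N} a) = (\<Sum>k\<le>N. f k * restr {..N} a k)"
    by (rule pairing_superset) (auto simp: restr_supp)
  also have "\<dots> \<le> (\<Sum>k\<le>N. \<delta>)"
  proof (rule sum_mono)
    fix k assume k: "k \<in> {..N}"
    have "\<bar>f k\<bar> * \<bar>a k\<bar> \<le> 1 * \<delta>"
      using D_wh_coordinate_le_1(1)[OF f, of k] coord_bound[OF \<xi>(1) a(1), of k] \<xi>(2)[of k] k a(2) by (intro mult_mono) auto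
    then show "f k * restr {..N} a k \<le> \<delta>" using k abs_ge_self[of "f k * a k"] by (simp add: restr_def abs_mult)
  qed
  finally show "pairing f (restr {..N} a) \<le> real (Suc N) * \<delta>" by simp
qed

text \<open>Finitely many coordinates vanish at some unit vector of \<open>U\<close>, and then the
  initial part of an approximant can be cut off. Of the \<open>N + 2\<close> equal parts of
  \<epsilon>, one goes to the approximation and the rest to the initial part.\<close>

lemma hump:
  assumes U: "subspace U" "infinite_dim U" "U \<subseteq> X" and \<epsilon>: "0 < \<epsilon>"
  shows "\<exists>\<xi>\<in>U. norm \<xi> = 1 \<and> (\<exists>w\<in>c00. supp w \<subseteq> {N<..} \<and> norm (\<xi> - \<iota> w) \<le> \<epsilon>)"
proof -
  have "\<exists>\<xi>\<in>U. norm \<xi> = 1 \<and> (\<forall>k<Suc N. coord k \<xi> = 0)"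
  proof (rule infinite_dim_unit_kernels[OF U(1,2)])
    show "coord k (x + y) = coord k x + coord k y" if "x \<in> U" "y \<in> U" for k x y
      by (rule coord_add) (use that U(3) in auto)
    show "coord k (c *\<^sub>R x) = c * coord k x" if "x \<in> U" for k c x
      by (rule coord_scale) (use that U(3) in auto)
  qed
  then obtain \<xi> where \<xi>: "\<xi> \<in> U" "norm \<xi> = 1" "\<forall>k<Suc N. coord k \<xi> = 0" by blast
  define \<delta> where "\<delta> = \<epsilon> / real (N + 2)"
  have \<delta>: "0 < \<delta>" "real (N + 2) * \<delta> = \<epsilon>" using \<epsilon> by (simp_all add: \<delta>_def)
  obtain a where a: "a \<in> c00" "norm (\<iota> a - \<xi>) < \<delta>" using approx[of \<xi> \<delta>] \<xi>(1) U(3) \<delta>(1) by blast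
  have ra: "restr {..N} a \<in> c00" "restr {N<..} a \<in> c00" using a(1) by (simp_all add: restr_c00)
  have "a = (\<lambda>k. restr {..N} a k + restr {N<..} a k)" by (auto simp: restr_def)
  then have sum: "\<iota> a = \<iota> (restr {..N} a) + \<iota> (restr {N<..} a)" using \<iota>(1)[OF ra] by simp
  have "norm (\<iota> (restr {..N} a)) \<le> real (Suc N) * \<delta>"
    unfolding \<iota>(3)[OF ra(1)]
  proof (rule initial_part_bound)
    show "\<xi> \<in> X" using \<xi>(1) U(3) by blast
    show "coord k \<xi> = 0" if "k \<le> N" for k using \<xi>(3) that by simp
    show "a \<in> c00" by (rule a(1))
    show "norm (\<iota> a - \<xi>) \<le> \<delta>" using a(2) by simp
  qed
  moreover have "\<xi> - \<iota> (restr {N<..} a) = (\<xi> - \<iota> a) + \<iota> (restr {..N} a)" by (simp add: sum)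
  then have "norm (\<xi> - \<iota> (restr {N<..} a)) \<le> norm (\<xi> - \<iota> a) + norm (\<iota> (restr {..N} a))"
    by (simp only: norm_triangle_ineq)
  ultimately have "norm (\<xi> - \<iota> (restr {N<..} a)) \<le> \<delta> + real (Suc N) * \<delta>"
    using a(2) by (simp add: norm_minus_commute)
  also have "\<dots> = \<epsilon>" using \<delta>(2) by (simp add: distrib_right)
  finally have "norm (\<xi> - \<iota> (restr {N<..} a)) \<le> \<epsilon>" .
  moreover have "supp (restr {N<..} a) \<subseteq> {N<..}" by (simp add: restr_supp)
  ultimately show ?thesis using \<xi>(1,2) ra(2) by auto
qed

text \<open>Restricting to the interval of block \<open>k\<close> isolates one term without
  increasing the norm; the 2 is the inverse of the lower bound for the blocks.\<close>

lemma block_coefficient: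
  assumes T: "mono T" and w: "\<And>k. w k \<in> c00" "\<And>k. supp (w k) \<subseteq> {T k<..T (Suc k)}" "\<And>k. 1 / 2 \<le> nrm (w k)"
    and k: "k < (p :: nat)"
  shows "\<bar>c k\<bar> \<le> 2 * nrm (\<lambda>i. \<Sum>k<p. c k * w k i)"
proof -
  define x where "x = (\<lambda>i. \<Sum>k<p. c k * w k i)"
  have xc: "x \<in> c00" unfolding x_def using w(1) by (intro c00_sum) auto
  have "restr {T k<..T (Suc k)} x = (\<lambda>i. c k * w k i)"
  proof
    fix i
    show "restr {T k<..T (Suc k)} x i = c k * w k i"
    proof (cases "i \<in> {T k<..T (Suc k)}")
      case True
      have "c l * w l i = 0" if "l \<in> {..<p}" "l \<noteq> k" for l
      proof -
        have "{T l<..T (Suc l)} \<inter> {T k<..T (Suc k)} = {}"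
          using monoD[OF T, of "Suc l" k] monoD[OF T, of "Suc k" l] that(2) by (cases "l < k") auto
        then have "i \<notin> supp (w l)" using w(2)[of l] True by blast
        then show ?thesis by (simp add: supp_def)
      qed
      then have "x i = c k * w k i" unfolding x_def using k by (intro disjoint_scalar_sum) auto
      then show ?thesis using True by (simp add: restr_def)
    next
      case False
      then have "i \<notin> supp (w k)" using w(2)[of k] by blast
      then have "w k i = 0" by (simp add: supp_def)
      then show ?thesis using False by (simp add: restr_def del: greaterThanAtMost_iff)
    qed
  qed
  then have "nrm (\<lambda>i. c k * w k i) \<le> nrm x" using nrm_restr[OF xc] by metis
  moreover have "nrm (\<lambda>i. c k * w k i) = \<bar>c k\<bar> * nrm (w k)"
    using \<iota>(3)[OF c00_scale[OF w(1)[of k], of "c k"]] \<iota>(2)[OF w(1)[of k], of "c k"] \<iota>(3)[OF w(1)[of k]] by simp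
  moreover have "\<bar>c k\<bar> * (1 / 2) \<le> \<bar>c k\<bar> * nrm (w k)" using w(3) by (intro mult_left_mono) auto
  ultimately show ?thesis by (simp add: x_def)
qed

lemma perturbation:
  assumes w: "\<And>k. w k \<in> c00" and \<theta>: "0 \<le> \<theta>" and close: "\<And>k. norm (\<zeta> k - \<iota> (w k)) \<le> \<theta> / 2 ^ Suc k"
    and c: "\<And>k. k < p \<Longrightarrow> \<bar>c k\<bar> \<le> C" and C: "0 \<le> C"
  shows "norm ((\<Sum>k<p. c k *\<^sub>R \<zeta> k) - \<iota> (\<lambda>i. \<Sum>k<p. c k * w k i)) \<le> C * \<theta>"
proof -
  have "(\<Sum>k<p. c k *\<^sub>R \<zeta> k) - \<iota> (\<lambda>i. \<Sum>k<p. c k * w k i) = (\<Sum>k<p. c k *\<^sub>R (\<zeta> k - \<iota> (w k)))"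
    using w by (simp add: \<iota>_sum scaleR_diff_right sum_subtractf)
  also have "norm \<dots> \<le> (\<Sum>k<p. C * (\<theta> / 2 ^ Suc k))"
  proof (rule order_trans[OF norm_sum], rule sum_mono)
    fix k assume "k \<in> {..<p}"
    then show "norm (c k *\<^sub>R (\<zeta> k - \<iota> (w k))) \<le> C * (\<theta> / 2 ^ Suc k)"
      unfolding norm_scaleR using c close C by (intro mult_mono) auto
  qed
  also have "\<dots> = C * (\<Sum>k<p. \<theta> / 2 ^ Suc k)" by (simp add: sum_distrib_left)
  also have "\<dots> \<le> C * \<theta>" using sum_half_powers[OF \<theta>] C by (intro mult_left_mono)
  finally show ?thesis .
qed

end

lemma sum_pad:
  fixes f :: "nat \<Rightarrow> 'b::real_vector"
  assumes "p \<le> q"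
  shows "(\<Sum>k<q. (if k < p then c k else 0) *\<^sub>R f k) = (\<Sum>k<p. c k *\<^sub>R f k)"
  using assms by (intro sum.mono_neutral_cong_right) auto

lemma sum_split_at:
  fixes f :: "nat \<Rightarrow> 'b::comm_monoid_add"
  shows "(\<Sum>k<a + p. f k) = (\<Sum>k<a. f k) + (\<Sum>i<p. f (a + i))"
  by (induction p) (simp_all add: add.assoc)

lemma infinite_dim_mono: "infinite_dim U \<Longrightarrow> U \<subseteq> V \<Longrightarrow> infinite_dim V"
  unfolding infinite_dim_def by (meson order_trans)

lemma homogeneous_bounded:
  fixes U :: "'a::real_normed_vector set" and T :: "'a \<Rightarrow> 'b::real_normed_vector"
  assumes U: "subspace U" and T: "\<And>c x. x \<in> U \<Longrightarrow> T (c *\<^sub>R x) = c *\<^sub>R T x" and cont: "continuous_on U T"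
  shows "\<exists>K\<ge>1. \<forall>x\<in>U. norm (T x) \<le> K * norm x"
proof -
  have U0: "0 \<in> U" using U by (rule subspace_0)
  have T0: "T 0 = 0" using T[OF U0, of 0] by simp
  obtain d where d: "d > 0" "\<And>x. x \<in> U \<Longrightarrow> dist x 0 < d \<Longrightarrow> dist (T x) (T 0) < 1"
    using cont U0 unfolding continuous_on_iff by (meson zero_less_one)
  have "norm (T x) \<le> max 1 (2 / d) * norm x" if x: "x \<in> U" for x
  proof (cases "x = 0")
    case False
    define s where "s = d / (2 * norm x)"
    have s: "0 < s" using d(1) False by (simp add: s_def)
    have "dist (s *\<^sub>R x) 0 < d" using False d(1) by (simp add: s_def)
    then have "dist (T (s *\<^sub>R x)) (T 0) < 1" using x U by (intro d(2)) (auto intro: subspace_scale)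
    then have "s * norm (T x) < 1" using T[OF x, of s] T0 s by simp
    then have "norm (T x) \<le> 1 / s" using s by (simp add: field_simps)
    also have "1 / s = 2 / d * norm x" by (simp add: s_def)
    also have "\<dots> \<le> max 1 (2 / d) * norm x" by (intro mult_right_mono) auto
    finally show ?thesis .
  qed (simp add: T0)
  then show ?thesis by (intro exI[of _ "max 1 (2 / d)"]) auto
qed

section \<open>Almost block sequences\<close>

context wh_space begin

text \<open>The distances to the blocks add up to at most 1/8. With the factor 2 of
  \<open>block_coefficient\<close> a combination is perturbed by a quarter of its norm, which can be
  absorbed.\<close>

definition hump_seq :: "(nat \<Rightarrow> nat) \<Rightarrow> (nat \<Rightarrow> 'a) \<Rightarrow> (nat \<Rightarrow> nat \<Rightarrow> real) \<Rightarrow> bool" where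
  "hump_seq T \<zeta> w \<longleftrightarrow> strict_mono T \<and> (\<forall>k. \<zeta> k \<in> X \<and> norm (\<zeta> k) = 1 \<and> w k \<in> c00 \<and>
     supp (w k) \<subseteq> {T k<..T (Suc k)} \<and> norm (\<zeta> k - \<iota> (w k)) \<le> (1 / 8) / 2 ^ Suc k)"

lemma hump_seqD:
  assumes "hump_seq T \<zeta> w"
  shows "strict_mono T" "mono T" "\<zeta> k \<in> X" "norm (\<zeta> k) = 1" "w k \<in> c00" "supp (w k) \<subseteq> {T k<..T (Suc k)}"
    "norm (\<zeta> k - \<iota> (w k)) \<le> (1 / 8) / 2 ^ Suc k" "1 / 2 \<le> nrm (w k)"
proof -
  show 1: "strict_mono T" "\<zeta> k \<in> X" "norm (\<zeta> k) = 1" "w k \<in> c00" "supp (w k) \<subseteq> {T k<..T (Suc k)}"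
    "norm (\<zeta> k - \<iota> (w k)) \<le> (1 / 8) / 2 ^ Suc k"
    using assms by (simp_all add: hump_seq_def)
  show "mono T" using 1(1) by (rule strict_mono_mono)
  have "norm (\<zeta> k) \<le> norm (\<zeta> k - \<iota> (w k)) + norm (\<iota> (w k))"
    using norm_triangle_ineq[of "\<zeta> k - \<iota> (w k)" "\<iota> (w k)"] by simp
  moreover have "(1 / 8) / 2 ^ Suc k \<le> (1 / 8 :: real)"
    using one_le_power[of "2 :: real" "Suc k"] by (simp add: divide_le_eq del: power_Suc)
  ultimately show "1 / 2 \<le> nrm (w k)" using 1(3,6) \<iota>(3)[OF 1(4)] by linarith
qed

lemma hump_seq_exists:
  assumes U: "subspace U" "infinite_dim U" "U \<subseteq> X"
  shows "\<exists>T \<zeta> w. hump_seq T \<zeta> w \<and> (\<forall>k. \<zeta> k \<in> U)"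
proof -
  define R where "R N z = (case z of (\<xi>, w) \<Rightarrow> \<xi> \<in> U \<and> norm \<xi> = 1 \<and> w \<in> c00 \<and> supp w \<subseteq> {N<..} \<and>
    norm (\<xi> - \<iota> w) \<le> (1 / 8) / 2 ^ Suc N)" for N z
  have "\<exists>z. R N z" for N
  proof -
    have "0 < (1 / 8) / (2 ^ Suc N :: real)" by simp
    from hump[OF U this, of N] obtain \<xi> w where "\<xi> \<in> U" "norm \<xi> = 1" "w \<in> c00" "supp w \<subseteq> {N<..}"
      "norm (\<xi> - \<iota> w) \<le> (1 / 8) / 2 ^ Suc N" by blast
    then have "R N (\<xi>, w)" by (simp add: R_def)
    then show ?thesis by blast
  qed
  then obtain T z where T: "strict_mono T" and z: "\<And>k. R (T k) (z k)" "\<And>k. Max (insert 0 (supp (snd (z k)))) \<le> T (Suc k)"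
    using recursive_blocks[of 0 R "\<lambda>z. Max (insert 0 (supp (snd z)))"] by blast
  have zk: "fst (z k) \<in> U" "norm (fst (z k)) = 1" "snd (z k) \<in> c00" "supp (snd (z k)) \<subseteq> {T k<..}"
    "norm (fst (z k) - \<iota> (snd (z k))) \<le> (1 / 8) / 2 ^ Suc (T k)" for k
    using z(1)[of k] by (simp_all add: R_def case_prod_beta)
  have "supp (snd (z k)) \<subseteq> {T k<..T (Suc k)}" for k
  proof
    fix i assume i: "i \<in> supp (snd (z k))"
    have "i \<le> Max (insert 0 (supp (snd (z k))))" using zk(3)[of k] i by (intro Max_ge) (auto simp: c00_def)
    then show "i \<in> {T k<..T (Suc k)}" using z(2)[of k] subsetD[OF zk(4) i] by simp
  qed
  moreover have "norm (fst (z k) - \<iota> (snd (z k))) \<le> (1 / 8) / 2 ^ Suc k" for k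
  proof -
    have "k \<le> T k" using T by (rule strict_mono_imp_increasing)
    then have "(2::real) ^ Suc k \<le> 2 ^ Suc (T k)" by (intro power_increasing) auto
    then have "(1 / 8) / 2 ^ Suc (T k) \<le> (1 / 8) / (2::real) ^ Suc k" by (intro divide_left_mono) auto
    then show ?thesis using zk(5)[of k] by linarith
  qed
  ultimately have "hump_seq T (\<lambda>k. fst (z k)) (\<lambda>k. snd (z k))"
    using T zk(1-3) U(3) unfolding hump_seq_def by auto
  then show ?thesis using zk(1) by blast
qed

text \<open>The perturbation is measured by the block combination itself, so \<open>nrm x\<close> is
  at most the norm of the given sum plus \<open>nrm x / 4\<close>, hence at most twice that norm.
  \<open>block_coefficient\<close> contributes the other factor 2.\<close>

lemma hump_seq_coefficients:
  assumes h: "hump_seq T \<zeta> w"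
  shows "k < p \<Longrightarrow> \<bar>c k\<bar> \<le> 4 * norm (\<Sum>k<p. c k *\<^sub>R \<zeta> k)"
proof -
  note h' = hump_seqD[OF h]
  define x where "x = (\<lambda>i. \<Sum>k<p. c k * w k i)"
  have xc: "x \<in> c00" unfolding x_def using h'(5) by (intro c00_sum) auto
  have co: "\<bar>c k\<bar> \<le> 2 * nrm x" if "k < p" for k
    unfolding x_def using block_coefficient[OF h'(2,5,6,8) that, where c = c] .
  have "norm ((\<Sum>k<p. c k *\<^sub>R \<zeta> k) - \<iota> x) \<le> 2 * nrm x * (1 / 8)"
    unfolding x_def by (rule perturbation[OF h'(5) _ h'(7)]) (use co nrm_nonneg in \<open>auto simp: x_def\<close>)
  moreover have "nrm x \<le> norm (\<Sum>k<p. c k *\<^sub>R \<zeta> k) + norm ((\<Sum>k<p. c k *\<^sub>R \<zeta> k) - \<iota> x)"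
    using norm_triangle_sub[of "\<iota> x" "\<Sum>k<p. c k *\<^sub>R \<zeta> k"] \<iota>(3)[OF xc] by (simp add: norm_minus_commute)
  ultimately have "nrm x \<le> 2 * norm (\<Sum>k<p. c k *\<^sub>R \<zeta> k)" using nrm_nonneg[of x] by linarith
  then show "k < p \<Longrightarrow> \<bar>c k\<bar> \<le> 4 * norm (\<Sum>k<p. c k *\<^sub>R \<zeta> k)" using co[of k] by linarith
qed

lemma hump_seq_infinite_dim:
  assumes h: "hump_seq T \<zeta> w" and S: "infinite S"
  shows "infinite_dim (span (\<zeta> ` S))"
proof (rule ccontr)
  assume "\<not> ?thesis"
  then obtain B where B: "finite B" "span (\<zeta> ` S) \<subseteq> span B" unfolding infinite_dim_def by blast
  have zero: "c j = 0" if F: "finite F" "(\<Sum>k\<in>F. c k *\<^sub>R \<zeta> k) = 0" "j \<in> F" for F c and j :: nat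
  proof -
    obtain p where p: "F \<subseteq> {..<p}" using finite_nat_iff_bounded F(1) by blast
    have "(\<Sum>k<p. (if k \<in> F then c k else 0) *\<^sub>R \<zeta> k) = (\<Sum>k\<in>F. c k *\<^sub>R \<zeta> k)"
      using p by (intro sum.mono_neutral_cong_right) auto
    then show ?thesis using hump_seq_coefficients[OF h, of j p "\<lambda>k. if k \<in> F then c k else 0"] F p by auto
  qed
  have inj: "inj \<zeta>"
  proof (rule injI, rule ccontr)
    fix k l assume kl: "\<zeta> k = \<zeta> l" "k \<noteq> l"
    then have "(\<Sum>j\<in>{k, l}. (if j = k then 1 else - 1) *\<^sub>R \<zeta> j) = 0" by simp
    from zero[OF _ this, of k] show False by simp
  qed
  obtain F where F: "F \<subseteq> S" "finite F" "card F = Suc (card B)" using infinite_arbitrarily_large[OF S] by blast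
  have "independent (\<zeta> ` F)"
  proof (rule independent_if_scalars_zero)
    fix f x assume f: "(\<Sum>x\<in>\<zeta> ` F. f x *\<^sub>R x) = 0" and x: "x \<in> \<zeta> ` F"
    have "(\<Sum>k\<in>F. f (\<zeta> k) *\<^sub>R \<zeta> k) = 0"
      using f inj_on_subset[OF inj subset_UNIV, of F] by (simp add: sum.reindex)
    then show "f x = 0" using zero[OF F(2), of "\<lambda>k. f (\<zeta> k)"] x by blast
  qed (use F in simp)
  moreover have "\<zeta> ` F \<subseteq> span B" using F(1) B(2) span_superset[of "\<zeta> ` S"] by blast
  ultimately have "card (\<zeta> ` F) \<le> card B" using independent_span_bound[OF B(1)] by blast
  then show False using F(3) inj_on_subset[OF inj subset_UNIV, of F] by (simp add: card_image)
qed

lemma span_representation: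
  assumes "\<xi> \<in> span (\<zeta> ` (S :: nat set))"
  shows "\<exists>p c. (\<forall>k. k \<notin> S \<longrightarrow> c k = 0) \<and> (\<xi> :: 'a) = (\<Sum>k<p. c k *\<^sub>R \<zeta> k)"
  using assms
proof (induction rule: span_induct_alt)
  case base
  show ?case by (intro exI[of _ 0] exI[of _ "\<lambda>_. 0"]) simp
next
  case (step a x y)
  then obtain j where j: "j \<in> S" "x = \<zeta> j" by blast
  obtain p c where pc: "\<forall>k. k \<notin> S \<longrightarrow> c k = 0" "y = (\<Sum>k<p. c k *\<^sub>R \<zeta> k)" using step by blast
  define q where "q = max p (Suc j)"
  define c' where "c' k = (if k < p then c k else 0) + (if k = j then a else 0)" for k
  have "(\<Sum>k<q. c' k *\<^sub>R \<zeta> k) = (\<Sum>k<q. (if k < p then c k else 0) *\<^sub>R \<zeta> k) + (\<Sum>k<q. (if k = j then a else 0) *\<^sub>R \<zeta> k)"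
    by (simp add: c'_def scaleR_add_left sum.distrib)
  also have "(\<Sum>k<q. (if k < p then c k else 0) *\<^sub>R \<zeta> k) = y" unfolding pc(2) by (rule sum_pad) (simp add: q_def)
  also have "(\<Sum>k<q. (if k = j then a else 0) *\<^sub>R \<zeta> k) = a *\<^sub>R x"
    by (simp add: if_distrib[of "\<lambda>z. z *\<^sub>R _"] j(2) q_def less_max_iff_disj cong: if_cong)
  finally have "a *\<^sub>R x + y = (\<Sum>k<q. c' k *\<^sub>R \<zeta> k)" by (simp add: add.commute)
  moreover have "\<forall>k. k \<notin> S \<longrightarrow> c' k = 0" using pc(1) j(1) by (auto simp: c'_def)
  ultimately show ?case by blast
qed

text \<open>The coefficients of the early blocks are controlled by the first coordinates, which vanish.\<close>

lemma tail_approximation: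
  assumes h: "hump_seq T \<zeta> w" and \<epsilon>: "0 < \<epsilon>"
  shows "\<exists>N'. \<forall>\<xi>\<in>closure (span (\<zeta> ` S)). norm \<xi> = 1 \<longrightarrow> (\<forall>k\<le>N'. coord k \<xi> = 0) \<longrightarrow>
    (\<exists>x\<in>c00. supp x \<subseteq> (\<Union>k\<in>S. supp (w k)) \<inter> {N<..} \<and> norm (\<xi> - \<iota> x) \<le> \<epsilon>)"
proof -
  note h' = hump_seqD[OF h]
  \<comment> \<open>The 7 is 1 + 1 + 4 + 1: the distance to the span, the perturbation of the early
    terms, the early blocks themselves, and the perturbation of the late terms.\<close>
  obtain k1 where k1: "(1 / 2 :: real) ^ k1 < \<epsilon> / 7" using real_arch_pow_inv[of "\<epsilon> / 7" "1 / 2"] \<epsilon> by auto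
  define k0 where "k0 = max k1 N"
  define \<tau> where "\<tau> = (1 / 2 :: real) ^ k0"
  have "\<tau> \<le> (1 / 2) ^ k1" unfolding \<tau>_def by (rule power_decreasing) (auto simp: k0_def)
  then have "7 * \<tau> \<le> \<epsilon>" using k1 by linarith
  moreover have "0 < \<tau>" "\<tau> \<le> 1" by (simp_all add: \<tau>_def power_le_one)
  ultimately have \<tau>: "0 < \<tau>" "7 * \<tau> \<le> \<epsilon>" "\<tau> \<le> 1" by blast+
  have XT: "span (\<zeta> ` S) \<subseteq> X" using h'(3) subspace_X by (intro span_minimal) auto
  have "closed X" using \<iota>(4) by auto
  then have clX: "closure (span (\<zeta> ` S)) \<subseteq> X" using XT by (intro closure_minimal)
  have "\<exists>x\<in>c00. supp x \<subseteq> (\<Union>k\<in>S. supp (w k)) \<inter> {N<..} \<and> norm (\<xi> - \<iota> x) \<le> \<epsilon>"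
    if \<xi>: "\<xi> \<in> closure (span (\<zeta> ` S))" "norm \<xi> = 1" "\<forall>k\<le>T k0. coord k \<xi> = 0" for \<xi>
  proof -
    have \<xi>X: "\<xi> \<in> X" using \<xi>(1) clX by blast
    obtain v where v: "v \<in> span (\<zeta> ` S)" "dist v \<xi> < \<tau>" using \<xi>(1) \<tau>(1) unfolding closure_approachable by blast
    obtain p c where c: "\<forall>k. k \<notin> S \<longrightarrow> c k = 0" "v = (\<Sum>k<p. c k *\<^sub>R \<zeta> k)" using span_representation[OF v(1)] by blast
    define d where "d k = (if k < p then c k else 0)" for k
    have dS: "d k = 0" if "k \<notin> S" for k using c(1) that by (simp add: d_def)
    have v_eq: "v = (\<Sum>k<k0 + p. d k *\<^sub>R \<zeta> k)" unfolding c(2) d_def by (rule sum_pad[symmetric]) simp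
    have nv: "norm (v - \<xi>) < \<tau>" using v(2) by (simp add: dist_norm)
    then have "norm v \<le> 2" using norm_triangle_ineq[of "v - \<xi>" \<xi>] \<xi>(2) \<tau>(3) by simp
    have d8: "\<bar>d k\<bar> \<le> 8" if "k < k0 + p" for k
      using hump_seq_coefficients[OF h that, of d] \<open>norm v \<le> 2\<close> unfolding v_eq[symmetric] by linarith
    define x' where "x' = (\<lambda>i. \<Sum>k<k0. d k * w k i)"
    define x where "x = (\<lambda>i. \<Sum>k<p. d (k0 + k) * w (k0 + k) i)"
    define s1 where "s1 = (\<Sum>k<k0. d k *\<^sub>R \<zeta> k)"
    define s2 where "s2 = (\<Sum>k<p. d (k0 + k) *\<^sub>R \<zeta> (k0 + k))"
    have v12: "v = s1 + s2" unfolding v_eq s1_def s2_def by (rule sum_split_at)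
    have xc: "x' \<in> c00" "x \<in> c00" unfolding x'_def x_def using h'(5) by (auto intro: c00_sum)
    have co: "\<bar>d k\<bar> \<le> 2 * nrm x'" if "k < k0" for k
      unfolding x'_def using block_coefficient[OF h'(2,5,6,8) that, where c = d] .
    have e1: "norm (s1 - \<iota> x') \<le> 2 * nrm x' * (1 / 8)"
      unfolding s1_def x'_def by (rule perturbation[OF h'(5) _ h'(7)]) (use co nrm_nonneg in \<open>auto simp: x'_def\<close>)
    have e2: "norm (s2 - \<iota> x) \<le> 8 * ((1 / 8) * \<tau>)"
      unfolding s2_def x_def
    proof (rule perturbation)
      show "w (k0 + k) \<in> c00" for k by (rule h'(5))
      show "norm (\<zeta> (k0 + k) - \<iota> (w (k0 + k))) \<le> 1 / 8 * \<tau> / 2 ^ Suc k" for k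
        using h'(7)[of "k0 + k"] by (simp add: \<tau>_def power_add power_one_over)
      show "\<bar>d (k0 + k)\<bar> \<le> 8" if "k < p" for k using d8[of "k0 + k"] that by simp
    qed (use \<tau> in auto)
    define \<delta> where "\<delta> = \<tau> / real (T k0 + 2)"
    have \<delta>: "0 < \<delta>" "real (T k0 + 2) * \<delta> = \<tau>" using \<tau>(1) by (simp_all add: \<delta>_def)
    obtain a where a: "a \<in> c00" "norm (\<iota> a - \<xi>) < \<delta>" using approx[OF \<xi>X \<delta>(1)] by blast
    have ra: "nrm (restr {..T k0} a) \<le> real (Suc (T k0)) * \<delta>"
      using \<xi>(3) a by (intro initial_part_bound[OF \<xi>X]) auto
    have sx': "supp x' \<subseteq> {..T k0}"
    proof -
      have "supp (w k) \<subseteq> {..T k0}" if "k < k0" for k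
      proof -
        have "T (Suc k) \<le> T k0" using that by (intro monoD[OF h'(2)]) simp
        then show ?thesis using h'(6)[of k] by fastforce
      qed
      then show ?thesis unfolding x'_def using supp_lincomb[where I = "{..<k0}" and a = d and u = w] by blast
    qed
    have Tge: "T k0 \<le> T (k0 + k)" for k by (rule monoD[OF h'(2)]) simp
    have sx: "supp x \<subseteq> {T k0<..}" "supp x \<subseteq> (\<Union>k\<in>S. supp (w k))"
    proof -
      have "i \<in> {T k0<..} \<and> i \<in> (\<Union>k\<in>S. supp (w k))" if i: "i \<in> supp x" for i
      proof -
        have "(\<Sum>k<p. d (k0 + k) * w (k0 + k) i) \<noteq> 0" using i by (simp add: x_def supp_def)
        then obtain k where k: "d (k0 + k) * w (k0 + k) i \<noteq> 0" by (rule sum.not_neutral_contains_not_neutral)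
        then have "k0 + k \<in> S" "i \<in> supp (w (k0 + k))" using dS by (auto simp: supp_def)
        then show ?thesis using h'(6)[of "k0 + k"] Tge[of k] by fastforce
      qed
      then show "supp x \<subseteq> {T k0<..}" "supp x \<subseteq> (\<Union>k\<in>S. supp (w k))" by blast+
    qed
    define y where "y = (\<lambda>k. x' k + x k)"
    have yc: "y \<in> c00" unfolding y_def by (rule c00_add[OF xc])
    have \<iota>y: "\<iota> y = \<iota> x' + \<iota> x" unfolding y_def by (rule \<iota>(1)[OF xc])
    define e where "e = (\<lambda>k. y k - a k)"
    have ec: "e \<in> c00" "\<iota> e = \<iota> y - \<iota> a" unfolding e_def using \<iota>_diff[OF yc a(1)] by auto
    \<comment> \<open>Up to \<open>T k0\<close> the late blocks vanish, so the early part is an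
      approximation error plus the initial part of \<open>a\<close>; the latter is small because the
      coordinates of \<xi> vanish. The resulting bound contains \<open>nrm x' / 4\<close>, which is
      absorbed.\<close>
    have "x' = (\<lambda>k. restr {..T k0} e k + restr {..T k0} a k)"
    proof
      fix k
      show "x' k = restr {..T k0} e k + restr {..T k0} a k"
      proof (cases "k \<le> T k0")
        case True
        then have "x k = 0" using sx(1) by (force simp: supp_def)
        then show ?thesis using True by (simp add: restr_def e_def y_def)
      next
        case False
        then have "x' k = 0" using sx' by (force simp: supp_def)
        then show ?thesis using False by (simp add: restr_def)
      qed
    qed
    then have "nrm x' \<le> nrm (restr {..T k0} e) + nrm (restr {..T k0} a)"
      using nrm_triangle[OF restr_c00[OF ec(1)] restr_c00[OF a(1)]] by metis
    also have "nrm (restr {..T k0} e) \<le> nrm e" by (rule nrm_restr[OF ec(1)])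
    also have "nrm e = norm ((\<iota> x' - s1) + (\<iota> x - s2) + (v - \<xi>) + (\<xi> - \<iota> a))"
      unfolding \<iota>(3)[OF ec(1), symmetric] ec(2) \<iota>y v12 by (simp add: algebra_simps)
    also have "\<dots> \<le> norm (\<iota> x' - s1) + norm (\<iota> x - s2) + norm (v - \<xi>) + norm (\<xi> - \<iota> a)"
      by (intro norm_triangle_le add_mono order_refl)
    also have "\<dots> \<le> 2 * nrm x' * (1 / 8) + 8 * ((1 / 8) * \<tau>) + \<tau> + \<delta>"
      using e1 e2 nv a(2) by (simp add: norm_minus_commute)
    finally have "nrm x' \<le> nrm x' / 4 + 2 * \<tau> + (\<delta> + real (Suc (T k0)) * \<delta>)" using ra by simp
    also have "\<delta> + real (Suc (T k0)) * \<delta> = \<tau>" using \<delta>(2) by (simp add: distrib_right)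
    finally have nx': "nrm x' \<le> 4 * \<tau>" by simp
    have "norm (\<xi> - \<iota> x) = norm ((\<xi> - v) + (s1 - \<iota> x') + \<iota> x' + (s2 - \<iota> x))" unfolding v12 by (simp add: algebra_simps)
    also have "\<dots> \<le> norm (\<xi> - v) + norm (s1 - \<iota> x') + norm (\<iota> x') + norm (s2 - \<iota> x)"
      by (intro norm_triangle_le add_mono order_refl)
    also have "\<dots> \<le> \<tau> + \<tau> + 4 * \<tau> + \<tau>"
      using nv e1 e2 nx' \<iota>(3)[OF xc(1)] by (simp add: norm_minus_commute)
    finally have "norm (\<xi> - \<iota> x) \<le> \<epsilon>" using \<tau>(2) by simp
    moreover have "{T k0<..} \<subseteq> {N<..}"
    proof -
      have "k0 \<le> T k0" using h'(1) by (rule strict_mono_imp_increasing)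
      then have "N \<le> T k0" by (simp add: k0_def)
      then show ?thesis by auto
    qed
    ultimately show ?thesis using xc(2) sx by (intro bexI[of _ x]) auto
  qed
  then show ?thesis by blast
qed

text \<open>Early coordinates of a vector and of its image are made to vanish simultaneously, so
  both are close to vectors far out, one supported in \<open>A\<close> and the other in
  \<open>B\<close>. Combinations with equal coefficients inherit the isomorphism up to perturbation
  and form the relation \<open>P\<close>.\<close>

lemma disjoint_spans_not_isomorphic:
  assumes h: "hump_seq T \<zeta> w" and S: "S1 \<inter> S2 = {}"
    and U: "closed_subspace_of U (closure (span (\<zeta> ` S1)))" "infinite_dim U"
    and V: "closed_subspace_of V (closure (span (\<zeta> ` S2)))" and iso: "isomorphic U V"
  shows False
proof -
  note h' = hump_seqD[OF h]
  from iso obtain \<Psi> \<Theta> where *: "(\<forall>x\<in>U. \<forall>y\<in>U. \<Psi> (x + y) = \<Psi> x + \<Psi> y) \<and>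
    (\<forall>c. \<forall>x\<in>U. \<Psi> (c *\<^sub>R x) = c *\<^sub>R \<Psi> x) \<and> homeomorphism U V \<Psi> \<Theta>"
    unfolding isomorphic_def by (elim exE) (rule that)
  then have \<Psi>: "\<And>x y. x \<in> U \<Longrightarrow> y \<in> U \<Longrightarrow> \<Psi> (x + y) = \<Psi> x + \<Psi> y" "\<And>c x. x \<in> U \<Longrightarrow> \<Psi> (c *\<^sub>R x) = c *\<^sub>R \<Psi> x"
    by simp_all
  have hom: "continuous_on U \<Psi>" "continuous_on V \<Theta>" "\<Psi> ` U = V" "\<forall>x\<in>U. \<Theta> (\<Psi> x) = x"
    using * by (simp_all add: homeomorphism_def)
  have Us: "subspace U" "U \<subseteq> closure (span (\<zeta> ` S1))" and Vs: "subspace V" "V \<subseteq> closure (span (\<zeta> ` S2))"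
    using U(1) V by (auto simp: closed_subspace_of_def)
  have "closed X" using \<iota>(4) by auto
  then have cl: "closure (span (\<zeta> ` S)) \<subseteq> X" for S
    using h'(3) subspace_X by (intro closure_minimal span_minimal) auto
  have UX: "U \<subseteq> X" and VX: "V \<subseteq> X" using Us(2) Vs(2) cl by blast+
  have \<Psi>V: "\<Psi> x \<in> V" and \<Theta>\<Psi>: "\<Theta> (\<Psi> x) = x" if "x \<in> U" for x
    using hom(3,4) that by auto
  have surj: "\<exists>x\<in>U. y = \<Psi> x" if "y \<in> V" for y using that unfolding hom(3)[symmetric] by blast
  have "\<exists>K\<ge>1. \<forall>x\<in>U. norm (\<Psi> x) \<le> K * norm x"
    by (rule homogeneous_bounded[OF Us(1) _ hom(1)]) (rule \<Psi>(2))
  then obtain Ka where "Ka \<ge> 1 \<and> (\<forall>x\<in>U. norm (\<Psi> x) \<le> Ka * norm x)" by (elim exE) (rule that)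
  then have Ka: "Ka \<ge> 1" "\<And>x. x \<in> U \<Longrightarrow> norm (\<Psi> x) \<le> Ka * norm x" by simp_all
  have \<Theta>hom: "\<Theta> (c *\<^sub>R y) = c *\<^sub>R \<Theta> y" if y: "y \<in> V" for c y
  proof -
    obtain x where x: "x \<in> U" "y = \<Psi> x" using surj[OF y] by blast
    have "c *\<^sub>R x \<in> U" using x(1) Us(1) by (simp add: subspace_scale)
    then show ?thesis using \<Psi>(2)[OF x(1), of c] \<Theta>\<Psi>[of "c *\<^sub>R x"] \<Theta>\<Psi>[OF x(1)] x(2) by simp
  qed
  have "\<exists>K\<ge>1. \<forall>y\<in>V. norm (\<Theta> y) \<le> K * norm y"
    by (rule homogeneous_bounded[OF Vs(1) _ hom(2)]) (rule \<Theta>hom)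
  then obtain Kb where "Kb \<ge> 1 \<and> (\<forall>y\<in>V. norm (\<Theta> y) \<le> Kb * norm y)" by (elim exE) (rule that)
  then have Kb: "Kb \<ge> 1" "\<And>y. y \<in> V \<Longrightarrow> norm (\<Theta> y) \<le> Kb * norm y" by simp_all
  define K0 where "K0 = max Ka Kb"
  have K0: "K0 \<ge> 1" using Ka(1) by (simp add: K0_def)
  have K\<Psi>: "norm (\<Psi> x) \<le> K0 * norm x" if "x \<in> U" for x
    using Ka(2)[OF that] mult_right_mono[of Ka K0 "norm x"] by (simp add: K0_def)
  have K\<Theta>: "norm x \<le> K0 * norm (\<Psi> x)" if "x \<in> U" for x
    using Kb(2)[OF \<Psi>V[OF that]] \<Theta>\<Psi>[OF that] mult_right_mono[of Kb K0 "norm (\<Psi> x)"] by (simp add: K0_def)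
  define A where "A = (\<Union>k\<in>S1. supp (w k))"
  define B where "B = (\<Union>k\<in>S2. supp (w k))"
  have AB: "A \<inter> B = {}"
  proof -
    have "supp (w k) \<inter> supp (w l) = {}" if "k \<in> S1" "l \<in> S2" for k l
      using block_disjoint[OF h'(2,6), of k l] S that by blast
    then show ?thesis by (auto simp: A_def B_def)
  qed
  \<comment> \<open>With this choice a perturbation of \<open>2 * nrm x * \<theta>\<close>,
    multiplied by \<open>K0 + 1\<close>, is half of \<open>nrm x\<close> and can be
    absorbed.\<close>
  define \<theta> where "\<theta> = 1 / (4 * (K0 + 1))"
  have \<theta>: "0 < \<theta>" "\<theta> \<le> 1 / 8" using K0 by (simp_all add: \<theta>_def field_simps)
  have \<theta>K: "2 * \<theta> * (K0 + 1) = 1 / 2" using K0 by (simp add: \<theta>_def)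
  define R where "R N z = (case z of (\<xi>, x, y) \<Rightarrow> \<xi> \<in> U \<and> norm \<xi> = 1 \<and> x \<in> c00 \<and> y \<in> c00 \<and>
    supp x \<subseteq> A \<inter> {N<..} \<and> supp y \<subseteq> B \<inter> {N<..} \<and> norm (\<xi> - \<iota> x) \<le> \<theta> / 2 ^ Suc N \<and> norm (\<Psi> \<xi> - \<iota> y) \<le> \<theta> / 2 ^ Suc N)" for N z
  have ex: "\<exists>z. R N z" for N
  proof -
    define \<epsilon> where "\<epsilon> = \<theta> / 2 ^ Suc N"
    have \<epsilon>: "0 < \<epsilon>" using \<theta>(1) by (simp add: \<epsilon>_def)
    from tail_approximation[OF h \<epsilon>, of S1 N, folded A_def] obtain Na
      where Na: "\<forall>\<xi>\<in>closure (span (\<zeta> ` S1)). norm \<xi> = 1 \<longrightarrow> (\<forall>k\<le>Na. coord k \<xi> = 0) \<longrightarrow>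
        (\<exists>x\<in>c00. supp x \<subseteq> A \<inter> {N<..} \<and> norm (\<xi> - \<iota> x) \<le> \<epsilon>)" by (elim exE) (rule that)
    \<comment> \<open>The image of a unit vector is normalized before it is approximated; scaling
      back multiplies the error by its norm, at most \<open>K0\<close>.\<close>
    have \<epsilon>': "0 < \<epsilon> / K0" using \<epsilon> K0 by simp
    from tail_approximation[OF h \<epsilon>', of S2 N, folded B_def] obtain Nb
      where Nb: "\<forall>\<xi>\<in>closure (span (\<zeta> ` S2)). norm \<xi> = 1 \<longrightarrow> (\<forall>k\<le>Nb. coord k \<xi> = 0) \<longrightarrow>
        (\<exists>x\<in>c00. supp x \<subseteq> B \<inter> {N<..} \<and> norm (\<xi> - \<iota> x) \<le> \<epsilon> / K0)" by (elim exE) (rule that)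
    \<comment> \<open>Even numbers address the coordinates of \<xi>, odd numbers those of its image,
      so one kernel argument handles both.\<close>
    define \<phi> where "\<phi> k \<xi> = (if even k then coord (k div 2) \<xi> else coord (k div 2) (\<Psi> \<xi>))" for k \<xi>
    define M where "M = 2 * (max Na Nb + 1)"
    have "\<exists>\<xi>\<in>U. norm \<xi> = 1 \<and> (\<forall>k<M. \<phi> k \<xi> = 0)"
    proof (rule infinite_dim_unit_kernels[OF Us(1) U(2)])
      fix k x y assume xy: "x \<in> U" "y \<in> U"
      have "x \<in> X" "y \<in> X" "\<Psi> x \<in> X" "\<Psi> y \<in> X" using xy UX VX \<Psi>V by blast+
      then show "\<phi> k (x + y) = \<phi> k x + \<phi> k y" by (simp add: \<phi>_def coord_add \<Psi>(1)[OF xy])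
    next
      fix k c x assume x: "x \<in> U"
      have "x \<in> X" "\<Psi> x \<in> X" using x UX VX \<Psi>V by blast+
      then show "\<phi> k (c *\<^sub>R x) = c * \<phi> k x" by (simp add: \<phi>_def coord_scale \<Psi>(2)[OF x])
    qed
    then obtain \<xi> where \<xi>: "\<xi> \<in> U" "norm \<xi> = 1" "\<forall>k<M. \<phi> k \<xi> = 0" by blast
    have c1: "coord k \<xi> = 0" if "k \<le> max Na Nb" for k
    proof -
      have "\<phi> (2 * k) \<xi> = 0" using \<xi>(3) that by (simp add: M_def)
      then show ?thesis by (simp add: \<phi>_def)
    qed
    have c2: "coord k (\<Psi> \<xi>) = 0" if "k \<le> max Na Nb" for k
    proof -
      have "2 * k + 1 < M" using that by (simp add: M_def)
      then have "\<phi> (2 * k + 1) \<xi> = 0" using \<xi>(3) by blast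
      then show ?thesis by (simp add: \<phi>_def)
    qed
    have "\<xi> \<in> closure (span (\<zeta> ` S1))" using \<xi>(1) Us(2) by (rule subsetD[rotated])
    moreover have "\<forall>k\<le>Na. coord k \<xi> = 0" using c1 by simp
    ultimately obtain x where x: "x \<in> c00" "supp x \<subseteq> A \<inter> {N<..}" "norm (\<xi> - \<iota> x) \<le> \<epsilon>"
      using bspec[OF Na] \<xi>(2) by blast
    define r where "r = norm (\<Psi> \<xi>)"
    have r: "0 < r" "r \<le> K0"
    proof -
      have "1 \<le> K0 * r" using K\<Theta>[OF \<xi>(1)] \<xi>(2) by (simp add: r_def)
      then show "0 < r" using K0 by (metis less_le_not_le mult_zero_right norm_ge_zero not_one_le_zero order_le_less r_def)
      show "r \<le> K0" using K\<Psi>[OF \<xi>(1)] \<xi>(2) by (simp add: r_def)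
    qed
    define \<eta> where "\<eta> = (1 / r) *\<^sub>R \<Psi> \<xi>"
    have \<Psi>\<xi>: "\<Psi> \<xi> \<in> V" by (rule \<Psi>V[OF \<xi>(1)])
    then have "\<eta> \<in> V" using Vs(1) by (simp add: \<eta>_def subspace_scale)
    then have "\<eta> \<in> closure (span (\<zeta> ` S2))" using Vs(2) by blast
    moreover have "norm \<eta> = 1" using r(1) by (simp add: \<eta>_def r_def)
    moreover have "\<forall>k\<le>Nb. coord k \<eta> = 0"
    proof -
      have "\<Psi> \<xi> \<in> X" using \<Psi>\<xi> VX by blast
      then show ?thesis using c2 by (simp add: \<eta>_def coord_scale)
    qed
    ultimately obtain y0 where y0: "y0 \<in> c00" "supp y0 \<subseteq> B \<inter> {N<..}" "norm (\<eta> - \<iota> y0) \<le> \<epsilon> / K0"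
      using bspec[OF Nb] by blast
    define y where "y = (\<lambda>k. r * y0 k)"
    have "\<Psi> \<xi> - \<iota> y = r *\<^sub>R (\<eta> - \<iota> y0)" using r(1) by (simp add: y_def \<iota>(2)[OF y0(1)] \<eta>_def scaleR_diff_right)
    then have "norm (\<Psi> \<xi> - \<iota> y) = r * norm (\<eta> - \<iota> y0)" using r(1) by simp
    also have "\<dots> \<le> K0 * (\<epsilon> / K0)" using r y0(3) K0 by (intro mult_mono) auto
    finally have "norm (\<Psi> \<xi> - \<iota> y) \<le> \<epsilon>" using K0 by simp
    moreover have "y \<in> c00" unfolding y_def using y0(1) by (rule c00_scale)
    moreover have "supp y \<subseteq> B \<inter> {N<..}" unfolding y_def using supp_scale y0(2) by (rule subset_trans)
    ultimately have "R N (\<xi>, x, y)" unfolding R_def \<epsilon>_def[symmetric] using \<xi>(1,2) x by simp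
    then show ?thesis by blast
  qed
  define e where "e z = (case z of (\<xi> :: 'a, x, y) \<Rightarrow> Max (insert 0 (supp x \<union> supp y)))" for z :: "'a \<times> (nat \<Rightarrow> real) \<times> (nat \<Rightarrow> real)"
  obtain Q z where Q: "strict_mono Q" and z: "\<And>k. R (Q k) (z k)" "\<And>k. e (z k) \<le> Q (Suc k)"
    using recursive_blocks[of 0 R e] ex by blast
  define \<xi> where "\<xi> k = fst (z k)" for k
  define xs where "xs k = fst (snd (z k))" for k
  define ys where "ys k = snd (snd (z k))" for k
  have zk: "z k = (\<xi> k, xs k, ys k)" for k by (simp add: \<xi>_def xs_def ys_def)
  have Rk: "\<xi> k \<in> U" "norm (\<xi> k) = 1" "xs k \<in> c00" "ys k \<in> c00" "supp (xs k) \<subseteq> A \<inter> {Q k<..}" "supp (ys k) \<subseteq> B \<inter> {Q k<..}"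
    "norm (\<xi> k - \<iota> (xs k)) \<le> \<theta> / 2 ^ Suc (Q k)" "norm (\<Psi> (\<xi> k) - \<iota> (ys k)) \<le> \<theta> / 2 ^ Suc (Q k)" for k
    using z(1)[of k] by (simp_all add: R_def zk)
  have Qm: "mono Q" using Q by (rule strict_mono_mono)
  have Qk: "k \<le> Q k" for k using Q by (rule strict_mono_imp_increasing)
  have sx: "supp (xs k) \<subseteq> {Q k<..Q (Suc k)}" for k
  proof
    fix i assume i: "i \<in> supp (xs k)"
    have "i \<le> Max (insert 0 (supp (xs k) \<union> supp (ys k)))" using Rk(3,4)[of k] i by (intro Max_ge) (auto simp: c00_def)
    then show "i \<in> {Q k<..Q (Suc k)}" using z(2)[of k] subsetD[OF Rk(5) i] by (simp add: e_def zk)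
  qed
  have \<theta>Q: "\<theta> / 2 ^ Suc (Q k) \<le> \<theta> / 2 ^ Suc k" for k
    using Qk[of k] \<theta>(1) by (intro divide_left_mono power_increasing) auto
  have close: "norm (\<xi> k - \<iota> (xs k)) \<le> \<theta> / 2 ^ Suc k" "norm (\<Psi> (\<xi> k) - \<iota> (ys k)) \<le> \<theta> / 2 ^ Suc k" for k
    using Rk(7,8)[of k] \<theta>Q[of k] by linarith+
  have half: "1 / 2 \<le> nrm (xs k)" for k
  proof -
    have "norm (\<xi> k) \<le> norm (\<xi> k - \<iota> (xs k)) + norm (\<iota> (xs k))"
      using norm_triangle_ineq[of "\<xi> k - \<iota> (xs k)" "\<iota> (xs k)"] by simp
    moreover have "\<theta> / 2 ^ Suc k \<le> \<theta>" 
      using \<theta>(1) one_le_power[of "2 :: real" "Suc k"] by (simp add: divide_le_eq mult_le_cancel_left1 del: power_Suc)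
    ultimately show ?thesis using close(1)[of k] \<theta>(2) Rk(2)[of k] \<iota>(3)[OF Rk(3)[of k]] by linarith
  qed
  define P where "P x y \<longleftrightarrow> (\<exists>p c. x = (\<lambda>i. \<Sum>k<p. c k * xs k i) \<and> y = (\<lambda>i. \<Sum>k<p. c k * ys k i))"
    for x y :: "nat \<Rightarrow> real"
  define K where "K = 2 * K0 + 1"
  have P_le: "nrm x \<le> K * nrm y \<and> nrm y \<le> K * nrm x" if "P x y" for x y
  proof -
    have "\<exists>p c. x = (\<lambda>i. \<Sum>k<p. c k * xs k i) \<and> y = (\<lambda>i. \<Sum>k<p. c k * ys k i)" using that unfolding P_def .
    then obtain p c where x: "x = (\<lambda>i. \<Sum>k<p. c k * xs k i)" and y: "y = (\<lambda>i. \<Sum>k<p. c k * ys k i)" by blast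
    have xc: "x \<in> c00" "y \<in> c00" unfolding x y using Rk(3,4) by (auto intro: c00_sum)
    define s where "s = (\<Sum>k<p. c k *\<^sub>R \<xi> k)"
    define t where "t = (\<Sum>k<p. c k *\<^sub>R \<Psi> (\<xi> k))"
    have "(\<Sum>k<q. c k *\<^sub>R \<xi> k) \<in> U \<and> \<Psi> (\<Sum>k<q. c k *\<^sub>R \<xi> k) = (\<Sum>k<q. c k *\<^sub>R \<Psi> (\<xi> k))" for q
    proof (induction q)
      case 0
      show ?case using subspace_0[OF Us(1)] \<Psi>(2)[OF subspace_0[OF Us(1)], of 0] by simp
    next
      case (Suc q)
      have "c q *\<^sub>R \<xi> q \<in> U" using Rk(1) Us(1) by (simp add: subspace_scale)
      then show ?case using Suc \<Psi>(1)[of "\<Sum>k<q. c k *\<^sub>R \<xi> k" "c q *\<^sub>R \<xi> q"] \<Psi>(2)[OF Rk(1)] Us(1) by (simp add: subspace_add)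
    qed
    then have sU: "s \<in> U" "\<Psi> s = t" by (simp_all add: s_def t_def)
    have co: "\<bar>c k\<bar> \<le> 2 * nrm x" if "k < p" for k
      unfolding x using block_coefficient[OF Qm Rk(3) sx half that, where c = c] .
    have e1: "norm (s - \<iota> x) \<le> 2 * nrm x * \<theta>"
      unfolding s_def x by (rule perturbation[OF Rk(3) _ close(1)]) (use co nrm_nonneg \<theta>(1) in \<open>auto simp: x\<close>)
    \<comment> \<open>The coefficients are controlled through the blocks \<open>xs\<close>, so the
      error on the side of \<open>y\<close> is measured by \<open>nrm x\<close> as well.\<close>
    have e2: "norm (t - \<iota> y) \<le> 2 * nrm x * \<theta>"
      unfolding t_def y by (rule perturbation[OF Rk(4) _ close(2)]) (use co nrm_nonneg \<theta>(1) in auto)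
    have nx: "nrm x \<le> norm s + 2 * nrm x * \<theta>" "norm s \<le> nrm x + 2 * nrm x * \<theta>"
      using norm_triangle_sub[of "\<iota> x" s] norm_triangle_sub[of s "\<iota> x"] e1 \<iota>(3)[OF xc(1)] by (simp_all add: norm_minus_commute)
    have ny: "nrm y \<le> norm t + 2 * nrm x * \<theta>" "norm t \<le> nrm y + 2 * nrm x * \<theta>"
      using norm_triangle_sub[of "\<iota> y" t] norm_triangle_sub[of t "\<iota> y"] e2 \<iota>(3)[OF xc(2)] by (simp_all add: norm_minus_commute)
    have st: "norm t \<le> K0 * norm s" "norm s \<le> K0 * norm t" using K\<Psi>[OF sU(1)] K\<Theta>[OF sU(1)] sU(2) by auto
    have n0: "0 \<le> nrm x" "0 \<le> nrm y" using nrm_nonneg by auto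
    have small: "2 * nrm x * \<theta> * (K0 + 1) = nrm x / 2" using \<theta>K by (simp add: mult_ac)
    then have small': "K0 * (2 * nrm x * \<theta>) + 2 * nrm x * \<theta> = nrm x / 2" by (simp add: algebra_simps)
    have "2 * nrm x * \<theta> \<le> nrm x / 2" using small' n0 \<theta>(1) K0 by (smt (verit) mult_nonneg_nonneg)
    have "K0 * norm t \<le> K0 * (nrm y + 2 * nrm x * \<theta>)" using ny(2) K0 by (intro mult_left_mono) auto
    then have "nrm x \<le> K0 * nrm y + (K0 * (2 * nrm x * \<theta>) + 2 * nrm x * \<theta>)"
      using nx(1) st(2) by (simp add: distrib_left)
    then have "nrm x \<le> 2 * (K0 * nrm y)" using small' by linarith
    then have 1: "nrm x \<le> K * nrm y" using n0 by (simp add: K_def distrib_right)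
    have "K0 * norm s \<le> K0 * (nrm x + 2 * nrm x * \<theta>)" using nx(2) K0 by (intro mult_left_mono) auto
    then have "nrm y \<le> K0 * nrm x + (K0 * (2 * nrm x * \<theta>) + 2 * nrm x * \<theta>)"
      using ny(1) st(1) by (simp add: distrib_left)
    moreover have "nrm x / 2 \<le> K0 * nrm x + nrm x" using n0 K0 mult_nonneg_nonneg[of K0 "nrm x"] by linarith
    ultimately have 2: "nrm y \<le> K * nrm x" unfolding K_def using small' by (simp add: distrib_right)
    show ?thesis using 1 2 by simp
  qed
  have "wh_pair m n N1 N2 \<sigma> P K A B"
  proof (unfold_locales)
    fix p :: nat and c :: "nat \<Rightarrow> real" and x y :: "nat \<Rightarrow> nat \<Rightarrow> real"
    assume P: "\<And>k. k < p \<Longrightarrow> P (x k) (y k)"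
    show "P (\<lambda>i. \<Sum>k<p. c k * x k i) (\<lambda>i. \<Sum>k<p. c k * y k i)"
      using P
    proof (induction p)
      case 0
      show ?case unfolding P_def by (intro exI[of _ 0]) simp
    next
      case (Suc p)
      have "P (\<lambda>i. \<Sum>k<p. c k * x k i) (\<lambda>i. \<Sum>k<p. c k * y k i)" using Suc by simp
      then obtain r a where a: "(\<lambda>i. \<Sum>k<p. c k * x k i) = (\<lambda>i. \<Sum>k<r. a k * xs k i)"
        "(\<lambda>i. \<Sum>k<p. c k * y k i) = (\<lambda>i. \<Sum>k<r. a k * ys k i)" unfolding P_def by blast
      have "P (x p) (y p)" using Suc.prems by simp
      then obtain r' a' where a': "x p = (\<lambda>i. \<Sum>k<r'. a' k * xs k i)" "y p = (\<lambda>i. \<Sum>k<r'. a' k * ys k i)"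
        unfolding P_def by blast
      define q where "q = max r r'"
      define b where "b k = (if k < r then a k else 0) + c p * (if k < r' then a' k else 0)" for k
      have comb: "(\<Sum>k<r. a k * f k) + c p * (\<Sum>k<r'. a' k * f k) = (\<Sum>k<q. b k * f k)" for f :: "nat \<Rightarrow> real"
      proof -
        have "(\<Sum>k<q. b k * f k) = (\<Sum>k<q. (if k < r then a k else 0) *\<^sub>R f k) + c p * (\<Sum>k<q. (if k < r' then a' k else 0) *\<^sub>R f k)"
          by (simp add: b_def distrib_right sum.distrib sum_distrib_left mult.assoc)
        also have "(\<Sum>k<q. (if k < r then a k else 0) *\<^sub>R f k) = (\<Sum>k<r. a k *\<^sub>R f k)" by (rule sum_pad) (simp add: q_def)
        also have "(\<Sum>k<q. (if k < r' then a' k else 0) *\<^sub>R f k) = (\<Sum>k<r'. a' k *\<^sub>R f k)" by (rule sum_pad) (simp add: q_def)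
        finally show ?thesis by simp
      qed
      have "(\<lambda>i. \<Sum>k<Suc p. c k * x k i) = (\<lambda>i. \<Sum>k<q. b k * xs k i)"
      proof
        fix i
        have "(\<Sum>k<Suc p. c k * x k i) = (\<Sum>k<r. a k * xs k i) + c p * (\<Sum>k<r'. a' k * xs k i)"
          using fun_cong[OF a(1), of i] fun_cong[OF a'(1), of i] by simp
        then show "(\<Sum>k<Suc p. c k * x k i) = (\<Sum>k<q. b k * xs k i)" by (simp only: comb)
      qed
      moreover have "(\<lambda>i. \<Sum>k<Suc p. c k * y k i) = (\<lambda>i. \<Sum>k<q. b k * ys k i)"
      proof
        fix i
        have "(\<Sum>k<Suc p. c k * y k i) = (\<Sum>k<r. a k * ys k i) + c p * (\<Sum>k<r'. a' k * ys k i)"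
          using fun_cong[OF a(2), of i] fun_cong[OF a'(2), of i] by simp
        then show "(\<Sum>k<Suc p. c k * y k i) = (\<Sum>k<q. b k * ys k i)" by (simp only: comb)
      qed
      ultimately show ?case unfolding P_def by blast
    qed
  next
    fix x y assume "P x y"
    then obtain p c where x: "x = (\<lambda>i. \<Sum>k<p. c k * xs k i)" and y: "y = (\<lambda>i. \<Sum>k<p. c k * ys k i)" unfolding P_def by blast
    show "x \<in> c00" "y \<in> c00" unfolding x y using Rk(3,4) by (auto intro: c00_sum)
    have "supp x \<subseteq> (\<Union>k<p. supp (xs k))" unfolding x by (rule supp_lincomb)
    then show "supp x \<subseteq> A" using Rk(5) by blast
    have "supp y \<subseteq> (\<Union>k<p. supp (ys k))" unfolding y by (rule supp_lincomb)
    then show "supp y \<subseteq> B" using Rk(6) by blast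
    show "nrm x \<le> K * nrm y" "nrm y \<le> K * nrm x" using P_le[OF \<open>P x y\<close>] by auto
  next
    show "A \<inter> B = {}" by (rule AB)
    show "1 \<le> K" using K0 by (simp add: K_def)
    fix N
    have "P (xs N) (ys N)"
    proof -
      have "(\<Sum>k<Suc N. (if k = N then 1 else 0) * f k) = f N" for f :: "nat \<Rightarrow> real"
        by (simp add: if_distrib[of "\<lambda>z. z * _"] cong: if_cong)
      then show ?thesis unfolding P_def by (intro exI[of _ "Suc N"] exI[of _ "\<lambda>k. if k = N then 1 else 0"]) simp
    qed
    moreover have "\<exists>i. xs N i \<noteq> 0"
    proof (rule ccontr)
      assume "\<not> ?thesis"
      then have "xs N = (\<lambda>_. 0)" by auto
      then show False using half[of N] \<iota>(3)[OF c00_zero] \<iota>_zero by simp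
    qed
    moreover have "supp (xs N) \<union> supp (ys N) \<subseteq> {N<..}"
    proof -
      have "{Q N<..} \<subseteq> {N<..}" using Qk[of N] by auto
      moreover have "supp (xs N) \<union> supp (ys N) \<subseteq> {Q N<..}" using Rk(5,6)[of N] by simp
      ultimately show ?thesis by (rule subset_trans[rotated])
    qed
    ultimately show "\<exists>x y. P x y \<and> (\<exists>i. x i \<noteq> 0) \<and> supp x \<union> supp y \<subseteq> {N<..}" by blast
  qed
  then show False by (rule wh_pair.no_disjoint_equivalent_blocks)
qed

end

theorem corollary7p10:
  fixes m n :: "nat \<Rightarrow> nat" and N1 N2 :: "nat set"
    and \<sigma> :: "(nat set \<times> nat) list \<Rightarrow> nat"
    and \<iota> :: "(nat \<Rightarrow> real) \<Rightarrow> 'a::banach" and X_wh :: "'a set"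
  assumes "wh_parameters m n N1 N2 \<sigma>"
    and "wh_completion m n N1 N2 \<sigma> \<iota> X_wh"
  shows "\<not> (\<exists>Y. closed_subspace_of Y X_wh \<and> infinite_dim Y \<and> quasi_minimal Y)"
proof
  assume "\<exists>Y. closed_subspace_of Y X_wh \<and> infinite_dim Y \<and> quasi_minimal Y"
  then obtain Y where Y: "subspace Y" "closed Y" "Y \<subseteq> X_wh" "infinite_dim Y" "quasi_minimal Y"
    by (auto simp: closed_subspace_of_def)
  interpret wh_space m n N1 N2 \<sigma> \<iota> X_wh
    using assms by unfold_locales
  obtain T \<zeta> w where h: "hump_seq T \<zeta> w" and \<zeta>Y: "\<And>k. \<zeta> k \<in> Y" using hump_seq_exists[OF Y(1,4,3)] by blast
  define Z where "Z S = closure (span (\<zeta> ` S))" for S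
  have Z: "closed_subspace_of (Z S) Y \<and> infinite_dim (Z S)" if "infinite S" for S
  proof -
    have "span (\<zeta> ` S) \<subseteq> Y" using \<zeta>Y Y(1) by (intro span_minimal) auto
    then have "Z S \<subseteq> Y" unfolding Z_def using Y(2) by (rule closure_minimal)
    moreover have "subspace (Z S)" unfolding Z_def by (rule subspace_closure) simp
    moreover have "infinite_dim (Z S)" unfolding Z_def
      using hump_seq_infinite_dim[OF h that] closure_subset by (rule infinite_dim_mono)
    ultimately show ?thesis by (simp add: closed_subspace_of_def Z_def)
  qed
  \<comment> \<open>Two disjoint infinite index sets. Both closed spans lie in \<open>Y\<close>, and
    total incomparability has two directions, which explains the two symmetric disjointness
    facts.\<close>
  define S1 where "S1 = {k :: nat. even k}"
  define S2 where "S2 = {k :: nat. odd k}"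
  have inf: "infinite S1" "infinite S2" unfolding S1_def S2_def infinite_nat_iff_unbounded
    by (metis (mono_tags, lifting) even_Suc lessI less_SucI mem_Collect_eq)+
  have disj: "S1 \<inter> S2 = {}" "S2 \<inter> S1 = {}" by (auto simp: S1_def S2_def)
  have "\<not> totally_incomparable (Z S1) (Z S2)"
    using Y(5) Z[OF inf(1)] Z[OF inf(2)] unfolding quasi_minimal_def by blast
  then consider U V where "closed_subspace_of U (Z S1)" "infinite_dim U" "closed_subspace_of V (Z S2)" "isomorphic U V"
    | U V where "closed_subspace_of U (Z S2)" "infinite_dim U" "closed_subspace_of V (Z S1)" "isomorphic U V"
    unfolding totally_incomparable_def by blast
  then show False
  proof cases
    case 1
    then show ?thesis using disjoint_spans_not_isomorphic[OF h disj(1)] unfolding Z_def by blast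
  next
    case 2
    then show ?thesis using disjoint_spans_not_isomorphic[OF h disj(2)] unfolding Z_def by blast
  qed
qed

end
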